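(* Let $F$ be an arbitrary field, let $C$ be a smooth projective conic over $F$ without rational point, and let $L$ be the function field of $C$. Let $A$ be a central simple $F$-algebra with an $F$-linear involution $\sigma$, let $\delta\in\{1,-1\}$, and let $h$ be a nonsingular $\delta$-hermitian form on a finitely generated right $A$-module $M$. Then the anisotropic kernel of $h_L$ is extended from $A$; that is, there exist a finitely generated right $A$-module $M'$ and a $\delta$-hermitian form $h'$ on $M'$ such that the $\delta$-hermitian form $h'_L$ on $L\otimes_F M'$ is isometric to the anisotropic kernel of $h_L$.
   Context: The characteristic of $F$ is arbitrary. An $F$-linear involution $\sigma$ on $A$ is an $F$-linear anti-automorphism with $\sigma^2=\mathrm{Id}$. For a finitely generated right $A$-module $M$, $B(M)$ is the $F$-space of sesquilinear forms $b\colon M\times M\to A$, i.e. biadditive maps with $b(xa,yc)=\sigma(a)b(x,y)c$ for $x,y\in M$, $a,c\in A$. Define $\mathsf{sw}\colon B(M)\to B(M)$ by $\mathsf{sw}(b)(x,y)=\sigma(b(y,x))$. A $\delta$-hermitian form on $M$ is an element of $H_\delta(M)=\ker(\mathrm{Id}-\delta\,\mathsf{sw})\subset B(M)$. Let ${}^\sigma M^*$ be the right $A$-module of $\sigma$-semilinear maps $M\to A$, i.e. additive maps $g$ with $g(xa)=\sigma(a)g(x)$. The form $h\in H_\delta(M)$ is nonsingular if the map $\widehat h\colon M\to{}^\sigma M^*$, $x\mapsto h(\bullet,x)$, is bijective. For a submodule $N\subset M$, $N^\perp=\{x\in M\mid h(x,y)=0\text{ for all }y\in N\}$. The submodule $N$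 is a sublagrangian (totally isotropic) if $N\subset N^\perp$. The form $h$ is isotropic if $M$ contains a nonzero sublagrangian, and anisotropic otherwise. If $N$ is a maximal sublagrangian, the form $h_0$ on $N^\perp/N$ given by $h_0(x+N,y+N)=h(x,y)$ for $x,y\in N^\perp$ is anisotropic and is called an anisotropic kernel of $h$; it is uniquely determined up to isometry. For the field extension $L/F$, put $A_L=L\otimes_FA$ (with involution $\mathrm{Id}\otimes\sigma$) and $M_L=L\otimes_FM$; $h_L$ denotes the $\delta$-hermitian form on the right $A_L$-module $M_L$ obtained from $h$ by scalar extension. All notions above apply to $A_L$ over $L$. *)

theory Defs
  imports "HOL-Algebra.Algebra" "HOL-Algebra.UnivPoly"
begin

section \<open>Conics and their function fields\<close>

text \<open>A plane conic is given by a ternary quadratic form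
  \<open>c\<^sub>x\<^sub>x X\<^sup>2 + c\<^sub>y\<^sub>y Y\<^sup>2 + c\<^sub>z\<^sub>z Z\<^sup>2 + c\<^sub>x\<^sub>y XY + c\<^sub>x\<^sub>z XZ + c\<^sub>y\<^sub>z YZ\<close>.\<close>

record 'f conic =
  cxx :: 'f
  cyy :: 'f
  czz :: 'f
  cxy :: 'f
  cxz :: 'f
  cyz :: 'f

definition conic_over :: "('f, 'p) ring_scheme \<Rightarrow> 'f conic \<Rightarrow> bool" where
  "conic_over F C \<longleftrightarrow> {cxx C, cyy C, czz C, cxy C, cxz C, cyz C} \<subseteq> carrier F"

text \<open>The defining form and its partial derivatives are evaluated in a commutative ring \<open>K\<close>
  that receives the coefficients through \<open>i\<close>.\<close>

definition conic_eval ::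
  "('k, 'p) ring_scheme \<Rightarrow> ('f \<Rightarrow> 'k) \<Rightarrow> 'f conic \<Rightarrow> 'k \<Rightarrow> 'k \<Rightarrow> 'k \<Rightarrow> 'k" where
  "conic_eval K i C x y z =
     i (cxx C) \<otimes>\<^bsub>K\<^esub> (x \<otimes>\<^bsub>K\<^esub> x) \<oplus>\<^bsub>K\<^esub> i (cyy C) \<otimes>\<^bsub>K\<^esub> (y \<otimes>\<^bsub>K\<^esub> y) \<oplus>\<^bsub>K\<^esub> i (czz C) \<otimes>\<^bsub>K\<^esub> (z \<otimes>\<^bsub>K\<^esub> z) \<oplus>\<^bsub>K\<^esub>
     i (cxy C) \<otimes>\<^bsub>K\<^esub> (x \<otimes>\<^bsub>K\<^esub> y) \<oplus>\<^bsub>K\<^esub> i (cxz C) \<otimes>\<^bsub>K\<^esub> (x \<otimes>\<^bsub>K\<^esub> z) \<oplus>\<^bsub>K\<^esub> i (cyz C) \<otimes>\<^bsub>K\<^esub> (y \<otimes>\<^bsub>K\<^esub> z)"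

definition conic_dx ::
  "('k, 'p) ring_scheme \<Rightarrow> ('f \<Rightarrow> 'k) \<Rightarrow> 'f conic \<Rightarrow> 'k \<Rightarrow> 'k \<Rightarrow> 'k \<Rightarrow> 'k" where
  "conic_dx K i C x y z = add_pow K (2::nat) (i (cxx C) \<otimes>\<^bsub>K\<^esub> x) \<oplus>\<^bsub>K\<^esub> i (cxy C) \<otimes>\<^bsub>K\<^esub> y \<oplus>\<^bsub>K\<^esub> i (cxz C) \<otimes>\<^bsub>K\<^esub> z"

definition conic_dy ::
  "('k, 'p) ring_scheme \<Rightarrow> ('f \<Rightarrow> 'k) \<Rightarrow> 'f conic \<Rightarrow> 'k \<Rightarrow> 'k \<Rightarrow> 'k \<Rightarrow> 'k" where
  "conic_dy K i C x y z = i (cxy C) \<otimes>\<^bsub>K\<^esub> x \<oplus>\<^bsub>K\<^esub> add_pow K (2::nat) (i (cyy C) \<otimes>\<^bsub>K\<^esub> y) \<oplus>\<^bsub>K\<^esub> i (cyz C) \<otimes>\<^bsub>K\<^esub> z"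

definition conic_dz ::
  "('k, 'p) ring_scheme \<Rightarrow> ('f \<Rightarrow> 'k) \<Rightarrow> 'f conic \<Rightarrow> 'k \<Rightarrow> 'k \<Rightarrow> 'k \<Rightarrow> 'k" where
  "conic_dz K i C x y z = i (cxz C) \<otimes>\<^bsub>K\<^esub> x \<oplus>\<^bsub>K\<^esub> i (cyz C) \<otimes>\<^bsub>K\<^esub> y \<oplus>\<^bsub>K\<^esub> add_pow K (2::nat) (i (czz C) \<otimes>\<^bsub>K\<^esub> z)"

text \<open>Smoothness is the Jacobian criterion at the geometric points. The form itself has to be
  among the equations of the singular locus: in characteristic 2 the partial derivatives of a
  smooth conic always have a common zero, which is not on the conic. The zero form is not
  smooth.\<close>

definition smooth_conic :: "('f, 'p) ring_scheme \<Rightarrow> 'f conic \<Rightarrow> bool" where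
  "smooth_conic F C \<longleftrightarrow> conic_over F C \<and>
     (let K = field.alg_closure F; i = ring.indexed_const F in
       \<not> (\<exists>x\<in>carrier K. \<exists>y\<in>carrier K. \<exists>z\<in>carrier K. (x, y, z) \<noteq> (\<zero>\<^bsub>K\<^esub>, \<zero>\<^bsub>K\<^esub>, \<zero>\<^bsub>K\<^esub>) \<and>
            conic_eval K i C x y z = \<zero>\<^bsub>K\<^esub> \<and> conic_dx K i C x y z = \<zero>\<^bsub>K\<^esub> \<and>
            conic_dy K i C x y z = \<zero>\<^bsub>K\<^esub> \<and> conic_dz K i C x y z = \<zero>\<^bsub>K\<^esub>))"

definition has_rational_point :: "('f, 'p) ring_scheme \<Rightarrow> 'f conic \<Rightarrow> bool" where
  "has_rational_point F C \<longleftrightarrow>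
     (\<exists>x\<in>carrier F. \<exists>y\<in>carrier F. \<exists>z\<in>carrier F. (x, y, z) \<noteq> (\<zero>\<^bsub>F\<^esub>, \<zero>\<^bsub>F\<^esub>, \<zero>\<^bsub>F\<^esub>) \<and>
        conic_eval F id C x y z = \<zero>\<^bsub>F\<^esub>)"

text \<open>A bivariate polynomial over \<open>F\<close> is an element of \<open>UP (UP F)\<close>, with \<open>X\<close> the inner and
  \<open>Y\<close> the outer variable. A field extension \<open>L/F\<close> is an \<open>F\<close>-algebra \<open>L\<close> that is a field.\<close>

definition conic_affine :: "('f, 'p) ring_scheme \<Rightarrow> 'f conic \<Rightarrow> nat \<Rightarrow> nat \<Rightarrow> 'f" where
  "conic_affine F C =
     (let P = UP (UP F); const = (\<lambda>p. monom P p 0) in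
        conic_eval P (\<lambda>c. const (monom (UP F) c 0)) C
          (const (monom (UP F) \<one>\<^bsub>F\<^esub> 1)) (monom P \<one>\<^bsub>UP F\<^esub> 1) \<one>\<^bsub>P\<^esub>)"

definition eval_xy ::
  "('f, 'p) ring_scheme \<Rightarrow> ('f, 'l) module \<Rightarrow> 'l \<Rightarrow> 'l \<Rightarrow> (nat \<Rightarrow> nat \<Rightarrow> 'f) \<Rightarrow> 'l" where
  "eval_xy F L x y =
     UnivPoly.eval (UP F) L (UnivPoly.eval F L (\<lambda>c. c \<odot>\<^bsub>L\<^esub> \<one>\<^bsub>L\<^esub>) x) y"

text \<open>\<open>L\<close> is (\<open>F\<close>-isomorphic to) the field of fractions of the coordinate ring
  \<open>F[X, Y] / (f(X, Y, 1))\<close> of the affine chart \<open>Z = 1\<close>. As the form \<open>f\<close> of a smooth conic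
  is irreducible of degree 2, the chart is a dense open subset of the conic.\<close>

definition conic_function_field ::
  "('f, 'p) ring_scheme \<Rightarrow> 'f conic \<Rightarrow> ('f, 'l) module \<Rightarrow> bool" where
  "conic_function_field F C L \<longleftrightarrow> algebra F L \<and> field L \<and>
     (\<exists>x\<in>carrier L. \<exists>y\<in>carrier L.
        a_kernel (UP (UP F)) L (eval_xy F L x y) = PIdl\<^bsub>UP (UP F)\<^esub> (conic_affine F C) \<and>
        (\<forall>u\<in>carrier L. \<exists>P\<in>carrier (UP (UP F)). \<exists>Q\<in>carrier (UP (UP F)).
           eval_xy F L x y Q \<noteq> \<zero>\<^bsub>L\<^esub> \<and> u \<otimes>\<^bsub>L\<^esub> eval_xy F L x y Q = eval_xy F L x y P))"


section \<open>Algebras with involution and right modules\<close>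

text \<open>Only the additive part and the scalar multiplication of a record \<open>M\<close> used as a module are
  relevant, as usual in \<open>HOL-Algebra\<close>.\<close>

definition finitely_generated :: "('r, 'p) ring_scheme \<Rightarrow> ('r, 'm) module \<Rightarrow> bool" where
  "finitely_generated R M \<longleftrightarrow> (\<exists>S. finite S \<and> S \<subseteq> carrier M \<and>
     (\<forall>x\<in>carrier M. \<exists>a\<in>S \<rightarrow> carrier R. x = (\<Oplus>\<^bsub>M\<^esub>s\<in>S. a s \<odot>\<^bsub>M\<^esub> s)))"

text \<open>The library locale \<open>algebra\<close> is restricted to commutative algebras.\<close>

locale assoc_algebra = module F A + A: ring A for F (structure) and A (structure) +
  assumes smult_mult_left:
      "\<lbrakk>c \<in> carrier F; a \<in> carrier A; b \<in> carrier A\<rbrakk> \<Longrightarrow>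
       (c \<odot>\<^bsub>A\<^esub> a) \<otimes>\<^bsub>A\<^esub> b = c \<odot>\<^bsub>A\<^esub> (a \<otimes>\<^bsub>A\<^esub> b)"
    and smult_mult_right:
      "\<lbrakk>c \<in> carrier F; a \<in> carrier A; b \<in> carrier A\<rbrakk> \<Longrightarrow>
       a \<otimes>\<^bsub>A\<^esub> (c \<odot>\<^bsub>A\<^esub> b) = c \<odot>\<^bsub>A\<^esub> (a \<otimes>\<^bsub>A\<^esub> b)"

text \<open>Central simple algebras are finite-dimensional by convention.\<close>

definition central_simple_algebra :: "('f, 'p) ring_scheme \<Rightarrow> ('f, 'a) module \<Rightarrow> bool" where
  "central_simple_algebra F A \<longleftrightarrow> field F \<and> assoc_algebra F A \<and> finitely_generated F A \<and>
     {z \<in> carrier A. \<forall>a\<in>carrier A. z \<otimes>\<^bsub>A\<^esub> a = a \<otimes>\<^bsub>A\<^esub> z} = {c \<odot>\<^bsub>A\<^esub> \<one>\<^bsub>A\<^esub> | c. c \<in> carrier F} \<and>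
     carrier A \<noteq> {\<zero>\<^bsub>A\<^esub>} \<and> (\<forall>I. ideal I A \<longrightarrow> I = {\<zero>\<^bsub>A\<^esub>} \<or> I = carrier A)"

definition linear_involution ::
  "('f, 'p) ring_scheme \<Rightarrow> ('f, 'a) module \<Rightarrow> ('a \<Rightarrow> 'a) \<Rightarrow> bool" where
  "linear_involution F A \<sigma> \<longleftrightarrow> \<sigma> \<in> carrier A \<rightarrow> carrier A \<and> \<sigma> \<one>\<^bsub>A\<^esub> = \<one>\<^bsub>A\<^esub> \<and>
     (\<forall>a\<in>carrier A. \<sigma> (\<sigma> a) = a) \<and>
     (\<forall>a\<in>carrier A. \<forall>b\<in>carrier A.
        \<sigma> (a \<oplus>\<^bsub>A\<^esub> b) = \<sigma> a \<oplus>\<^bsub>A\<^esub> \<sigma> b \<and> \<sigma> (a \<otimes>\<^bsub>A\<^esub> b) = \<sigma> b \<otimes>\<^bsub>A\<^esub> \<sigma> a) \<and>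
     (\<forall>c\<in>carrier F. \<forall>a\<in>carrier A. \<sigma> (c \<odot>\<^bsub>A\<^esub> a) = c \<odot>\<^bsub>A\<^esub> \<sigma> a)"

text \<open>For a right module the scalar multiplication \<open>a \<odot>\<^bsub>M\<^esub> x\<close> stands for \<open>xa\<close>; note the order of
  the factors in the associativity law. The library predicate \<open>submodule\<close> does not involve that
  law and is used for submodules of right modules as well.\<close>

locale right_module = A?: ring A + M?: abelian_group M 
    for A :: "('a, 'p) ring_scheme" (structure) and M :: "('a, 'm) module" (structure) +
  assumes act_closed:
      "\<lbrakk>a \<in> carrier A; x \<in> carrier M\<rbrakk> \<Longrightarrow> a \<odot>\<^bsub>M\<^esub> x \<in> carrier M"
    and act_add_scalar:
      "\<lbrakk>a \<in> carrier A; b \<in> carrier A; x \<in> carrier M\<rbrakk> \<Longrightarrow>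
       (a \<oplus>\<^bsub>A\<^esub> b) \<odot>\<^bsub>M\<^esub> x = a \<odot>\<^bsub>M\<^esub> x \<oplus>\<^bsub>M\<^esub> b \<odot>\<^bsub>M\<^esub> x"
    and act_add:
      "\<lbrakk>a \<in> carrier A; x \<in> carrier M; y \<in> carrier M\<rbrakk> \<Longrightarrow>
       a \<odot>\<^bsub>M\<^esub> (x \<oplus>\<^bsub>M\<^esub> y) = a \<odot>\<^bsub>M\<^esub> x \<oplus>\<^bsub>M\<^esub> a \<odot>\<^bsub>M\<^esub> y"
    and act_assoc:
      "\<lbrakk>a \<in> carrier A; b \<in> carrier A; x \<in> carrier M\<rbrakk> \<Longrightarrow>
       (a \<otimes>\<^bsub>A\<^esub> b) \<odot>\<^bsub>M\<^esub> x = b \<odot>\<^bsub>M\<^esub> (a \<odot>\<^bsub>M\<^esub> x)"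
    and act_one:
      "x \<in> carrier M \<Longrightarrow> \<one>\<^bsub>A\<^esub> \<odot>\<^bsub>M\<^esub> x = x"


section \<open>Hermitian forms\<close>

definition sesquilinear ::
  "('a, 'p) ring_scheme \<Rightarrow> ('a \<Rightarrow> 'a) \<Rightarrow> ('a, 'm) module \<Rightarrow> ('m \<Rightarrow> 'm \<Rightarrow> 'a) \<Rightarrow> bool" where
  "sesquilinear A \<sigma> M b \<longleftrightarrow> b \<in> carrier M \<rightarrow> carrier M \<rightarrow> carrier A \<and>
     (\<forall>x\<in>carrier M. \<forall>y\<in>carrier M. \<forall>z\<in>carrier M.
        b (x \<oplus>\<^bsub>M\<^esub> y) z = b x z \<oplus>\<^bsub>A\<^esub> b y z \<and> b z (x \<oplus>\<^bsub>M\<^esub> y) = b z x \<oplus>\<^bsub>A\<^esub> b z y) \<and>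
     (\<forall>x\<in>carrier M. \<forall>y\<in>carrier M. \<forall>a\<in>carrier A. \<forall>c\<in>carrier A.
        b (a \<odot>\<^bsub>M\<^esub> x) (c \<odot>\<^bsub>M\<^esub> y) = \<sigma> a \<otimes>\<^bsub>A\<^esub> b x y \<otimes>\<^bsub>A\<^esub> c)"

definition sw :: "('a \<Rightarrow> 'a) \<Rightarrow> ('m \<Rightarrow> 'm \<Rightarrow> 'a) \<Rightarrow> 'm \<Rightarrow> 'm \<Rightarrow> 'a" where
  "sw \<sigma> b x y = \<sigma> (b y x)"

text \<open>The sign \<open>\<delta>\<close> is an integer acting on \<open>A\<close>, so that the same \<open>\<delta>\<close> serves over all base fields.\<close>

definition hermitian_form ::
  "('a, 'p) ring_scheme \<Rightarrow> ('a \<Rightarrow> 'a) \<Rightarrow> int \<Rightarrow> ('a, 'm) module \<Rightarrow> ('m \<Rightarrow> 'm \<Rightarrow> 'a) \<Rightarrow> bool" where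
  "hermitian_form A \<sigma> \<delta> M h \<longleftrightarrow> sesquilinear A \<sigma> M h \<and>
     (\<forall>x\<in>carrier M. \<forall>y\<in>carrier M. h x y \<ominus>\<^bsub>A\<^esub> add_pow A \<delta> (sw \<sigma> h x y) = \<zero>\<^bsub>A\<^esub>)"

definition semilinear_dual ::
  "('a, 'p) ring_scheme \<Rightarrow> ('a \<Rightarrow> 'a) \<Rightarrow> ('a, 'm) module \<Rightarrow> ('m \<Rightarrow> 'a) set" where
  "semilinear_dual A \<sigma> M = {g \<in> carrier M \<rightarrow>\<^sub>E carrier A.
     (\<forall>x\<in>carrier M. \<forall>y\<in>carrier M. g (x \<oplus>\<^bsub>M\<^esub> y) = g x \<oplus>\<^bsub>A\<^esub> g y) \<and>
     (\<forall>x\<in>carrier M. \<forall>a\<in>carrier A. g (a \<odot>\<^bsub>M\<^esub> x) = \<sigma> a \<otimes>\<^bsub>A\<^esub> g x)}"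

definition nonsingular_form ::
  "('a, 'p) ring_scheme \<Rightarrow> ('a \<Rightarrow> 'a) \<Rightarrow> ('a, 'm) module \<Rightarrow> ('m \<Rightarrow> 'm \<Rightarrow> 'a) \<Rightarrow> bool" where
  "nonsingular_form A \<sigma> M h \<longleftrightarrow>
     bij_betw (\<lambda>x. \<lambda>y\<in>carrier M. h y x) (carrier M) (semilinear_dual A \<sigma> M)"

definition perp ::
  "('a, 'p) ring_scheme \<Rightarrow> ('a, 'm) module \<Rightarrow> ('m \<Rightarrow> 'm \<Rightarrow> 'a) \<Rightarrow> 'm set \<Rightarrow> 'm set" where
  "perp A M h N = {x \<in> carrier M. \<forall>y\<in>N. h x y = \<zero>\<^bsub>A\<^esub>}"

definition sublagrangian ::
  "('a, 'p) ring_scheme \<Rightarrow> ('a, 'm) module \<Rightarrow> ('m \<Rightarrow> 'm \<Rightarrow> 'a) \<Rightarrow> 'm set \<Rightarrow> bool" where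
  "sublagrangian A M h N \<longleftrightarrow> submodule N A M \<and> N \<subseteq> perp A M h N"

definition maximal_sublagrangian ::
  "('a, 'p) ring_scheme \<Rightarrow> ('a, 'm) module \<Rightarrow> ('m \<Rightarrow> 'm \<Rightarrow> 'a) \<Rightarrow> 'm set \<Rightarrow> bool" where
  "maximal_sublagrangian A M h N \<longleftrightarrow> sublagrangian A M h N \<and>
     (\<forall>N'. sublagrangian A M h N' \<and> N \<subseteq> N' \<longrightarrow> N' = N)"

text \<open>For a maximal sublagrangian \<open>N\<close> this is the anisotropic kernel: the module of cosets
  \<open>perp N / N\<close> with the form induced by \<open>h\<close>, where any representatives of the cosets may be
  used. It depends only up to isometry on \<open>N\<close>.\<close>

definition kernel_module ::
  "('a, 'p) ring_scheme \<Rightarrow> ('a, 'm) module \<Rightarrow> ('m \<Rightarrow> 'm \<Rightarrow> 'a) \<Rightarrow> 'm set \<Rightarrow> ('a, 'm set) module" where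
  "kernel_module A M h N =
     \<lparr>carrier = {N +>\<^bsub>M\<^esub> x | x. x \<in> perp A M h N},
      monoid.mult = undefined, monoid.one = undefined,
      ring.zero = N, ring.add = (\<lambda>P Q. P <+>\<^bsub>M\<^esub> Q),
      module.smult = (\<lambda>a P. \<Union>x\<in>P. N +>\<^bsub>M\<^esub> (a \<odot>\<^bsub>M\<^esub> x))\<rparr>"

definition kernel_form :: "('m \<Rightarrow> 'm \<Rightarrow> 'a) \<Rightarrow> 'm set \<Rightarrow> 'm set \<Rightarrow> 'a" where
  "kernel_form h P Q = h (SOME x. x \<in> P) (SOME y. y \<in> Q)"

definition isometric ::
  "('a, 'p) ring_scheme \<Rightarrow> ('a, 'm) module \<Rightarrow> ('m \<Rightarrow> 'm \<Rightarrow> 'a) \<Rightarrow>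
   ('a, 'n) module \<Rightarrow> ('n \<Rightarrow> 'n \<Rightarrow> 'a) \<Rightarrow> bool" where
  "isometric A M h M' h' \<longleftrightarrow> (\<exists>\<phi>. bij_betw \<phi> (carrier M) (carrier M') \<and>
     (\<forall>x\<in>carrier M. \<forall>y\<in>carrier M. \<phi> (x \<oplus>\<^bsub>M\<^esub> y) = \<phi> x \<oplus>\<^bsub>M'\<^esub> \<phi> y) \<and>
     (\<forall>x\<in>carrier M. \<forall>a\<in>carrier A. \<phi> (a \<odot>\<^bsub>M\<^esub> x) = a \<odot>\<^bsub>M'\<^esub> \<phi> x) \<and>
     (\<forall>x\<in>carrier M. \<forall>y\<in>carrier M. h' (\<phi> x) (\<phi> y) = h x y))"


section \<open>Scalar extension\<close>

text \<open>\<open>L \<otimes>\<^sub>F V\<close> is the free abelian group on \<open>L \<times> V\<close> modulo the bilinearity and balancing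
  relations; its elements are cosets of \<open>tensor_kernel\<close>.\<close>

type_synonym ('l, 'v) tensor = "(('l \<times> 'v) \<Rightarrow>\<^sub>0 int) set"

definition tensor_free :: "('f, 'l) module \<Rightarrow> ('f, 'v) module \<Rightarrow> (('l \<times> 'v) \<Rightarrow>\<^sub>0 int) monoid" where
  "tensor_free L V = free_Abelian_group (carrier L \<times> carrier V)"

definition tensor_relations ::
  "('f, 'p) ring_scheme \<Rightarrow> ('f, 'l) module \<Rightarrow> ('f, 'v) module \<Rightarrow> (('l \<times> 'v) \<Rightarrow>\<^sub>0 int) set" where
  "tensor_relations F L V =
     {frag_of (k \<oplus>\<^bsub>L\<^esub> l, v) - frag_of (k, v) - frag_of (l, v) | k l v.
        k \<in> carrier L \<and> l \<in> carrier L \<and> v \<in> carrier V} \<union>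
     {frag_of (l, v \<oplus>\<^bsub>V\<^esub> w) - frag_of (l, v) - frag_of (l, w) | l v w.
        l \<in> carrier L \<and> v \<in> carrier V \<and> w \<in> carrier V} \<union>
     {frag_of (c \<odot>\<^bsub>L\<^esub> l, v) - frag_of (l, c \<odot>\<^bsub>V\<^esub> v) | c l v.
        c \<in> carrier F \<and> l \<in> carrier L \<and> v \<in> carrier V}"

definition tensor_kernel ::
  "('f, 'p) ring_scheme \<Rightarrow> ('f, 'l) module \<Rightarrow> ('f, 'v) module \<Rightarrow> (('l \<times> 'v) \<Rightarrow>\<^sub>0 int) set" where
  "tensor_kernel F L V = generate (tensor_free L V) (tensor_relations F L V)"

definition tensor_group ::
  "('f, 'p) ring_scheme \<Rightarrow> ('f, 'l) module \<Rightarrow> ('f, 'v) module \<Rightarrow> ('l, 'v) tensor monoid" where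
  "tensor_group F L V = tensor_free L V Mod tensor_kernel F L V"

definition tensor_class ::
  "('f, 'p) ring_scheme \<Rightarrow> ('f, 'l) module \<Rightarrow> ('f, 'v) module \<Rightarrow>
   (('l \<times> 'v) \<Rightarrow>\<^sub>0 int) \<Rightarrow> ('l, 'v) tensor" where
  "tensor_class F L V u = tensor_kernel F L V #>\<^bsub>tensor_free L V\<^esub> u"

text \<open>The additive map \<open>L \<otimes> V \<rightarrow> L \<otimes> W\<close> and the biadditive map \<open>(L \<otimes> U) \<times> (L \<otimes> V) \<rightarrow> L \<otimes> W\<close>
  given by \<open>k \<otimes> v \<mapsto> \<phi> (k, v)\<close> and \<open>(k \<otimes> u, l \<otimes> v) \<mapsto> \<phi> (k, u) (l, v)\<close> on elementary
  tensors, where a pair returned by \<open>\<phi>\<close> is read as an elementary tensor. In the uses below \<open>\<phi>\<close> respects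
  the relations, so the choice of representatives is immaterial.\<close>

definition tensor_map ::
  "('f, 'p) ring_scheme \<Rightarrow> ('f, 'l) module \<Rightarrow> ('f, 'w) module \<Rightarrow>
   ('l \<times> 'v \<Rightarrow> 'l \<times> 'w) \<Rightarrow> ('l, 'v) tensor \<Rightarrow> ('l, 'w) tensor" where
  "tensor_map F L W \<phi> s =
     tensor_class F L W (frag_extend (\<lambda>p. frag_of (\<phi> p)) (SOME u. u \<in> s))"

definition tensor_map2 ::
  "('f, 'p) ring_scheme \<Rightarrow> ('f, 'l) module \<Rightarrow> ('f, 'w) module \<Rightarrow>
   ('l \<times> 'u \<Rightarrow> 'l \<times> 'v \<Rightarrow> 'l \<times> 'w) \<Rightarrow> ('l, 'u) tensor \<Rightarrow> ('l, 'v) tensor \<Rightarrow> ('l, 'w) tensor" where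
  "tensor_map2 F L W \<phi> s t =
     tensor_class F L W
       (frag_extend (\<lambda>p. frag_extend (\<lambda>q. frag_of (\<phi> p q)) (SOME v. v \<in> t)) (SOME u. u \<in> s))"

definition ext_algebra ::
  "('f, 'p) ring_scheme \<Rightarrow> ('f, 'l) module \<Rightarrow> ('f, 'a) module \<Rightarrow> ('l, ('l, 'a) tensor) module" where
  "ext_algebra F L A =
     \<lparr>carrier = carrier (tensor_group F L A),
      monoid.mult = tensor_map2 F L A (\<lambda>(k, a) (l, b). (k \<otimes>\<^bsub>L\<^esub> l, a \<otimes>\<^bsub>A\<^esub> b)),
      monoid.one = tensor_class F L A (frag_of (\<one>\<^bsub>L\<^esub>, \<one>\<^bsub>A\<^esub>)),
      ring.zero = \<one>\<^bsub>tensor_group F L A\<^esub>,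
      ring.add = monoid.mult (tensor_group F L A),
      module.smult = (\<lambda>k. tensor_map F L A (\<lambda>(l, a). (k \<otimes>\<^bsub>L\<^esub> l, a)))\<rparr>"

text \<open>The \<open>F\<close>-space underlying a right \<open>A\<close>-module.\<close>

definition restrict_scalars :: "('f, 'a) module \<Rightarrow> ('a, 'm) module \<Rightarrow> ('f, 'm) module" where
  "restrict_scalars A M =
     \<lparr>carrier = carrier M, monoid.mult = monoid.mult M, monoid.one = monoid.one M, ring.zero = ring.zero M, ring.add = ring.add M,
      module.smult = (\<lambda>c x. (c \<odot>\<^bsub>A\<^esub> \<one>\<^bsub>A\<^esub>) \<odot>\<^bsub>M\<^esub> x)\<rparr>"

text \<open>The right module \<open>L \<otimes>\<^sub>F M\<close> over \<open>L \<otimes>\<^sub>F A\<close>, with \<open>(l \<otimes> x)(k \<otimes> a) = lk \<otimes> xa\<close>, and the form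
  \<open>h\<^sub>L\<close> on it, with \<open>h\<^sub>L (k \<otimes> x) (l \<otimes> y) = kl \<otimes> h x y\<close>.\<close>

definition ext_module ::
  "('f, 'p) ring_scheme \<Rightarrow> ('f, 'l) module \<Rightarrow> ('f, 'a) module \<Rightarrow> ('a, 'm) module \<Rightarrow>
   (('l, 'a) tensor, ('l, 'm) tensor) module" where
  "ext_module F L A M = (let V = restrict_scalars A M in
     \<lparr>carrier = carrier (tensor_group F L V),
      monoid.mult = undefined, monoid.one = undefined,
      ring.zero = \<one>\<^bsub>tensor_group F L V\<^esub>,
      ring.add = monoid.mult (tensor_group F L V),
      module.smult = tensor_map2 F L V (\<lambda>(k, a) (l, x). (l \<otimes>\<^bsub>L\<^esub> k, a \<odot>\<^bsub>M\<^esub> x))\<rparr>)"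

definition ext_form ::
  "('f, 'p) ring_scheme \<Rightarrow> ('f, 'l) module \<Rightarrow> ('f, 'a) module \<Rightarrow> ('m \<Rightarrow> 'm \<Rightarrow> 'a) \<Rightarrow>
   ('l, 'm) tensor \<Rightarrow> ('l, 'm) tensor \<Rightarrow> ('l, 'a) tensor" where
  "ext_form F L A h = tensor_map2 F L A (\<lambda>(k, x) (l, y). (k \<otimes>\<^bsub>L\<^esub> l, h x y))"

end

theory Submission
  imports Defs
begin

text \<open>A central simple algebra carries a nondegenerate symmetric trace form \<open>\<tau>\<close>, so \<open>h\<^sub>L\<close> may be replaced
  by the \<open>L\<close>-bilinear extension \<open>\<beta>\<close> of \<open>\<tau> h\<close> to \<open>L \<otimes> M\<close>, together with the action of \<open>A\<close>.
  Since the conic has no rational point, \<open>L\<close> is a quadratic extension of \<open>F(x)\<close> with a single place at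
  infinity, of degree 2. Let \<open>N\<close> be a maximal sublagrangian and \<open>P\<close> its orthogonal, both regarded as vector
  bundles on the conic. Riemann-Roch provides many global sections of \<open>P\<close> that have no pole at infinity
  modulo \<open>N\<close>. They form an \<open>F\<close>-space \<open>Q\<close>, stable under \<open>A\<close>, and \<open>\<beta>\<close> takes values on \<open>Q\<close> that are
  regular everywhere, hence constants. By maximality of \<open>N\<close> the form is nondegenerate on \<open>Q / (Q \<inter> N)\<close>,
  because its radical generates a sublagrangian; comparing dimensions, \<open>N\<close> and \<open>Q\<close> span \<open>P\<close> over \<open>L\<close>. So
  \<open>Q / (Q \<inter> N)\<close> is an \<open>A\<close>-module with a form whose scalar extension is the anisotropic kernel.\<close>

\<comment> \<open>The quotient bundle of \<open>P\<close> by \<open>N\<close> is self-dual, hence of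
  degree 0, and as the conic has genus 0 its Euler characteristic equals its rank \<open>r\<close>.
  So it has at least \<open>r\<close> independent global sections, whatever its shape. Sections pair
  to constants and there is no radical, so a basis of them over \<open>F\<close> stays independent
  over \<open>L\<close>; there are exactly \<open>r\<close>, and they span the bundle generically.
  The obstacle is that a section of the quotient need not lift to a section of \<open>P\<close>.
  Therefore pole order \<open>d\<close> is allowed, large enough for the sections of
  \<open>N\<close> to reach every leading form from order \<open>d\<close> on, and regularity at
  infinity is imposed only modulo \<open>N\<close>. No sheaf cohomology appears: two affine charts
  cover the conic, and all counts are dimensions of explicit quotients over \<open>F\<close>,
  compared by inequalities. The trace form is not tied to the involution, so \<open>\<beta>\<close>
  need not be symmetric; orthogonality is shown to be symmetric only for submodules. One
  \<open>M'\<close> has to serve every maximal sublagrangian, so the uniqueness of the anisotropic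
  kernel is part of the proof.\<close>
text \<open>With this, \<open>x \<oplus>\<^sub>V y\<close> may be written for \<open>x \<oplus>\<^bsub>V\<^esub> y\<close>, and similarly for the other operations.\<close>

syntax "_index" :: "logic \<Rightarrow> index"  ("\<^sub>_" [1000] 1000)

section \<open>Linear algebra\<close>

definition subsp :: "('k, 'p) ring_scheme \<Rightarrow> ('k, 'v, 'q) module_scheme \<Rightarrow> 'v set \<Rightarrow> bool" where
  "subsp K V S \<longleftrightarrow> S \<subseteq> carrier V \<and> \<zero>\<^sub>V \<in> S \<and> (\<forall>x\<in>S. \<forall>y\<in>S. x \<oplus>\<^sub>V y \<in> S) \<and>
     (\<forall>a\<in>carrier K. \<forall>x\<in>S. a \<odot>\<^sub>V x \<in> S)"

definition ssum :: "('k, 'v, 'q) module_scheme \<Rightarrow> 'v set \<Rightarrow> 'v set \<Rightarrow> 'v set" where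
  "ssum V S T = {s \<oplus>\<^sub>V t | s t. s \<in> S \<and> t \<in> T}"

definition adj :: "('k, 'p) ring_scheme \<Rightarrow> ('k, 'v, 'q) module_scheme \<Rightarrow> 'v set \<Rightarrow> 'v \<Rightarrow> 'v set" where
  "adj K V S v = {s \<oplus>\<^sub>V a \<odot>\<^sub>V v | s a. s \<in> S \<and> a \<in> carrier K}"

text \<open>\<open>qdim K V T S n\<close> says that \<open>S / T\<close> has dimension \<open>n\<close>.\<close>

inductive qdim :: "('k, 'p) ring_scheme \<Rightarrow> ('k, 'v, 'q) module_scheme \<Rightarrow> 'v set \<Rightarrow> 'v set \<Rightarrow> nat \<Rightarrow> bool"
  for K V where
  qdim_refl: "subsp K V T \<Longrightarrow> qdim K V T T 0"
| qdim_step: "qdim K V T S n \<Longrightarrow> v \<in> carrier V \<Longrightarrow> v \<notin> S \<Longrightarrow> qdim K V T (adj K V S v) (Suc n)"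

text \<open>Relative to sets \<open>T\<close> and \<open>S\<close>: the residue pairing below is
  additive with values in the constants only on vectors of bounded pole order, and
  \<open>\<beta>\<close> takes constant values only on the descended space.\<close>

definition bilin ::
  "('k, 'p) ring_scheme \<Rightarrow> ('k, 'v, 'q) module_scheme \<Rightarrow> 'v set \<Rightarrow> 'v set \<Rightarrow> ('v \<Rightarrow> 'v \<Rightarrow> 'k) \<Rightarrow> bool" where
  "bilin K V T S p \<longleftrightarrow> (\<forall>t\<in>T. \<forall>s\<in>S. p t s \<in> carrier K) \<and>
     (\<forall>t\<in>T. \<forall>t'\<in>T. \<forall>s\<in>S. p (t \<oplus>\<^sub>V t') s = p t s \<oplus>\<^sub>K p t' s) \<and>
     (\<forall>t\<in>T. \<forall>s\<in>S. \<forall>s'\<in>S. p t (s \<oplus>\<^sub>V s') = p t s \<oplus>\<^sub>K p t s') \<and>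
     (\<forall>a\<in>carrier K. \<forall>t\<in>T. \<forall>s\<in>S. p (a \<odot>\<^sub>V t) s = a \<otimes>\<^sub>K p t s \<and> p t (a \<odot>\<^sub>V s) = a \<otimes>\<^sub>K p t s)"

lemma bilin_flip: "bilin K V T S p \<Longrightarrow> bilin K V S T (\<lambda>s t. p t s)"
  unfolding bilin_def by blast

lemma bilin_mono: "bilin K V T S p \<Longrightarrow> T' \<subseteq> T \<Longrightarrow> S' \<subseteq> S \<Longrightarrow> bilin K V T' S' p"
  unfolding bilin_def by (meson in_mono)

text \<open>The field is a parameter of its own because the same \<open>V\<close> is viewed both
  over \<open>L\<close> and over the constants, the latter being \<open>L\<close> with a smaller
  carrier. The two views share the addition and the scalar multiplication.\<close>

locale vecsp = module K V + field K for K (structure) and V (structure)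

section \<open>Subspaces, their sums, and adjunction of a vector\<close>

context vecsp
begin

lemma subspD:
  assumes "subsp K V S"
  shows "S \<subseteq> carrier V" "\<zero>\<^sub>V \<in> S" "x \<in> S \<Longrightarrow> x \<in> carrier V"
    "x \<in> S \<Longrightarrow> y \<in> S \<Longrightarrow> x \<oplus>\<^sub>V y \<in> S" "a \<in> carrier K \<Longrightarrow> x \<in> S \<Longrightarrow> a \<odot>\<^sub>V x \<in> S"
  using assms unfolding subsp_def by auto

lemma subsp_neg: "subsp K V S \<Longrightarrow> x \<in> S \<Longrightarrow> \<ominus>\<^sub>V x \<in> S"
  using smult_l_minus[of "\<one>" x] subspD[of S] by (metis R.one_closed R.a_inv_closed smult_one)

lemma subsp_diff: "subsp K V S \<Longrightarrow> x \<in> S \<Longrightarrow> y \<in> S \<Longrightarrow> x \<ominus>\<^sub>V y \<in> S"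
  by (simp add: a_minus_def subsp_neg subspD)

lemma subsp_carrier: "subsp K V (carrier V)"
  unfolding subsp_def by auto

lemma subsp_zero: "subsp K V {\<zero>\<^sub>V}"
  unfolding subsp_def by auto

lemma subsp_inter: "subsp K V S \<Longrightarrow> subsp K V T \<Longrightarrow> subsp K V (S \<inter> T)"
  unfolding subsp_def by auto

lemma subsp_cancel:
  assumes "subsp K V S" "x \<in> carrier V" "s \<in> S" "s \<oplus>\<^sub>V x \<in> S"
  shows "x \<in> S"
proof -
  have "s \<in> carrier V" using subspD[OF assms(1)] assms(3) by auto
  then have "x = (s \<oplus>\<^sub>V x) \<ominus>\<^sub>V s" using assms(2)
    by (simp add: a_minus_def M.a_comm[of s x] M.a_assoc M.r_neg)
  then show ?thesis using subsp_diff[OF assms(1) assms(4) assms(3)] by simp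
qed

lemma subsp_cancel': 
  assumes "subsp K V S" "x \<in> carrier V" "s \<in> S" "x \<oplus>\<^sub>V s \<in> S"
  shows "x \<in> S"
  using subsp_cancel[of S x s] assms subspD[OF assms(1)] by (metis M.a_comm)

lemma ssum_subsp:
  assumes "subsp K V S" "subsp K V T" shows "subsp K V (ssum V S T)"
proof -
  note [simp] = subspD[OF assms(1)] subspD[OF assms(2)]
  have "\<exists>s' t'. (s \<oplus>\<^sub>V t) \<oplus>\<^sub>V (u \<oplus>\<^sub>V v) = s' \<oplus>\<^sub>V t' \<and> s' \<in> S \<and> t' \<in> T"
    if "s \<in> S" "t \<in> T" "u \<in> S" "v \<in> T" for s t u v
    by (rule exI[of _ "s \<oplus>\<^sub>V u"], rule exI[of _ "t \<oplus>\<^sub>V v"]) (use that in \<open>simp add: M.a_ac\<close>)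
  moreover have "\<exists>s' t'. a \<odot>\<^sub>V (s \<oplus>\<^sub>V t) = s' \<oplus>\<^sub>V t' \<and> s' \<in> S \<and> t' \<in> T"
    if "s \<in> S" "t \<in> T" "a \<in> carrier K" for s t a
    by (rule exI[of _ "a \<odot>\<^sub>V s"], rule exI[of _ "a \<odot>\<^sub>V t"]) (use that in \<open>simp add: smult_r_distr\<close>)
  moreover have "\<exists>s t. \<zero>\<^sub>V = s \<oplus>\<^sub>V t \<and> s \<in> S \<and> t \<in> T"
    by (rule exI[of _ "\<zero>\<^sub>V"], rule exI[of _ "\<zero>\<^sub>V"]) simp
  ultimately show ?thesis unfolding subsp_def ssum_def by (auto simp: subspD)
qed

lemma ssum_ge1: "subsp K V T \<Longrightarrow> S \<subseteq> carrier V \<Longrightarrow> S \<subseteq> ssum V S T"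
  unfolding ssum_def by (force dest: subspD(2))

lemma ssum_ge2: "subsp K V S \<Longrightarrow> T \<subseteq> carrier V \<Longrightarrow> T \<subseteq> ssum V S T"
  unfolding ssum_def by (force dest: subspD(2))

lemma ssum_least: "subsp K V Z \<Longrightarrow> S \<subseteq> Z \<Longrightarrow> T \<subseteq> Z \<Longrightarrow> ssum V S T \<subseteq> Z"
  unfolding ssum_def by (auto dest: subspD(4))

lemma ssum_mono: "S \<subseteq> S' \<Longrightarrow> T \<subseteq> T' \<Longrightarrow> ssum V S T \<subseteq> ssum V S' T'"
  unfolding ssum_def by blast

lemma adj_subsp:
  assumes "subsp K V S" "v \<in> carrier V" shows "subsp K V (adj K V S v)"
proof -
  note [simp] = subspD[OF assms(1)] assms(2)
  have "\<exists>s' a'. (s \<oplus>\<^sub>V a \<odot>\<^sub>V v) \<oplus>\<^sub>V (u \<oplus>\<^sub>V b \<odot>\<^sub>V v) = s' \<oplus>\<^sub>V a' \<odot>\<^sub>V v \<and> s' \<in> S \<and> a' \<in> carrier K"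
    if "s \<in> S" "a \<in> carrier K" "u \<in> S" "b \<in> carrier K" for s a u b
    by (rule exI[of _ "s \<oplus>\<^sub>V u"], rule exI[of _ "a \<oplus> b"]) (use that in \<open>simp add: M.a_ac smult_l_distr\<close>)
  moreover have "\<exists>s' a'. b \<odot>\<^sub>V (s \<oplus>\<^sub>V a \<odot>\<^sub>V v) = s' \<oplus>\<^sub>V a' \<odot>\<^sub>V v \<and> s' \<in> S \<and> a' \<in> carrier K"
    if "s \<in> S" "a \<in> carrier K" "b \<in> carrier K" for s a b
    by (rule exI[of _ "b \<odot>\<^sub>V s"], rule exI[of _ "b \<otimes> a"])
      (use that in \<open>simp add: smult_r_distr smult_assoc1\<close>)
  moreover have "\<exists>s a. \<zero>\<^sub>V = s \<oplus>\<^sub>V a \<odot>\<^sub>V v \<and> s \<in> S \<and> a \<in> carrier K"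
    by (rule exI[of _ "\<zero>\<^sub>V"], rule exI[of _ "\<zero>"]) simp
  ultimately show ?thesis unfolding subsp_def adj_def by (auto simp: subspD)
qed

lemma adj_ge: "S \<subseteq> carrier V \<Longrightarrow> v \<in> carrier V \<Longrightarrow> S \<subseteq> adj K V S v"
  unfolding adj_def by (force intro: exI[of _ "\<zero>"])

lemma adj_mem: "subsp K V S \<Longrightarrow> v \<in> carrier V \<Longrightarrow> v \<in> adj K V S v"
  unfolding adj_def by (force intro: exI[of _ "\<one>"] dest: subspD(2))

lemma adj_least: "subsp K V Z \<Longrightarrow> S \<subseteq> Z \<Longrightarrow> v \<in> Z \<Longrightarrow> adj K V S v \<subseteq> Z"
  unfolding adj_def by (auto dest: subspD(4,5))

lemma adj_mono: "S \<subseteq> T \<Longrightarrow> adj K V S v \<subseteq> adj K V T v"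
  unfolding adj_def by blast

text \<open>Steinitz exchange: in \<open>x = s + a v\<close> the scalar \<open>a\<close> is nonzero,
  since otherwise \<open>x\<close> would lie in \<open>S\<close>; dividing by it expresses
  \<open>v\<close> through \<open>x\<close>.\<close>

lemma adj_exchange:
  assumes S: "subsp K V S" and v: "v \<in> carrier V" and x: "x \<in> adj K V S v" "x \<notin> S"
  shows "adj K V S x = adj K V S v"
proof
  have xc: "x \<in> carrier V" using adj_subsp[OF S v] x(1) subspD(3) by auto
  show "adj K V S x \<subseteq> adj K V S v"
    using adj_least[OF adj_subsp[OF S v]] adj_ge[of S v] subspD(1)[OF S] v x(1) by auto
  obtain s a where sa: "x = s \<oplus>\<^sub>V a \<odot>\<^sub>V v" "s \<in> S" "a \<in> carrier K" using x(1) unfolding adj_def by auto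
  have sc: "s \<in> carrier V" using sa S subspD by auto
  have a0: "a \<noteq> \<zero>" using sa x(2) v sc by auto
  then have au: "inv a \<in> carrier K" "inv a \<otimes> a = \<one>"
    using sa(3) field_Units by auto
  have "inv a \<odot>\<^sub>V x = inv a \<odot>\<^sub>V s \<oplus>\<^sub>V v"
    using sa sc v au by (simp add: smult_r_distr smult_assoc1[symmetric])
  moreover have "inv a \<odot>\<^sub>V x \<in> adj K V S x"
    using au adj_subsp[OF S xc] adj_mem[OF S xc] subspD(5) by blast
  moreover have "inv a \<odot>\<^sub>V s \<in> adj K V S x"
    using au sa(2) S adj_ge[of S x] xc subspD(1,5)[OF S] by blast
  ultimately have "v \<in> adj K V S x"
    using subsp_cancel[OF adj_subsp[OF S xc] v] by auto
  then show "adj K V S v \<subseteq> adj K V S x"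
    using adj_least[OF adj_subsp[OF S xc]] adj_ge[of S x] subspD(1)[OF S] xc by auto
qed

lemma adj_commute:
  assumes "S \<subseteq> carrier V" "v \<in> carrier V" "x \<in> carrier V"
  shows "adj K V (adj K V S v) x = adj K V (adj K V S x) v"
proof -
  have *: "(s \<oplus>\<^sub>V a \<odot>\<^sub>V v) \<oplus>\<^sub>V b \<odot>\<^sub>V x = (s \<oplus>\<^sub>V b \<odot>\<^sub>V x) \<oplus>\<^sub>V a \<odot>\<^sub>V v"
    if "s \<in> S" "a \<in> carrier K" "b \<in> carrier K" for s a b
    using that assms by (simp add: M.a_ac subset_iff)
  show ?thesis unfolding adj_def
    apply (intro equalityI subsetI)
    using * by (clarsimp, metis)+
qed

section \<open>Existence, uniqueness and additivity of relative dimensions\<close>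

lemma qdim_subsp: "qdim K V T S n \<Longrightarrow> subsp K V T \<and> subsp K V S \<and> T \<subseteq> S"
proof (induction rule: qdim.induct)
  case (qdim_step T S n v)
  then show ?case using adj_subsp[of S v] adj_ge[of S v] subspD(1) by auto
qed auto

lemma qdim_0: "qdim K V T S 0 \<Longrightarrow> S = T"
  by (erule qdim.cases) auto

lemma qdim_trans: "qdim K V S U m \<Longrightarrow> qdim K V T S n \<Longrightarrow> qdim K V T U (n + m)"
  by (induction rule: qdim.induct) (auto intro: qdim.intros)

lemma qdim_step1: "subsp K V S \<Longrightarrow> v \<in> carrier V \<Longrightarrow> v \<notin> S \<Longrightarrow> qdim K V S (adj K V S v) 1"
  using qdim_step[OF qdim_refl, of K V S v] by simp

lemma qdim_adj_le: "subsp K V S \<Longrightarrow> v \<in> carrier V \<Longrightarrow> \<exists>j\<le>1. qdim K V S (adj K V S v) j"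
proof (cases "v \<in> S")
  case True
  assume "subsp K V S" "v \<in> carrier V"
  then have "adj K V S v = S" using adj_least[of S S v] adj_ge[of S v] True subspD(1) by blast
  then show ?thesis using qdim_refl[of K V S] \<open>subsp K V S\<close> by (intro exI[of _ 0]) auto
qed (use qdim_step1 in \<open>auto intro!: exI[of _ 1]\<close>)

text \<open>Each step of the chain survives the adjunction of \<open>x\<close> at both ends: if a
  new vector \<open>v\<close> fell into \<open>S + K x\<close>, exchange would put \<open>x\<close>
  into \<open>S + K v\<close>, against the assumption that \<open>x\<close> is outside the top
  space.\<close>

lemma qdim_adj:
  assumes "qdim K V Y S k" "x \<in> carrier V" "x \<notin> S"
  shows "qdim K V (adj K V Y x) (adj K V S x) k"
  using assms
proof (induction rule: qdim.induct)
  case (qdim_refl T)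
  then show ?case by (simp add: adj_subsp qdim.qdim_refl)
next
  case (qdim_step T S n v)
  have S: "subsp K V S" using qdim_step qdim_subsp by auto
  have "x \<notin> S" using qdim_step.prems adj_ge[of S v] S subspD(1) qdim_step.hyps by auto
  then have IH: "qdim K V (adj K V T x) (adj K V S x) n" using qdim_step by auto
  have "v \<notin> adj K V S x"
  proof
    assume "v \<in> adj K V S x"
    then have "adj K V S v = adj K V S x"
      using adj_exchange[OF S qdim_step.prems(1), of v] qdim_step.hyps by auto
    then show False using adj_mem[OF S qdim_step.prems(1)] qdim_step.prems(2) by auto
  qed
  then show ?case using qdim.qdim_step[OF IH, of v] qdim_step adj_commute[of S v x] S subspD(1) by simp
qed

text \<open>The source of all dimension arithmetic. Along the chain from \<open>T\<close> to
  \<open>S\<close> one follows the intersection with \<open>Z\<close>; at each step \<open>Z\<close>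
  either stays inside the smaller space or contains a vector that may replace the adjoined
  one.\<close>

lemma qdim_mid:
  assumes "qdim K V T S n" "subsp K V Z" "T \<subseteq> Z" "Z \<subseteq> S"
  shows "\<exists>m\<le>n. qdim K V T Z m \<and> qdim K V Z S (n - m)"
  using assms
proof (induction arbitrary: Z rule: qdim.induct)
  case (qdim_refl T)
  then have "Z = T" by auto
  then show ?case using qdim_refl by (auto intro: qdim.qdim_refl)
next
  case (qdim_step T S n v)
  have S: "subsp K V S" "T \<subseteq> S" using qdim_step qdim_subsp by auto
  obtain m where m: "m \<le> n" "qdim K V T (Z \<inter> S) m" "qdim K V (Z \<inter> S) S (n - m)"
    using qdim_step.IH[of "Z \<inter> S"] subsp_inter[OF _ S(1)] qdim_step.prems S by auto
  show ?case
  proof (cases "Z \<subseteq> S")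
    case True
    then have "Z \<inter> S = Z" by auto
    then have "qdim K V Z (adj K V S v) (Suc n - m)" 
      using qdim.qdim_step[of K V Z S "n - m" v] m qdim_step.hyps by (simp add: Suc_diff_le)
    then show ?thesis using m True \<open>Z \<inter> S = Z\<close> by (auto intro!: exI[of _ m])
  next
    case False
    then obtain x where x: "x \<in> Z" "x \<notin> S" by auto
    have xc: "x \<in> carrier V" using x qdim_step.prems subspD by auto
    have eq: "adj K V S v = adj K V S x"
      using adj_exchange[OF S(1) qdim_step.hyps(2), of x] x qdim_step.prems by auto
    \<comment> \<open>A modular law: writing an element of \<open>Z\<close> as
      \<open>s + a x\<close> with \<open>x\<close> in \<open>Z\<close> forces \<open>s\<close> into
      \<open>Z\<close>.\<close>
    have Z: "Z = adj K V (Z \<inter> S) x"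
    proof
      show "adj K V (Z \<inter> S) x \<subseteq> Z" using adj_least[OF qdim_step.prems(1)] x by auto
      show "Z \<subseteq> adj K V (Z \<inter> S) x"
      proof
        fix z assume z: "z \<in> Z"
        then obtain s a where sa: "z = s \<oplus>\<^sub>V a \<odot>\<^sub>V x" "s \<in> S" "a \<in> carrier K"
          using qdim_step.prems eq unfolding adj_def by blast
        have "s \<in> Z" using subsp_cancel'[OF qdim_step.prems(1), of s "a \<odot>\<^sub>V x"] sa z x subspD[OF S(1)] 
          subspD[OF qdim_step.prems(1)] by auto
        then show "z \<in> adj K V (Z \<inter> S) x" using sa unfolding adj_def by auto
      qed
    qed
    have "qdim K V T Z (Suc m)" using qdim.qdim_step[OF m(2) xc] x Z by auto
    moreover have "qdim K V Z (adj K V S v) (n - m)"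
      using qdim_adj[OF m(3) xc x(2)] Z eq by auto
    ultimately show ?thesis using m by (auto intro!: exI[of _ "Suc m"])
  qed
qed

lemma qdim_self: "qdim K V S S j \<Longrightarrow> j = 0"
proof (erule qdim.cases)
  fix T S' n v assume a: "S = T" "S = adj K V S' v" "j = Suc n" "qdim K V T S' n" "v \<in> carrier V" "v \<notin> S'"
  then have "v \<in> S" using adj_mem[of S' v] qdim_subsp by blast
  then show "j = 0" using a qdim_subsp[OF a(4)] by auto
qed auto

text \<open>The last intermediate space \<open>S\<close> of the first chain is inserted into the
  second one by \<open>qdim_mid\<close>. Below \<open>S\<close> the induction hypothesis applies,
  and above it there is exactly one step.\<close>

lemma qdim_unique: "qdim K V T S n \<Longrightarrow> qdim K V T S m \<Longrightarrow> n = m"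
proof (induction arbitrary: m rule: qdim.induct)
  case (qdim_refl T) then show ?case using qdim_self by auto
next
  case (qdim_step T S n v)
  have S: "subsp K V S" "T \<subseteq> S" using qdim_step qdim_subsp by auto
  have SS: "S \<subseteq> adj K V S v" using adj_ge[of S v] S subspD(1) qdim_step by auto
  obtain i where i: "i \<le> m" "qdim K V T S i" "qdim K V S (adj K V S v) (m - i)"
    using qdim_mid[OF qdim_step.prems S(1) S(2) SS] by auto
  have "n = i" using qdim_step.IH i by auto
  moreover have "m - i = 1"
    using i(3)
  proof (cases rule: qdim.cases)
    case qdim_refl
    then show ?thesis using adj_mem[OF S(1) qdim_step.hyps(2)] qdim_step.hyps(3) by auto
  next
    case (qdim_step S' n' w)
    have S': "subsp K V S'" "S \<subseteq> S'" using qdim_step qdim_subsp by auto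
    \<comment> \<open>Nothing lies strictly between \<open>S\<close> and \<open>S + K v\<close>: a
      vector outside \<open>S\<close> generates \<open>v\<close> by exchange.\<close>
    have "S' = S"
    proof (rule ccontr)
      assume "S' \<noteq> S"
      then obtain x where x: "x \<in> S'" "x \<notin> S" using S' by auto
      then have "x \<in> adj K V S v" using local.qdim_step adj_ge[of S' w] S' subspD(1) by auto
      then have "adj K V S v = adj K V S x" using adj_exchange[OF S(1)] x qdim_step.hyps by (metis \<open>v \<in> carrier V\<close>)
      also have "\<dots> \<subseteq> S'" using adj_least[OF S'(1)] S' x by auto
      finally show False using local.qdim_step adj_mem[OF S'(1)] by auto
    qed
    then show ?thesis using local.qdim_step qdim_self by auto
  qed
  ultimately show ?case using i(1) by simp
qed

lemma qdim_sub:
  assumes "qdim K V T S n" "subsp K V Z" "T \<subseteq> Z" "Z \<subseteq> S"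
  obtains m where "m \<le> n" "qdim K V T Z m" "qdim K V Z S (n - m)"
  using qdim_mid[OF assms] by auto

lemma qdim_diff:
  assumes "qdim K V T S n" "qdim K V T Z m" "Z \<subseteq> S"
  shows "m \<le> n" "qdim K V Z S (n - m)"
proof -
  obtain i where "i \<le> n" "qdim K V T Z i" "qdim K V Z S (n - i)"
    using qdim_mid[OF assms(1) _ _ assms(3)] qdim_subsp[OF assms(2)] by auto
  then show "m \<le> n" "qdim K V Z S (n - m)" using qdim_unique[OF assms(2)] by auto
qed

lemma qdim_diff':
  assumes "qdim K V T S n" "qdim K V Z S m" "T \<subseteq> Z"
  shows "m \<le> n" "qdim K V T Z (n - m)"
proof -
  obtain i where i: "i \<le> n" "qdim K V T Z i" "qdim K V Z S (n - i)"
    using qdim_mid[OF assms(1) _ assms(3)] qdim_subsp[OF assms(2)] by auto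
  then have "m = n - i" using qdim_unique[OF assms(2)] by auto
  then show "m \<le> n" "qdim K V T Z (n - m)" using i by auto
qed

text \<open>A step of the chain contributes to the intersection only if the larger space contains a
  vector of \<open>S\<close> outside the smaller one, and then that vector can be taken as the
  adjoined one. So no step counts more than once.\<close>

lemma qdim_inter:
  assumes "qdim K V Z Y n" "subsp K V S"
  shows "\<exists>m\<le>n. qdim K V (Z \<inter> S) (Y \<inter> S) m"
  using assms
proof (induction rule: qdim.induct)
  case (qdim_refl T) then show ?case by (auto intro: qdim.qdim_refl subsp_inter)
next
  case (qdim_step T Y n v)
  obtain m where m: "m \<le> n" "qdim K V (T \<inter> S) (Y \<inter> S) m" using qdim_step by auto
  have Y: "subsp K V Y" using qdim_step qdim_subsp by auto
  show ?case
  proof (cases "adj K V Y v \<inter> S \<subseteq> Y")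
    case True
    then have "adj K V Y v \<inter> S = Y \<inter> S" using adj_ge[of Y v] Y subspD(1) qdim_step by blast
    then show ?thesis using m by (auto intro!: exI[of _ m])
  next
    case False
    then obtain w where w: "w \<in> adj K V Y v" "w \<in> S" "w \<notin> Y" by auto
    have wc: "w \<in> carrier V" using w qdim_step subspD by auto
    have eq: "adj K V Y v = adj K V Y w" using adj_exchange[OF Y] w qdim_step by auto
    have "adj K V Y v \<inter> S = adj K V (Y \<inter> S) w"
    proof
      show "adj K V (Y \<inter> S) w \<subseteq> adj K V Y v \<inter> S"
        using adj_least[OF qdim_step.prems, of "Y \<inter> S" w] w adj_mono[of "Y \<inter> S" Y w] eq by auto
      show "adj K V Y v \<inter> S \<subseteq> adj K V (Y \<inter> S) w"
      proof
        fix z assume z: "z \<in> adj K V Y v \<inter> S"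
        then obtain s a where sa: "z = s \<oplus>\<^sub>V a \<odot>\<^sub>V w" "s \<in> Y" "a \<in> carrier K"
          using eq unfolding adj_def by blast
        have "s \<in> S" using subsp_cancel'[OF qdim_step.prems(1), of s "a \<odot>\<^sub>V w"] sa z w subspD[OF Y] 
          subspD[OF qdim_step.prems(1)] by auto
        then show "z \<in> adj K V (Y \<inter> S) w" using sa unfolding adj_def by auto
      qed
    qed
    then show ?thesis using qdim.qdim_step[OF m(2) wc] w m by (auto intro!: exI[of _ "Suc m"])
  qed
qed

text \<open>Every vector adjoined to \<open>T'\<close> imposes one more linear condition on
  \<open>S\<close>, which lowers the annihilator by at most one dimension; the vectors of
  \<open>T'\<close> impose none.\<close>

lemma qdim_annih:
  assumes "qdim K V T' T k" "subsp K V S" "bilin K V T S p" "\<And>t s. t \<in> T' \<Longrightarrow> s \<in> S \<Longrightarrow> p t s = \<zero>"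
  shows "\<exists>j\<le>k. qdim K V {s \<in> S. \<forall>t\<in>T. p t s = \<zero>} S j"
  using assms
proof (induction rule: qdim.induct)
  case (qdim_refl T)
  then have "{s \<in> S. \<forall>t\<in>T. p t s = \<zero>} = S" by auto
  then show ?case using qdim_refl by (auto intro: qdim.qdim_refl)
next
  case (qdim_step T' T k v)
  have T: "subsp K V T" using qdim_step qdim_subsp by auto
  note Tv = adj_subsp[OF T \<open>v \<in> carrier V\<close>]
  have TT: "T \<subseteq> adj K V T v" "v \<in> adj K V T v" using adj_ge[of T v] adj_mem[OF T] T subspD(1) qdim_step by auto
  note B = qdim_step.prems(2)
  note S = subspD[OF qdim_step.prems(1)]
  let ?S1 = "{s \<in> S. \<forall>t\<in>T. p t s = \<zero>}" and ?S0 = "{s \<in> S. \<forall>t\<in>adj K V T v. p t s = \<zero>}"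
  obtain j where j: "j \<le> k" "qdim K V ?S1 S j"
    using qdim_step.IH[OF qdim_step.prems(1) bilin_mono[OF B TT(1)]] qdim_step.prems by auto
  have S1: "subsp K V ?S1" using j qdim_subsp by auto
  have S0: "?S0 = {s \<in> ?S1. p v s = \<zero>}"
  proof (intro equalityI subsetI)
    fix s assume s: "s \<in> {s \<in> ?S1. p v s = \<zero>}"
    have "p t s = \<zero>" if tt: "t \<in> adj K V T v" for t
    proof -
      obtain t' a where t': "t = t' \<oplus>\<^sub>V a \<odot>\<^sub>V v" "t' \<in> T" "a \<in> carrier K" using tt unfolding adj_def by blast
      have "p t s = p t' s \<oplus> a \<otimes> p v s"
        using B s t' TT subspD(5)[OF Tv] unfolding bilin_def by (simp add: subset_iff)
      then show ?thesis using s t' by simp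
    qed
    then show "s \<in> ?S0" using s by auto
  qed (use TT in auto)
  show ?case
  proof (cases "\<forall>s\<in>?S1. p v s = \<zero>")
    case True
    then have "?S0 = ?S1" using S0 by auto
    then show ?thesis using j by (auto intro!: exI[of _ j])
  next
    case False
    then obtain w where w: "w \<in> ?S1" "p v w \<noteq> \<zero>" by auto
    have wc: "w \<in> carrier V" using w S by auto
    have pvw: "p v w \<in> carrier K" using B w TT unfolding bilin_def by auto
    then have iw: "inv (p v w) \<in> carrier K" "inv (p v w) \<otimes> p v w = \<one>"
      using w(2) field_Units by auto
    have s0: "subsp K V ?S0" unfolding S0 subsp_def
    proof (intro conjI ballI)
      show "\<zero>\<^sub>V \<in> {s \<in> ?S1. p v s = \<zero>}"
      proof -
        have "p v (\<zero> \<odot>\<^sub>V w) = \<zero> \<otimes> p v w" using B w TT unfolding bilin_def by blast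
        then show ?thesis using subspD(2)[OF S1] pvw wc by auto
      qed
    qed (use B TT S S1 in \<open>auto simp: bilin_def subset_iff subsp_def\<close>)
    have "?S1 = adj K V ?S0 w"
    proof
      show "adj K V ?S0 w \<subseteq> ?S1" using adj_least[OF S1, of ?S0 w] w S0 by auto
      show "?S1 \<subseteq> adj K V ?S0 w"
      proof
        fix z assume z: "z \<in> ?S1"
        have pvz: "p v z \<in> carrier K" using B z TT unfolding bilin_def by auto
        \<comment> \<open>Subtracting this multiple of \<open>w\<close> from \<open>z\<close>
          produces a vector on which \<open>p v\<close> vanishes.\<close>
        let ?a = "p v z \<otimes> inv (p v w)"
        have a: "?a \<in> carrier K" using pvz iw by auto
        have zc: "z \<in> carrier V" using z S by auto
        let ?s = "z \<oplus>\<^sub>V (\<ominus> ?a) \<odot>\<^sub>V w"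
        have s1: "?s \<in> ?S1" using subspD(4,5)[OF S1] z w a by (meson R.a_inv_closed)
        have "(\<ominus> ?a) \<odot>\<^sub>V w \<in> S" using w S(5) a by auto
        then have "p v ?s = p v z \<oplus> (\<ominus> ?a) \<otimes> p v w"
          using B z w TT a unfolding bilin_def by auto
        also have "\<dots> = \<zero>" using pvz pvw iw by (simp add: R.m_assoc R.l_minus R.r_neg)
        finally have "?s \<in> ?S0" using s1 S0 by auto
        moreover have "z = ?s \<oplus>\<^sub>V ?a \<odot>\<^sub>V w"
          using zc wc a by (simp add: M.a_assoc smult_l_distr[symmetric] R.l_neg)
        ultimately show "z \<in> adj K V ?S0 w" using a unfolding adj_def by blast
      qed
    qed
    moreover have "w \<notin> ?S0" using w S0 by auto
    ultimately have "qdim K V ?S0 ?S1 1" using qdim_step1[OF s0 wc] by simp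
    then have "qdim K V ?S0 S (1 + j)" using qdim_trans[OF j(2)] by blast
    then show ?thesis using j by (auto intro!: exI[of _ "1 + j"])
  qed
qed

text \<open>If \<open>Z\<close> and \<open>Y\<close> had the same annihilator in \<open>S\<close>,
  its codimension would be at most \<open>dim Z / T\<close>. Its annihilator in \<open>Y\<close> is
  \<open>T\<close> by nondegeneracy, so two uses of \<open>qdim_annih\<close> would give
  \<open>dim Y / T \<le> dim Z / T\<close>, impossible for a proper subspace.\<close>

lemma separation:
  assumes Y: "qdim K V T Y k" and Z: "subsp K V Z" "T \<subseteq> Z" "Z \<subset> Y" and S: "subsp K V S"
    and B: "bilin K V Y S p" and T: "\<And>t s. t \<in> T \<Longrightarrow> s \<in> S \<Longrightarrow> p t s = \<zero>"
    and nd: "\<And>y. y \<in> Y \<Longrightarrow> (\<And>s. s \<in> S \<Longrightarrow> p y s = \<zero>) \<Longrightarrow> y \<in> T"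
  shows "\<exists>s\<in>S. (\<forall>x\<in>Z. p x s = \<zero>) \<and> (\<exists>y\<in>Y. p y s \<noteq> \<zero>)"
proof (rule ccontr)
  assume "\<not> ?thesis"
  then have eq: "{s \<in> S. \<forall>t\<in>Z. p t s = \<zero>} = {s \<in> S. \<forall>t\<in>Y. p t s = \<zero>}" using Z(3) by blast
  obtain m where m: "m \<le> k" "qdim K V T Z m" "qdim K V Z Y (k - m)"
    using qdim_sub[OF Y Z(1,2)] Z(3) by auto
  have "k - m \<noteq> 0" using m(3) Z(3) qdim_0[of Z Y] by auto
  obtain j where j: "j \<le> m" "qdim K V {s \<in> S. \<forall>t\<in>Z. p t s = \<zero>} S j"
    using qdim_annih[OF m(2) S bilin_mono[OF B]] Z(3) T by blast
  have YS: "subsp K V Y" using Y qdim_subsp by auto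
  obtain i where i: "i \<le> j" "qdim K V {y \<in> Y. \<forall>s\<in>S. p y s = \<zero>} Y i"
    using qdim_annih[OF j(2)[unfolded eq] YS bilin_flip[OF B]] by auto
  have "{y \<in> Y. \<forall>s\<in>S. p y s = \<zero>} = T" using nd T qdim_subsp[OF Y] by blast
  then have "i = k" using i(2) qdim_unique[OF _ Y] by auto
  then show False using i j m \<open>k - m \<noteq> 0\<close> by auto
qed

end

text \<open>The last hypothesis says that \<open>g\<close> induces an injection of
  \<open>S / T\<close> into \<open>W / Z\<close>. Linearity is stated on \<open>S\<close> only, and
  source and target may be different spaces; typical uses are multiplication by a fixed function and
  \<open>r \<mapsto> r u\<close> for a fixed vector.\<close>

lemma qdim_map:
  fixes K :: "('k, 'p) ring_scheme"
  assumes "vecsp K V" "vecsp K W" "qdim K V T S n"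
    and "\<And>s. s \<in> S \<Longrightarrow> g s \<in> carrier W"
    and "\<And>s t. s \<in> S \<Longrightarrow> t \<in> S \<Longrightarrow> g (s \<oplus>\<^sub>V t) = g s \<oplus>\<^sub>W g t"
    and "\<And>a s. a \<in> carrier K \<Longrightarrow> s \<in> S \<Longrightarrow> g (a \<odot>\<^sub>V s) = a \<odot>\<^sub>W g s"
    and "subsp K W Z" "\<And>s. s \<in> S \<Longrightarrow> g s \<in> Z \<longleftrightarrow> s \<in> T"
  shows "qdim K W Z (ssum W Z (g ` S)) n"
proof -
  interpret V: vecsp K V by fact
  interpret W: vecsp K W by fact
  show ?thesis
    using assms(3-)
  proof (induction rule: qdim.induct)
    case (qdim_refl T)
    have "ssum W Z (g ` T) = Z"
    proof
      show "ssum W Z (g ` T) \<subseteq> Z" using W.ssum_least[OF qdim_refl(5), of Z "g ` T"] qdim_refl(6) by blast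
      have "\<zero>\<^sub>V \<in> T" using V.subspD(2)[OF qdim_refl(1)] .
      then have "g (\<zero>\<^sub>K \<odot>\<^sub>V \<zero>\<^sub>V) = \<zero>\<^sub>K \<odot>\<^sub>W g \<zero>\<^sub>V" using qdim_refl by blast
      then have "g \<zero>\<^sub>V = \<zero>\<^sub>W" using qdim_refl(2)[OF \<open>\<zero>\<^sub>V \<in> T\<close>] by simp
      then show "Z \<subseteq> ssum W Z (g ` T)" unfolding ssum_def 
        using \<open>\<zero>\<^sub>V \<in> T\<close> W.subspD(3)[OF qdim_refl(5)] by (force intro: exI[of _ "\<zero>\<^sub>W"] rev_image_eqI)
    qed
    then show ?case using qdim_refl by (auto intro: qdim.qdim_refl)
  next
    case (qdim_step T S n v)
    have S: "subsp K V S" using qdim_step V.qdim_subsp by auto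
    note vc = \<open>v \<in> carrier V\<close>
    have SS: "S \<subseteq> adj K V S v" "v \<in> adj K V S v"
      using V.adj_ge[of S v] V.adj_mem[OF S] S V.subspD(1) qdim_step by auto
    have TS: "T \<subseteq> S" using qdim_step V.qdim_subsp by auto
    have IH: "qdim K W Z (ssum W Z (g ` S)) n"
      by (rule qdim_step.IH) (use qdim_step.prems subsetD[OF SS(1)] in \<open>blast+\<close>)
    have gv: "g v \<in> carrier W" using qdim_step.prems(1) SS by auto
    have gS: "\<And>s. s \<in> S \<Longrightarrow> g s \<in> carrier W" using qdim_step.prems(1) SS by auto
    have av: "a \<odot>\<^sub>V v \<in> adj K V S v" if "a \<in> carrier K" for a
      using V.subspD(5)[OF V.adj_subsp[OF S vc]] SS that by auto
    have gad: "g (s \<oplus>\<^sub>V a \<odot>\<^sub>V v) = g s \<oplus>\<^sub>W a \<odot>\<^sub>W g v" if "s \<in> S" "a \<in> carrier K" for s a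
      using qdim_step.prems(2)[of s "a \<odot>\<^sub>V v"] qdim_step.prems(3)[of a v] that SS av by auto
    have Xc: "Z \<subseteq> carrier W" using qdim_step.prems W.subspD by auto
    \<comment> \<open>Otherwise \<open>g v = z + g s\<close> with \<open>z\<close> in
      \<open>Z\<close>, so that \<open>s - v\<close> is mapped into \<open>Z\<close> and hence lies
      in \<open>T\<close>; then \<open>v\<close> would lie in \<open>S\<close>.\<close>
    have "g v \<notin> ssum W Z (g ` S)"
    proof
      assume "g v \<in> ssum W Z (g ` S)"
      then obtain x s where xs: "x \<in> Z" "s \<in> S" "g v = x \<oplus>\<^sub>W g s" unfolding ssum_def by auto
      have sc: "s \<in> carrier V" using xs S V.subspD by auto
      have "g (s \<oplus>\<^sub>V (\<ominus>\<^sub>K \<one>\<^sub>K) \<odot>\<^sub>V v) = g s \<oplus>\<^sub>W (\<ominus>\<^sub>K \<one>\<^sub>K) \<odot>\<^sub>W g v"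
        using gad xs by auto
      also have "\<dots> = \<ominus>\<^sub>W x"
      proof -
        have c: "g s \<in> carrier W" "x \<in> carrier W" using xs gS Xc by auto
        have 1: "(\<ominus>\<^sub>K \<one>\<^sub>K) \<odot>\<^sub>W (x \<oplus>\<^sub>W g s) = \<ominus>\<^sub>W (x \<oplus>\<^sub>W g s)"
          using c by (simp add: W.smult_l_minus)
        have 2: "\<ominus>\<^sub>W (x \<oplus>\<^sub>W g s) = \<ominus>\<^sub>W g s \<oplus>\<^sub>W \<ominus>\<^sub>W x"
          using c by (simp add: W.M.minus_add W.M.a_comm)
        have 3: "g s \<oplus>\<^sub>W (\<ominus>\<^sub>W g s \<oplus>\<^sub>W \<ominus>\<^sub>W x) = \<ominus>\<^sub>W x"
          using c by (simp add: W.M.a_assoc[symmetric] W.M.r_neg)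
        show ?thesis unfolding xs(3) 1 2 3 ..
      qed
      finally have "g (s \<oplus>\<^sub>V (\<ominus>\<^sub>K \<one>\<^sub>K) \<odot>\<^sub>V v) \<in> Z" using W.subsp_neg qdim_step.prems xs by auto
      moreover have "s \<oplus>\<^sub>V (\<ominus>\<^sub>K \<one>\<^sub>K) \<odot>\<^sub>V v \<in> adj K V S v" using xs unfolding adj_def by auto
      ultimately have "s \<oplus>\<^sub>V (\<ominus>\<^sub>K \<one>\<^sub>K) \<odot>\<^sub>V v \<in> S" using qdim_step.prems(5) TS by auto
      then have "(\<ominus>\<^sub>K \<one>\<^sub>K) \<odot>\<^sub>V v \<in> S" using V.subsp_cancel[OF S _ xs(2)] vc by auto
      then have "\<ominus>\<^sub>V ((\<ominus>\<^sub>K \<one>\<^sub>K) \<odot>\<^sub>V v) \<in> S" using V.subsp_neg[OF S] by auto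
      then show False using qdim_step.hyps vc by (simp add: V.smult_l_minus)
    qed
    moreover have "ssum W Z (g ` adj K V S v) = adj K W (ssum W Z (g ` S)) (g v)"
    proof -
      have *: "x \<oplus>\<^sub>W g (s \<oplus>\<^sub>V a \<odot>\<^sub>V v) = (x \<oplus>\<^sub>W g s) \<oplus>\<^sub>W a \<odot>\<^sub>W g v"
        if "x \<in> Z" "s \<in> S" "a \<in> carrier K" for x s a
        using that gad gv gS Xc by (simp add: W.M.a_assoc subset_iff)
      show ?thesis
      proof (intro equalityI subsetI)
        fix z assume "z \<in> ssum W Z (g ` adj K V S v)"
        then obtain x s a where r: "x \<in> Z" "s \<in> S" "a \<in> carrier K" "z = x \<oplus>\<^sub>W g (s \<oplus>\<^sub>V a \<odot>\<^sub>V v)"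
          unfolding ssum_def adj_def by auto
        have "x \<oplus>\<^sub>W g s \<in> ssum W Z (g ` S)" using r unfolding ssum_def by auto
        then show "z \<in> adj K W (ssum W Z (g ` S)) (g v)"
          unfolding r(4) *[OF r(1-3)] adj_def using r(3) by auto
      next
        fix z assume "z \<in> adj K W (ssum W Z (g ` S)) (g v)"
        then obtain x s a where r: "x \<in> Z" "s \<in> S" "a \<in> carrier K" "z = (x \<oplus>\<^sub>W g s) \<oplus>\<^sub>W a \<odot>\<^sub>W g v"
          unfolding ssum_def adj_def by auto
        have "g (s \<oplus>\<^sub>V a \<odot>\<^sub>V v) \<in> g ` adj K V S v" using r unfolding adj_def by auto
        then show "z \<in> ssum W Z (g ` adj K V S v)"
          unfolding r(4) *[OF r(1-3), symmetric] ssum_def using r(1) by auto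
      qed
    qed
    ultimately show ?case using qdim.qdim_step[OF IH gv] by simp
  qed
qed

context vecsp
begin

lemma qdim_ssum:
  assumes "qdim K V T S n" "subsp K V Z" "Z \<inter> S = T"
  shows "qdim K V Z (ssum V Z S) n"
proof -
  have S: "subsp K V S" using qdim_subsp[OF assms(1)] by simp
  have "qdim K V Z (ssum V Z ((\<lambda>x. x) ` S)) n"
  proof (rule qdim_map[OF vecsp_axioms vecsp_axioms assms(1)])
    show "\<And>s. s \<in> S \<Longrightarrow> s \<in> carrier V" using subspD(3)[OF S] .
    show "\<And>s. s \<in> S \<Longrightarrow> (s \<in> Z) = (s \<in> T)" using assms(3) by blast
  qed (rule refl assms(2))+
  then show ?thesis by simp
qed

lemma qdim_ssum_le:
  assumes "qdim K V T S n" "subsp K V Z" "T \<subseteq> Z"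
  shows "\<exists>m\<le>n. qdim K V Z (ssum V Z S) m"
proof -
  have S: "subsp K V S" "T \<subseteq> S" using qdim_subsp[OF assms(1)] by auto
  obtain m where "m \<le> n" "qdim K V T (Z \<inter> S) m" "qdim K V (Z \<inter> S) S (n - m)"
    using qdim_sub[OF assms(1) subsp_inter[OF assms(2) S(1)]] assms S by auto
  then show ?thesis using qdim_ssum[OF _ assms(2)] by (metis diff_le_self)
qed

end

section \<open>Tensor products\<close>

abbreviation tens :: "('f, 'p) ring_scheme \<Rightarrow> ('f, 'l) module \<Rightarrow> ('f, 'v) module \<Rightarrow> 'l \<Rightarrow> 'v \<Rightarrow> ('l, 'v) tensor" where
  "tens F L V l v \<equiv> tensor_class F L V (frag_of (l, v))"

locale tensor = L: algebra F L + V: module F V for F and L :: "('f, 'l) module" and V :: "('f, 'v) module"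
begin

abbreviation "Fr \<equiv> tensor_free L V"
abbreviation "TK \<equiv> tensor_kernel F L V"
abbreviation "TG \<equiv> tensor_group F L V"
abbreviation "cls \<equiv> tensor_class F L V"

lemma Fr_carrier: "u \<in> carrier Fr \<longleftrightarrow> Poly_Mapping.keys u \<subseteq> carrier L \<times> carrier V"
  by (simp add: tensor_free_def)

lemma Fr_comm: "comm_group Fr"
  by (simp add: tensor_free_def abelian_free_Abelian_group)

lemma Fr_group: "group Fr"
  by (simp add: tensor_free_def)

lemma Fr_ops: "u \<otimes>\<^sub>Fr w = u + w" "\<one>\<^sub>Fr = 0"
  by (simp_all add: tensor_free_def)

lemma Fr_inv: "u \<in> carrier Fr \<Longrightarrow> inv\<^bsub>Fr\<^esub> u = - u"
  by (simp add: tensor_free_def)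

lemma Fr_of: "l \<in> carrier L \<Longrightarrow> v \<in> carrier V \<Longrightarrow> frag_of (l, v) \<in> carrier Fr"
  by (simp add: Fr_carrier)

lemma Fr_diff: "u \<in> carrier Fr \<Longrightarrow> w \<in> carrier Fr \<Longrightarrow> u - w \<in> carrier Fr"
  unfolding Fr_carrier by (meson Un_least keys_diff order_trans)

lemma rel_sub: "tensor_relations F L V \<subseteq> carrier Fr"
  unfolding tensor_relations_def by (auto intro!: Fr_diff Fr_of)

lemma TK_subgroup: "subgroup TK Fr"
  unfolding tensor_kernel_def using group.generate_is_subgroup[OF Fr_group rel_sub] .

lemma TK_diff: "u \<in> TK \<Longrightarrow> w \<in> TK \<Longrightarrow> u - w \<in> TK"
proof -
  assume u: "u \<in> TK" "w \<in> TK"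
  then have "u \<otimes>\<^sub>Fr inv\<^bsub>Fr\<^esub> w \<in> TK"
    using subgroup.m_closed[OF TK_subgroup] subgroup.m_inv_closed[OF TK_subgroup] by blast
  then show ?thesis using u subgroup.subset[OF TK_subgroup] by (simp add: Fr_ops Fr_inv subset_iff)
qed

lemma TK_normal: "TK \<lhd> Fr"
  using TK_subgroup comm_group.subgroup_imp_normal[OF Fr_comm] by blast

lemma TG_carrier: "carrier TG = cls ` carrier Fr"
  unfolding tensor_group_def tensor_class_def carrier_FactGroup ..

lemma cls_closed: "u \<in> carrier Fr \<Longrightarrow> cls u \<in> carrier TG"
  using TG_carrier by auto

lemma TG_comm: "comm_group TG"
  unfolding tensor_group_def using comm_group.abelian_FactGroup[OF Fr_comm TK_subgroup] .

lemma cls_add: "u \<in> carrier Fr \<Longrightarrow> w \<in> carrier Fr \<Longrightarrow> cls u \<otimes>\<^sub>TG cls w = cls (u + w)"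
  unfolding tensor_group_def tensor_class_def
  using normal.rcos_sum[OF TK_normal] by (simp add: Fr_ops)

lemma cls_mem: "u \<in> carrier Fr \<Longrightarrow> u \<in> cls u"
  unfolding tensor_class_def using group.rcos_self[OF Fr_group] TK_subgroup by blast

lemma cls_eq_iff: "u \<in> carrier Fr \<Longrightarrow> w \<in> carrier Fr \<Longrightarrow> cls u = cls w \<longleftrightarrow> u - w \<in> TK"
proof -
  assume uw: "u \<in> carrier Fr" "w \<in> carrier Fr"
  have "(u \<in> TK #>\<^bsub>Fr\<^esub> w) = (u - w \<in> TK)"
    using subgroup.rcos_module[OF TK_subgroup Fr_group uw(2,1)] uw by (simp add: Fr_inv Fr_ops)
  then show ?thesis unfolding tensor_class_def
    using group.repr_independence[OF Fr_group _ uw(2) TK_subgroup, of u] 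
      group.repr_independenceD[OF Fr_group TK_subgroup uw(1)] group.rcos_self[OF Fr_group uw(1) TK_subgroup]
    by blast
qed

lemma cls_zero: "\<one>\<^sub>TG = cls 0"
proof -
  have "TK #>\<^bsub>Fr\<^esub> \<one>\<^sub>Fr = TK"
    using group.coset_mult_one[OF Fr_group] TK_subgroup subgroup.subset by blast
  then show ?thesis by (simp add: tensor_group_def tensor_class_def Fr_ops)
qed

lemma cls_mem_carrier: "u \<in> carrier Fr \<Longrightarrow> w \<in> cls u \<Longrightarrow> w \<in> carrier Fr"
  unfolding tensor_class_def using subgroup.elemrcos_carrier[OF TK_subgroup Fr_group] by blast

lemma cls_some:
  assumes "s \<in> carrier TG" shows "(SOME u. u \<in> s) \<in> carrier Fr" "cls (SOME u. u \<in> s) = s"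
proof -
  obtain u where u: "u \<in> carrier Fr" "s = cls u" using assms TG_carrier by auto
  then have "(SOME u. u \<in> s) \<in> cls u" using cls_mem by (metis someI)
  moreover from this show "(SOME u. u \<in> s) \<in> carrier Fr" using cls_mem_carrier u by blast
  ultimately show "cls (SOME u. u \<in> s) = s"
    using u(2) group.repr_independence[OF Fr_group _ u(1) TK_subgroup] unfolding tensor_class_def by blast
qed

lemma rel_kill:
  assumes "comm_group G" "h \<in> hom Fr G" "\<And>r. r \<in> tensor_relations F L V \<Longrightarrow> h r = \<one>\<^sub>G"
    and "u \<in> TK" shows "h u = \<one>\<^sub>G"
proof -
  interpret h: group_hom Fr G h
    using assms Fr_group by (simp add: group_hom_def group_hom_axioms_def comm_group.axioms)
  have "TK \<subseteq> kernel Fr G h" unfolding tensor_kernel_def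
    by (rule group.generate_subgroup_incl[OF Fr_group _ h.subgroup_kernel])
      (use rel_sub assms in \<open>auto simp: kernel_def\<close>)
  then show ?thesis using assms(4) unfolding kernel_def by auto
qed

lemma hom_cls_eq:
  assumes "comm_group G" "h \<in> hom Fr G" "\<And>r. r \<in> tensor_relations F L V \<Longrightarrow> h r = \<one>\<^sub>G"
    and "u \<in> carrier Fr" "w \<in> carrier Fr" "cls u = cls w" shows "h u = h w"
proof -
  interpret h: group_hom Fr G h
    using assms Fr_group by (simp add: group_hom_def group_hom_axioms_def comm_group.axioms)
  have "h (u - w) = \<one>\<^sub>G" using rel_kill assms cls_eq_iff by blast
  moreover have "h ((u - w) \<otimes>\<^sub>Fr w) = h (u - w) \<otimes>\<^sub>G h w" using assms Fr_diff h.hom_mult by blast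
  ultimately show ?thesis using assms(5) by (simp add: Fr_ops)
qed

lemma tens_closed: "l \<in> carrier L \<Longrightarrow> v \<in> carrier V \<Longrightarrow> tens F L V l v \<in> carrier TG"
  using cls_closed Fr_of by blast

lemma rel_zero: "r \<in> tensor_relations F L V \<Longrightarrow> r \<in> TK"
  unfolding tensor_kernel_def by (rule generate.incl)

lemma TK_rels:
  "k \<in> carrier L \<Longrightarrow> l \<in> carrier L \<Longrightarrow> v \<in> carrier V \<Longrightarrow>
     frag_of (k \<oplus>\<^sub>L l, v) - frag_of (k, v) - frag_of (l, v) \<in> TK"
  "l \<in> carrier L \<Longrightarrow> v \<in> carrier V \<Longrightarrow> w \<in> carrier V \<Longrightarrow>
     frag_of (l, v \<oplus>\<^sub>V w) - frag_of (l, v) - frag_of (l, w) \<in> TK"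
  "c \<in> carrier F \<Longrightarrow> l \<in> carrier L \<Longrightarrow> v \<in> carrier V \<Longrightarrow>
     frag_of (c \<odot>\<^sub>L l, v) - frag_of (l, c \<odot>\<^sub>V v) \<in> TK"
  by (rule rel_zero, unfold tensor_relations_def, blast)+

lemma Fr_add: "u \<in> carrier Fr \<Longrightarrow> w \<in> carrier Fr \<Longrightarrow> u + w \<in> carrier Fr"
  unfolding Fr_carrier by (meson Un_least keys_add order_trans)

lemma tens_add_l: "k \<in> carrier L \<Longrightarrow> l \<in> carrier L \<Longrightarrow> v \<in> carrier V \<Longrightarrow>
    tens F L V (k \<oplus>\<^sub>L l) v = tens F L V k v \<otimes>\<^sub>TG tens F L V l v"
proof -
  assume a: "k \<in> carrier L" "l \<in> carrier L" "v \<in> carrier V"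
  then have "frag_of (k \<oplus>\<^sub>L l, v) - frag_of (k, v) - frag_of (l, v) \<in> TK"
    by (intro TK_rels)
  then have "frag_of (k \<oplus>\<^sub>L l, v) - (frag_of (k, v) + frag_of (l, v)) \<in> TK" by (simp add: diff_diff_add)
  then show ?thesis using a cls_add Fr_of cls_eq_iff Fr_add by simp
qed

lemma tens_add_r: "l \<in> carrier L \<Longrightarrow> v \<in> carrier V \<Longrightarrow> w \<in> carrier V \<Longrightarrow>
    tens F L V l (v \<oplus>\<^sub>V w) = tens F L V l v \<otimes>\<^sub>TG tens F L V l w"
proof -
  assume a: "l \<in> carrier L" "v \<in> carrier V" "w \<in> carrier V"
  then have "frag_of (l, v \<oplus>\<^sub>V w) - frag_of (l, v) - frag_of (l, w) \<in> TK"
    by (intro TK_rels)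
  then have "frag_of (l, v \<oplus>\<^sub>V w) - (frag_of (l, v) + frag_of (l, w)) \<in> TK" by (simp add: diff_diff_add)
  then show ?thesis using a cls_add Fr_of cls_eq_iff Fr_add by simp
qed

lemma tens_smult: "c \<in> carrier F \<Longrightarrow> l \<in> carrier L \<Longrightarrow> v \<in> carrier V \<Longrightarrow>
    tens F L V (c \<odot>\<^sub>L l) v = tens F L V l (c \<odot>\<^sub>V v)"
proof -
  assume a: "c \<in> carrier F" "l \<in> carrier L" "v \<in> carrier V"
  then have "frag_of (c \<odot>\<^sub>L l, v) - frag_of (l, c \<odot>\<^sub>V v) \<in> TK"
    by (intro TK_rels)
  then show ?thesis using a Fr_of cls_eq_iff by simp
qed

lemma tens_zero: "v \<in> carrier V \<Longrightarrow> tens F L V \<zero>\<^sub>L v = \<one>\<^sub>TG"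
proof -
  assume a: "v \<in> carrier V"
  interpret G: comm_group TG by (rule TG_comm)
  have "tens F L V \<zero>\<^sub>L v \<otimes>\<^sub>TG tens F L V \<zero>\<^sub>L v = tens F L V \<zero>\<^sub>L v"
    using tens_add_l[of "\<zero>\<^sub>L" "\<zero>\<^sub>L" v] a by simp
  then show ?thesis using tens_closed[of "\<zero>\<^sub>L" v] a G.l_cancel_one by auto
qed

lemma tens_neg: "l \<in> carrier L \<Longrightarrow> v \<in> carrier V \<Longrightarrow> inv\<^bsub>TG\<^esub> (tens F L V l v) = tens F L V (\<ominus>\<^sub>L l) v"
proof -
  assume a: "l \<in> carrier L" "v \<in> carrier V"
  interpret G: comm_group TG by (rule TG_comm)
  have "tens F L V (\<ominus>\<^sub>L l) v \<otimes>\<^sub>TG tens F L V l v = \<one>\<^sub>TG"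
    using tens_add_l[of "\<ominus>\<^sub>L l" l v] a tens_zero by (simp add: L.l_neg)
  then show ?thesis using a tens_closed G.inv_equality by auto
qed

lemma tensor_induct [consumes 1, case_names tens add]:
  assumes "s \<in> carrier TG"
    and t: "\<And>l v. l \<in> carrier L \<Longrightarrow> v \<in> carrier V \<Longrightarrow> P (tens F L V l v)"
    and a: "\<And>s t. s \<in> carrier TG \<Longrightarrow> t \<in> carrier TG \<Longrightarrow> P s \<Longrightarrow> P t \<Longrightarrow> P (s \<otimes>\<^sub>TG t)"
  shows "P s"
proof -
  interpret G: comm_group TG by (rule TG_comm)
  obtain u where u: "u \<in> carrier Fr" "s = cls u" using assms TG_carrier by auto
  have cneg: "cls (- u) = inv\<^bsub>TG\<^esub> (cls u)" if "u \<in> carrier Fr" for u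
  proof -
    have "- u \<in> carrier Fr" using that by (simp add: Fr_carrier)
    then have "cls (- u) \<otimes>\<^sub>TG cls u = \<one>\<^sub>TG" using cls_add[of "- u" u] that cls_zero by simp
    then show ?thesis using G.inv_equality cls_closed that \<open>- u \<in> carrier Fr\<close> by metis
  qed
  have z: "P \<one>\<^sub>TG" using t[of "\<zero>\<^sub>L" "\<zero>\<^sub>V"] tens_zero[of "\<zero>\<^sub>V"] by simp
  \<comment> \<open>A class and its inverse are treated together: the induction on the free group
    runs over differences, whereas \<open>P\<close> is known to be preserved by sums only. For
    generators the inverse is again an elementary tensor.\<close>
  have "P (cls u) \<and> P (inv\<^bsub>TG\<^esub> (cls u))"
    using u(1)[unfolded Fr_carrier]
  proof (induction u rule: free_Abelian_group_induct[consumes 1])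
    case 1 show ?case using z cls_zero[symmetric] by simp
  next
    case (2 u w)
    then have uw: "u \<in> carrier Fr" "w \<in> carrier Fr" by (auto simp: Fr_carrier)
    then have "- w \<in> carrier Fr" "- u \<in> carrier Fr" by (auto simp: Fr_carrier)
    then have "cls (u - w) = cls u \<otimes>\<^sub>TG inv\<^bsub>TG\<^esub> (cls w)" "inv\<^bsub>TG\<^esub> (cls (u - w)) = cls w \<otimes>\<^sub>TG inv\<^bsub>TG\<^esub> (cls u)"
      using cls_add[of u "- w"] cls_add[of w "- u"] uw cneg[of "u - w"] cneg[OF uw(1)] cneg[OF uw(2)] Fr_diff by auto
    then show ?case using a 2 uw cls_closed by simp
  next
    case (3 p)
    then show ?case using t tens_neg by (cases p) auto
  qed
  then show ?thesis using u by simp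
qed

text \<open>All maps out of \<open>L \<otimes> V\<close> that are not given by a definition come
  from here: the action of \<open>L\<close>, the coordinate functionals \<open>\<mu>\<close>, the
  extension of the involution and the comparison map \<open>\<psi>\<close>.\<close>

lemma universal:
  assumes G: "comm_group G" and f: "\<And>l v. l \<in> carrier L \<Longrightarrow> v \<in> carrier V \<Longrightarrow> f l v \<in> carrier G"
    "\<And>k l v. k \<in> carrier L \<Longrightarrow> l \<in> carrier L \<Longrightarrow> v \<in> carrier V \<Longrightarrow> f (k \<oplus>\<^sub>L l) v = f k v \<otimes>\<^sub>G f l v"
    "\<And>l v w. l \<in> carrier L \<Longrightarrow> v \<in> carrier V \<Longrightarrow> w \<in> carrier V \<Longrightarrow> f l (v \<oplus>\<^sub>V w) = f l v \<otimes>\<^sub>G f l w"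
    "\<And>c l v. c \<in> carrier F \<Longrightarrow> l \<in> carrier L \<Longrightarrow> v \<in> carrier V \<Longrightarrow> f (c \<odot>\<^sub>L l) v = f l (c \<odot>\<^sub>V v)"
  obtains g where "g \<in> hom TG G" "\<And>l v. l \<in> carrier L \<Longrightarrow> v \<in> carrier V \<Longrightarrow> g (tens F L V l v) = f l v"
proof -
  interpret G: comm_group G by fact
  have im: "(\<lambda>p. f (fst p) (snd p)) ` (carrier L \<times> carrier V) \<subseteq> carrier G" using f(1) by auto
  obtain h where h: "h \<in> hom Fr G" "\<And>p. p \<in> carrier L \<times> carrier V \<Longrightarrow> h (frag_of p) = f (fst p) (snd p)"
    unfolding tensor_free_def by (rule G.free_Abelian_group_universal[OF im]) blast
  interpret h: group_hom Fr G h
    using h Fr_group G.is_group by (simp add: group_hom_def group_hom_axioms_def)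
  have hd: "h (u - w) = h u \<otimes>\<^sub>G inv\<^bsub>G\<^esub> h w" if "u \<in> carrier Fr" "w \<in> carrier Fr" for u w
    using h.hom_mult[of u "- w"] h.hom_inv[of w] that by (simp add: Fr_ops Fr_inv Fr_carrier)
  have c: "a \<otimes>\<^sub>G b \<otimes>\<^sub>G inv\<^bsub>G\<^esub> a \<otimes>\<^sub>G inv\<^bsub>G\<^esub> b = \<one>\<^sub>G" if "a \<in> carrier G" "b \<in> carrier G" for a b
    using that G.m_comm[of a b] by (simp add: G.m_assoc)
  have k: "h r = \<one>\<^sub>G" if "r \<in> tensor_relations F L V" for r
    using that unfolding tensor_relations_def
  proof (elim UnE CollectE exE conjE)
    fix k l v assume r: "r = frag_of (k \<oplus>\<^sub>L l, v) - frag_of (k, v) - frag_of (l, v)"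
      "k \<in> carrier L" "l \<in> carrier L" "v \<in> carrier V"
    then show ?thesis using c[of "f k v" "f l v"] by (simp add: hd Fr_of Fr_diff h(2) f)
  next
    fix l v w assume r: "r = frag_of (l, v \<oplus>\<^sub>V w) - frag_of (l, v) - frag_of (l, w)"
      "l \<in> carrier L" "v \<in> carrier V" "w \<in> carrier V"
    then show ?thesis using c[of "f l v" "f l w"] by (simp add: hd Fr_of Fr_diff h(2) f)
  next
    fix a l v assume r: "r = frag_of (a \<odot>\<^sub>L l, v) - frag_of (l, a \<odot>\<^sub>V v)"
      "a \<in> carrier F" "l \<in> carrier L" "v \<in> carrier V"
    then have "f l (a \<odot>\<^sub>V v) \<in> carrier G" using f(1) by simp
    then show ?thesis using r by (simp add: hd Fr_of Fr_diff h(2) f(4))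
  qed
  obtain g where "g \<in> hom (Fr Mod TK) G" "\<And>u. u \<in> carrier Fr \<Longrightarrow> g (TK #>\<^bsub>Fr\<^esub> u) = h u"
    using FactGroup_universal[OF h(1) TK_normal] hom_cls_eq[OF G h(1) k] unfolding tensor_class_def by blast
  then show thesis using that h(2) Fr_of unfolding tensor_group_def tensor_class_def by auto
qed

end

section \<open>Extension of bilinear maps to tensor products\<close>

definition fbil :: "('f, 'p) ring_scheme \<Rightarrow> ('f, 'u) module \<Rightarrow> ('f, 'v) module \<Rightarrow> ('f, 'w) module \<Rightarrow> ('u \<Rightarrow> 'v \<Rightarrow> 'w) \<Rightarrow> bool" where
  "fbil F U V W f \<longleftrightarrow> (\<forall>u\<in>carrier U. \<forall>v\<in>carrier V. f u v \<in> carrier W) \<and>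
     (\<forall>u\<in>carrier U. \<forall>u'\<in>carrier U. \<forall>v\<in>carrier V. f (u \<oplus>\<^sub>U u') v = f u v \<oplus>\<^sub>W f u' v) \<and>
     (\<forall>u\<in>carrier U. \<forall>v\<in>carrier V. \<forall>v'\<in>carrier V. f u (v \<oplus>\<^sub>V v') = f u v \<oplus>\<^sub>W f u v') \<and>
     (\<forall>c\<in>carrier F. \<forall>u\<in>carrier U. \<forall>v\<in>carrier V. f (c \<odot>\<^sub>U u) v = c \<odot>\<^sub>W f u v \<and> f u (c \<odot>\<^sub>V v) = c \<odot>\<^sub>W f u v)"

text \<open>The map \<open>\<phi>\<close> on representatives is a parameter, prescribed on the
  carriers only, because the action and the form on \<open>L \<otimes> M\<close> are defined with
  the factors from \<open>L\<close> in opposite orders. Commutativity of \<open>L\<close> reconciles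
  them.\<close>

locale tensor3 = U: tensor F L U + V: tensor F L V + W: tensor F L W for F L U V W +
  fixes f and \<phi>
  assumes fb: "fbil F U V W f"
    and phi: "\<And>k u l v. k \<in> carrier L \<Longrightarrow> u \<in> carrier U \<Longrightarrow> l \<in> carrier L \<Longrightarrow> v \<in> carrier V \<Longrightarrow>
      \<phi> (k, u) (l, v) = (k \<otimes>\<^sub>L l, f u v)"
begin

abbreviation "FE2 u v \<equiv> frag_extend (\<lambda>p. frag_extend (\<lambda>q. frag_of (\<phi> p q)) v) u"

lemma fbD:
  "u \<in> carrier U \<Longrightarrow> v \<in> carrier V \<Longrightarrow> f u v \<in> carrier W"
  "u \<in> carrier U \<Longrightarrow> u' \<in> carrier U \<Longrightarrow> v \<in> carrier V \<Longrightarrow> f (u \<oplus>\<^sub>U u') v = f u v \<oplus>\<^sub>W f u' v"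
  "u \<in> carrier U \<Longrightarrow> v \<in> carrier V \<Longrightarrow> v' \<in> carrier V \<Longrightarrow> f u (v \<oplus>\<^sub>V v') = f u v \<oplus>\<^sub>W f u v'"
  "c \<in> carrier F \<Longrightarrow> u \<in> carrier U \<Longrightarrow> v \<in> carrier V \<Longrightarrow> f (c \<odot>\<^sub>U u) v = c \<odot>\<^sub>W f u v"
  "c \<in> carrier F \<Longrightarrow> u \<in> carrier U \<Longrightarrow> v \<in> carrier V \<Longrightarrow> f u (c \<odot>\<^sub>V v) = c \<odot>\<^sub>W f u v"
  using fb unfolding fbil_def by auto

lemma FE2_add_l: "FE2 (u + u') v = FE2 u v + FE2 u' v"
  by (simp add: frag_extend_add)

lemma FE2_diff_l: "FE2 (u - u') v = FE2 u v - FE2 u' v"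
  by (simp add: frag_extend_diff)

lemma FE_pointwise: "frag_extend (\<lambda>p. a p + b p) u = frag_extend a u + frag_extend b u"
proof -
  have "Poly_Mapping.keys u \<subseteq> UNIV" by simp
  then show ?thesis by (induction u rule: frag_induction) (auto simp: frag_extend_diff)
qed

lemma FE_pointwise_diff: "frag_extend (\<lambda>p. a p - b p) u = frag_extend a u - frag_extend b u"
proof -
  have "Poly_Mapping.keys u \<subseteq> UNIV" by simp
  then show ?thesis by (induction u rule: frag_induction) (auto simp: frag_extend_diff)
qed

lemma FE2_add_r: "FE2 u (v + v') = FE2 u v + FE2 u v'"
  by (simp add: frag_extend_add FE_pointwise)

lemma FE2_diff_r: "FE2 u (v - v') = FE2 u v - FE2 u v'"
  by (simp add: frag_extend_diff FE_pointwise_diff)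

lemma FE2_of:
  assumes "k \<in> carrier L" "u \<in> carrier U" "l \<in> carrier L" "v \<in> carrier V"
  shows "FE2 (frag_of (k, u)) (frag_of (l, v)) = frag_of (k \<otimes>\<^sub>L l, f u v)"
  using assms phi by simp

lemma FE2_closed: assumes "u \<in> carrier U.Fr" "v \<in> carrier V.Fr" shows "FE2 u v \<in> carrier W.Fr"
  using assms(1)[unfolded U.Fr_carrier]
proof (induction u rule: free_Abelian_group_induct[consumes 1])
  case (3 p)
  then obtain k x where p: "p = (k, x)" "k \<in> carrier L" "x \<in> carrier U" by auto
  show ?case using assms(2)[unfolded V.Fr_carrier]
  proof (induction v rule: free_Abelian_group_induct[consumes 1])
    case (3 q)
    then obtain l y where q: "q = (l, y)" "l \<in> carrier L" "y \<in> carrier V" by auto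
    show ?case using FE2_of[OF p(2,3) q(2,3)] W.Fr_of p q fbD(1) by simp
  qed (auto simp: W.Fr_carrier frag_extend_diff dest!: subsetD[OF keys_diff])
qed (auto simp: W.Fr_carrier frag_extend_diff dest!: subsetD[OF keys_diff])

text \<open>For a fixed generator in the second argument, the class of \<open>FE2\<close> is a
  homomorphism in the first one that kills the three kinds of relations. General second arguments
  follow by additivity.\<close>

lemma FE2_TK_l:
  assumes u: "u \<in> U.TK" and v: "v \<in> carrier V.Fr" shows "FE2 u v \<in> W.TK"
proof -
  interpret WG: comm_group W.TG by (rule W.TG_comm)
  have "W.cls (FE2 u (frag_of q)) = \<one>\<^sub>W.TG" if q: "q \<in> carrier L \<times> carrier V" for q
  proof (rule U.rel_kill[OF W.TG_comm _ _ u])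
    obtain l y where q: "q = (l, y)" "l \<in> carrier L" "y \<in> carrier V" using q by auto
    have qf: "frag_of q \<in> carrier V.Fr" using q V.Fr_of by simp
    show "(\<lambda>u. W.cls (FE2 u (frag_of q))) \<in> hom U.Fr W.TG"
      using FE2_closed[OF _ qf] W.cls_closed W.cls_add by (simp add: hom_def frag_extend_add Pi_def U.Fr_ops)
    fix r assume "r \<in> tensor_relations F L U"
    then have "FE2 r (frag_of q) \<in> W.TK"
      unfolding tensor_relations_def
    proof (elim UnE CollectE exE conjE)
      fix k l' x assume r: "r = frag_of (k \<oplus>\<^sub>L l', x) - frag_of (k, x) - frag_of (l', x)" 
        "k \<in> carrier L" "l' \<in> carrier L" "x \<in> carrier U"
      have "FE2 r (frag_of q) = frag_of (k \<otimes>\<^sub>L l \<oplus>\<^sub>L l' \<otimes>\<^sub>L l, f x y) - frag_of (k \<otimes>\<^sub>L l, f x y) - frag_of (l' \<otimes>\<^sub>L l, f x y)"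
        using r q by (simp add: frag_extend_diff phi U.L.l_distr)
      then show ?thesis using r q fbD by (simp add: W.TK_rels)
    next
      fix k x w assume r: "r = frag_of (k, x \<oplus>\<^sub>U w) - frag_of (k, x) - frag_of (k, w)" 
        "k \<in> carrier L" "x \<in> carrier U" "w \<in> carrier U"
      have "FE2 r (frag_of q) = frag_of (k \<otimes>\<^sub>L l, f x y \<oplus>\<^sub>W f w y) - frag_of (k \<otimes>\<^sub>L l, f x y) - frag_of (k \<otimes>\<^sub>L l, f w y)"
        using r q by (simp add: frag_extend_diff phi fbD)
      moreover have "k \<otimes>\<^sub>L l \<in> carrier L" "f x y \<in> carrier W" "f w y \<in> carrier W" using r q fbD by auto
      ultimately show ?thesis by (simp add: W.TK_rels)
    next
      fix c k x assume r: "r = frag_of (c \<odot>\<^sub>L k, x) - frag_of (k, c \<odot>\<^sub>U x)" 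
        "c \<in> carrier F" "k \<in> carrier L" "x \<in> carrier U"
      have "FE2 r (frag_of q) = frag_of (c \<odot>\<^sub>L (k \<otimes>\<^sub>L l), f x y) - frag_of (k \<otimes>\<^sub>L l, c \<odot>\<^sub>W f x y)"
        using r q by (simp add: frag_extend_diff phi fbD U.L.smult_assoc2)
      moreover have "k \<otimes>\<^sub>L l \<in> carrier L" "f x y \<in> carrier W" using r q fbD by auto
      ultimately show ?thesis using r q fbD by (simp add: W.TK_rels)
    qed
    moreover have "FE2 r (frag_of q) \<in> carrier W.Fr"
      using FE2_closed[OF _ qf] U.rel_sub \<open>r \<in> tensor_relations F L U\<close> by blast
    ultimately show "W.cls (FE2 r (frag_of q)) = \<one>\<^sub>W.TG"
      using W.cls_eq_iff[of _ 0] W.cls_zero by (simp add: W.Fr_carrier)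
  qed
  then have q: "FE2 u (frag_of q) \<in> W.TK" if "q \<in> carrier L \<times> carrier V" for q
    using W.cls_eq_iff[of "FE2 u (frag_of q)" 0] W.cls_zero that FE2_closed[of u "frag_of q"] 
      u subgroup.subset[OF U.TK_subgroup] by (auto simp: W.Fr_carrier V.Fr_carrier)
  show ?thesis using v[unfolded V.Fr_carrier]
  proof (induction v rule: free_Abelian_group_induct[consumes 1])
    case 1
    show ?case using subgroup.one_closed[OF W.TK_subgroup] W.Fr_ops by (simp add: frag_extend_eq_0)
  next
    case (2 v w)
    then show ?case by (simp add: FE2_diff_r W.TK_diff)
  qed (use q in auto)
qed

lemma FE2_TK_r:
  assumes v: "v \<in> V.TK" and u: "u \<in> carrier U.Fr" shows "FE2 u v \<in> W.TK"
proof -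
  interpret WG: comm_group W.TG by (rule W.TG_comm)
  have "W.cls (FE2 (frag_of q) v) = \<one>\<^sub>W.TG" if q: "q \<in> carrier L \<times> carrier U" for q
  proof (rule V.rel_kill[OF W.TG_comm _ _ v])
    obtain l y where q: "q = (l, y)" "l \<in> carrier L" "y \<in> carrier U" using q by auto
    have qf: "frag_of q \<in> carrier U.Fr" using q U.Fr_of by simp
    show "(\<lambda>v. W.cls (FE2 (frag_of q) v)) \<in> hom V.Fr W.TG"
      using FE2_closed[OF qf] W.cls_closed W.cls_add by (simp add: hom_def frag_extend_add Pi_def V.Fr_ops)
    fix r assume "r \<in> tensor_relations F L V"
    then have "FE2 (frag_of q) r \<in> W.TK"
      unfolding tensor_relations_def
    proof (elim UnE CollectE exE conjE)
      fix k l' x assume r: "r = frag_of (k \<oplus>\<^sub>L l', x) - frag_of (k, x) - frag_of (l', x)" 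
        "k \<in> carrier L" "l' \<in> carrier L" "x \<in> carrier V"
      have "FE2 (frag_of q) r = frag_of (l \<otimes>\<^sub>L k \<oplus>\<^sub>L l \<otimes>\<^sub>L l', f y x) - frag_of (l \<otimes>\<^sub>L k, f y x) - frag_of (l \<otimes>\<^sub>L l', f y x)"
        using r q by (simp add: frag_extend_diff phi U.L.r_distr)
      then show ?thesis using r q fbD by (simp add: W.TK_rels)
    next
      fix k x w assume r: "r = frag_of (k, x \<oplus>\<^sub>V w) - frag_of (k, x) - frag_of (k, w)" 
        "k \<in> carrier L" "x \<in> carrier V" "w \<in> carrier V"
      have "FE2 (frag_of q) r = frag_of (l \<otimes>\<^sub>L k, f y x \<oplus>\<^sub>W f y w) - frag_of (l \<otimes>\<^sub>L k, f y x) - frag_of (l \<otimes>\<^sub>L k, f y w)"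
        using r q by (simp add: frag_extend_diff phi fbD)
      moreover have "l \<otimes>\<^sub>L k \<in> carrier L" "f y x \<in> carrier W" "f y w \<in> carrier W" using r q fbD by auto
      ultimately show ?thesis by (simp add: W.TK_rels)
    next
      fix c k x assume r: "r = frag_of (c \<odot>\<^sub>L k, x) - frag_of (k, c \<odot>\<^sub>V x)" 
        "c \<in> carrier F" "k \<in> carrier L" "x \<in> carrier V"
      have "l \<otimes>\<^sub>L (c \<odot>\<^sub>L k) = c \<odot>\<^sub>L (l \<otimes>\<^sub>L k)"
        using r q U.L.smult_assoc2[of c k l] by (simp add: U.L.m_comm)
      then have "FE2 (frag_of q) r = frag_of (c \<odot>\<^sub>L (l \<otimes>\<^sub>L k), f y x) - frag_of (l \<otimes>\<^sub>L k, c \<odot>\<^sub>W f y x)"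
        using r q by (simp add: frag_extend_diff phi fbD)
      moreover have "l \<otimes>\<^sub>L k \<in> carrier L" "f y x \<in> carrier W" using r q fbD by auto
      ultimately show ?thesis using r q fbD by (simp add: W.TK_rels)
    qed
    moreover have "FE2 (frag_of q) r \<in> carrier W.Fr"
      using FE2_closed[OF qf] V.rel_sub \<open>r \<in> tensor_relations F L V\<close> by blast
    ultimately show "W.cls (FE2 (frag_of q) r) = \<one>\<^sub>W.TG"
      using W.cls_eq_iff[of _ 0] W.cls_zero by (simp add: W.Fr_carrier)
  qed
  then have q: "FE2 (frag_of q) v \<in> W.TK" if "q \<in> carrier L \<times> carrier U" for q
    using W.cls_eq_iff[of "FE2 (frag_of q) v" 0] W.cls_zero that FE2_closed[of "frag_of q" v] 
      v subgroup.subset[OF V.TK_subgroup] by (auto simp: W.Fr_carrier U.Fr_carrier)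
  show ?thesis using u[unfolded U.Fr_carrier]
  proof (induction u rule: free_Abelian_group_induct[consumes 1])
    case 1
    show ?case using subgroup.one_closed[OF W.TK_subgroup] W.Fr_ops by simp
  next
    case (2 u w)
    then show ?case by (simp add: FE2_diff_l W.TK_diff)
  qed (use q in auto)
qed

abbreviation "tm \<equiv> tensor_map2 F L W \<phi>"

text \<open>This disposes of the arbitrary representatives in \<open>tensor_map2\<close>: changing
  either argument by a relation changes the value by a relation.\<close>

lemma tm_cls:
  assumes u: "u \<in> carrier U.Fr" and v: "v \<in> carrier V.Fr"
  shows "tm (U.cls u) (V.cls v) = W.cls (FE2 u v)"
proof -
  let ?u = "SOME w. w \<in> U.cls u" and ?v = "SOME w. w \<in> V.cls v"
  have u': "?u \<in> carrier U.Fr" "?u - u \<in> U.TK" using U.cls_some[OF U.cls_closed[OF u]] U.cls_eq_iff u by auto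
  have v': "?v \<in> carrier V.Fr" "?v - v \<in> V.TK" using V.cls_some[OF V.cls_closed[OF v]] V.cls_eq_iff v by auto
  have "W.cls (FE2 ?u ?v) = W.cls (FE2 u ?v)"
    using W.cls_eq_iff[OF FE2_closed[OF u'(1) v'(1)] FE2_closed[OF u v'(1)]] FE2_TK_l[OF u'(2) v'(1)] 
    by (simp add: FE2_diff_l)
  also have "\<dots> = W.cls (FE2 u v)"
    using W.cls_eq_iff[OF FE2_closed[OF u v'(1)] FE2_closed[OF u v]] FE2_TK_r[OF v'(2) u] 
    by (simp add: FE2_diff_r)
  finally show ?thesis unfolding tensor_map2_def .
qed

lemma tm_closed: "s \<in> carrier U.TG \<Longrightarrow> t \<in> carrier V.TG \<Longrightarrow> tm s t \<in> carrier W.TG"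
  unfolding U.TG_carrier V.TG_carrier using tm_cls FE2_closed W.cls_closed by auto

lemma tm_add_l: "s \<in> carrier U.TG \<Longrightarrow> s' \<in> carrier U.TG \<Longrightarrow> t \<in> carrier V.TG \<Longrightarrow>
    tm (s \<otimes>\<^sub>U.TG s') t = tm s t \<otimes>\<^sub>W.TG tm s' t"
  unfolding U.TG_carrier V.TG_carrier
  by (auto simp: tm_cls FE2_closed W.cls_add U.cls_add U.Fr_add FE2_add_l)

lemma tm_add_r: "s \<in> carrier U.TG \<Longrightarrow> t \<in> carrier V.TG \<Longrightarrow> t' \<in> carrier V.TG \<Longrightarrow>
    tm s (t \<otimes>\<^sub>V.TG t') = tm s t \<otimes>\<^sub>W.TG tm s t'"
  unfolding U.TG_carrier V.TG_carrier
  by (auto simp: tm_cls FE2_closed W.cls_add V.cls_add V.Fr_add FE2_add_r)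

lemma tm_tens: "k \<in> carrier L \<Longrightarrow> u \<in> carrier U \<Longrightarrow> l \<in> carrier L \<Longrightarrow> v \<in> carrier V \<Longrightarrow>
    tm (tens F L U k u) (tens F L V l v) = tens F L W (k \<otimes>\<^sub>L l) (f u v)"
  using tm_cls[OF U.Fr_of V.Fr_of] FE2_of by simp

end

section \<open>Forms over the function field\<close>

text \<open>\<open>L\<close> as a module over itself. With the scalars cut down to the constants it
  is the ambient space of both filtrations.\<close>

definition reg_mod :: "('l, 'q) ring_scheme \<Rightarrow> ('l, 'l) module" where
  "reg_mod L = \<lparr>carrier = carrier L, monoid.mult = monoid.mult L, monoid.one = monoid.one L,
     ring.zero = ring.zero L, ring.add = ring.add L, module.smult = monoid.mult L\<rparr>"

lemma reg_mod_simps [simp]: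
  "carrier (reg_mod L) = carrier L" "\<zero>\<^bsub>reg_mod L\<^esub> = \<zero>\<^sub>L"
  "x \<oplus>\<^bsub>reg_mod L\<^esub> y = x \<oplus>\<^sub>L y" "a \<odot>\<^bsub>reg_mod L\<^esub> x = a \<otimes>\<^sub>L x"
  by (simp_all add: reg_mod_def)

lemma (in cring) reg_module: "module R (reg_mod R)"
proof (rule moduleI)
  show "abelian_group (reg_mod R)"
    by (rule abelian_groupI) (auto simp: a_assoc l_neg intro: bexI[of _ "\<ominus> _"] a_comm)
qed (auto simp: l_distr r_distr m_assoc is_cring)

lemma (in field) vecsp_subfield:
  assumes "subfield k R" "module R V"
  shows "vecsp (R\<lparr>carrier := k\<rparr>) V"
proof -
  interpret V: module R V by fact
  interpret k: field "R\<lparr>carrier := k\<rparr>" using subfield_iff(2)[OF assms(1)] .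
  have ks: "k \<subseteq> carrier R" using subfieldE(3)[OF assms(1)] .
  have "module (R\<lparr>carrier := k\<rparr>) V"
    by (rule moduleI) (use ks in \<open>auto simp: k.is_cring V.abelian_group_axioms subset_iff V.smult_l_distr V.smult_r_distr V.smult_assoc1\<close>)
  then show ?thesis by (simp add: vecsp_def k.field_axioms)
qed

text \<open>\<open>Rd d\<close> stands for the functions on the conic whose only poles are at infinity and have order
  at most \<open>d\<close>, \<open>Lm e\<close> for the functions with poles of order at most \<open>e\<close> at infinity, and \<open>c\<close> for a
  residue at infinity, which makes the two filtrations dual to each other.\<close>

locale filt = field L for L :: "('l, 'q) ring_scheme" (structure) +
  fixes k :: "'l set" and Rd :: "nat \<Rightarrow> 'l set" and Lm :: "int \<Rightarrow> 'l set" and x :: 'l and c :: "'l \<Rightarrow> 'l"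
  assumes k: "subfield k L"
    and Rd_subsp: "subsp (L\<lparr>carrier := k\<rparr>) (reg_mod L) (Rd d)"
    and Lm_subsp: "subsp (L\<lparr>carrier := k\<rparr>) (reg_mod L) (Lm e)"
    and Rd_Lm: "Rd d \<subseteq> Lm (int d)"
    and Rd_inter: "z \<in> Rd d \<Longrightarrow> z \<in> Lm (int d') \<Longrightarrow> z \<in> Rd d'"
    and Rd_neg: "z \<in> Rd d \<Longrightarrow> z \<in> Lm (-1) \<Longrightarrow> z = \<zero>"
    and Lm_mono1: "Lm e \<subseteq> Lm (e + 1)"
    and Lm_mult: "z \<in> Lm e \<Longrightarrow> w \<in> Lm f \<Longrightarrow> z \<otimes> w \<in> Lm (e + f)"
    and Rd_mult: "z \<in> Rd d \<Longrightarrow> w \<in> Rd d' \<Longrightarrow> z \<otimes> w \<in> Rd (d + d')"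
    and x_Rd: "x \<in> Rd 1" and x_nz: "x \<noteq> \<zero>" and x_inv: "inv x \<in> Lm (-1)"
    and Rd_dim: "qdim (L\<lparr>carrier := k\<rparr>) (reg_mod L) {\<zero>} (Rd d) (2 * d + 1)"
    and Lm_dim: "qdim (L\<lparr>carrier := k\<rparr>) (reg_mod L) (Lm (e - 1)) (Lm e) 2"
    and Rd_0: "Rd 0 = k"
    and c_k: "z \<in> Lm e \<Longrightarrow> c z \<in> k"
    and c_add: "z \<in> Lm e \<Longrightarrow> w \<in> Lm e \<Longrightarrow> c (z \<oplus> w) = c z \<oplus> c w"
    and c_smult: "a \<in> k \<Longrightarrow> z \<in> Lm e \<Longrightarrow> c (a \<otimes> z) = a \<otimes> c z"
    and c_Lm0: "z \<in> Lm 0 \<Longrightarrow> c z = \<zero>"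
    and c_xR: "z \<in> Rd d \<Longrightarrow> c (x \<otimes> z) = \<zero>"
    and c_nondeg: "z \<in> Lm 1 \<Longrightarrow> (\<And>w. w \<in> Lm 0 \<Longrightarrow> c (w \<otimes> z) = \<zero>) \<Longrightarrow> z \<in> Lm 0"
    and denom: "z \<in> carrier L \<Longrightarrow> \<exists>d d' q. q \<in> Rd d \<and> q \<noteq> \<zero> \<and> q \<otimes> z \<in> Rd d'"
    and Lm_Rd: "z \<in> Lm e \<Longrightarrow> \<exists>N d. x [^] (N::nat) \<otimes> z \<in> Rd d"
begin

abbreviation "Kk \<equiv> L\<lparr>carrier := k\<rparr>"

text \<open>For the conic, \<open>RR\<close> becomes \<open>F[x, y]\<close>, the functions regular
  off infinity, and \<open>LL\<close> its localisation at \<open>x\<close>, the functions whose only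
  other poles are at zeros of \<open>x\<close>.\<close>

definition "RR = (\<Union>d. Rd d)"
definition "LL = (\<Union>e. Lm e)"

sublocale Lk: vecsp Kk "reg_mod L"
  using vecsp_subfield[OF k reg_module] .

lemma k_sub: "k \<subseteq> carrier L" using subfieldE(3)[OF k] .

lemma Lm_mono: "e \<le> f \<Longrightarrow> Lm e \<subseteq> Lm f"
proof (induction f rule: int_ge_induct)
  case (step f) then show ?case using Lm_mono1 by blast
qed simp

lemma Rd_mono: "d \<le> d' \<Longrightarrow> Rd d \<subseteq> Rd d'"
  using Rd_inter Rd_Lm Lm_mono[of "int d" "int d'"] by (meson in_mono of_nat_le_iff subsetI)

lemma Rd_carrier: "z \<in> Rd d \<Longrightarrow> z \<in> carrier L"
  using Lk.subspD(3)[OF Rd_subsp] by simp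

lemma Lm_carrier: "z \<in> Lm e \<Longrightarrow> z \<in> carrier L"
  using Lk.subspD(3)[OF Lm_subsp] by simp

lemma x_carrier: "x \<in> carrier L" using x_Rd Rd_carrier by auto

lemma xinv: "inv x \<in> carrier L" "inv x \<otimes> x = \<one>" "x \<otimes> inv x = \<one>"
  using x_carrier x_nz field_Units by auto

lemma x_Lm: "x \<in> Lm 1" using x_Rd Rd_Lm[of 1] by auto

lemma x_mult_Lm: "z \<in> Lm e \<Longrightarrow> x \<otimes> z \<in> Lm (e + 1)"
  using Lm_mult[OF x_Lm, of z e] by (simp add: add.commute)

lemma xinv_mult_Lm: "z \<in> Lm e \<Longrightarrow> inv x \<otimes> z \<in> Lm (e - 1)"
  using Lm_mult[OF x_inv, of z e] by simp

lemma x_mult_Rd: "z \<in> Rd d \<Longrightarrow> x \<otimes> z \<in> Rd (Suc d)"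
  using Rd_mult[OF x_Rd, of z d] by simp

lemma k_Lm0: "k \<subseteq> Lm 0" using Rd_Lm[of 0] Rd_0 by simp

lemma RR_subsp: "subsp Kk (reg_mod L) RR"
  unfolding subsp_def
proof (intro conjI ballI)
  fix z w assume "z \<in> RR" "w \<in> RR"
  then obtain d d' where "z \<in> Rd d" "w \<in> Rd d'" unfolding RR_def by auto
  then have "z \<in> Rd (max d d')" "w \<in> Rd (max d d')" using Rd_mono[of d "max d d'"] Rd_mono[of d' "max d d'"] by auto
  then show "z \<oplus>\<^bsub>reg_mod L\<^esub> w \<in> RR" using Lk.subspD(4)[OF Rd_subsp] unfolding RR_def by blast
next
  fix a z assume "a \<in> carrier Kk" "z \<in> RR"
  then show "a \<odot>\<^bsub>reg_mod L\<^esub> z \<in> RR" using Lk.subspD(5)[OF Rd_subsp, of a z] unfolding RR_def by blast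
qed (use Lk.subspD[OF Rd_subsp] in \<open>auto simp: RR_def\<close>)

lemma LL_subsp: "subsp Kk (reg_mod L) LL"
  unfolding subsp_def
proof (intro conjI ballI)
  fix z w assume "z \<in> LL" "w \<in> LL"
  then obtain d d' where "z \<in> Lm d" "w \<in> Lm d'" unfolding LL_def by auto
  then have "z \<in> Lm (max d d')" "w \<in> Lm (max d d')" using Lm_mono[of d "max d d'"] Lm_mono[of d' "max d d'"] by auto
  then show "z \<oplus>\<^bsub>reg_mod L\<^esub> w \<in> LL" using Lk.subspD(4)[OF Lm_subsp] unfolding LL_def by blast
next
  fix a z assume "a \<in> carrier Kk" "z \<in> LL"
  then show "a \<odot>\<^bsub>reg_mod L\<^esub> z \<in> LL" using Lk.subspD(5)[OF Lm_subsp, of a z] unfolding LL_def by blast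
qed (use Lk.subspD[OF Lm_subsp] in \<open>auto simp: LL_def\<close>)

lemma RR_mult: "z \<in> RR \<Longrightarrow> w \<in> RR \<Longrightarrow> z \<otimes> w \<in> RR"
  unfolding RR_def using Rd_mult by blast

lemma LL_both: "z \<in> LL \<Longrightarrow> w \<in> LL \<Longrightarrow> \<exists>e. z \<in> Lm e \<and> w \<in> Lm e"
proof -
  assume "z \<in> LL" "w \<in> LL"
  then obtain d d' where "z \<in> Lm d" "w \<in> Lm d'" unfolding LL_def by auto
  then have "z \<in> Lm (max d d')" "w \<in> Lm (max d d')" using Lm_mono[of d "max d d'"] Lm_mono[of d' "max d d'"] by auto
  then show ?thesis by blast
qed

lemma RR_Lm_neg: "z \<in> RR \<Longrightarrow> z \<in> Lm e \<Longrightarrow> e < 0 \<Longrightarrow> z = \<zero>"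
  using Rd_neg Lm_mono[of e "-1"] unfolding RR_def by auto

lemma RR_carrier: "z \<in> RR \<Longrightarrow> z \<in> carrier L"
  using Rd_carrier unfolding RR_def by auto

text \<open>Division by \<open>x\<close> lowers the order at infinity, so \<open>z\<close> has a
  zero there while being regular everywhere else; such a function is 0.\<close>

lemma x_RR_Lm0: "z \<in> RR \<Longrightarrow> x \<otimes> z \<in> Lm e \<Longrightarrow> e \<le> 0 \<Longrightarrow> z = \<zero>"
proof -
  assume z: "z \<in> RR" "x \<otimes> z \<in> Lm e" "e \<le> 0"
  have "inv x \<otimes> (x \<otimes> z) = z" using z RR_carrier xinv x_carrier by (simp add: m_assoc[symmetric])
  then have "z \<in> Lm (e - 1)" using xinv_mult_Lm[OF z(2)] by simp
  then show ?thesis using RR_Lm_neg z by auto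
qed

text \<open>Residues against all of \<open>LL\<close> detect a regular function. A power of
  \<open>x\<close> moves its leading term to order 1, where \<open>c_nondeg\<close> applies and
  shows that the order was in fact smaller; repeating this ends at a regular function with a zero at
  infinity.\<close>

lemma c_RR_zero:
  assumes "z \<in> RR" "\<And>w. w \<in> LL \<Longrightarrow> c (w \<otimes> z) = \<zero>" shows "z = \<zero>"
proof -
  obtain d where d: "z \<in> Rd d" using assms(1) unfolding RR_def by auto
  \<comment> \<open>The counter \<open>j\<close> measures how far the order has been lowered;
    \<open>d + 1\<close> rounds reach order -1.\<close>
  have "z \<in> Lm (int d - int j)" if "j \<le> Suc d" for j
    using that
  proof (induction j)
    case 0 then show ?case using d Rd_Lm by auto
  next
    case (Suc j)
    have zc: "z \<in> carrier L" using d Rd_carrier by auto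
    define e where "e = int d - int j - 1"
    have ze: "z \<in> Lm (e + 1)" using Suc by (simp add: e_def)
    have xp: "inv x [^] (m::nat) \<in> Lm (- int m)" for m
    proof (induction m)
      case 0 then show ?case using k_Lm0 subringE(3)[OF subfieldE(1)[OF k]] by auto
    next
      case (Suc m) then show ?case using Lm_mult[OF Suc x_inv] by (simp add: algebra_simps)
    qed
    have e0: "0 \<le> e + 1" using Suc by (simp add: e_def)
    \<comment> \<open>The order \<open>e + 1\<close> of \<open>z\<close> has to become 1. For
      \<open>e = -1\<close> this means multiplying by \<open>x\<close>, otherwise by the power
      \<open>e\<close> of \<open>inv x\<close>.\<close>
    consider "e = -1" | "e \<ge> 0" using e0 by linarith
    then show ?case
    proof cases
      case 1
      have "x \<otimes> z \<in> Lm 1" using x_mult_Lm[OF ze] 1 by simp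
      moreover have "c (w \<otimes> (x \<otimes> z)) = \<zero>" if "w \<in> Lm 0" for w
      proof -
        have "w \<otimes> x \<in> LL" using Lm_mult[OF that x_Lm] unfolding LL_def by auto
        then show ?thesis using assms(2) Lm_carrier[OF that] x_carrier zc by (simp add: m_assoc[symmetric])
      qed
      ultimately have "x \<otimes> z \<in> Lm 0" by (rule c_nondeg)
      then have "z = \<zero>" using x_RR_Lm0[OF assms(1), of 0] by simp
      then show ?thesis using Lk.subspD(2)[OF Lm_subsp] by simp
    next
      case 2
      let ?y = "inv x [^] nat e"
      have y: "?y \<in> Lm (- e)" using xp[of "nat e"] 2 by simp
      have yc: "?y \<in> carrier L" using y Lm_carrier by auto
      have "?y \<otimes> z \<in> Lm 1" using Lm_mult[OF y ze] by simp
      moreover have "c (w \<otimes> (?y \<otimes> z)) = \<zero>" if "w \<in> Lm 0" for w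
      proof -
        have "w \<otimes> ?y \<in> LL" using Lm_mult[OF that y] unfolding LL_def by auto
        then show ?thesis using assms(2) Lm_carrier[OF that] yc zc by (simp add: m_assoc[symmetric])
      qed
      ultimately have yz: "?y \<otimes> z \<in> Lm 0" by (rule c_nondeg)
      have xn: "x [^] (m::nat) \<in> Lm (int m)" for m
      proof (induction m)
        case 0 then show ?case using k_Lm0 subringE(3)[OF subfieldE(1)[OF k]] by auto
      next
        case (Suc m) then show ?case using Lm_mult[OF Suc x_Lm] by (simp add: add.commute)
      qed
      have "x [^] nat e \<otimes> ?y = \<one>" using x_carrier xinv by (simp add: nat_pow_distrib[symmetric] m_comm)
      then have "z = x [^] nat e \<otimes> (?y \<otimes> z)" using x_carrier yc zc by (simp add: m_assoc[symmetric])
      then have "z \<in> Lm e" using Lm_mult[OF xn[of "nat e"] yz] 2 by simp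
      then show ?thesis by (simp add: e_def algebra_simps)
    qed
  qed
  from this[of "Suc d"] have "z \<in> Lm (-1)" by simp
  then show ?thesis using Rd_neg d by blast
qed

end


text \<open>A form defined over the constants: \<open>e\<close> and \<open>es\<close> are dual bases
  with constant products, as obtained from bases over \<open>F\<close>. The coordinates
  \<open>\<beta> u (es i)\<close> trivialise \<open>U\<close> on the whole conic, and every subspace
  of \<open>U\<close> becomes a bundle inside the trivial one.\<close>

locale filt_form = filt L k Rd Lm x c + U: module L U
  for L :: "('l, 'q) ring_scheme" (structure) and k Rd Lm x c and U :: "('l, 'u) module" +
  fixes n :: nat and e es :: "nat \<Rightarrow> 'u" and \<beta> :: "'u \<Rightarrow> 'u \<Rightarrow> 'l"
  assumes bil: "bilin L U (carrier U) (carrier U) \<beta>"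
    and e_car: "i < n \<Longrightarrow> e i \<in> carrier U" and es_car: "i < n \<Longrightarrow> es i \<in> carrier U"
    and expand: "u \<in> carrier U \<Longrightarrow> u = (\<Oplus>\<^sub>U i\<in>{..<n}. \<beta> u (es i) \<odot>\<^sub>U e i)"
    and dual: "i < n \<Longrightarrow> j < n \<Longrightarrow> \<beta> (e i) (es j) = (if i = j then \<one> else \<zero>)"
    and e_k: "i < n \<Longrightarrow> j < n \<Longrightarrow> \<beta> (e i) (e j) \<in> k"
    and es_k: "i < n \<Longrightarrow> j < n \<Longrightarrow> \<beta> (es i) (es j) \<in> k"
begin

sublocale Uk: vecsp Kk U
  using vecsp_subfield[OF k U.module_axioms] .

sublocale UL: vecsp L U
  by (simp add: vecsp_def U.module_axioms field_axioms)

lemma bD: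
  "u \<in> carrier U \<Longrightarrow> v \<in> carrier U \<Longrightarrow> \<beta> u v \<in> carrier L"
  "u \<in> carrier U \<Longrightarrow> u' \<in> carrier U \<Longrightarrow> v \<in> carrier U \<Longrightarrow> \<beta> (u \<oplus>\<^sub>U u') v = \<beta> u v \<oplus> \<beta> u' v"
  "u \<in> carrier U \<Longrightarrow> v \<in> carrier U \<Longrightarrow> v' \<in> carrier U \<Longrightarrow> \<beta> u (v \<oplus>\<^sub>U v') = \<beta> u v \<oplus> \<beta> u v'"
  "a \<in> carrier L \<Longrightarrow> u \<in> carrier U \<Longrightarrow> v \<in> carrier U \<Longrightarrow> \<beta> (a \<odot>\<^sub>U u) v = a \<otimes> \<beta> u v"
  "a \<in> carrier L \<Longrightarrow> u \<in> carrier U \<Longrightarrow> v \<in> carrier U \<Longrightarrow> \<beta> u (a \<odot>\<^sub>U v) = a \<otimes> \<beta> u v"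
  using bil unfolding bilin_def by auto

lemma b_zero: "u \<in> carrier U \<Longrightarrow> \<beta> \<zero>\<^sub>U u = \<zero>" "u \<in> carrier U \<Longrightarrow> \<beta> u \<zero>\<^sub>U = \<zero>"
  using bD(4)[of \<zero> u u] bD(5)[of \<zero> u u] bD(1)[of u u] by simp_all

lemma b_sum_l:
  assumes "finite I" "\<And>i. i \<in> I \<Longrightarrow> f i \<in> carrier U" "v \<in> carrier U"
  shows "\<beta> (\<Oplus>\<^sub>U i\<in>I. f i) v = (\<Oplus>i\<in>I. \<beta> (f i) v)"
  using assms
proof (induction I rule: finite_induct)
  case (insert i I)
  then show ?case by (simp add: bD Pi_def)
qed (simp add: b_zero)

lemma b_sum_r:
  assumes "finite I" "\<And>i. i \<in> I \<Longrightarrow> f i \<in> carrier U" "v \<in> carrier U"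
  shows "\<beta> v (\<Oplus>\<^sub>U i\<in>I. f i) = (\<Oplus>i\<in>I. \<beta> v (f i))"
  using assms
proof (induction I rule: finite_induct)
  case (insert i I)
  then show ?case by (simp add: bD Pi_def)
qed (simp add: b_zero)

lemma b_expand_l: "u \<in> carrier U \<Longrightarrow> v \<in> carrier U \<Longrightarrow> \<beta> u v = (\<Oplus>i\<in>{..<n}. \<beta> u (es i) \<otimes> \<beta> (e i) v)"
proof -
  assume u: "u \<in> carrier U" "v \<in> carrier U"
  have "\<beta> u v = \<beta> (\<Oplus>\<^sub>U i\<in>{..<n}. \<beta> u (es i) \<odot>\<^sub>U e i) v" using expand[OF u(1)] by simp
  also have "\<dots> = (\<Oplus>i\<in>{..<n}. \<beta> (\<beta> u (es i) \<odot>\<^sub>U e i) v)"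
    by (rule b_sum_l) (use u e_car es_car bD(1) in auto)
  also have "\<dots> = (\<Oplus>i\<in>{..<n}. \<beta> u (es i) \<otimes> \<beta> (e i) v)"
    by (rule finsum_cong') (use u e_car es_car bD in auto)
  finally show ?thesis .
qed

lemma b_expand_r: "u \<in> carrier U \<Longrightarrow> v \<in> carrier U \<Longrightarrow> \<beta> u v = (\<Oplus>i\<in>{..<n}. \<beta> v (es i) \<otimes> \<beta> u (e i))"
proof -
  assume u: "u \<in> carrier U" "v \<in> carrier U"
  have "\<beta> u v = \<beta> u (\<Oplus>\<^sub>U i\<in>{..<n}. \<beta> v (es i) \<odot>\<^sub>U e i)" using expand[OF u(2)] by simp
  also have "\<dots> = (\<Oplus>i\<in>{..<n}. \<beta> u (\<beta> v (es i) \<odot>\<^sub>U e i))"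
    by (rule b_sum_r) (use u e_car es_car bD(1) in auto)
  also have "\<dots> = (\<Oplus>i\<in>{..<n}. \<beta> v (es i) \<otimes> \<beta> u (e i))"
    by (rule finsum_cong') (use u e_car es_car bD in auto)
  finally show ?thesis .
qed

lemma subsp_sum:
  assumes "subsp Kk (reg_mod L) E" "finite I" "\<And>i. i \<in> I \<Longrightarrow> f i \<in> E"
  shows "(\<Oplus>i\<in>I. f i) \<in> E"
  using assms(2,3)
proof (induction I rule: finite_induct)
  case (insert i I)
  have "f ` insert i I \<subseteq> carrier L" using insert Lk.subspD(1)[OF assms(1)] by auto
  then show ?case using insert Lk.subspD(4)[OF assms(1), of "f i"] by (simp add: Pi_def image_subset_iff)
qed (use Lk.subspD(2)[OF assms(1)] in simp)

text \<open>The vectors with all coordinates in \<open>E\<close>. For \<open>E = Rd d\<close> these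
  are the global sections with poles of order at most \<open>d\<close> at infinity, for
  \<open>E = Lm d\<close> their local counterparts near infinity.\<close>

definition UE :: "'l set \<Rightarrow> 'u set" where
  "UE E = {u \<in> carrier U. \<forall>i<n. \<beta> u (es i) \<in> E}"

lemma UE_carrier: "u \<in> UE E \<Longrightarrow> u \<in> carrier U" unfolding UE_def by auto

lemma UE_subsp: assumes "subsp Kk (reg_mod L) E" shows "subsp Kk U (UE E)"
  unfolding subsp_def
proof (intro conjI ballI)
  show "\<zero>\<^sub>U \<in> UE E" using Lk.subspD(2)[OF assms] es_car b_zero by (auto simp: UE_def)
  fix u v assume "u \<in> UE E" "v \<in> UE E"
  then show "u \<oplus>\<^sub>U v \<in> UE E" using Lk.subspD(4)[OF assms] es_car bD(2) by (auto simp: UE_def)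
next
  fix a u assume "a \<in> carrier Kk" "u \<in> UE E"
  then show "a \<odot>\<^sub>U u \<in> UE E" using Lk.subspD(5)[OF assms, of a] es_car bD(4) k_sub by (auto simp: UE_def)
qed (auto simp: UE_def)

lemma UE_mono: "E \<subseteq> E' \<Longrightarrow> UE E \<subseteq> UE E'" unfolding UE_def by auto

lemma UE_smult:
  assumes "u \<in> UE E" "l \<in> carrier L" "\<And>z. z \<in> E \<Longrightarrow> l \<otimes> z \<in> E'" shows "l \<odot>\<^sub>U u \<in> UE E'"
  using assms es_car bD(4) unfolding UE_def by auto

lemma UE_smult_k:
  assumes "l \<in> E" "subsp Kk (reg_mod L) E" "u \<in> UE k" shows "l \<odot>\<^sub>U u \<in> UE E"
  using UE_smult[OF assms(3), of l E] assms Lk.subspD(3,5)[OF assms(2)] k_sub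
  by (simp add: m_comm subset_iff)

lemma es_UE: "i < n \<Longrightarrow> es i \<in> UE k"
  using es_car es_k unfolding UE_def by auto

text \<open>Since the products of basis vectors are constants, \<open>\<beta> u v\<close> is a
  combination with constant coefficients of products of coordinates of \<open>u\<close> and
  \<open>v\<close>.\<close>

lemma b_UE:
  assumes "u \<in> UE E" "v \<in> UE E'" "subsp Kk (reg_mod L) E" "subsp Kk (reg_mod L) E'" "subsp Kk (reg_mod L) E''"
    and "\<And>z w. z \<in> E \<Longrightarrow> w \<in> E' \<Longrightarrow> z \<otimes> w \<in> E''"
  shows "\<beta> u v \<in> E''"
proof -
  have uv: "u \<in> carrier U" "v \<in> carrier U" using assms UE_carrier by auto
  have "\<beta> (e i) v \<in> E'" if i: "i < n" for i
  proof -
    have "\<beta> v (es j) \<otimes> \<beta> (e i) (e j) \<in> E'" if "j < n" for j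
    proof -
      have "\<beta> (e i) (e j) \<otimes> \<beta> v (es j) \<in> E'"
        using Lk.subspD(5)[OF assms(4)] e_k[OF i that] assms(2) that unfolding UE_def by simp
      then show ?thesis using bD(1) e_car es_car uv i that by (simp add: m_comm)
    qed
    then show ?thesis unfolding b_expand_r[OF e_car[OF i] uv(2)] by (intro subsp_sum[OF assms(4)]) auto
  qed
  then show ?thesis using assms(1,6) unfolding b_expand_l[OF uv] UE_def by (intro subsp_sum[OF assms(5)]) auto
qed

lemma UE_dim:
  assumes "qdim Kk (reg_mod L) E E' m" shows "qdim Kk U (UE E) (UE E') (n * m)"
  using assms
proof (induction rule: qdim.induct)
  case (qdim_refl T) then show ?case by (simp add: qdim.qdim_refl UE_subsp)
next
  case (qdim_step T S m z)
  have S: "subsp Kk (reg_mod L) S" using qdim_step Lk.qdim_subsp by auto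
  have zc: "z \<in> carrier L" using qdim_step by simp
  let ?S = "adj Kk (reg_mod L) S z"
  have SS: "S \<subseteq> ?S" "z \<in> ?S" using Lk.adj_ge[of S z] Lk.adj_mem[OF S] Lk.subspD(1)[OF S] zc by auto
  have S': "subsp Kk (reg_mod L) ?S" using Lk.adj_subsp[OF S] zc by simp
  \<comment> \<open>\<open>D j\<close> releases the first \<open>j\<close> coordinates into the
    larger space. Adjoining \<open>z e_j\<close> leads from \<open>D j\<close> to
    \<open>D (j + 1)\<close>, so all \<open>n\<close> coordinates cost \<open>n\<close>
    steps.\<close>
  define D where "D j = {u \<in> carrier U. \<forall>i<n. \<beta> u (es i) \<in> (if i < j then ?S else S)}" for j
  have D0: "D 0 = UE S" unfolding D_def UE_def by simp
  have Dn: "D n = UE ?S" unfolding D_def UE_def by auto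
  have ze: "z \<odot>\<^sub>U e j \<in> carrier U" if "j < n" for j using e_car[OF that] zc by simp
  have bze: "\<beta> (z \<odot>\<^sub>U e j) (es i) = (if i = j then z else \<zero>)" if "i < n" "j < n" for i j
    using bD(4)[OF zc e_car[OF that(2)] es_car[OF that(1)]] dual[OF that(2,1)] zc by simp
  have "qdim Kk U (UE S) (D j) j" if "j \<le> n" for j
    using that
  proof (induction j)
    case 0 show ?case unfolding D0 by (rule qdim.qdim_refl[OF UE_subsp[OF S]])
  next
    case (Suc j)
    then have IH: "qdim Kk U (UE S) (D j) j" and j: "j < n" by auto
    have "z \<odot>\<^sub>U e j \<notin> D j"
    proof
      assume "z \<odot>\<^sub>U e j \<in> D j"
      then have "\<beta> (z \<odot>\<^sub>U e j) (es j) \<in> (if j < j then ?S else S)" unfolding D_def using j by blast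
      then show False using bze[OF j j] qdim_step.hyps(3) by simp
    qed
    moreover have "adj Kk U (D j) (z \<odot>\<^sub>U e j) = D (Suc j)"
    proof (intro equalityI subsetI)
      fix u assume "u \<in> adj Kk U (D j) (z \<odot>\<^sub>U e j)"
      then obtain s a where sa: "u = s \<oplus>\<^sub>U a \<odot>\<^sub>U (z \<odot>\<^sub>U e j)" "s \<in> D j" "a \<in> k" unfolding adj_def by auto
      have ac: "a \<in> carrier L" using sa k_sub by auto
      have sc: "s \<in> carrier U" using sa unfolding D_def by auto
      have "\<beta> u (es i) \<in> (if i < Suc j then ?S else S)" if i: "i < n" for i
      proof -
        have "\<beta> u (es i) = \<beta> s (es i) \<oplus> a \<otimes> (if i = j then z else \<zero>)"
          using sa bD(2)[OF sc _ es_car[OF i]] bD(4)[OF ac ze[OF j] es_car[OF i]] ze[OF j] ac bze[OF i j] by simp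
        moreover have "\<beta> s (es i) \<in> (if i < j then ?S else S)" using sa i unfolding D_def by auto
        moreover have "\<beta> s (es i) \<in> carrier L" using bD(1)[OF sc es_car[OF i]] .
        moreover have "\<beta> s (es j) \<oplus> a \<otimes> z \<in> ?S" if "\<beta> s (es j) \<in> S" 
          using that sa(3) unfolding adj_def by auto
        ultimately show ?thesis using ac SS by (auto split: if_splits)
      qed
      then show "u \<in> D (Suc j)" using sa sc ze[OF j] ac unfolding D_def by auto
    next
      fix u assume u: "u \<in> D (Suc j)"
      then have uc: "u \<in> carrier U" unfolding D_def by auto
      have "\<beta> u (es j) \<in> ?S" using u j unfolding D_def by auto
      then obtain s a where sa: "\<beta> u (es j) = s \<oplus> a \<otimes> z" "s \<in> S" "a \<in> k" unfolding adj_def by auto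
      have ac: "a \<in> carrier L" using sa k_sub by auto
      have sc: "s \<in> carrier L" using sa Lk.subspD(3)[OF S] by auto
      let ?w = "a \<odot>\<^sub>U (z \<odot>\<^sub>U e j)"
      have wc: "?w \<in> carrier U" using ac ze[OF j] by simp
      have mw: "\<ominus>\<^sub>U ?w = (\<ominus> a) \<odot>\<^sub>U (z \<odot>\<^sub>U e j)" using U.smult_l_minus[OF ac ze[OF j]] by simp
      have "u \<ominus>\<^sub>U ?w \<in> D j" unfolding D_def
      proof (intro CollectI conjI allI impI)
        fix i assume i: "i < n"
        have "\<beta> (u \<ominus>\<^sub>U ?w) (es i) = \<beta> u (es i) \<oplus> (\<ominus> a) \<otimes> (if i = j then z else \<zero>)"
          unfolding a_minus_def mw
          using bD(2)[OF uc _ es_car[OF i]] bD(4)[OF _ ze[OF j] es_car[OF i]] ze[OF j] ac bze[OF i j] by simp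
        moreover have "s \<oplus> a \<otimes> z \<oplus> \<ominus> a \<otimes> z = s" using sc ac zc by (simp add: a_assoc l_minus r_neg)
        moreover have "\<beta> u (es i) \<in> (if i < Suc j then ?S else S)" using u i unfolding D_def by auto
        moreover have "\<beta> u (es i) \<in> carrier L" using bD(1)[OF uc es_car[OF i]] .
        ultimately show "\<beta> (u \<ominus>\<^sub>U ?w) (es i) \<in> (if i < j then ?S else S)" using sa ac by (auto simp: less_Suc_eq)
      qed (use uc wc in simp)
      moreover have "u = (u \<ominus>\<^sub>U ?w) \<oplus>\<^sub>U ?w" using uc wc by (simp add: a_minus_def U.M.a_assoc U.M.l_neg)
      ultimately show "u \<in> adj Kk U (D j) (z \<odot>\<^sub>U e j)" using sa(3) unfolding adj_def by auto
    qed
    ultimately show ?case using qdim.qdim_step[OF IH ze[OF j]] by simp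
  qed
  from this[of n] have "qdim Kk U (UE S) (UE ?S) n" using Dn by simp
  from Uk.qdim_trans[OF this qdim_step.IH] show ?case by (simp add: algebra_simps)
qed

end

section \<open>Subspaces as bundles: fibre at infinity and growth of sections\<close>

context filt_form
begin

text \<open>A subspace \<open>Z\<close> is treated as a vector bundle on the conic: \<open>nu Z d\<close> counts its global sections
  with poles of order at most \<open>d\<close> at infinity, \<open>rho Z\<close> is the dimension of its fibre at infinity.\<close>

definition le :: "'u set \<Rightarrow> int \<Rightarrow> 'u set" where "le Z d = Z \<inter> UE (Lm d)"
definition rg :: "'u set \<Rightarrow> nat \<Rightarrow> 'u set" where "rg Z d = Z \<inter> UE (Rd d)"

definition rho :: "'u set \<Rightarrow> nat" where "rho Z = (THE m. qdim Kk U (le Z (-1)) (le Z 0) m)"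
definition nu :: "'u set \<Rightarrow> nat \<Rightarrow> nat" where "nu Z d = (THE m. qdim Kk U {\<zero>\<^sub>U} (rg Z d) m)"

lemma L_to_k: "subsp L U Z \<Longrightarrow> subsp Kk U Z"
  unfolding subsp_def using k_sub by auto

lemma le_subsp: "subsp L U Z \<Longrightarrow> subsp Kk U (le Z d)"
  unfolding le_def using Uk.subsp_inter[OF L_to_k UE_subsp[OF Lm_subsp]] .

lemma rg_subsp: "subsp L U Z \<Longrightarrow> subsp Kk U (rg Z d)"
  unfolding rg_def using Uk.subsp_inter[OF L_to_k UE_subsp[OF Rd_subsp]] .

lemma le_mono: "d \<le> d' \<Longrightarrow> le Z d \<subseteq> le Z d'"
  unfolding le_def using UE_mono[OF Lm_mono] by blast

lemma rg_mono: "d \<le> d' \<Longrightarrow> rg Z d \<subseteq> rg Z d'"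
  unfolding rg_def using UE_mono[OF Rd_mono] by blast

lemma le_sub: "le Z d \<subseteq> Z" unfolding le_def by auto
lemma rg_sub: "rg Z d \<subseteq> Z" unfolding rg_def by auto
lemma le_mono_set: "Z \<subseteq> Y \<Longrightarrow> le Z d \<subseteq> le Y d" unfolding le_def by auto
lemma rg_mono_set: "Z \<subseteq> Y \<Longrightarrow> rg Z d \<subseteq> rg Y d" unfolding rg_def by auto
lemma rg_le: "rg Z d \<subseteq> le Z (int d)" unfolding rg_def le_def using UE_mono[OF Rd_Lm] by blast
lemma rg_inter_le: "rg Z d \<inter> le Z (int d') \<subseteq> rg Z d'"
  unfolding rg_def le_def UE_def using Rd_inter by auto

lemma smult_inv:
  assumes "a \<in> carrier L" "a \<noteq> \<zero>" "u \<in> carrier U"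
  shows "inv a \<odot>\<^sub>U (a \<odot>\<^sub>U u) = u" "a \<odot>\<^sub>U (inv a \<odot>\<^sub>U u) = u"
proof -
  have "inv a \<in> carrier L" "inv a \<otimes> a = \<one>" "a \<otimes> inv a = \<one>" using assms field_Units by auto
  then show "inv a \<odot>\<^sub>U (a \<odot>\<^sub>U u) = u" "a \<odot>\<^sub>U (inv a \<odot>\<^sub>U u) = u"
    using assms by (simp_all add: U.smult_assoc1[symmetric])
qed

lemma le_x: "subsp L U Z \<Longrightarrow> u \<in> le Z d \<Longrightarrow> x \<odot>\<^sub>U u \<in> le Z (d + 1)"
  unfolding le_def using UL.subspD(5)[of Z x u] UE_smult[of u "Lm d" x "Lm (d+1)"] x_carrier x_mult_Lm by auto

lemma le_xinv: "subsp L U Z \<Longrightarrow> u \<in> le Z d \<Longrightarrow> inv x \<odot>\<^sub>U u \<in> le Z (d - 1)"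
  unfolding le_def using UL.subspD(5)[of Z "inv x" u] UE_smult[of u "Lm d" "inv x" "Lm (d-1)"] xinv xinv_mult_Lm by auto

lemma le_step: assumes "subsp L U Z" shows "\<exists>m. qdim Kk U (le Z (d - 1)) (le Z d) m"
  using Uk.qdim_inter[OF UE_dim[OF Lm_dim[of d]] L_to_k[OF assms]]
  unfolding le_def Int_commute[of Z] by (elim exE conjE) (rule exI)

text \<open>Multiplication by \<open>a\<close> carries the graded piece of degree \<open>d\<close>
  isomorphically to that of degree \<open>d + s\<close>. With \<open>x\<close> for
  \<open>s = 1\<close> and \<open>inv x\<close> for \<open>s = -1\<close> this makes the dimension
  of the graded pieces independent of the degree.\<close>

lemma le_shift:
  assumes Z: "subsp L U Z" and q: "qdim Kk U (le Z (d - 1)) (le Z d) m"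
    and a: "a \<in> carrier L" "a \<noteq> \<zero>" "\<And>d u. u \<in> le Z d \<Longrightarrow> a \<odot>\<^sub>U u \<in> le Z (d + s)"
      "\<And>d u. u \<in> le Z d \<Longrightarrow> inv a \<odot>\<^sub>U u \<in> le Z (d - s)"
  shows "qdim Kk U (le Z (d + s - 1)) (le Z (d + s)) m"
proof -
  have zc: "u \<in> carrier U" if "u \<in> le Z d" for u d using that UL.subspD(3)[OF Z] le_sub by blast
  have "qdim Kk U (le Z (d + s - 1)) (ssum U (le Z (d + s - 1)) ((\<lambda>u. a \<odot>\<^sub>U u) ` le Z d)) m"
  proof (rule qdim_map[OF Uk.vecsp_axioms Uk.vecsp_axioms q])
    fix u assume u: "u \<in> le Z d"
    show "a \<odot>\<^sub>U u \<in> carrier U" using zc[OF u] a by simp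
    show "(a \<odot>\<^sub>U u \<in> le Z (d + s - 1)) = (u \<in> le Z (d - 1))"
    proof
      assume "a \<odot>\<^sub>U u \<in> le Z (d + s - 1)"
      from a(4)[OF this] show "u \<in> le Z (d - 1)" using smult_inv(1)[OF a(1,2) zc[OF u]] by (simp add: algebra_simps)
    next
      assume "u \<in> le Z (d - 1)"
      from a(3)[OF this] show "a \<odot>\<^sub>U u \<in> le Z (d + s - 1)" by (simp add: algebra_simps)
    qed
    fix v assume "v \<in> le Z d"
    then show "a \<odot>\<^sub>U (u \<oplus>\<^sub>U v) = a \<odot>\<^sub>U u \<oplus>\<^sub>U a \<odot>\<^sub>U v" using zc u a by (simp add: U.smult_r_distr)
  next
    fix b u assume "b \<in> carrier Kk" "u \<in> le Z d"
    then show "a \<odot>\<^sub>U (b \<odot>\<^sub>U u) = b \<odot>\<^sub>U (a \<odot>\<^sub>U u)"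
      using zc a k_sub by (simp add: U.smult_assoc1[symmetric] m_comm subset_iff)
  qed (rule le_subsp[OF Z])
  moreover have "ssum U (le Z (d + s - 1)) ((\<lambda>u. a \<odot>\<^sub>U u) ` le Z d) = le Z (d + s)"
  proof
    show "ssum U (le Z (d + s - 1)) ((\<lambda>u. a \<odot>\<^sub>U u) ` le Z d) \<subseteq> le Z (d + s)"
      by (rule Uk.ssum_least[OF le_subsp[OF Z]]) (use a le_mono[of "d + s - 1" "d + s"] in auto)
    have "(\<lambda>u. a \<odot>\<^sub>U u) ` le Z d \<subseteq> carrier U" using zc a by auto
    then have "(\<lambda>u. a \<odot>\<^sub>U u) ` le Z d \<subseteq> ssum U (le Z (d + s - 1)) ((\<lambda>u. a \<odot>\<^sub>U u) ` le Z d)"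
      using Uk.ssum_ge2[OF le_subsp[OF Z]] by blast
    moreover have "u \<in> (\<lambda>u. a \<odot>\<^sub>U u) ` le Z d" if u: "u \<in> le Z (d + s)" for u
      using a(4)[OF u] smult_inv(2)[OF a(1,2) zc[OF u]] by (metis add_diff_cancel_right' imageI)
    ultimately show "le Z (d + s) \<subseteq> ssum U (le Z (d + s - 1)) ((\<lambda>u. a \<odot>\<^sub>U u) ` le Z d)" by blast
  qed
  ultimately show ?thesis by simp
qed

lemma rho: assumes Z: "subsp L U Z" shows "qdim Kk U (le Z (d - 1)) (le Z d) (rho Z)"
proof -
  obtain m where q: "qdim Kk U (le Z (-1)) (le Z 0) m" using le_step[OF Z, of 0] by auto
  then have 0: "qdim Kk U (le Z (0 - 1)) (le Z 0) (rho Z)"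
    unfolding rho_def diff_0 by (rule theI) (rule Uk.qdim_unique[OF _ q])
  show ?thesis
  proof (induction d rule: int_induct[where k = 0])
    case base show ?case using 0 by simp
  next
    case (step1 i)
    show ?case by (rule le_shift[OF Z step1(2) x_carrier x_nz]) (use le_x[OF Z] le_xinv[OF Z] in auto)
  next
    case (step2 i)
    have ii: "inv (inv x) = x" "inv x \<noteq> \<zero>" using x_carrier x_nz field_Units xinv by (auto simp: Units_inv_inv)
    show ?case using le_shift[OF Z step2(2) xinv(1) ii(2), of "-1"] le_x[OF Z] le_xinv[OF Z] ii by simp
  qed
qed

lemma rho_eq: "subsp L U Z \<Longrightarrow> qdim Kk U (le Z (d - 1)) (le Z d) m \<Longrightarrow> m = rho Z"
  using rho Uk.qdim_unique by blast

lemma rho_chain: assumes Z: "subsp L U Z" shows "qdim Kk U (le Z d) (le Z (d + int j)) (rho Z * j)"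
proof (induction j)
  case 0 then show ?case using le_subsp[OF Z] by (simp add: qdim.qdim_refl)
next
  case (Suc j)
  have "qdim Kk U (le Z (d + int j)) (le Z (d + int (Suc j))) (rho Z)"
    using rho[OF Z, of "d + int (Suc j)"] by simp
  from Uk.qdim_trans[OF this Suc] show ?case by (simp add: algebra_simps)
qed

lemma rho_mono: assumes "subsp L U Z" "subsp L U Y" "Z \<subseteq> Y" shows "rho Z \<le> rho Y"
proof -
  have "le Y d \<inter> Z = le Z d" for d using assms(3) unfolding le_def by auto
  moreover from Uk.qdim_inter[OF rho[OF assms(2), of 0] L_to_k[OF assms(1)]]
  obtain m where "m \<le> rho Y" "qdim Kk U (le Y (0 - 1) \<inter> Z) (le Y 0 \<inter> Z) m"
    by (elim exE conjE)
  ultimately show ?thesis using rho_eq[OF assms(1), of 0 m] by simp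
qed

lemma UE_zero: "UE {\<zero>} = {\<zero>\<^sub>U}"
proof
  show "UE {\<zero>} \<subseteq> {\<zero>\<^sub>U}"
  proof
    fix u assume u: "u \<in> UE {\<zero>}"
    have "(\<Oplus>\<^sub>U i\<in>{..<n}. \<beta> u (es i) \<odot>\<^sub>U e i) = (\<Oplus>\<^sub>U i\<in>{..<n}. \<zero>\<^sub>U)"
      by (rule U.M.finsum_cong') (use u e_car in \<open>auto simp: UE_def\<close>)
    then show "u \<in> {\<zero>\<^sub>U}" using expand[OF UE_carrier[OF u]] by simp
  qed
qed (use b_zero es_car in \<open>auto simp: UE_def\<close>)

lemma rg_carrier_dim: "qdim Kk U {\<zero>\<^sub>U} (UE (Rd d)) (n * (2 * d + 1))"
  using UE_dim[OF Rd_dim[of d]] UE_zero by simp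

lemma nu: assumes Z: "subsp L U Z" shows "qdim Kk U {\<zero>\<^sub>U} (rg Z d) (nu Z d)"
proof -
  have 0: "{\<zero>\<^sub>U} \<subseteq> rg Z d" using Uk.subspD(2)[OF rg_subsp[OF Z]] by simp
  have "rg Z d \<subseteq> UE (Rd d)" unfolding rg_def by (rule Int_lower2)
  from Uk.qdim_mid[OF rg_carrier_dim[of d] rg_subsp[OF Z, of d] 0 this]
  obtain m where q: "qdim Kk U {\<zero>\<^sub>U} (rg Z d) m" by (elim exE conjE)
  then show ?thesis unfolding nu_def by (rule theI) (rule Uk.qdim_unique[OF _ q])
qed

lemma xpow: "x [^] (m::nat) \<in> carrier L" "x [^] (m::nat) \<noteq> \<zero>"
proof -
  show "x [^] (m::nat) \<in> carrier L" using x_carrier by simp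
  show "x [^] (m::nat) \<noteq> \<zero>" by (induction m) (use x_carrier x_nz integral_iff in auto)
qed

lemma le_xpow: "subsp L U Z \<Longrightarrow> u \<in> le Z d \<Longrightarrow> x [^] (m::nat) \<odot>\<^sub>U u \<in> le Z (d + int m)"
proof (induction m)
  case 0
  have "u \<in> carrier U" using UL.subspD(3)[OF 0(1)] 0(2) le_sub by blast
  then show ?case using 0 by simp
next
  case (Suc m)
  have uc: "u \<in> carrier U" using Suc UL.subspD(3) le_sub by blast
  have "x [^] Suc m \<odot>\<^sub>U u = x \<odot>\<^sub>U (x [^] m \<odot>\<^sub>U u)"
    using uc x_carrier by (simp add: U.smult_assoc1[symmetric] m_comm)
  then show ?case using le_x[OF Suc.prems(1) Suc.IH[OF Suc.prems]] by (simp add: algebra_simps)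
qed

lemma le_xpow_inv: "subsp L U Z \<Longrightarrow> u \<in> le Z d \<Longrightarrow> \<exists>w\<in>le Z (d - int m). u = x [^] (m::nat) \<odot>\<^sub>U w"
proof (induction m)
  case 0
  have "u \<in> carrier U" using UL.subspD(3)[OF 0(1)] 0(2) le_sub by blast
  then show ?case using 0 by (intro bexI[of _ u]) auto
next
  case (Suc m)
  then obtain w where w: "w \<in> le Z (d - int m)" "u = x [^] m \<odot>\<^sub>U w" by auto
  have wc: "w \<in> carrier U" using w Suc.prems UL.subspD(3) le_sub by blast
  have "u = x [^] Suc m \<odot>\<^sub>U (inv x \<odot>\<^sub>U w)"
    using w wc x_carrier xinv by (simp add: U.smult_assoc1[symmetric] m_assoc)
  then show ?case using le_xinv[OF Suc.prems(1) w(1)] by (intro bexI) (auto simp: algebra_simps)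
qed

lemma xpow_Rd: "z \<in> Rd d \<Longrightarrow> x [^] (m::nat) \<otimes> z \<in> Rd (d + m)"
proof (induction m)
  case 0 then show ?case using Rd_carrier by auto
next
  case (Suc m)
  have "x [^] Suc m \<otimes> z = x \<otimes> (x [^] m \<otimes> z)" using x_carrier Rd_carrier[OF Suc.prems] by (simp add: m_ac)
  then show ?case using x_mult_Rd[OF Suc.IH[OF Suc.prems]] by simp
qed

lemma rg_xpow: "subsp L U Z \<Longrightarrow> u \<in> rg Z d \<Longrightarrow> x [^] (m::nat) \<odot>\<^sub>U u \<in> rg Z (d + m)"
  unfolding rg_def using UL.subspD(5)[of Z "x [^] m" u] UE_smult[of u "Rd d" "x [^] m" "Rd (d+m)"] xpow xpow_Rd by auto

text \<open>There are finitely many coordinates, so one power of \<open>x\<close> clears all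
  denominators. The statement with \<open>j\<close> in its proof collects them one at a
  time.\<close>

lemma UE_bounded:
  assumes "u \<in> carrier U" "\<And>i. i < n \<Longrightarrow> \<exists>N d. x [^] (N::nat) \<otimes> \<beta> u (es i) \<in> Rd d"
  shows "\<exists>N d. x [^] (N::nat) \<odot>\<^sub>U u \<in> UE (Rd d)"
proof -
  have "\<exists>N d. \<forall>i<j. x [^] (N::nat) \<otimes> \<beta> u (es i) \<in> Rd d" if "j \<le> n" for j
    using that
  proof (induction j)
    case (Suc j)
    then obtain N d where 1: "\<forall>i<j. x [^] (N::nat) \<otimes> \<beta> u (es i) \<in> Rd d" by auto
    obtain N' d' where 2: "x [^] (N'::nat) \<otimes> \<beta> u (es j) \<in> Rd d'" using assms(2)[of j] Suc by auto
    have b: "\<beta> u (es i) \<in> carrier L" if "i < Suc j" for i using bD(1)[OF assms(1) es_car[of i]] Suc that by auto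
    have "x [^] (N + N') \<otimes> \<beta> u (es i) \<in> Rd (max (d + N') (d' + N))" if i: "i < Suc j" for i
    proof (cases "i = j")
      case True
      have "x [^] (N + N') \<otimes> \<beta> u (es i) = x [^] N \<otimes> (x [^] N' \<otimes> \<beta> u (es i))"
        using b[OF i] x_carrier by (simp add: nat_pow_mult[symmetric] m_assoc)
      then show ?thesis using xpow_Rd[OF 2, of N] True Rd_mono[of "d' + N" "max (d + N') (d' + N)"] by auto
    next
      case False
      have "x [^] (N + N') \<otimes> \<beta> u (es i) = x [^] N' \<otimes> (x [^] N \<otimes> \<beta> u (es i))"
        using b[OF i] x_carrier by (simp add: nat_pow_mult[symmetric] m_ac)
      then show ?thesis using xpow_Rd[of _ d N'] 1 i False Rd_mono[of "d + N'" "max (d + N') (d' + N)"] by auto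
    qed
    then show ?case by blast
  qed auto
  then obtain N d where "\<forall>i<n. x [^] (N::nat) \<otimes> \<beta> u (es i) \<in> Rd d" by blast
  then have "x [^] N \<odot>\<^sub>U u \<in> UE (Rd d)" using assms(1) x_carrier bD(4) es_car unfolding UE_def by auto
  then show ?thesis by blast
qed

text \<open>In large degree every leading form of \<open>Z\<close> is attained by an element with polynomial coordinates.\<close>

lemma stabilize:
  assumes Z: "subsp L U Z"
  shows "\<exists>D. \<forall>d\<ge>D. le Z (int d) \<subseteq> ssum U (le Z (int d - 1)) (rg Z d)"
proof -
  \<comment> \<open>The induction runs along a chain from order -1 to order 0, finite by
    \<open>rho\<close>. Working with \<open>x^d u\<close> instead of vectors of order
    \<open>d\<close> keeps the chain independent of \<open>d\<close>.\<close>
  have *: "\<exists>D. \<forall>d\<ge>D. \<forall>u\<in>Y. x [^] (d::nat) \<odot>\<^sub>U u \<in> ssum U (le Z (int d - 1)) (rg Z d)"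
    if "qdim Kk U (le Z (-1)) Y m" "Y \<subseteq> le Z 0" for Y m
    using that
  proof (induction "le Z (-1)" Y m rule: qdim.induct)
    case qdim_refl
    have "x [^] (d::nat) \<odot>\<^sub>U u \<in> ssum U (le Z (int d - 1)) (rg Z d)" if "u \<in> le Z (-1)" for d u
      using le_xpow[OF Z that, of d] Uk.ssum_ge1[OF rg_subsp[OF Z], of "le Z (int d - 1)"] 
        Uk.subspD(1)[OF le_subsp[OF Z]] by (auto simp: algebra_simps)
    then show ?case by blast
  next
    case (qdim_step Y m v)
    have Y: "subsp Kk U Y" using qdim_step Uk.qdim_subsp by auto
    have YY: "Y \<subseteq> adj Kk U Y v" "v \<in> adj Kk U Y v"
      using Uk.adj_ge[of Y v] Uk.adj_mem[OF Y] Y Uk.subspD(1) qdim_step by auto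
    obtain D where D: "\<forall>d\<ge>D. \<forall>u\<in>Y. x [^] (d::nat) \<odot>\<^sub>U u \<in> ssum U (le Z (int d - 1)) (rg Z d)"
      using qdim_step YY by auto
    have v: "v \<in> le Z 0" using qdim_step.prems YY by auto
    have vc: "v \<in> carrier U" by fact
    have "\<exists>N d. x [^] (N::nat) \<otimes> \<beta> v (es i) \<in> Rd d" if "i < n" for i
      using v that Lm_Rd unfolding le_def UE_def by auto
    then obtain N d0 where N: "x [^] (N::nat) \<odot>\<^sub>U v \<in> UE (Rd d0)" using UE_bounded[OF vc] by auto
    have N1: "x [^] N \<odot>\<^sub>U v \<in> rg Z d0" using N UL.subspD(5)[OF Z xpow(1)] v unfolding rg_def le_def by auto
    then have N2: "x [^] N \<odot>\<^sub>U v \<in> rg Z N" using le_xpow[OF Z v, of N] rg_inter_le[of Z d0 N] by auto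
    \<comment> \<open>Beyond \<open>N\<close> a further power of \<open>x\<close> keeps
      \<open>x^d v\<close> regular off infinity, so the bound for the larger space is the maximum of
      \<open>N\<close> and the bound for \<open>Y\<close>.\<close>
    have "x [^] d \<odot>\<^sub>U u \<in> ssum U (le Z (int d - 1)) (rg Z d)" if d: "d \<ge> max D N" and u: "u \<in> adj Kk U Y v" for d u
    proof -
      obtain s a where sa: "u = s \<oplus>\<^sub>U a \<odot>\<^sub>U v" "s \<in> Y" "a \<in> k" using u unfolding adj_def by auto
      have sc: "s \<in> carrier U" "a \<in> carrier L" using sa Uk.subspD(3)[OF Y] k_sub by auto
      have S: "subsp Kk U (ssum U (le Z (int d - 1)) (rg Z d))" using Uk.ssum_subsp[OF le_subsp[OF Z] rg_subsp[OF Z]] .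
      have "x [^] d = x [^] (d - N) \<otimes> x [^] N" using d x_carrier by (simp add: nat_pow_mult)
      then have "x [^] d \<odot>\<^sub>U v \<in> rg Z (N + (d - N))"
        using rg_xpow[OF Z N2, of "d - N"] x_carrier vc by (simp add: U.smult_assoc1)
      then have "x [^] d \<odot>\<^sub>U v \<in> ssum U (le Z (int d - 1)) (rg Z d)"
        using d Uk.ssum_ge2[OF le_subsp[OF Z], of "rg Z d"] Uk.subspD(1)[OF rg_subsp[OF Z]] by auto
      then have "a \<odot>\<^sub>U (x [^] d \<odot>\<^sub>U v) \<in> ssum U (le Z (int d - 1)) (rg Z d)"
        using Uk.subspD(5)[OF S] sa by auto
      moreover have "x [^] d \<odot>\<^sub>U s \<in> ssum U (le Z (int d - 1)) (rg Z d)" using D d sa by auto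
      moreover have "x [^] d \<odot>\<^sub>U u = x [^] d \<odot>\<^sub>U s \<oplus>\<^sub>U a \<odot>\<^sub>U (x [^] d \<odot>\<^sub>U v)"
        using sa sc vc x_carrier by (simp add: U.smult_r_distr U.smult_assoc1[symmetric] m_comm)
      ultimately show ?thesis using Uk.subspD(4)[OF S] by simp
    qed
    then show ?case by blast
  qed
  obtain D where D: "\<forall>d\<ge>D. \<forall>u\<in>le Z 0. x [^] (d::nat) \<odot>\<^sub>U u \<in> ssum U (le Z (int d - 1)) (rg Z d)"
    using *[OF rho[OF Z, of 0, simplified]] by auto
  have "le Z (int d) \<subseteq> ssum U (le Z (int d - 1)) (rg Z d)" if "d \<ge> D" for d
  proof
    fix u assume "u \<in> le Z (int d)"
    then obtain w where "w \<in> le Z 0" "u = x [^] d \<odot>\<^sub>U w" using le_xpow_inv[OF Z, of u "int d" d] by auto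
    then show "u \<in> ssum U (le Z (int d - 1)) (rg Z d)" using D that by auto
  qed
  then show ?thesis by blast
qed

text \<open>Sections of order \<open>d + 1\<close> modulo sections of order \<open>d\<close> always
  embed into the graded piece at infinity; the hypothesis says that they fill it.\<close>

lemma nu_step:
  assumes Z: "subsp L U Z" and D: "le Z (int (Suc d)) \<subseteq> ssum U (le Z (int d)) (rg Z (Suc d))"
  shows "nu Z (Suc d) = nu Z d + rho Z"
proof -
  have r: "rg Z d \<subseteq> rg Z (Suc d)" using rg_mono[of d "Suc d"] by simp
  have q: "nu Z d \<le> nu Z (Suc d)" "qdim Kk U (rg Z d) (rg Z (Suc d)) (nu Z (Suc d) - nu Z d)"
    using Uk.qdim_diff[OF nu[OF Z] nu[OF Z] r] by auto
  have i: "le Z (int d) \<inter> rg Z (Suc d) = rg Z d"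
    using rg_inter_le[of Z "Suc d" d] r rg_le[of Z d] by auto
  have "ssum U (le Z (int d)) (rg Z (Suc d)) = le Z (int (Suc d))"
    using D Uk.ssum_least[OF le_subsp[OF Z], of "le Z (int d)" "int (Suc d)" "rg Z (Suc d)"] 
      le_mono[of "int d" "int (Suc d)"] rg_le[of Z "Suc d"] by auto
  then have "qdim Kk U (le Z (int (Suc d) - 1)) (le Z (int (Suc d))) (nu Z (Suc d) - nu Z d)"
    using Uk.qdim_ssum[OF q(2) le_subsp[OF Z] i] by simp
  from rho_eq[OF Z this] q(1) show ?thesis by simp
qed

text \<open>The Hilbert function of \<open>Z\<close> is eventually linear, and its slope is the
  fibre dimension \<open>rho Z\<close>.\<close>

lemma nu_grow:
  assumes Z: "subsp L U Z" and D: "\<forall>d\<ge>D. le Z (int d) \<subseteq> ssum U (le Z (int d - 1)) (rg Z d)"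
  shows "nu Z (D + j) = nu Z D + rho Z * j"
proof (induction j)
  case (Suc j)
  have "le Z (int (Suc (D + j))) \<subseteq> ssum U (le Z (int (D + j))) (rg Z (Suc (D + j)))"
    using D[rule_format, of "Suc (D + j)"] by simp
  from nu_step[OF Z this] show ?case using Suc by simp
qed simp

lemma common_denom:
  assumes u: "u \<in> carrier U"
  shows "\<exists>q\<in>RR. q \<noteq> \<zero> \<and> (\<exists>d. q \<odot>\<^sub>U u \<in> UE (Rd d))"
proof -
  have "\<exists>q\<in>RR. q \<noteq> \<zero> \<and> (\<forall>i<j. q \<otimes> \<beta> u (es i) \<in> RR)" if "j \<le> n" for j
    using that
  proof (induction j)
    case 0
    have "\<one> \<in> RR" using Rd_0 subringE(3)[OF subfieldE(1)[OF k]] unfolding RR_def by auto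
    then show ?case by (intro bexI[of _ \<one>]) auto
  next
    case (Suc j)
    then obtain q where q: "q \<in> RR" "q \<noteq> \<zero>" "\<forall>i<j. q \<otimes> \<beta> u (es i) \<in> RR" by auto
    have b: "\<beta> u (es i) \<in> carrier L" if "i < Suc j" for i using bD(1)[OF u es_car[of i]] Suc that by auto
    obtain p where p: "p \<in> RR" "p \<noteq> \<zero>" "p \<otimes> \<beta> u (es j) \<in> RR" 
      using denom[OF b[of j]] unfolding RR_def by auto
    have "p \<otimes> q \<otimes> \<beta> u (es i) \<in> RR" if i: "i < Suc j" for i
    proof (cases "i = j")
      case True
      have "p \<otimes> q \<otimes> \<beta> u (es i) = q \<otimes> (p \<otimes> \<beta> u (es i))" using p q b[OF i] RR_carrier by (simp add: m_ac)
      then show ?thesis using RR_mult[OF q(1) p(3)] True by simp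
    next
      case False
      then have "q \<otimes> \<beta> u (es i) \<in> RR" using q i by auto
      then show ?thesis using RR_mult[OF p(1)] p q b[OF i] RR_carrier by (simp add: m_assoc)
    qed
    moreover have "p \<otimes> q \<noteq> \<zero>" using p q integral_iff RR_carrier by auto
    ultimately show ?case using RR_mult[OF p(1) q(1)] by blast
  qed
  then obtain q where q: "q \<in> RR" "q \<noteq> \<zero>" "\<forall>i<n. q \<otimes> \<beta> u (es i) \<in> RR" by auto
  have qc: "q \<in> carrier L" using q RR_carrier by auto
  have "\<exists>d. \<forall>i<j. q \<otimes> \<beta> u (es i) \<in> Rd d" if "j \<le> n" for j
    using that
  proof (induction j)
    case (Suc j)
    then obtain d where d: "\<forall>i<j. q \<otimes> \<beta> u (es i) \<in> Rd d" by auto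
    obtain d' where d': "q \<otimes> \<beta> u (es j) \<in> Rd d'" using q(3)[rule_format, of j] Suc.prems unfolding RR_def by auto
    have "\<forall>i<Suc j. q \<otimes> \<beta> u (es i) \<in> Rd (max d d')"
      using d d' Rd_mono[of d "max d d'"] Rd_mono[of d' "max d d'"] by (auto simp: less_Suc_eq)
    then show ?case by blast
  qed auto
  then obtain d where "\<forall>i<n. q \<otimes> \<beta> u (es i) \<in> Rd d" by blast
  then have "q \<odot>\<^sub>U u \<in> UE (Rd d)" using u qc bD(4) es_car unfolding UE_def by auto
  then show ?thesis using q by blast
qed

text \<open>The infinite place has degree 2. A new vector, with its denominators cleared,
  contributes its multiples by \<open>Rd\<close>, whose dimension grows by 2 with each degree; a
  comparison of the slopes of the Hilbert functions gives the bound.\<close>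

lemma rho_adj:
  assumes Z: "subsp L U Z" and u: "u \<in> carrier U" "u \<notin> Z"
  shows "rho Z + 2 \<le> rho (adj L U Z u)"
proof -
  let ?Y = "adj L U Z u"
  have Y: "subsp L U ?Y" using UL.adj_subsp[OF Z u(1)] .
  have ZY: "Z \<subseteq> ?Y" "u \<in> ?Y" using UL.adj_ge[of Z u] UL.adj_mem[OF Z u(1)] UL.subspD(1)[OF Z] u by auto
  \<comment> \<open>A common denominator \<open>q\<close> replaces \<open>u\<close> by a multiple
    with regular coordinates; the line spanned modulo \<open>Z\<close> stays the same.\<close>
  obtain q d0 where q: "q \<in> RR" "q \<noteq> \<zero>" "q \<odot>\<^sub>U u \<in> UE (Rd d0)" using common_denom[OF u(1)] by auto
  have qc: "q \<in> carrier L" using q RR_carrier by auto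
  let ?u = "q \<odot>\<^sub>U u"
  have uc: "?u \<in> carrier U" using qc u by simp
  have uY: "?u \<in> rg ?Y d0" using q UL.subspD(5)[OF Y qc ZY(2)] unfolding rg_def by auto
  have uZ: "a = \<zero>" if "a \<in> carrier L" "a \<odot>\<^sub>U ?u \<in> Z" for a
  proof (rule ccontr)
    assume "a \<noteq> \<zero>"
    then have "inv a \<odot>\<^sub>U (a \<odot>\<^sub>U ?u) = ?u" "inv a \<in> carrier L" using smult_inv(1) that uc field_Units by auto
    then have "?u \<in> Z" using UL.subspD(5)[OF Z, of "inv a" "a \<odot>\<^sub>U ?u"] that by simp
    moreover have "inv q \<in> carrier L" using q qc field_Units by auto
    ultimately show False using UL.subspD(5)[OF Z, of "inv q" ?u] smult_inv(1)[OF qc q(2) u(1)] u(2) by auto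
  qed
  obtain D1 where D1: "\<forall>d\<ge>D1. le Z (int d) \<subseteq> ssum U (le Z (int d - 1)) (rg Z d)" using stabilize[OF Z] by auto
  obtain D2 where D2: "\<forall>d\<ge>D2. le ?Y (int d) \<subseteq> ssum U (le ?Y (int d - 1)) (rg ?Y d)" using stabilize[OF Y] by auto
  define D where "D = max (max D1 D2) d0"
  have DD: "\<forall>d\<ge>D. le Z (int d) \<subseteq> ssum U (le Z (int d - 1)) (rg Z d)"
    "\<forall>d\<ge>D. le ?Y (int d) \<subseteq> ssum U (le ?Y (int d - 1)) (rg ?Y d)" "d0 \<le> D"
    using D1 D2 unfolding D_def by auto
  \<comment> \<open>The vectors \<open>r (q u)\<close> with \<open>r\<close> of degree at most
    \<open>D + j - d0\<close> are sections of the larger space, independent modulo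
    \<open>Z\<close>.\<close>
  have grow: "nu Z (D + j) + (2 * (D + j - d0) + 1) \<le> nu ?Y (D + j)" for j
  proof -
    let ?d = "D + j"
    have d: "(?d - d0) + d0 = ?d" using DD by simp
    have im: "r \<odot>\<^sub>U ?u \<in> rg ?Y ?d" if "r \<in> Rd (?d - d0)" for r
    proof -
      have "r \<odot>\<^sub>U ?u \<in> UE (Rd ?d)"
        using UE_smult[OF q(3) Rd_carrier[OF that], of "Rd ?d"] Rd_mult[OF that] d by metis
      then show ?thesis using UL.subspD(5)[OF Y Rd_carrier[OF that]] uY unfolding rg_def by auto
    qed
    have "qdim Kk U (rg Z ?d) (ssum U (rg Z ?d) ((\<lambda>r. r \<odot>\<^sub>U ?u) ` Rd (?d - d0))) (2 * (?d - d0) + 1)"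
    proof (rule qdim_map[OF Lk.vecsp_axioms Uk.vecsp_axioms Rd_dim])
      fix r assume r: "r \<in> Rd (?d - d0)"
      show "r \<odot>\<^sub>U ?u \<in> carrier U" using Rd_carrier[OF r] uc by (rule U.smult_closed)
      have "\<zero>\<^sub>U \<in> rg Z ?d" using Uk.subspD(2)[OF rg_subsp[OF Z]] .
      then show "(r \<odot>\<^sub>U ?u \<in> rg Z ?d) = (r \<in> {\<zero>})"
        using uZ[OF Rd_carrier[OF r]] rg_sub[of Z ?d] uc by auto
      fix s assume s: "s \<in> Rd (?d - d0)"
      show "(r \<oplus>\<^bsub>reg_mod L\<^esub> s) \<odot>\<^sub>U ?u = r \<odot>\<^sub>U ?u \<oplus>\<^sub>U s \<odot>\<^sub>U ?u"
        using U.smult_l_distr[OF Rd_carrier[OF r] Rd_carrier[OF s] uc] by simp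
    next
      fix a s assume s: "a \<in> carrier Kk" "s \<in> Rd (?d - d0)"
      show "(a \<odot>\<^bsub>reg_mod L\<^esub> s) \<odot>\<^sub>U ?u = a \<odot>\<^sub>U (s \<odot>\<^sub>U ?u)"
        using U.smult_assoc1[OF _ Rd_carrier[OF s(2)] uc, of a] s k_sub by auto
    qed (rule rg_subsp[OF Z])
    from Uk.qdim_trans[OF this nu[OF Z]]
    have *: "qdim Kk U {\<zero>\<^sub>U} (ssum U (rg Z ?d) ((\<lambda>r. r \<odot>\<^sub>U ?u) ` Rd (?d - d0))) (nu Z ?d + (2 * (?d - d0) + 1))" .
    have "ssum U (rg Z ?d) ((\<lambda>r. r \<odot>\<^sub>U ?u) ` Rd (?d - d0)) \<subseteq> rg ?Y ?d"
      by (rule Uk.ssum_least[OF rg_subsp[OF Y]]) (use im rg_mono_set[OF ZY(1)] in auto)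
    from Uk.qdim_diff(1)[OF nu[OF Y] * this] show ?thesis .
  qed
  show ?thesis
  proof (rule ccontr)
    assume "\<not> ?thesis"
    then have r: "rho ?Y \<le> rho Z + 1" by simp
    \<comment> \<open>With a slope of at most \<open>rho Z + 1\<close> the inequality
      \<open>grow\<close> would leave a surplus of at least \<open>j\<close> on its left, which
      exceeds the constant \<open>nu ?Y D\<close> for this \<open>j\<close>.\<close>
    define j where "j = nu ?Y D + 1"
    have "nu Z D + rho Z * j + 2 * (D + j - d0) + 1 \<le> nu ?Y D + rho ?Y * j"
      using grow[of j] nu_grow[OF Z DD(1), of j] nu_grow[OF Y DD(2), of j] by simp
    moreover have "rho ?Y * j \<le> rho Z * j + j" using mult_right_mono[OF r, of j] by (simp add: algebra_simps)
    moreover have "2 * (D + j - d0) \<ge> 2 * j" using DD(3) by simp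
    ultimately show False using j_def by linarith
  qed
qed

lemma rho_adj_chain: "qdim L U Z Y m \<Longrightarrow> rho Z + 2 * m \<le> rho Y"
proof (induction rule: qdim.induct)
  case (qdim_step Z Y m v)
  then show ?case using rho_adj[of Y v] UL.qdim_subsp[OF qdim_step(1)] by simp
qed simp

end

text \<open>The operators stand for the action of \<open>A\<close>. No symmetry of
  \<open>\<beta>\<close> is assumed, because \<open>\<tau>\<close> is not known to be invariant
  under \<open>\<sigma>\<close>; left and right orthogonals are only required to agree for stable
  subspaces, where they are the orthogonals of the hermitian form itself.\<close>

locale filt_herm = filt_form L k Rd Lm x c U n e es \<beta>
  for L :: "('l, 'q) ring_scheme" (structure) and k Rd Lm x c and U :: "('l, 'u) module"
    and n :: nat and e es :: "nat \<Rightarrow> 'u" and \<beta> :: "'u \<Rightarrow> 'u \<Rightarrow> 'l" +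
  fixes \<T> :: "('u \<Rightarrow> 'u) set"
  assumes T_add: "T \<in> \<T> \<Longrightarrow> u \<in> carrier U \<Longrightarrow> v \<in> carrier U \<Longrightarrow> T (u \<oplus>\<^sub>U v) = T u \<oplus>\<^sub>U T v"
    and T_smult: "T \<in> \<T> \<Longrightarrow> a \<in> carrier L \<Longrightarrow> u \<in> carrier U \<Longrightarrow> T (a \<odot>\<^sub>U u) = a \<odot>\<^sub>U T u"
    and T_UE: "T \<in> \<T> \<Longrightarrow> subsp (L\<lparr>carrier := k\<rparr>) (reg_mod L) E \<Longrightarrow> u \<in> UE E \<Longrightarrow> T u \<in> UE E"
    and T_perp: "subsp L U Z \<Longrightarrow> (\<And>T u. T \<in> \<T> \<Longrightarrow> u \<in> Z \<Longrightarrow> T u \<in> Z) \<Longrightarrow> T \<in> \<T> \<Longrightarrow> u \<in> carrier U \<Longrightarrow>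
        (\<And>v. v \<in> Z \<Longrightarrow> \<beta> v u = \<zero>) \<Longrightarrow> w \<in> Z \<Longrightarrow> \<beta> w (T u) = \<zero>"
    and perp_flip: "subsp L U Z \<Longrightarrow> (\<And>T u. T \<in> \<T> \<Longrightarrow> u \<in> Z \<Longrightarrow> T u \<in> Z) \<Longrightarrow> u \<in> carrier U \<Longrightarrow>
        (\<forall>v\<in>Z. \<beta> v u = \<zero>) \<longleftrightarrow> (\<forall>v\<in>Z. \<beta> u v = \<zero>)"
begin

lemma T_car: "T \<in> \<T> \<Longrightarrow> u \<in> carrier U \<Longrightarrow> T u \<in> carrier U"
  using T_UE[of T "carrier L" u] Lk.subsp_carrier bD(1) es_car unfolding UE_def by auto

definition stable :: "'u set \<Rightarrow> bool" where
  "stable Z \<longleftrightarrow> subsp L U Z \<and> (\<forall>T\<in>\<T>. \<forall>u\<in>Z. T u \<in> Z)"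

definition orth :: "'u set \<Rightarrow> 'u set" where
  "orth Z = {u \<in> carrier U. \<forall>v\<in>Z. \<beta> v u = \<zero>}"

lemma orth_subsp: "Z \<subseteq> carrier U \<Longrightarrow> subsp L U (orth Z)"
  unfolding orth_def subsp_def using b_zero bD by (auto simp: subset_iff)

lemma stable_subsp: "stable Z \<Longrightarrow> subsp L U Z" unfolding stable_def by auto

lemma stable_sub: "stable Z \<Longrightarrow> Z \<subseteq> carrier U" using stable_subsp UL.subspD(1) by auto

lemma stable_orth: "stable Z \<Longrightarrow> stable (orth Z)"
  unfolding stable_def
proof (intro conjI ballI)
  assume Z: "subsp L U Z \<and> (\<forall>T\<in>\<T>. \<forall>u\<in>Z. T u \<in> Z)"
  then show "subsp L U (orth Z)" using orth_subsp UL.subspD(1) by auto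
  fix T u assume T: "T \<in> \<T>" "u \<in> orth Z"
  then show "T u \<in> orth Z" using T_perp[of Z T u] Z T_car[of T u] unfolding orth_def by blast
qed

lemma orth_flip: "stable Z \<Longrightarrow> u \<in> carrier U \<Longrightarrow> u \<in> orth Z \<longleftrightarrow> (\<forall>v\<in>Z. \<beta> u v = \<zero>)"
  unfolding stable_def orth_def using perp_flip[of Z u] by auto

lemma stable_inter: "stable Z \<Longrightarrow> stable Y \<Longrightarrow> stable (Z \<inter> Y)"
  unfolding stable_def using UL.subsp_inter by auto

definition Lspan :: "'u set \<Rightarrow> 'u set" where
  "Lspan S = {u \<in> carrier U. \<forall>Z. subsp L U Z \<longrightarrow> S \<subseteq> Z \<longrightarrow> u \<in> Z}"

lemma Lspan_subsp: "subsp L U (Lspan S)"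
  unfolding subsp_def
proof (intro conjI ballI)
  show "\<zero>\<^sub>U \<in> Lspan S" using UL.subspD(2) unfolding Lspan_def by auto
  fix u v assume "u \<in> Lspan S" "v \<in> Lspan S"
  then show "u \<oplus>\<^sub>U v \<in> Lspan S" using UL.subspD(4) unfolding Lspan_def by auto
next
  fix a u assume "a \<in> carrier L" "u \<in> Lspan S"
  then show "a \<odot>\<^sub>U u \<in> Lspan S" using UL.subspD(5) unfolding Lspan_def by auto
qed (auto simp: Lspan_def)

lemma Lspan_ge: "S \<subseteq> carrier U \<Longrightarrow> S \<subseteq> Lspan S" unfolding Lspan_def by auto

lemma Lspan_least: "subsp L U Z \<Longrightarrow> S \<subseteq> Z \<Longrightarrow> Lspan S \<subseteq> Z" unfolding Lspan_def by auto

lemma Lspan_stable: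
  assumes S: "S \<subseteq> carrier U" "\<And>T u. T \<in> \<T> \<Longrightarrow> u \<in> S \<Longrightarrow> T u \<in> S" shows "stable (Lspan S)"
  unfolding stable_def
proof (intro conjI ballI)
  fix T u assume T: "T \<in> \<T>" and u: "u \<in> Lspan S"
  \<comment> \<open>The vectors of the span that \<open>T\<close> sends back into it form a subspace
    containing \<open>S\<close>, hence the whole span.\<close>
  let ?Z = "{u \<in> Lspan S. T u \<in> Lspan S}"
  note Ls = Lspan_subsp[of S]
  have T0: "T \<zero>\<^sub>U = \<zero>\<^sub>U" using T_smult[OF T, of \<zero> "\<zero>\<^sub>U"] T_car[OF T, of "\<zero>\<^sub>U"] by simp
  have "subsp L U ?Z" unfolding subsp_def
  proof (intro conjI ballI)
    show "?Z \<subseteq> carrier U" using UL.subspD(1)[OF Ls] by auto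
    show "\<zero>\<^sub>U \<in> ?Z" using T0 UL.subspD(2)[OF Ls] by simp
    fix u v assume "u \<in> ?Z" "v \<in> ?Z"
    then show "u \<oplus>\<^sub>U v \<in> ?Z" using UL.subspD(3,4)[OF Ls] T_add[OF T, of u v] by auto
  next
    fix a u assume "a \<in> carrier L" "u \<in> ?Z"
    then show "a \<odot>\<^sub>U u \<in> ?Z" using UL.subspD(3,5)[OF Ls] T_smult[OF T, of a u] by auto
  qed
  moreover have "S \<subseteq> ?Z" using Lspan_ge[OF S(1)] S(2)[OF T] by auto
  ultimately show "T u \<in> Lspan S" using Lspan_least u by blast
qed (rule Lspan_subsp)

end

section \<open>Residue duality, the Riemann-Roch inequality and descent\<close>

locale max_isotropic = filt_herm L k Rd Lm x c U n e es \<beta> \<T>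
  for L :: "('l, 'q) ring_scheme" (structure) and k Rd Lm x c and U :: "('l, 'u) module"
    and n :: nat and e es :: "nat \<Rightarrow> 'u" and \<beta> :: "'u \<Rightarrow> 'u \<Rightarrow> 'l" and \<T> +
  fixes N :: "'u set"
  assumes N: "stable N" and N_iso: "N \<subseteq> orth N"
    and N_max: "stable Z \<Longrightarrow> N \<subseteq> Z \<Longrightarrow> Z \<subseteq> orth Z \<Longrightarrow> Z = N"
begin

abbreviation "Np \<equiv> orth N"

lemma Np: "stable Np" using stable_orth[OF N] .
lemmas Ns = stable_subsp[OF N] and Nps = stable_subsp[OF Np]

lemma N_Np_b: "u \<in> N \<Longrightarrow> v \<in> Np \<Longrightarrow> \<beta> u v = \<zero>" "u \<in> N \<Longrightarrow> v \<in> Np \<Longrightarrow> \<beta> v u = \<zero>"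
proof -
  assume "u \<in> N" and v: "v \<in> Np"
  then show "\<beta> u v = \<zero>" "\<beta> v u = \<zero>" using orth_flip[OF N, of v] unfolding orth_def by auto
qed

text \<open>The Serre duality pairing: the residue at infinity of the value of the form.\<close>

definition pair :: "'u \<Rightarrow> 'u \<Rightarrow> 'l" where "pair u v = c (\<beta> u v)"

lemma b_Lm: "u \<in> UE (Lm d) \<Longrightarrow> v \<in> UE (Lm d') \<Longrightarrow> \<beta> u v \<in> Lm (d + d')"
  by (rule b_UE[OF _ _ Lm_subsp Lm_subsp Lm_subsp]) (auto intro: Lm_mult)

lemma b_Rd: "u \<in> UE (Rd d) \<Longrightarrow> v \<in> UE (Rd d') \<Longrightarrow> \<beta> u v \<in> Rd (d + d')"
  by (rule b_UE[OF _ _ Rd_subsp Rd_subsp Rd_subsp]) (auto intro: Rd_mult)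

lemma pair_bilin: "bilin Kk U (UE (Lm d)) (UE (Lm d')) pair"
proof -
  have car: "u \<in> UE E \<Longrightarrow> u \<in> carrier U" for u E by (rule UE_carrier)
  show ?thesis unfolding bilin_def pair_def
  proof (intro conjI ballI)
    fix u v assume u: "u \<in> UE (Lm d)" and v: "v \<in> UE (Lm d')"
    show "c (\<beta> u v) \<in> carrier Kk" using c_k[OF b_Lm[OF u v]] by simp
    fix u' assume u': "u' \<in> UE (Lm d)"
    show "c (\<beta> (u \<oplus>\<^sub>U u') v) = c (\<beta> u v) \<oplus>\<^sub>Kk c (\<beta> u' v)"
      using c_add[OF b_Lm[OF u v] b_Lm[OF u' v]] bD(2) u u' v car by simp
  next
    fix u v v' assume u: "u \<in> UE (Lm d)" and v: "v \<in> UE (Lm d')" and v': "v' \<in> UE (Lm d')"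
    show "c (\<beta> u (v \<oplus>\<^sub>U v')) = c (\<beta> u v) \<oplus>\<^sub>Kk c (\<beta> u v')"
      using c_add[OF b_Lm[OF u v] b_Lm[OF u v']] bD(3) u v' v car by simp
  next
    fix a u v assume a: "a \<in> carrier Kk" and u: "u \<in> UE (Lm d)" and v: "v \<in> UE (Lm d')"
    have ac: "a \<in> k" "a \<in> carrier L" using a k_sub by auto
    show "c (\<beta> (a \<odot>\<^sub>U u) v) = a \<otimes>\<^sub>Kk c (\<beta> u v)" "c (\<beta> u (a \<odot>\<^sub>U v)) = a \<otimes>\<^sub>Kk c (\<beta> u v)"
      using c_smult[OF ac(1) b_Lm[OF u v]] bD(4,5)[OF ac(2)] u v car by simp_all
  qed
qed

lemma le_UE: "le Z d \<subseteq> UE (Lm d)" unfolding le_def by auto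
lemma rg_UE: "rg Z d \<subseteq> UE (Rd d)" unfolding rg_def by auto
lemma UE_Rd_Lm: "UE (Rd d) \<subseteq> UE (Lm (int d))" using UE_mono[OF Rd_Lm] .

text \<open>Testing against the multiples \<open>w (es i)\<close> isolates the residues of the
  single coordinates.\<close>

lemma pair_nondeg:
  assumes t: "t \<in> UE (Lm 1)" "\<And>s. s \<in> UE (Lm 0) \<Longrightarrow> pair t s = \<zero>" shows "t \<in> UE (Lm 0)"
  unfolding UE_def
proof (intro CollectI conjI allI impI)
  show tc: "t \<in> carrier U" using t UE_carrier by auto
  fix i assume i: "i < n"
  show "\<beta> t (es i) \<in> Lm 0"
  proof (rule c_nondeg)
    show "\<beta> t (es i) \<in> Lm 1" using t i unfolding UE_def by auto
    fix w assume w: "w \<in> Lm 0"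
    have "w \<odot>\<^sub>U es i \<in> UE (Lm 0)" using UE_smult_k[OF w Lm_subsp es_UE[OF i]] .
    from t(2)[OF this] show "c (w \<otimes> \<beta> t (es i)) = \<zero>"
      using bD(5)[OF Lm_carrier[OF w] tc es_car[OF i]] unfolding pair_def by simp
  qed
qed

text \<open>The pairing is nondegenerate between orders 1 modulo 0 and orders 0 modulo -1, both of
  dimension \<open>2 n\<close>, and the leading forms of \<open>N\<close> and \<open>Np\<close>
  annihilate each other. This expresses \<open>dim N + dim Np \<le> n\<close> in terms of fibres at
  infinity.\<close>

lemma rho_N_Np: "rho N + rho Np \<le> 2 * n"
proof -
  have S: "subsp Kk U (UE (Lm 0))" using UE_subsp[OF Lm_subsp] .
  have T: "subsp Kk U (le N 1)" using le_subsp[OF Ns] .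
  have qN: "qdim Kk U (le N 0) (le N 1) (rho N)" using rho[OF Ns, of 1] by simp
  have B: "bilin Kk U (le N 1) (UE (Lm 0)) pair" using bilin_mono[OF pair_bilin le_UE order_refl] .
  have z0: "pair t s = \<zero>" if "t \<in> UE (Lm 0)" "s \<in> UE (Lm 0)" for t s
    using b_Lm[OF that] c_Lm0 unfolding pair_def by simp
  define S0 where "S0 = {s \<in> UE (Lm 0). \<forall>t\<in>le N 1. pair t s = \<zero>}"
  have "\<exists>j\<le>rho N. qdim Kk U S0 (UE (Lm 0)) j" unfolding S0_def
    using Uk.qdim_annih[OF qN S B] z0 le_UE[of N 0] by auto
  then obtain j where j: "j \<le> rho N" "qdim Kk U S0 (UE (Lm 0)) j" by blast
  \<comment> \<open>Annihilating back returns exactly \<open>le N 0\<close>, which turns the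
    inequality \<open>j \<le> rho N\<close> into an equality.\<close>
  have "{t \<in> le N 1. \<forall>s\<in>UE (Lm 0). pair t s = \<zero>} = le N 0"
  proof
    show "{t \<in> le N 1. \<forall>s\<in>UE (Lm 0). pair t s = \<zero>} \<subseteq> le N 0"
      using pair_nondeg le_UE[of N 1] unfolding le_def by auto
    show "le N 0 \<subseteq> {t \<in> le N 1. \<forall>s\<in>UE (Lm 0). pair t s = \<zero>}"
      using le_mono[of 0 1 N] z0 le_UE[of N 0] by auto
  qed
  moreover have z1: "\<And>s t. s \<in> S0 \<Longrightarrow> t \<in> le N 1 \<Longrightarrow> pair t s = \<zero>\<^sub>Kk" unfolding S0_def by auto
  have "\<exists>i\<le>j. qdim Kk U {t \<in> le N 1. \<forall>s\<in>UE (Lm 0). pair t s = \<zero>} (le N 1) i"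
    using Uk.qdim_annih[OF j(2) T bilin_flip[OF B] z1] by simp
  ultimately have "rho N \<le> j" using Uk.qdim_unique[OF qN] by metis
  then have jr: "j = rho N" using j by simp
  have q2: "qdim Kk U (UE (Lm (-1))) (UE (Lm 0)) (n * 2)" using UE_dim[OF Lm_dim[of 0]] by simp
  have "UE (Lm (-1)) \<subseteq> S0"
  proof
    fix s assume s: "s \<in> UE (Lm (-1))"
    then have "s \<in> UE (Lm 0)" using UE_mono[OF Lm_mono[of "-1" 0]] by auto
    moreover have "pair t s = \<zero>" if "t \<in> le N 1" for t
      using b_Lm[of t 1 s "-1"] s that le_UE[of N 1] c_Lm0 unfolding pair_def by auto
    ultimately show "s \<in> S0" unfolding S0_def by auto
  qed
  from Uk.qdim_diff'[OF q2 j(2) this] have q3: "j \<le> n * 2" "qdim Kk U (UE (Lm (-1))) S0 (n * 2 - j)" .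
  \<comment> \<open>The leading forms of \<open>Np\<close> sit inside the annihilator
    \<open>S0\<close>, whose dimension over order -1 is \<open>2 n - rho N\<close>.\<close>
  have "le Np 0 \<subseteq> S0"
    using N_Np_b(1) le_sub[of N 1] le_sub[of Np 0] c_Lm0[OF Lk.subspD(2)[OF Lm_subsp, simplified]] le_UE[of Np 0]
    unfolding S0_def pair_def by (auto simp: subset_iff)
  then have "S0 \<inter> le Np 0 = le Np 0" by auto
  moreover have "UE (Lm (-1)) \<inter> le Np 0 = le Np (-1)"
    using UE_mono[OF Lm_mono[of "-1" 0]] unfolding le_def by auto
  moreover from Uk.qdim_inter[OF q3(2) le_subsp[OF Nps, of 0]]
  obtain m where "m \<le> n * 2 - j" "qdim Kk U (UE (Lm (-1)) \<inter> le Np 0) (S0 \<inter> le Np 0) m" by (elim exE conjE)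
  ultimately have "rho Np \<le> n * 2 - j" using rho_eq[OF Nps, of 0 m] by simp
  then show ?thesis using q3(1) jr by simp
qed

text \<open>A Riemann-Roch inequality: the conditions defining \<open>rg Np d\<close> inside the space of all vectors
  with coordinates in \<open>Rd d\<close> form the dual of \<open>le N (d + 1)\<close> modulo \<open>le N (- d) + x rg N d\<close>.\<close>

lemma riemann_roch:
  assumes D: "\<forall>d\<ge>D. le N (int d) \<subseteq> ssum U (le N (int d - 1)) (rg N d)" and d: "d \<ge> D"
  shows "n * (2 * d + 1) + nu N d \<le> nu Np d + rho N * (2 * d + 1)"
proof -
  let ?xN = "(\<lambda>u. x \<odot>\<^sub>U u) ` rg N d"
  let ?T = "le N (int d + 1)" and ?T' = "ssum U (le N (- int d)) ?xN"
  have Nc: "u \<in> carrier U" if "u \<in> N" for u using that UL.subspD(3)[OF Ns] by auto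
  \<comment> \<open>The two summands of \<open>?T'\<close> meet only in 0. The coordinates of such a
    \<open>u\<close> are regular, and after multiplication by \<open>x\<close> they have order at
    most \<open>-d\<close>, which is at most 0.\<close>
  have xs: "x \<odot>\<^sub>U u \<in> le N (- int d) \<longleftrightarrow> u = \<zero>\<^sub>U" if u: "u \<in> rg N d" for u
  proof
    assume a: "x \<odot>\<^sub>U u \<in> le N (- int d)"
    have uc: "u \<in> carrier U" using u rg_sub Nc by blast
    have "\<beta> u (es i) = \<zero>" if i: "i < n" for i
    proof (rule x_RR_Lm0)
      show "\<beta> u (es i) \<in> RR" using rg_UE[THEN subsetD, OF u] i unfolding UE_def RR_def by auto
      show "x \<otimes> \<beta> u (es i) \<in> Lm (- int d)" 
        using a i bD(4)[OF x_carrier uc es_car[OF i]] unfolding le_def UE_def by auto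
    qed simp
    then have "u \<in> UE {\<zero>}" using uc unfolding UE_def by auto
    then show "u = \<zero>\<^sub>U" using UE_zero by simp
  qed (use x_carrier Uk.subspD(2)[OF le_subsp[OF Ns]] in simp)
  have "qdim Kk U (le N (- int d)) ?T' (nu N d)"
  proof (rule qdim_map[OF Uk.vecsp_axioms Uk.vecsp_axioms nu[OF Ns]])
    fix u assume u: "u \<in> rg N d"
    have uc: "u \<in> carrier U" using u rg_sub Nc by blast
    show "x \<odot>\<^sub>U u \<in> carrier U" using uc x_carrier by simp
    show "(x \<odot>\<^sub>U u \<in> le N (- int d)) = (u \<in> {\<zero>\<^sub>U})" using xs[OF u] by simp
    fix v assume v: "v \<in> rg N d"
    have vc: "v \<in> carrier U" using v rg_sub Nc by blast
    show "x \<odot>\<^sub>U (u \<oplus>\<^sub>U v) = x \<odot>\<^sub>U u \<oplus>\<^sub>U x \<odot>\<^sub>U v" using uc vc x_carrier by (simp add: U.smult_r_distr)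
  next
    fix a u assume a: "a \<in> carrier Kk" and u: "u \<in> rg N d"
    have uc: "u \<in> carrier U" using u rg_sub Nc by blast
    show "x \<odot>\<^sub>U (a \<odot>\<^sub>U u) = a \<odot>\<^sub>U (x \<odot>\<^sub>U u)"
      using uc a k_sub x_carrier by (simp add: U.smult_assoc1[symmetric] m_comm subset_iff)
  qed (rule le_subsp[OF Ns])
  \<comment> \<open>From order \<open>-d\<close> to order \<open>d + 1\<close> there are
    \<open>2 d + 1\<close> graded pieces, each of dimension \<open>rho N\<close>.\<close>
  moreover have "qdim Kk U (le N (- int d)) ?T (rho N * (2 * d + 1))"
    using rho_chain[OF Ns, of "- int d" "2 * d + 1"] by (simp add: algebra_simps)
  moreover have "?xN \<subseteq> ?T" using le_x[OF Ns] rg_le[of N d] by auto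
  then have "?T' \<subseteq> ?T" using Uk.ssum_least[OF le_subsp[OF Ns]] le_mono[of "- int d" "int d + 1" N] by auto
  ultimately have q: "nu N d \<le> rho N * (2 * d + 1)" "qdim Kk U ?T' ?T (rho N * (2 * d + 1) - nu N d)"
    using Uk.qdim_diff by blast+
  have S: "subsp Kk U (UE (Rd d))" using UE_subsp[OF Rd_subsp] .
  have B: "bilin Kk U ?T (UE (Rd d)) pair" using bilin_mono[OF pair_bilin le_UE UE_Rd_Lm] .
  \<comment> \<open>\<open>?T'\<close> imposes no condition: its first summand pairs into order
    \<open>-d + d = 0\<close>, its second one into \<open>x\<close> times a regular function, and
    \<open>c\<close> vanishes on both.\<close>
  have z: "pair t s = \<zero>" if t: "t \<in> ?T'" and s: "s \<in> UE (Rd d)" for t s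
  proof -
    obtain a b where ab: "t = a \<oplus>\<^sub>U x \<odot>\<^sub>U b" "a \<in> le N (- int d)" "b \<in> rg N d" using t unfolding ssum_def by auto
    have bc: "b \<in> carrier U" "a \<in> carrier U" "s \<in> carrier U" using ab Nc rg_sub le_sub s UE_carrier by blast+
    have 1: "\<beta> a s \<in> Lm 0" using b_Lm[OF le_UE[THEN subsetD, OF ab(2)] UE_Rd_Lm[THEN subsetD, OF s]] by simp
    have 2: "\<beta> b s \<in> Rd (d + d)" using b_Rd ab(3) s rg_UE by blast
    have 3: "x \<otimes> \<beta> b s \<in> Rd (Suc (d + d))" using x_mult_Rd[OF 2] .
    have "\<beta> t s = \<beta> a s \<oplus> x \<otimes> \<beta> b s" using ab bc x_carrier bD by simp
    moreover have "\<beta> a s \<in> Lm (int (Suc (d + d)))" using 1 Lm_mono[of 0 "int (Suc (d+d))"] by auto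
    moreover have "x \<otimes> \<beta> b s \<in> Lm (int (Suc (d + d)))" using 3 Rd_Lm by blast
    ultimately have "c (\<beta> t s) = c (\<beta> a s) \<oplus> c (x \<otimes> \<beta> b s)" using c_add by simp
    then show ?thesis using c_Lm0[OF 1] c_xR[OF 2] unfolding pair_def by simp
  qed
  obtain j where j: "j \<le> rho N * (2 * d + 1) - nu N d"
    "qdim Kk U {s \<in> UE (Rd d). \<forall>t\<in>?T. pair t s = \<zero>} (UE (Rd d)) j"
    using Uk.qdim_annih[OF q(2) S B] z by auto
  \<comment> \<open>This is where \<open>D\<close> enters. A vector of order above
    \<open>d + 1\<close> is \<open>x\<close> times the sum of a regular vector and one of lower
    order, so beyond \<open>?T\<close> only multiples of \<open>x\<close> by regular vectors occur,
    and these have residue 0. Thus testing on \<open>?T\<close> amounts to testing on every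
    \<open>le N e'\<close>.\<close>
  have gen: "le N e' \<subseteq> ssum U ?T ((\<lambda>u. x \<odot>\<^sub>U u) ` (N \<inter> UE RR))" if "int d + 1 \<le> e'" for e'
    using that
  proof (induction e' rule: int_ge_induct)
    case base
    have "\<zero>\<^sub>U \<in> N \<inter> UE RR" using UL.subspD(2)[OF Ns] Uk.subspD(2)[OF UE_subsp[OF RR_subsp]] by auto
    then have "\<zero>\<^sub>U \<in> (\<lambda>u. x \<odot>\<^sub>U u) ` (N \<inter> UE RR)" using x_carrier by (auto intro!: image_eqI[of _ _ "\<zero>\<^sub>U"])
    moreover have "v \<oplus>\<^sub>U \<zero>\<^sub>U = v" if "v \<in> ?T" for v using that Nc le_sub by (metis U.M.r_zero subsetD)
    ultimately show ?case unfolding ssum_def by (intro subsetI CollectI) metis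
  next
    case (step i)
    show ?case
    proof
      fix v assume v: "v \<in> le N (i + 1)"
      have vc: "v \<in> carrier U" using v le_sub Nc by blast
      define d' where "d' = nat i"
      have d': "i = int d'" "d' \<ge> D" using step d by (auto simp: d'_def)
      have "inv x \<odot>\<^sub>U v \<in> le N (int d')" using le_xinv[OF Ns v] d' by simp
      then obtain a r where ar: "inv x \<odot>\<^sub>U v = a \<oplus>\<^sub>U r" "a \<in> le N (int d' - 1)" "r \<in> rg N d'"
        using D d' unfolding ssum_def by blast
      have c': "a \<in> carrier U" "r \<in> carrier U" using ar Nc le_sub rg_sub by blast+
      have "v = x \<odot>\<^sub>U (a \<oplus>\<^sub>U r)" using smult_inv(2)[OF x_carrier x_nz vc] ar by simp
      then have v2: "v = x \<odot>\<^sub>U a \<oplus>\<^sub>U x \<odot>\<^sub>U r" using c' x_carrier by (simp add: U.smult_r_distr)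
      have "x \<odot>\<^sub>U a \<in> le N i" using le_x[OF Ns ar(2)] d' by simp
      then obtain t w where tw: "x \<odot>\<^sub>U a = t \<oplus>\<^sub>U x \<odot>\<^sub>U w" "t \<in> ?T" "w \<in> N \<inter> UE RR"
        using step unfolding ssum_def by blast
      have c2: "t \<in> carrier U" "w \<in> carrier U" using tw Nc le_sub by blast+
      have rR: "r \<in> N \<inter> UE RR" using ar(3) unfolding rg_def UE_def RR_def by auto
      have NR: "subsp Kk U (N \<inter> UE RR)" using Uk.subsp_inter[OF L_to_k[OF Ns] UE_subsp[OF RR_subsp]] .
      have "v = t \<oplus>\<^sub>U x \<odot>\<^sub>U (w \<oplus>\<^sub>U r)" using v2 tw(1) c' c2 x_carrier by (simp add: U.smult_r_distr U.M.a_assoc)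
      then show "v \<in> ssum U ?T ((\<lambda>u. x \<odot>\<^sub>U u) ` (N \<inter> UE RR))"
        using tw(2) Uk.subspD(4)[OF NR tw(3) rR] unfolding ssum_def by blast
    qed
  qed
  \<comment> \<open>The nontrivial inclusion turns vanishing residues into orthogonality. For
    \<open>v\<close> in \<open>N\<close> a multiple \<open>q v\<close> is regular and
    \<open>N\<close> is stable under multiplication by \<open>LL\<close>, so
    \<open>\<beta> (q v) s\<close> is a regular function all of whose residues vanish;
    \<open>c_RR_zero\<close> makes it 0.\<close>
  have "{s \<in> UE (Rd d). \<forall>t\<in>?T. pair t s = \<zero>} = rg Np d"
  proof
    show "rg Np d \<subseteq> {s \<in> UE (Rd d). \<forall>t\<in>?T. pair t s = \<zero>}"
      using N_Np_b(1) le_sub[of N] rg_sub[of Np d] c_Lm0[OF Lk.subspD(2)[OF Lm_subsp, simplified]] rg_UE[of Np d]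
      unfolding pair_def by (auto simp: subset_iff)
    show "{s \<in> UE (Rd d). \<forall>t\<in>?T. pair t s = \<zero>} \<subseteq> rg Np d"
    proof
      fix s assume s: "s \<in> {s \<in> UE (Rd d). \<forall>t\<in>?T. pair t s = \<zero>}"
      have sR: "s \<in> UE (Rd d)" and sc: "s \<in> carrier U" using s UE_carrier by auto
      have LL0: "pair v s = \<zero>" if v: "v \<in> le N e'" for v e'
      proof -
        have "v \<in> le N (max e' (int d + 1))" using v le_mono[of e' "max e' (int d + 1)" N] by auto
        then obtain t w where tw: "v = t \<oplus>\<^sub>U x \<odot>\<^sub>U w" "t \<in> ?T" "w \<in> N \<inter> UE RR"
          using gen[of "max e' (int d + 1)"] unfolding ssum_def by auto
        have c2: "t \<in> carrier U" "w \<in> carrier U" using tw Nc le_sub by blast+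
        have "\<beta> w s \<in> RR"
          by (rule b_UE[of _ RR _ "Rd d"]) (use tw sR RR_subsp Rd_subsp RR_mult in \<open>auto simp: RR_def\<close>)
        then obtain d'' where r: "\<beta> w s \<in> Rd d''" unfolding RR_def by auto
        have 1: "\<beta> t s \<in> Lm (int d + 1 + int d)" by (rule b_Lm[OF le_UE[THEN subsetD, OF tw(2)] UE_Rd_Lm[THEN subsetD, OF sR]])
        have 2: "x \<otimes> \<beta> w s \<in> Lm (int (Suc d''))" using x_mult_Rd[OF r] Rd_Lm by blast
        obtain f where f: "\<beta> t s \<in> Lm f" "x \<otimes> \<beta> w s \<in> Lm f" using LL_both[of "\<beta> t s" "x \<otimes> \<beta> w s"] 1 2 unfolding LL_def by blast
        have "\<beta> v s = \<beta> t s \<oplus> x \<otimes> \<beta> w s" using tw c2 sc x_carrier bD by simp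
        then have "c (\<beta> v s) = c (\<beta> t s) \<oplus> c (x \<otimes> \<beta> w s)" using c_add[OF f] by simp
        moreover have "c (\<beta> t s) = \<zero>" using s tw(2) unfolding pair_def by auto
        ultimately show ?thesis using c_xR[OF r] unfolding pair_def by simp
      qed
      have "\<beta> v s = \<zero>" if v: "v \<in> N" for v
      proof -
        have vc: "v \<in> carrier U" using v Nc by auto
        obtain q d' where q: "q \<in> RR" "q \<noteq> \<zero>" "q \<odot>\<^sub>U v \<in> UE (Rd d')" using common_denom[OF vc] by auto
        have qc: "q \<in> carrier L" using q RR_carrier by auto
        have qv: "q \<odot>\<^sub>U v \<in> N" using UL.subspD(5)[OF Ns qc v] .
        have "\<beta> (q \<odot>\<^sub>U v) s = \<zero>"
        proof (rule c_RR_zero)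
          show "\<beta> (q \<odot>\<^sub>U v) s \<in> RR" using b_Rd[OF q(3) sR] unfolding RR_def by auto
          fix w assume "w \<in> LL"
          then obtain f where w: "w \<in> Lm f" unfolding LL_def by auto
          have "w \<odot>\<^sub>U (q \<odot>\<^sub>U v) \<in> UE (Lm (f + int d'))"
            using UE_smult[OF q(3) Lm_carrier[OF w], of "Lm (f + int d')"] Lm_mult[OF w] Rd_Lm by blast
          then have "w \<odot>\<^sub>U (q \<odot>\<^sub>U v) \<in> le N (f + int d')"
            using UL.subspD(5)[OF Ns Lm_carrier[OF w] qv] unfolding le_def by auto
          from LL0[OF this] show "c (w \<otimes> \<beta> (q \<odot>\<^sub>U v) s) = \<zero>"
            using bD(4)[OF Lm_carrier[OF w] Nc[OF qv] sc] unfolding pair_def by simp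
        qed
        then show ?thesis using bD(4)[OF qc vc sc] bD(1)[OF vc sc] q(2) qc integral_iff by simp
      qed
      then show "s \<in> rg Np d" using sR sc unfolding rg_def orth_def by auto
    qed
  qed
  then have j2: "qdim Kk U (rg Np d) (UE (Rd d)) j" using j(2) by simp
  \<comment> \<open>The codimension \<open>j\<close> of \<open>rg Np d\<close> among all vectors
    with coordinates in \<open>Rd d\<close> is at most the number of conditions counted
    above.\<close>
  from Uk.qdim_unique[OF Uk.qdim_trans[OF j2 nu[OF Nps]] rg_carrier_dim[of d]]
  have "nu Np d + j = n * (2 * d + 1)" .
  then show ?thesis using j(1) q(1) by linarith
qed


text \<open>Raising the permitted order by one adds at most the graded piece of \<open>Np\<close>
  modulo that of \<open>N\<close>. In place of \<open>N\<close> only its vectors with coordinates in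
  \<open>LL\<close> are used, on which an order at infinity is defined.\<close>

lemma quotient_bound:
  "\<exists>j\<le>(rho Np - rho N) * d. qdim Kk U (ssum U (N \<inter> UE LL) (le Np 0)) (ssum U (N \<inter> UE LL) (le Np (int d))) j"
proof (induction d)
  have NL: "subsp Kk U (N \<inter> UE LL)" using Uk.subsp_inter[OF L_to_k[OF Ns] UE_subsp[OF LL_subsp]] .
  case 0
  then show ?case using qdim.qdim_refl[OF Uk.ssum_subsp[OF NL le_subsp[OF Nps]]] by auto
next
  case (Suc d)
  have NL: "subsp Kk U (N \<inter> UE LL)" using Uk.subsp_inter[OF L_to_k[OF Ns] UE_subsp[OF LL_subsp]] .
  let ?G = "\<lambda>e'. ssum U (N \<inter> UE LL) (le Np e')"
  obtain j where j: "j \<le> (rho Np - rho N) * d" "qdim Kk U (?G 0) (?G (int d)) j" using Suc by auto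
  let ?e = "int d + 1" 
  let ?T0 = "ssum U (le Np (int d)) (le N ?e)"
  have qN: "qdim Kk U (le N (int d)) (le N ?e) (rho N)" using rho[OF Ns, of ?e] by simp
  have qP: "qdim Kk U (le Np (int d)) (le Np ?e) (rho Np)" using rho[OF Nps, of ?e] by simp
  have "le Np (int d) \<inter> le N ?e = le N (int d)"
    using le_mono[of "int d" ?e N] N_iso unfolding le_def by auto
  from Uk.qdim_ssum[OF qN le_subsp[OF Nps] this] have q0: "qdim Kk U (le Np (int d)) ?T0 (rho N)" .
  have "?T0 \<subseteq> le Np ?e" using Uk.ssum_least[OF le_subsp[OF Nps]] le_mono[of "int d" ?e Np] le_mono_set[OF N_iso] by auto
  from Uk.qdim_diff(2)[OF qP q0 this] have q1: "qdim Kk U ?T0 (le Np ?e) (rho Np - rho N)" .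
  have G: "subsp Kk U (?G (int d))" using Uk.ssum_subsp[OF NL le_subsp[OF Nps]] .
  have NLc: "N \<inter> UE LL \<subseteq> carrier U" using Uk.subspD(1)[OF NL] .
  have leN: "le N ?e \<subseteq> N \<inter> UE LL" unfolding le_def UE_def LL_def by auto
  have "?T0 \<subseteq> ?G (int d)"
    using Uk.ssum_least[OF G, of "le Np (int d)" "le N ?e"] Uk.ssum_ge1[OF le_subsp[OF Nps] NLc] leN
      Uk.ssum_ge2[OF NL] Uk.subspD(1)[OF le_subsp[OF Nps]] by blast
  from Uk.qdim_ssum_le[OF q1 G this] obtain m where
    m: "m \<le> rho Np - rho N" "qdim Kk U (?G (int d)) (ssum U (?G (int d)) (le Np ?e)) m" by (elim exE conjE)
  have "ssum U (?G (int d)) (le Np ?e) = ?G ?e"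
  proof
    have G': "subsp Kk U (?G ?e)" using Uk.ssum_subsp[OF NL le_subsp[OF Nps]] .
    show "ssum U (?G (int d)) (le Np ?e) \<subseteq> ?G ?e"
    proof (rule Uk.ssum_least[OF G'])
      show "?G (int d) \<subseteq> ?G ?e" by (rule Uk.ssum_mono[OF order_refl le_mono]) simp
      show "le Np ?e \<subseteq> ?G ?e" by (rule Uk.ssum_ge2[OF NL Uk.subspD(1)[OF le_subsp[OF Nps]]])
    qed
    show "?G ?e \<subseteq> ssum U (?G (int d)) (le Np ?e)"
      by (rule Uk.ssum_mono[OF Uk.ssum_ge1[OF le_subsp[OF Nps] NLc] order_refl])
  qed
  then have "qdim Kk U (?G 0) (?G (int (Suc d))) (j + m)"
    using Uk.qdim_trans[OF m(2) j(2)] by (simp add: algebra_simps)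
  then show ?case using j(1) m(1) by (auto intro!: exI[of _ "j + m"])
qed

text \<open>Let \<open>r = n - rho N\<close>. Riemann-Roch gives at least \<open>r (2 d + 1)\<close>
  sections of \<open>Np\<close> modulo those of \<open>N\<close>, and regularity at infinity modulo
  \<open>N\<close> costs at most \<open>2 r d\<close> of them. The remaining \<open>r\<close> are as
  many as the dimension of \<open>Np / N\<close>.\<close>

theorem descent:
  "\<exists>Q m. subsp Kk U Q \<and> Q \<subseteq> Np \<and> (\<forall>T\<in>\<T>. \<forall>q\<in>Q. T q \<in> Q) \<and> qdim Kk U (Q \<inter> N) Q m \<and>
     (\<forall>q\<in>Q. \<forall>q'\<in>Q. \<beta> q q' \<in> k) \<and> (\<forall>q\<in>Q. (\<forall>q'\<in>Q. \<beta> q q' = \<zero>) \<longrightarrow> q \<in> N) \<and>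
     (\<forall>Z. subsp L U Z \<longrightarrow> N \<subseteq> Z \<longrightarrow> Q \<subseteq> Z \<longrightarrow> Np \<subseteq> Z)"
proof -
  obtain d where D: "\<forall>d'\<ge>d. le N (int d') \<subseteq> ssum U (le N (int d' - 1)) (rg N d')" using stabilize[OF Ns] by auto
  have NL: "subsp Kk U (N \<inter> UE LL)" using Uk.subsp_inter[OF L_to_k[OF Ns] UE_subsp[OF LL_subsp]] .
  let ?G = "\<lambda>e'. ssum U (N \<inter> UE LL) (le Np e')"
  \<comment> \<open>Sections of \<open>Np\<close> with poles of order at most \<open>d\<close> which
    become regular at infinity after subtracting an element of \<open>N\<close>. The subtracted
    element need not be a global section.\<close>
  define Q where "Q = ?G 0 \<inter> rg Np d"
  have G: "subsp Kk U (?G f)" for f using Uk.ssum_subsp[OF NL le_subsp[OF Nps]] .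
  have Q: "subsp Kk U Q" unfolding Q_def using Uk.subsp_inter[OF G rg_subsp[OF Nps]] .
  have QP: "Q \<subseteq> Np" unfolding Q_def using rg_sub by auto
  have Npc: "Np \<subseteq> carrier U" using stable_sub[OF Np] .
  have Nc: "N \<subseteq> carrier U" using stable_sub[OF N] .
  have QT: "T q \<in> Q" if T: "T \<in> \<T>" and q: "q \<in> Q" for T q
  proof -
    obtain a b where ab: "q = a \<oplus>\<^sub>U b" "a \<in> N \<inter> UE LL" "b \<in> le Np 0" "q \<in> rg Np d"
      using q unfolding Q_def ssum_def by auto
    have "a \<in> carrier U" "b \<in> carrier U" using ab Nc Npc le_sub by blast+
    then have "T q = T a \<oplus>\<^sub>U T b" using ab T_add[OF T] by simp
    moreover have "T a \<in> N \<inter> UE LL" using ab T_UE[OF T LL_subsp] N T unfolding stable_def by auto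
    moreover have "T b \<in> le Np 0" using ab T_UE[OF T Lm_subsp] Np T unfolding stable_def le_def by auto
    moreover have "T q \<in> rg Np d" using ab T_UE[OF T Rd_subsp] Np T unfolding stable_def rg_def by auto
    ultimately show ?thesis unfolding Q_def ssum_def by auto
  qed
  have lN: "rg N d \<subseteq> N \<inter> UE LL" unfolding rg_def UE_def LL_def using Rd_Lm by blast
  have rN: "rg N d \<subseteq> rg Np d" using rg_mono_set[OF N_iso] .
  have "rg N d \<subseteq> Q"
    using lN rN Uk.ssum_ge1[OF le_subsp[OF Nps] Uk.subspD(1)[OF NL], of 0] unfolding Q_def by blast
  \<comment> \<open>Within \<open>N\<close> the condition at infinity is empty, so \<open>Q\<close>
    meets \<open>N\<close> in all sections of order at most \<open>d\<close>.\<close>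
  moreover have QN: "Q \<inter> N \<subseteq> rg N d" unfolding Q_def rg_def by auto
  ultimately have QN: "Q \<inter> N = rg N d" using rg_sub[of N d] by auto
  obtain j where j: "j \<le> (rho Np - rho N) * d" "qdim Kk U (?G 0) (?G (int d)) j" using quotient_bound by blast
  have "rg Np d \<subseteq> ?G (int d)"
    using rg_le[of Np d] Uk.ssum_ge2[OF NL Uk.subspD(1)[OF le_subsp[OF Nps]]] by blast
  then have "?G (int d) \<inter> rg Np d = rg Np d" by auto
  with Uk.qdim_inter[OF j(2) rg_subsp[OF Nps, of d]]
  obtain j' where j': "j' \<le> j" "qdim Kk U Q (rg Np d) j'" unfolding Q_def by auto
  have a: "nu N d \<le> nu Np d" "qdim Kk U (rg N d) (rg Np d) (nu Np d - nu N d)"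
    using Uk.qdim_diff[OF nu[OF Nps] nu[OF Ns] rN] by auto
  define m where "m = nu Np d - nu N d - j'"
  have m: "j' \<le> nu Np d - nu N d" "qdim Kk U (Q \<inter> N) Q m"
    using Uk.qdim_diff'[OF a(2) j'(2)] \<open>rg N d \<subseteq> Q\<close> QN unfolding m_def by auto
  \<comment> \<open>As \<open>rho N\<close> is twice the dimension of \<open>N\<close>, the number
    \<open>r\<close> is the dimension of \<open>Np / N\<close>, and the claim is that
    \<open>Q\<close> has at least this dimension modulo \<open>N\<close>. The count is
    \<open>r (2 d + 1) - 2 r d = r\<close>.\<close>
  have m_ge: "n \<le> rho N + m"
  proof -
    have r: "rho N \<le> rho Np" using rho_mono[OF Ns Nps N_iso] .
    define r where "r = n - rho N"
    have nr: "n = rho N + r" using r rho_N_Np unfolding r_def by linarith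
    have "rho Np - rho N \<le> 2 * r" using rho_N_Np nr by linarith
    then have "(rho Np - rho N) * d \<le> (2 * r) * d" by (rule mult_le_mono1)
    then have jj: "j' \<le> 2 * (r * d)" using j(1) j'(1) by (simp only: mult.assoc)
    have "n * (2 * d + 1) + nu N d \<le> nu Np d + rho N * (2 * d + 1)" by (rule riemann_roch[OF D order_refl])
    moreover have "n * (2 * d + 1) = rho N * (2 * d + 1) + r * (2 * d + 1)" using arg_cong[where f = "\<lambda>t. t * (2 * d + 1)", OF nr] unfolding add_mult_distrib .
    moreover have "r * (2 * d + 1) = 2 * (r * d) + r" by simp
    ultimately have "2 * (r * d) + r + nu N d \<le> nu Np d" by linarith
    then show ?thesis using jj nr unfolding m_def by linarith
  qed
  \<comment> \<open>Elements of \<open>N\<close> do not change the product, so it may be computed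
    from parts of order 0 and has no pole at infinity. It is also regular elsewhere, hence a
    constant.\<close>
  have Qk: "\<beta> q q' \<in> k" if q: "q \<in> Q" "q' \<in> Q" for q q'
  proof -
    obtain a b where ab: "q = a \<oplus>\<^sub>U b" "a \<in> N" "b \<in> le Np 0" "q \<in> UE (Rd d)"
      using q unfolding Q_def rg_def ssum_def by auto
    obtain a' b' where ab': "q' = a' \<oplus>\<^sub>U b'" "a' \<in> N" "b' \<in> le Np 0" "q' \<in> UE (Rd d)"
      using q unfolding Q_def rg_def ssum_def by auto
    have bP: "b \<in> Np" "b' \<in> Np" "a' \<in> Np" using ab ab' le_sub N_iso by blast+
    have cc: "a \<in> carrier U" "b \<in> carrier U" "a' \<in> carrier U" "b' \<in> carrier U" using ab ab' Nc Npc bP by auto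
    have "\<beta> q q' = \<beta> b b'"
      using cc ab(1) ab'(1) N_Np_b[OF ab(2) bP(2)] N_Np_b[OF ab(2) bP(3)] N_Np_b[OF ab'(2) bP(1)] bD by simp
    then have "\<beta> q q' \<in> Lm 0" using b_Lm[of b 0 b' 0] ab ab' le_UE by auto
    then show ?thesis using Rd_inter[OF b_Rd[OF ab(4) ab'(4)], of 0] Rd_0 by simp
  qed
  \<comment> \<open>The span of \<open>N\<close> and \<open>Q\<close> meets its own orthogonal in an
    isotropic stable subspace containing \<open>N\<close>, which is \<open>N\<close> by maximality;
    a vector orthogonal to \<open>Q\<close> lies in this intersection.\<close>
  have Qn: "q \<in> N" if q: "q \<in> Q" "\<And>q'. q' \<in> Q \<Longrightarrow> \<beta> q q' = \<zero>" for q
  proof -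
    let ?S = "Lspan (N \<union> Q)"
    have S: "stable ?S" by (rule Lspan_stable) (use Nc Npc QP N QT in \<open>auto simp: stable_def\<close>)
    have SNQ: "N \<subseteq> ?S" "Q \<subseteq> ?S" using Lspan_ge[of "N \<union> Q"] Nc Npc QP by auto
    have SP: "?S \<subseteq> Np" using Lspan_least[OF Nps] N_iso QP by auto
    have "?S \<inter> orth ?S = N"
    proof (rule N_max[OF stable_inter[OF S stable_orth[OF S]]])
      show "N \<subseteq> ?S \<inter> orth ?S" using SNQ(1) N_Np_b(2) SP Nc unfolding orth_def by blast
      show "?S \<inter> orth ?S \<subseteq> orth (?S \<inter> orth ?S)" unfolding orth_def by blast
    qed
    moreover have qc: "q \<in> carrier U" using q QP Npc by auto
    have "\<forall>v\<in>?S. \<beta> q v = \<zero>"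
    proof -
      let ?Z = "{v \<in> carrier U. \<beta> q v = \<zero>}"
      have "subsp L U ?Z" unfolding subsp_def using b_zero bD qc by auto
      moreover have "N \<union> Q \<subseteq> ?Z" using q N_Np_b(2) QP Nc Npc by auto
      ultimately show ?thesis using Lspan_least by blast
    qed
    then have "q \<in> orth ?S" using orth_flip[OF S qc] by simp
    ultimately show ?thesis using q SNQ by auto
  qed
  have B: "bilin Kk U Q Q \<beta>"
    using Qk bD QP Npc k_sub unfolding bilin_def by (simp add: subset_iff)
  \<comment> \<open>Independence over the constants modulo \<open>N\<close> implies independence
    over \<open>L\<close>. Nondegeneracy yields for each new vector \<open>v\<close> a test vector
    of \<open>Q\<close> orthogonal to the earlier ones but not to \<open>v\<close>; being orthogonal
    to their \<open>L\<close>-span as well, it keeps \<open>v\<close> out of it. The last clause of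
    the statement carries this through the induction.\<close>
  have chain: "\<exists>Z. qdim L U N Z i \<and> Y \<subseteq> Z \<and> (\<forall>Z'. subsp L U Z' \<longrightarrow> N \<subseteq> Z' \<longrightarrow> Y \<subseteq> Z' \<longrightarrow> Z \<subseteq> Z') \<and>
      (\<forall>t\<in>Q. (\<forall>y\<in>Y. \<beta> y t = \<zero>) \<longrightarrow> (\<forall>z\<in>Z. \<beta> z t = \<zero>))"
    if "qdim Kk U (Q \<inter> N) Y i" "Y \<subseteq> Q" for Y i
    using that
  proof (induction "Q \<inter> N" Y i rule: qdim.induct)
    case qdim_refl
    show ?case
      by (rule exI[of _ N]) (use qdim.qdim_refl[OF Ns] N_Np_b(1) QP in blast)
  next
    case (qdim_step Y i v)
    have Y: "subsp Kk U Y" "Q \<inter> N \<subseteq> Y" using Uk.qdim_subsp[OF qdim_step(1)] by auto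
    have vc: "v \<in> carrier U" by fact
    have YY: "Y \<subseteq> adj Kk U Y v" "v \<in> adj Kk U Y v"
      using Uk.adj_ge[of Y v] Uk.adj_mem[OF Y(1)] Uk.subspD(1)[OF Y(1)] vc by auto
    have vQ: "v \<in> Q" "Y \<subseteq> Q" using YY qdim_step.prems by auto
    obtain Z where Z: "qdim L U N Z i" "Y \<subseteq> Z" "\<forall>Z'. subsp L U Z' \<longrightarrow> N \<subseteq> Z' \<longrightarrow> Y \<subseteq> Z' \<longrightarrow> Z \<subseteq> Z'"
      "\<forall>t\<in>Q. (\<forall>y\<in>Y. \<beta> y t = \<zero>) \<longrightarrow> (\<forall>z\<in>Z. \<beta> z t = \<zero>)" using qdim_step.hyps(2)[OF vQ(2)] by auto
    have Zs: "subsp L U Z" using UL.qdim_subsp[OF Z(1)] by auto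
    have "qdim Kk U (Q \<inter> N) (adj Kk U Y v) (Suc i)" using qdim.qdim_step[OF qdim_step.hyps(1) vc qdim_step.hyps(4)] .
    then have "\<exists>s\<in>Q. (\<forall>y\<in>Y. \<beta> y s = \<zero>\<^sub>Kk) \<and> (\<exists>y\<in>adj Kk U Y v. \<beta> y s \<noteq> \<zero>\<^sub>Kk)"
    proof (rule Uk.separation[OF _ Y _ Q, where p = \<beta>])
      show "Y \<subset> adj Kk U Y v" using YY qdim_step.hyps(4) by blast
      show "bilin Kk U (adj Kk U Y v) Q \<beta>" using bilin_mono[OF B qdim_step.prems order_refl] .
      fix t s assume "t \<in> Q \<inter> N" "s \<in> Q"
      then show "\<beta> t s = \<zero>\<^sub>Kk" using N_Np_b(1) QP by auto
    next
      fix y assume "y \<in> adj Kk U Y v" "\<And>s. s \<in> Q \<Longrightarrow> \<beta> y s = \<zero>\<^sub>Kk"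
      then show "y \<in> Q \<inter> N" using Qn qdim_step.prems by auto
    qed
    then obtain s y where s: "s \<in> Q" "\<forall>y\<in>Y. \<beta> y s = \<zero>" "y \<in> adj Kk U Y v" "\<beta> y s \<noteq> \<zero>" by auto
    have sc: "s \<in> carrier U" using s QP Npc by auto
    obtain w a where wa: "y = w \<oplus>\<^sub>U a \<odot>\<^sub>U v" "w \<in> Y" "a \<in> k" using s(3) unfolding adj_def by auto
    have "w \<in> carrier U" "a \<in> carrier L" using wa k_sub Uk.subspD(3)[OF Y(1)] by auto
    then have "\<beta> y s = a \<otimes> \<beta> v s" using wa s(2) bD vc sc by simp
    then have "\<beta> v s \<noteq> \<zero>" using s(4) \<open>a \<in> carrier L\<close> by auto
    then have "v \<notin> Z" using Z(4) s by auto
    from qdim.qdim_step[OF Z(1) vc this] have 1: "qdim L U N (adj L U Z v) (Suc i)" .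
    have ZZ: "Z \<subseteq> adj L U Z v" "v \<in> adj L U Z v"
      using UL.adj_ge[of Z v] UL.adj_mem[OF Zs] UL.subspD(1)[OF Zs] vc by auto
    have 2: "adj Kk U Y v \<subseteq> adj L U Z v"
      using Uk.adj_least[OF L_to_k[OF UL.adj_subsp[OF Zs vc]]] Z(2) ZZ by blast
    have 3: "adj L U Z v \<subseteq> Z'" if "subsp L U Z'" "N \<subseteq> Z'" "adj Kk U Y v \<subseteq> Z'" for Z'
      using UL.adj_least[OF that(1), of Z v] Z(3) that YY by blast
    have 4: "\<beta> z t = \<zero>" if t: "t \<in> Q" "\<forall>y\<in>adj Kk U Y v. \<beta> y t = \<zero>" "z \<in> adj L U Z v" for t z
    proof -
      have tc: "t \<in> carrier U" using t QP Npc by auto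
      obtain w a where wa: "z = w \<oplus>\<^sub>U a \<odot>\<^sub>U v" "w \<in> Z" "a \<in> carrier L" using t(3) unfolding adj_def by auto
      have "\<beta> w t = \<zero>" "\<beta> v t = \<zero>" using Z(4) t wa YY by auto
      then show ?thesis using wa bD vc tc UL.subspD(3)[OF Zs wa(2)] by simp
    qed
    show ?case using 1 2 3 4 by blast
  qed
  obtain Z where Z: "qdim L U N Z m" "\<forall>Z'. subsp L U Z' \<longrightarrow> N \<subseteq> Z' \<longrightarrow> Q \<subseteq> Z' \<longrightarrow> Z \<subseteq> Z'"
    using chain[OF m(2)] by auto
  have Zs: "subsp L U Z" using UL.qdim_subsp[OF Z(1)] by auto
  \<comment> \<open>If the span were smaller, a further vector of \<open>Np\<close> would raise
    \<open>rho\<close> by 2 beyond \<open>rho N + 2 m\<close>, against \<open>rho_N_Np\<close> and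
    \<open>m_ge\<close>.\<close>
  have "Np \<subseteq> Z"
  proof (rule ccontr)
    assume "\<not> Np \<subseteq> Z"
    then obtain u where u: "u \<in> Np" "u \<notin> Z" by auto
    have uc: "u \<in> carrier U" using u Npc by auto
    have "Z \<subseteq> Np" using Z(2) Nps N_iso QP by blast
    then have "adj L U Z u \<subseteq> Np" using UL.adj_least[OF Nps] u by auto
    then have "rho (adj L U Z u) \<le> rho Np" using rho_mono[OF UL.adj_subsp[OF Zs uc] Nps] by simp
    moreover have "rho Z + 2 \<le> rho (adj L U Z u)" using rho_adj[OF Zs uc u(2)] .
    moreover have "rho N + 2 * m \<le> rho Z" using rho_adj_chain[OF Z(1)] .
    ultimately show False using rho_N_Np m_ge by linarith
  qed
  then have ZZ: "Np \<subseteq> Z'" if "subsp L U Z'" "N \<subseteq> Z'" "Q \<subseteq> Z'" for Z' using Z(2) that by (meson order_trans)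
  show ?thesis
  proof (intro exI conjI ballI allI impI)
    show "subsp Kk U Q" "Q \<subseteq> Np" "qdim Kk U (Q \<inter> N) Q m" by fact+
  qed (use QT Qk Qn ZZ in auto)
qed

end

section \<open>The function field of a conic\<close>

text \<open>Polynomials of degree at most \<open>d\<close> in \<open>x\<close> and \<open>y\<close>, in Horner form.\<close>

primrec horner :: "('l, 'q) ring_scheme \<Rightarrow> 'l set \<Rightarrow> 'l \<Rightarrow> 'l \<Rightarrow> nat \<Rightarrow> 'l set" where
  "horner L k x y 0 = k"
| "horner L k x y (Suc d) = {a \<oplus>\<^sub>L b \<otimes>\<^sub>L y \<oplus>\<^sub>L x \<otimes>\<^sub>L z | a b z. a \<in> k \<and> b \<in> k \<and> z \<in> horner L k x y d}"

text \<open>The assumption \<open>free\<close> says that \<open>1\<close> and \<open>y\<close> stay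
  independent modulo \<open>x\<close>, which makes the Horner form unique; \<open>y_square\<close>
  bounds the degree of products.\<close>

locale quad_ext = field L for L :: "('l, 'q) ring_scheme" (structure) +
  fixes k :: "'l set" and x y :: 'l
  assumes k: "subfield k L" and x: "x \<in> carrier L" "x \<noteq> \<zero>" and y: "y \<in> carrier L"
    and y_square: "y \<otimes> y \<in> horner L k x y 2"
    and free: "a \<in> k \<Longrightarrow> b \<in> k \<Longrightarrow> z \<in> horner L k x y d \<Longrightarrow> a \<oplus> b \<otimes> y \<oplus> x \<otimes> z = \<zero> \<Longrightarrow> a = \<zero> \<and> b = \<zero>"
begin

abbreviation "Rd \<equiv> horner L k x y"
abbreviation "Kk \<equiv> L\<lparr>carrier := k\<rparr>"

sublocale Lk: vecsp Kk "reg_mod L"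
  using vecsp_subfield[OF k reg_module] .

lemma k_sub: "a \<in> k \<Longrightarrow> a \<in> carrier L" using subfieldE(3)[OF k] by auto

lemma kD: "\<zero> \<in> k" "\<one> \<in> k" "a \<in> k \<Longrightarrow> b \<in> k \<Longrightarrow> a \<oplus> b \<in> k" "a \<in> k \<Longrightarrow> b \<in> k \<Longrightarrow> a \<otimes> b \<in> k"
  "a \<in> k \<Longrightarrow> \<ominus> a \<in> k"
  using subringE(2,3,5,6,7)[OF subfieldE(1)[OF k]] by auto

lemma Rd_car: "z \<in> Rd d \<Longrightarrow> z \<in> carrier L"
  by (induction d arbitrary: z) (use k_sub x y in auto)

lemma Rd_SucI: "a \<in> k \<Longrightarrow> b \<in> k \<Longrightarrow> z \<in> Rd d \<Longrightarrow> a \<oplus> b \<otimes> y \<oplus> x \<otimes> z \<in> Rd (Suc d)"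
  by auto

lemma Rd_add: "z \<in> Rd d \<Longrightarrow> w \<in> Rd d \<Longrightarrow> z \<oplus> w \<in> Rd d"
proof (induction d arbitrary: z w)
  case (Suc d)
  obtain a b z' where z: "z = a \<oplus> b \<otimes> y \<oplus> x \<otimes> z'" "a \<in> k" "b \<in> k" "z' \<in> Rd d" using Suc by auto
  obtain a' b' w' where w: "w = a' \<oplus> b' \<otimes> y \<oplus> x \<otimes> w'" "a' \<in> k" "b' \<in> k" "w' \<in> Rd d" using Suc by auto
  have "z \<oplus> w = (a \<oplus> a') \<oplus> (b \<oplus> b') \<otimes> y \<oplus> x \<otimes> (z' \<oplus> w')"
    using z w k_sub Rd_car x y by (simp add: a_ac l_distr r_distr)
  then show ?case using Rd_SucI[of "a \<oplus> a'" "b \<oplus> b'" "z' \<oplus> w'" d] z w kD Suc.IH by simp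
qed (auto simp: kD)

lemma Rd_smult: "c \<in> k \<Longrightarrow> z \<in> Rd d \<Longrightarrow> c \<otimes> z \<in> Rd d"
proof (induction d arbitrary: z)
  case (Suc d)
  obtain a b z' where z: "z = a \<oplus> b \<otimes> y \<oplus> x \<otimes> z'" "a \<in> k" "b \<in> k" "z' \<in> Rd d" using Suc by auto
  have "c \<otimes> z = (c \<otimes> a) \<oplus> (c \<otimes> b) \<otimes> y \<oplus> x \<otimes> (c \<otimes> z')"
    using z Suc.prems k_sub Rd_car x y by (simp add: m_ac r_distr)
  then show ?case using Rd_SucI[of "c \<otimes> a" "c \<otimes> b" "c \<otimes> z'" d] z kD Suc by simp
qed (auto simp: kD)

lemma Rd_zero: "\<zero> \<in> Rd d"
proof (induction d)
  case (Suc d) then show ?case using Rd_SucI[of \<zero> \<zero> \<zero> d] kD x y by simp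
qed (simp add: kD)

lemma Rd_subsp: "subsp Kk (reg_mod L) (Rd d)"
  unfolding subsp_def using Rd_car Rd_zero Rd_add Rd_smult by auto

lemma Rd_neg: "z \<in> Rd d \<Longrightarrow> \<ominus> z \<in> Rd d"
  using Rd_smult[OF kD(5)[OF kD(2)], of z d] Rd_car[of z d] by (simp add: l_minus)

lemma Rd_diff: "z \<in> Rd d \<Longrightarrow> w \<in> Rd d \<Longrightarrow> z \<ominus> w \<in> Rd d"
  unfolding a_minus_def using Rd_add Rd_neg by simp

lemma Rd_Suc: "Rd d \<subseteq> Rd (Suc d)"
proof (induction d)
  case 0
  have "a \<in> Rd (Suc 0)" if "a \<in> k" for a
    using Rd_SucI[of a \<zero> \<zero> 0] that kD k_sub x y by simp
  then show ?case by auto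
next
  case (Suc d)
  then show ?case by auto
qed

lemma Rd_mono: "d \<le> d' \<Longrightarrow> Rd d \<subseteq> Rd d'"
  by (rule lift_Suc_mono_le[of Rd]) (use Rd_Suc in auto)

lemma k_Rd: "a \<in> k \<Longrightarrow> a \<in> Rd d" using Rd_mono[of 0 d] by auto

lemma x_Rd: "z \<in> Rd d \<Longrightarrow> x \<otimes> z \<in> Rd (Suc d)"
  using Rd_SucI[of \<zero> \<zero> z d] kD x y Rd_car[of z d] by simp

lemma y_in: "y \<in> Rd (Suc d)"
  using Rd_SucI[of \<zero> \<one> \<zero> d] kD Rd_zero x y by simp

lemma x_in: "x \<in> Rd (Suc d)"
  using x_Rd[OF k_Rd[OF kD(2)], of d] x by simp

text \<open>Here the equation of the conic enters: \<open>y^2\<close> has degree 2, so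
  multiplication by \<open>y\<close> raises the degree by one only.\<close>

lemma y_Rd: "z \<in> Rd d \<Longrightarrow> y \<otimes> z \<in> Rd (Suc d)"
proof (induction d arbitrary: z)
  case 0
  then have "y \<otimes> z = \<zero> \<oplus> z \<otimes> y \<oplus> x \<otimes> \<zero>" using k_sub x y by (simp add: m_comm)
  then show ?case using Rd_SucI[of \<zero> z \<zero> 0] 0 kD by simp
next
  case (Suc d)
  obtain a b z' where z: "z = a \<oplus> b \<otimes> y \<oplus> x \<otimes> z'" "a \<in> k" "b \<in> k" "z' \<in> Rd d" using Suc by auto
  have "y \<otimes> z = a \<otimes> y \<oplus> b \<otimes> (y \<otimes> y) \<oplus> x \<otimes> (y \<otimes> z')"
    using z k_sub Rd_car x y by (simp add: m_ac r_distr)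
  moreover have "y \<otimes> y \<in> Rd (Suc (Suc d))" using y_square Rd_mono[of 2 "Suc (Suc d)"] by (auto simp del: horner.simps)
  ultimately show ?case using Rd_add Rd_smult z y_in x_Rd Suc.IH[OF z(4)] by (simp del: horner.simps)
qed

lemma Rd_mult: "z \<in> Rd d \<Longrightarrow> w \<in> Rd d' \<Longrightarrow> z \<otimes> w \<in> Rd (d + d')"
proof (induction d arbitrary: z)
  case 0 then show ?case using Rd_smult by simp
next
  case (Suc d)
  obtain a b z' where z: "z = a \<oplus> b \<otimes> y \<oplus> x \<otimes> z'" "a \<in> k" "b \<in> k" "z' \<in> Rd d" using Suc by auto
  have "z \<otimes> w = a \<otimes> w \<oplus> b \<otimes> (y \<otimes> w) \<oplus> x \<otimes> (z' \<otimes> w)"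
    using z Suc.prems k_sub Rd_car x y by (simp add: m_ac r_distr l_distr)
  moreover have "w \<in> Rd (Suc (d + d'))" "y \<otimes> w \<in> Rd (Suc (d + d'))"
    using Suc.prems Rd_mono[of d' "Suc (d + d')"] y_Rd[of w "d'"] Rd_mono[of "Suc d'" "Suc (d + d')"] 
    by (auto simp del: horner.simps)
  ultimately show ?case using Rd_add Rd_smult z x_Rd[OF Suc.IH[OF z(4) Suc.prems(2)]] by (simp del: horner.simps)
qed

lemma strip0: assumes "z \<in> Rd d" "x \<otimes> z \<in> k" shows "z = \<zero>"
proof -
  have zc: "z \<in> carrier L" using assms Rd_car by auto
  have "\<ominus> (x \<otimes> z) \<oplus> \<zero> \<otimes> y \<oplus> x \<otimes> z = \<zero>" using zc x y by (simp add: l_neg)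
  then have "\<ominus> (x \<otimes> z) = \<zero>" using free[OF kD(5)[OF assms(2)] kD(1) assms(1)] by simp
  then have "x \<otimes> z = \<zero>" using zc x by (metis m_closed minus_minus minus_zero)
  then show ?thesis using zc x integral_iff by simp
qed

text \<open>By \<open>free\<close> a multiple of \<open>x\<close> has no constant term and no
  \<open>y\<close> term in its Horner form, so \<open>x\<close> cancels and the degree
  drops.\<close>

lemma strip: assumes "z \<in> Rd d" "x \<otimes> z \<in> Rd (Suc e)" shows "z \<in> Rd e"
proof -
  obtain a b w where w: "x \<otimes> z = a \<oplus> b \<otimes> y \<oplus> x \<otimes> w" "a \<in> k" "b \<in> k" "w \<in> Rd e" using assms by auto
  have c: "z \<in> carrier L" "w \<in> carrier L" "a \<in> carrier L" "b \<in> carrier L" using assms w Rd_car k_sub by auto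
  have "w \<ominus> z \<in> Rd (max d e)" using assms(1) w(4) Rd_mono[of d "max d e"] Rd_mono[of e "max d e"] by (intro Rd_diff) auto
  moreover have "a \<oplus> b \<otimes> y \<oplus> x \<otimes> (w \<ominus> z) = (a \<oplus> b \<otimes> y \<oplus> x \<otimes> w) \<ominus> x \<otimes> z"
    using c x y by (simp add: a_minus_def r_distr r_minus a_assoc)
  then have "a \<oplus> b \<otimes> y \<oplus> x \<otimes> (w \<ominus> z) = \<zero>" using w(1) c x y by (simp add: a_minus_def r_neg)
  ultimately have "a = \<zero>" "b = \<zero>" using free w(2,3) by blast+
  then have "x \<otimes> z = x \<otimes> w" using w(1) c x y by simp
  then have "z = w" using m_lcancel[OF x(2,1) c(1,2)] by simp
  then show ?thesis using w(4) by simp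
qed

lemma xp: "x [^] (n::nat) \<in> carrier L" "x [^] (n::nat) \<noteq> \<zero>"
proof -
  show "x [^] (n::nat) \<in> carrier L" using x by simp
  show "x [^] (n::nat) \<noteq> \<zero>" by (induction n) (use x integral_iff in auto)
qed

lemma xSuc: "z \<in> carrier L \<Longrightarrow> x [^] Suc n \<otimes> z = x \<otimes> (x [^] n \<otimes> z)"
  using x by (simp add: m_ac)

lemma xpow_Rd: "z \<in> Rd d \<Longrightarrow> x [^] (n::nat) \<otimes> z \<in> Rd (d + n)"
proof (induction n)
  case (Suc n) then show ?case using x_Rd[of "x [^] n \<otimes> z" "d + n"] xSuc[OF Rd_car] by (simp del: horner.simps nat_pow_Suc)
qed (simp add: Rd_car)

lemma strip_pow: "z \<in> Rd d \<Longrightarrow> x [^] (n::nat) \<otimes> z \<in> Rd (e + n) \<Longrightarrow> z \<in> Rd e"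
proof (induction n)
  case (Suc n)
  have "x [^] n \<otimes> z \<in> Rd (e + n)"
    by (rule strip[OF xpow_Rd[OF Suc.prems(1)]]) (use Suc xSuc[OF Rd_car] in \<open>simp del: horner.simps nat_pow_Suc\<close>)
  then show ?case using Suc by simp
qed (simp add: Rd_car)

text \<open>The quotients \<open>r / x^n\<close> with \<open>r\<close> of degree at most
  \<open>n + e\<close>. For the conic these are the functions of order at most \<open>e\<close> at
  infinity that are regular on the rest of the chart where the first coordinate is nonzero. That
  chart contains all points at infinity, since \<open>(0 : 1 : 0)\<close> is not on the
  conic.\<close>

definition Lm :: "int \<Rightarrow> 'l set" where
  "Lm e = {z \<in> carrier L. \<exists>n d. x [^] (n::nat) \<otimes> z \<in> Rd d \<and> int d \<le> e + int n}"

lemma Lm_car: "z \<in> Lm e \<Longrightarrow> z \<in> carrier L" unfolding Lm_def by auto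

lemma xpow_add: "z \<in> carrier L \<Longrightarrow> x [^] (n + m :: nat) \<otimes> z = x [^] n \<otimes> (x [^] m \<otimes> z)"
  using x by (simp add: nat_pow_mult[symmetric] m_assoc)

text \<open>All large exponents serve as denominators, so two elements can be brought to a common
  one.\<close>

lemma Lm_big:
  assumes "z \<in> Lm e" shows "\<exists>n0. \<forall>n\<ge>n0. 0 \<le> e + int n \<and> x [^] (n::nat) \<otimes> z \<in> Rd (nat (e + int n))"
proof -
  obtain m d where m: "x [^] (m::nat) \<otimes> z \<in> Rd d" "int d \<le> e + int m" "z \<in> carrier L" using assms unfolding Lm_def by auto
  have "0 \<le> e + int n \<and> x [^] n \<otimes> z \<in> Rd (nat (e + int n))" if n: "n \<ge> m" for n
  proof -
    have "x [^] n \<otimes> z = x [^] (n - m) \<otimes> (x [^] m \<otimes> z)" using xpow_add[OF m(3), of "n - m" m] n by simp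
    then have "x [^] n \<otimes> z \<in> Rd (d + (n - m))" using xpow_Rd[OF m(1)] by simp
    moreover have "d + (n - m) \<le> nat (e + int n)" "0 \<le> e + int n" using m(2) n by auto
    ultimately show ?thesis using Rd_mono by blast
  qed
  then show ?thesis by blast
qed

lemma LmI: "z \<in> carrier L \<Longrightarrow> x [^] (n::nat) \<otimes> z \<in> Rd d \<Longrightarrow> int d \<le> e + int n \<Longrightarrow> z \<in> Lm e"
  unfolding Lm_def by blast

lemma Rd_Lm: "Rd d \<subseteq> Lm (int d)"
  using LmI[of _ 0 d] Rd_car by auto

lemma Lm_add: "z \<in> Lm e \<Longrightarrow> w \<in> Lm e \<Longrightarrow> z \<oplus> w \<in> Lm e"
proof -
  assume z: "z \<in> Lm e" and w: "w \<in> Lm e"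
  obtain n0 where n0: "\<forall>n\<ge>n0. 0 \<le> e + int n \<and> x [^] (n::nat) \<otimes> z \<in> Rd (nat (e + int n))" using Lm_big[OF z] by auto
  obtain n1 where n1: "\<forall>n\<ge>n1. 0 \<le> e + int n \<and> x [^] (n::nat) \<otimes> w \<in> Rd (nat (e + int n))" using Lm_big[OF w] by auto
  let ?n = "max n0 n1"
  have "x [^] ?n \<otimes> (z \<oplus> w) \<in> Rd (nat (e + int ?n))" "0 \<le> e + int ?n"
    using n0 n1 Rd_add Lm_car[OF z] Lm_car[OF w] x by (simp_all add: r_distr)
  then show ?thesis using LmI[of "z \<oplus> w" ?n "nat (e + int ?n)" e] Lm_car[OF z] Lm_car[OF w] by simp
qed

lemma Lm_mult: "z \<in> Lm e \<Longrightarrow> w \<in> Lm f \<Longrightarrow> z \<otimes> w \<in> Lm (e + f)"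
proof -
  assume z: "z \<in> Lm e" and w: "w \<in> Lm f"
  obtain n d where n: "x [^] (n::nat) \<otimes> z \<in> Rd d" "int d \<le> e + int n" using z unfolding Lm_def by auto
  obtain m d' where m: "x [^] (m::nat) \<otimes> w \<in> Rd d'" "int d' \<le> f + int m" using w unfolding Lm_def by auto
  have "x [^] (n + m) \<otimes> (z \<otimes> w) = (x [^] n \<otimes> z) \<otimes> (x [^] m \<otimes> w)"
    using Lm_car[OF z] Lm_car[OF w] x by (simp add: nat_pow_mult[symmetric] m_ac)
  then have "x [^] (n + m) \<otimes> (z \<otimes> w) \<in> Rd (d + d')" using Rd_mult[OF n(1) m(1)] by simp
  then show ?thesis using LmI[of "z \<otimes> w" "n + m" "d + d'" "e + f"] Lm_car[OF z] Lm_car[OF w] n(2) m(2) by simp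
qed

lemma k_Lm: "a \<in> k \<Longrightarrow> a \<in> Lm 0" using Rd_Lm[of 0] by auto

lemma Lm_mono: "e \<le> f \<Longrightarrow> Lm e \<subseteq> Lm f" unfolding Lm_def by force

lemma Lm_subsp: "subsp Kk (reg_mod L) (Lm e)"
  unfolding subsp_def
proof (intro conjI ballI)
  show "\<zero>\<^bsub>reg_mod L\<^esub> \<in> Lm e" using LmI[of \<zero> "nat (- e)" 0 e] kD x by simp
  fix a z assume "a \<in> carrier Kk" "z \<in> Lm e"
  then show "a \<odot>\<^bsub>reg_mod L\<^esub> z \<in> Lm e" using Lm_mult[OF k_Lm, of a z e] by simp
qed (use Lm_car Lm_add in auto)

lemma LmD: "\<zero> \<in> Lm e" "a \<in> k \<Longrightarrow> z \<in> Lm e \<Longrightarrow> a \<otimes> z \<in> Lm e" "z \<in> Lm e \<Longrightarrow> w \<in> Lm e \<Longrightarrow> z \<ominus> w \<in> Lm e"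
proof -
  show "\<zero> \<in> Lm e" "a \<in> k \<Longrightarrow> z \<in> Lm e \<Longrightarrow> a \<otimes> z \<in> Lm e" using Lk.subspD(2,5)[OF Lm_subsp] by auto
  have "\<ominus> w \<in> Lm e" if "w \<in> Lm e" for w
    using Lk.subspD(5)[OF Lm_subsp, of "\<ominus> \<one>" w] that kD Lm_car[OF that] by (simp add: l_minus)
  then show "z \<in> Lm e \<Longrightarrow> w \<in> Lm e \<Longrightarrow> z \<ominus> w \<in> Lm e" unfolding a_minus_def using Lm_add by auto
qed

lemma Rd_inter: assumes "z \<in> Rd d" "z \<in> Lm (int d')" shows "z \<in> Rd d'"
proof -
  obtain n0 where "\<forall>n\<ge>n0. 0 \<le> int d' + int n \<and> x [^] (n::nat) \<otimes> z \<in> Rd (nat (int d' + int n))"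
    using Lm_big[OF assms(2)] by auto
  then have "x [^] n0 \<otimes> z \<in> Rd (d' + n0)" by (metis nat_int of_nat_add order_refl)
  then show ?thesis using strip_pow assms by blast
qed

lemma Rd_neg_zero: assumes "z \<in> Rd d" "z \<in> Lm (-1)" shows "z = \<zero>"
proof -
  obtain n0 where n0: "\<forall>n\<ge>n0. 0 \<le> -1 + int n \<and> x [^] (n::nat) \<otimes> z \<in> Rd (nat (-1 + int n))"
    using Lm_big[OF assms(2)] by auto
  \<comment> \<open>An exponent of at least 1 leaves a factor \<open>x\<close> to be split off;
    cancelling the other powers puts \<open>x z\<close> into \<open>Rd 0\<close>, and by
    \<open>strip0\<close> no nonzero multiple of \<open>x\<close> is a constant.\<close>
  let ?n = "max n0 1"
  have "x [^] ?n \<otimes> z \<in> Rd (nat (-1 + int ?n))" using n0 by simp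
  moreover have "nat (-1 + int ?n) = 0 + (?n - 1)" by simp
  moreover have "x [^] ?n \<otimes> z = x [^] (?n - 1) \<otimes> (x \<otimes> z)"
    using xpow_add[OF Rd_car[OF assms(1)], of "?n - 1" 1] x by simp
  ultimately have "x \<otimes> z \<in> Rd 0" using strip_pow[OF x_Rd[OF assms(1)], of "?n - 1" 0] by simp
  then show ?thesis using strip0 assms(1) by simp
qed

lemma xinv: "inv x \<in> carrier L" "inv x \<otimes> x = \<one>" "x \<otimes> inv x = \<one>"
  using x field_Units by auto

lemma xinv_Lm: "inv x \<in> Lm (-1)" using LmI[of "inv x" 1 0 "-1"] xinv kD x by simp

lemma x_Lm: "x \<in> Lm 1" using x_in[of 0] Rd_Lm[of 1] by auto

lemma y_Lm: "y \<in> Lm 1" using y_in[of 0] Rd_Lm[of 1] by auto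

text \<open>The leading part in degree \<open>n + 1\<close> has the two monomials
  \<open>x^(n+1)\<close> and \<open>x^n y\<close>: the place at infinity has degree 2.\<close>

lemma Rd_top:
  "w \<in> Rd (Suc n) \<Longrightarrow> \<exists>w'\<in>Rd n. \<exists>a\<in>k. \<exists>b\<in>k. w = w' \<oplus> a \<otimes> x [^] Suc n \<oplus> b \<otimes> (x [^] n \<otimes> y)"
proof (induction n arbitrary: w)
  case 0
  then obtain a b z where w: "w = a \<oplus> b \<otimes> y \<oplus> x \<otimes> z" "a \<in> k" "b \<in> k" "z \<in> k" by auto
  then have "w = a \<oplus> z \<otimes> x [^] Suc 0 \<oplus> b \<otimes> (x [^] (0::nat) \<otimes> y)" using k_sub x y by (simp add: a_ac m_comm)
  then show ?case using w by force
next
  case (Suc n)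
  obtain a b z where w: "w = a \<oplus> b \<otimes> y \<oplus> x \<otimes> z" "a \<in> k" "b \<in> k" "z \<in> Rd (Suc n)"
    using Suc.prems unfolding horner.simps(2)[of L k x y "Suc n"] by blast
  obtain z' a' b' where z: "z' \<in> Rd n" "a' \<in> k" "b' \<in> k" "z = z' \<oplus> a' \<otimes> x [^] Suc n \<oplus> b' \<otimes> (x [^] n \<otimes> y)"
    using Suc.IH[OF w(4)] by auto
  have "w = (a \<oplus> b \<otimes> y \<oplus> x \<otimes> z') \<oplus> a' \<otimes> x [^] Suc (Suc n) \<oplus> b' \<otimes> (x [^] Suc n \<otimes> y)"
    unfolding w(1) z(4) using w z k_sub Rd_car x y by (simp add: r_distr a_assoc m_ac)
  then show ?case using z Rd_SucI[OF w(2,3) z(1)] by blast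
qed

lemma inv_xp: "inv (x [^] (n::nat)) \<in> carrier L" "x [^] n \<otimes> inv (x [^] n) = \<one>" "inv (x [^] n) \<otimes> x [^] n = \<one>"
  using xp field_Units by auto

lemma Lm_top:
  assumes z: "z \<in> Lm (int e + 1)"
  shows "\<exists>l\<in>Lm (int e). \<exists>a\<in>k. \<exists>b\<in>k. z = l \<oplus> a \<otimes> x [^] Suc e \<oplus> b \<otimes> (x [^] e \<otimes> y)"
proof -
  have zc: "z \<in> carrier L" using z Lm_car by auto
  obtain n where "0 \<le> int e + 1 + int n" "x [^] (n::nat) \<otimes> z \<in> Rd (nat (int e + 1 + int n))" using Lm_big[OF z] by auto
  moreover have "nat (int e + 1 + int n) = Suc (n + e)" by simp
  ultimately obtain w a b where w: "w \<in> Rd (n + e)" "a \<in> k" "b \<in> k"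
    "x [^] n \<otimes> z = w \<oplus> a \<otimes> x [^] Suc (n + e) \<oplus> b \<otimes> (x [^] (n + e) \<otimes> y)" using Rd_top by metis
  have ab: "a \<in> carrier L" "b \<in> carrier L" "w \<in> carrier L" using w k_sub Rd_car by auto
  let ?i = "inv (x [^] n)"
  have p: "?i \<otimes> x [^] (n + m) = x [^] (m::nat)" for m
    using inv_xp[of n] x by (simp add: nat_pow_mult[symmetric] m_assoc[symmetric])
  have "z = ?i \<otimes> (x [^] n \<otimes> z)" using inv_xp[of n] zc xp by (simp add: m_assoc[symmetric])
  also have "\<dots> = ?i \<otimes> w \<oplus> a \<otimes> (?i \<otimes> x [^] (n + Suc e)) \<oplus> b \<otimes> ((?i \<otimes> x [^] (n + e)) \<otimes> y)"
    unfolding w(4) using inv_xp[of n] ab xp y x by (simp add: r_distr m_ac)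
  finally have "z = ?i \<otimes> w \<oplus> a \<otimes> x [^] Suc e \<oplus> b \<otimes> (x [^] e \<otimes> y)" unfolding p .
  moreover have "?i \<otimes> w \<in> Lm (int e)"
    by (rule LmI[of _ n "n + e"]) (use inv_xp[of n] ab w xp in \<open>auto simp: m_assoc[symmetric]\<close>)
  ultimately show ?thesis using w by blast
qed

lemma Lm1: "z \<in> Lm 1 \<Longrightarrow> \<exists>l\<in>Lm 0. \<exists>a\<in>k. \<exists>b\<in>k. z = l \<oplus> a \<otimes> x \<oplus> b \<otimes> y"
  using Lm_top[of z 0] x y by simp

lemma Lm0_Rd: "z \<in> Rd d \<Longrightarrow> z \<in> Lm 0 \<Longrightarrow> z \<in> k"
  using Rd_inter[of z d 0] by simp

text \<open>The equation shows that \<open>l\<close> is a polynomial; being of order 0 at infinity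
  it is a constant, and \<open>free\<close> applies.\<close>

lemma free': 
  assumes "l \<in> Lm 0" "r \<in> Rd d" "b \<in> k" "l \<oplus> x \<otimes> r \<oplus> b \<otimes> y = \<zero>" shows "b = \<zero>" "l = \<zero>"
proof -
  have c: "l \<in> carrier L" "r \<in> carrier L" "b \<in> carrier L" using assms Lm_car Rd_car k_sub by auto
  have 1: "l = \<ominus> (x \<otimes> r \<oplus> b \<otimes> y)"
    using minus_equality[of l "x \<otimes> r \<oplus> b \<otimes> y"] assms(4) c x y by (simp add: a_assoc)
  have "x \<otimes> r \<oplus> b \<otimes> y \<in> Rd (Suc d)" using Rd_add[OF x_Rd[OF assms(2)] Rd_smult[OF assms(3) y_in]] .
  then have "l \<in> Rd (Suc d)" unfolding 1 by (rule Rd_neg)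
  then have "l \<in> k" using Lm0_Rd assms(1) by blast
  moreover have "l \<oplus> b \<otimes> y \<oplus> x \<otimes> r = \<zero>" using assms(4) c x y by (simp add: a_ac)
  ultimately show "b = \<zero>" "l = \<zero>" using free assms by blast+
qed

text \<open>Divided by \<open>x\<close>, the decomposition says that \<open>y / x\<close> spans
  \<open>LL / (Lm (-1) + RR)\<close>, the first cohomology of the two charts with a zero prescribed
  at infinity. For the conic this twist is the canonical bundle, and \<open>c\<close> is the trace
  map of Serre duality, normalised by \<open>c y = 1\<close>.\<close>

definition c :: "'l \<Rightarrow> 'l" where
  "c z = (THE b. b \<in> k \<and> (\<exists>l\<in>Lm 0. \<exists>d. \<exists>r\<in>Rd d. z = l \<oplus> x \<otimes> r \<oplus> b \<otimes> y))"

lemma c_eq: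
  assumes l: "l \<in> Lm 0" and r: "r \<in> Rd d" and b: "b \<in> k" and z: "z = l \<oplus> x \<otimes> r \<oplus> b \<otimes> y"
  shows "c z = b"
  unfolding c_def
proof (rule the_equality)
  show "b \<in> k \<and> (\<exists>l\<in>Lm 0. \<exists>d. \<exists>r\<in>Rd d. z = l \<oplus> x \<otimes> r \<oplus> b \<otimes> y)" using assms by blast
  fix b' assume "b' \<in> k \<and> (\<exists>l\<in>Lm 0. \<exists>d. \<exists>r\<in>Rd d. z = l \<oplus> x \<otimes> r \<oplus> b' \<otimes> y)"
  then obtain l' d' r' where b': "b' \<in> k" "l' \<in> Lm 0" "r' \<in> Rd d'" "z = l' \<oplus> x \<otimes> r' \<oplus> b' \<otimes> y" by auto
  have cc: "l \<in> carrier L" "r \<in> carrier L" "b \<in> carrier L" "l' \<in> carrier L" "r' \<in> carrier L" "b' \<in> carrier L"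
    using assms b' Lm_car Rd_car k_sub by auto
  have "(l' \<ominus> l) \<oplus> x \<otimes> (r' \<ominus> r) \<oplus> (b' \<ominus> b) \<otimes> y = (l' \<oplus> x \<otimes> r' \<oplus> b' \<otimes> y) \<ominus> (l \<oplus> x \<otimes> r \<oplus> b \<otimes> y)"
    using cc x y by (simp add: a_minus_def l_distr r_distr minus_add l_minus r_minus a_ac)
  also have "\<dots> = \<zero>" using b'(4) z cc x y by (simp add: a_minus_def r_neg)
  finally have e: "(l' \<ominus> l) \<oplus> x \<otimes> (r' \<ominus> r) \<oplus> (b' \<ominus> b) \<otimes> y = \<zero>" .
  have "r' \<ominus> r \<in> Rd (max d d')"
    using r b'(3) Rd_mono[of d "max d d'"] Rd_mono[of d' "max d d'"] by (intro Rd_diff) auto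
  moreover have "b' \<ominus> b \<in> k" using b b' kD unfolding a_minus_def by auto
  ultimately have "b' \<ominus> b = \<zero>" using free'(1)[OF LmD(3)[OF b'(2) l] _ _ e] by blast
  then show "b' = b" using cc by simp
qed

text \<open>Leading terms are removed one order at a time by \<open>Lm_top\<close>. All of them are
  multiples of \<open>x\<close> by a polynomial, except \<open>y\<close> itself.\<close>

lemma c_decomp: "z \<in> Lm e \<Longrightarrow> \<exists>l\<in>Lm 0. \<exists>d. \<exists>r\<in>Rd d. \<exists>b\<in>k. z = l \<oplus> x \<otimes> r \<oplus> b \<otimes> y"
proof -
  have *: "\<exists>l\<in>Lm 0. \<exists>d. \<exists>r\<in>Rd d. \<exists>b\<in>k. z = l \<oplus> x \<otimes> r \<oplus> b \<otimes> y" if "z \<in> Lm (int n)" for n z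
    using that
  proof (induction n arbitrary: z)
    case 0
    then have "z = z \<oplus> x \<otimes> \<zero> \<oplus> \<zero> \<otimes> y" using Lm_car x y by simp
    then show ?case using 0 kD Rd_zero by (metis of_nat_0)
  next
    case (Suc n)
    obtain l a b where l: "l \<in> Lm (int n)" "a \<in> k" "b \<in> k" "z = l \<oplus> a \<otimes> x [^] Suc n \<oplus> b \<otimes> (x [^] n \<otimes> y)"
      using Lm_top[of z n] Suc.prems by (auto simp: algebra_simps)
    obtain l' d r b' where l': "l' \<in> Lm 0" "r \<in> Rd d" "b' \<in> k" "l = l' \<oplus> x \<otimes> r \<oplus> b' \<otimes> y" using Suc.IH[OF l(1)] by blast
    have cc: "a \<in> carrier L" "b \<in> carrier L" "l' \<in> carrier L" "r \<in> carrier L" "b' \<in> carrier L" using l l' k_sub Lm_car Rd_car by auto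
    have ax: "a \<otimes> x [^] n \<in> Rd n" using Rd_smult[OF l(2)] xpow_Rd[OF k_Rd[OF kD(2)], of n 0] xp by simp
    show ?case
    \<comment> \<open>For \<open>n = 0\<close> the new term in \<open>y\<close> is no multiple of
      \<open>x\<close> and is added to the residue.\<close>
    proof (cases n)
      case 0
      have "z = l' \<oplus> x \<otimes> (r \<oplus> a \<otimes> x [^] n) \<oplus> (b' \<oplus> b) \<otimes> y"
        unfolding l(4) l'(4) using 0 cc x y by (simp add: r_distr l_distr a_ac m_ac)
      moreover have "r \<oplus> a \<otimes> x [^] n \<in> Rd (max d n)"
        using l'(2) ax Rd_mono[of d "max d n"] Rd_mono[of n "max d n"] by (intro Rd_add) auto
      ultimately show ?thesis using l' kD l by blast
    next
      case (Suc m)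
      have "z = l' \<oplus> x \<otimes> (r \<oplus> (a \<otimes> x [^] n \<oplus> b \<otimes> (x [^] m \<otimes> y))) \<oplus> b' \<otimes> y"
        unfolding l(4) l'(4) using Suc cc x y by (simp add: r_distr l_distr a_ac m_ac)
      moreover have "b \<otimes> (x [^] m \<otimes> y) \<in> Rd n" using Rd_smult[OF l(3)] xpow_Rd[OF y_in[of 0], of m] Suc by (simp del: horner.simps)
      then have "r \<oplus> (a \<otimes> x [^] n \<oplus> b \<otimes> (x [^] m \<otimes> y)) \<in> Rd (max d n)"
        using l'(2) ax Rd_mono[of d "max d n"] Rd_mono[of n "max d n"] by (intro Rd_add) auto
      ultimately show ?thesis using l' by blast
    qed
  qed
  assume "z \<in> Lm e"
  then have "z \<in> Lm (int (nat e))" using Lm_mono[of e "int (nat e)"] by auto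
  then show ?thesis by (rule *)
qed

lemma Lm_x: "z \<in> Lm e \<Longrightarrow> x \<otimes> z \<in> Lm (e + 1)" using Lm_mult[OF x_Lm, of z e] by (simp add: add.commute)
lemma Lm_xinv: "z \<in> Lm e \<Longrightarrow> inv x \<otimes> z \<in> Lm (e - 1)" using Lm_mult[OF xinv_Lm, of z e] by simp

lemma Lm_dim_shift:
  assumes q: "qdim Kk (reg_mod L) (Lm (e - 1)) (Lm e) 2"
    and a: "a \<in> carrier L" "a \<noteq> \<zero>" "\<And>d z. z \<in> Lm d \<Longrightarrow> a \<otimes> z \<in> Lm (d + s)"
      "\<And>d z. z \<in> Lm d \<Longrightarrow> inv a \<otimes> z \<in> Lm (d - s)"
  shows "qdim Kk (reg_mod L) (Lm (e + s - 1)) (Lm (e + s)) 2"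
proof -
  have ai: "inv a \<in> carrier L" "inv a \<otimes> a = \<one>" "a \<otimes> inv a = \<one>" using a field_Units by auto
  have i1: "inv a \<otimes> (a \<otimes> z) = z" "a \<otimes> (inv a \<otimes> z) = z" if "z \<in> carrier L" for z
    using ai a that by (simp_all add: m_assoc[symmetric])
  have "qdim Kk (reg_mod L) (Lm (e + s - 1)) (ssum (reg_mod L) (Lm (e + s - 1)) ((\<lambda>z. a \<otimes> z) ` Lm e)) 2"
  proof (rule qdim_map[OF Lk.vecsp_axioms Lk.vecsp_axioms q])
    fix z assume z: "z \<in> Lm e"
    show "a \<otimes> z \<in> carrier (reg_mod L)" using a Lm_car[OF z] by simp
    show "(a \<otimes> z \<in> Lm (e + s - 1)) = (z \<in> Lm (e - 1))"
      using a(3)[of z "e - 1"] a(4)[of "a \<otimes> z" "e + s - 1"] i1[OF Lm_car[OF z]] by (auto simp: algebra_simps)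
    fix w assume w: "w \<in> Lm e"
    show "a \<otimes> (z \<oplus>\<^bsub>reg_mod L\<^esub> w) = a \<otimes> z \<oplus>\<^bsub>reg_mod L\<^esub> a \<otimes> w" using a Lm_car[OF z] Lm_car[OF w] by (simp add: r_distr)
  next
    fix b z assume "b \<in> carrier Kk" "z \<in> Lm e"
    then show "a \<otimes> (b \<odot>\<^bsub>reg_mod L\<^esub> z) = b \<odot>\<^bsub>reg_mod L\<^esub> (a \<otimes> z)" using a k_sub Lm_car by (simp add: m_ac)
  qed (rule Lm_subsp)
  moreover have "ssum (reg_mod L) (Lm (e + s - 1)) ((\<lambda>z. a \<otimes> z) ` Lm e) = Lm (e + s)"
  proof
    show "ssum (reg_mod L) (Lm (e + s - 1)) ((\<lambda>z. a \<otimes> z) ` Lm e) \<subseteq> Lm (e + s)"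
      by (rule Lk.ssum_least[OF Lm_subsp]) (use a Lm_mono[of "e + s - 1" "e + s"] in auto)
    have "(\<lambda>z. a \<otimes> z) ` Lm e \<subseteq> carrier (reg_mod L)" using Lm_car a by auto
    then have "(\<lambda>z. a \<otimes> z) ` Lm e \<subseteq> ssum (reg_mod L) (Lm (e + s - 1)) ((\<lambda>z. a \<otimes> z) ` Lm e)"
      using Lk.ssum_ge2[OF Lm_subsp] by blast
    moreover have "z \<in> (\<lambda>z. a \<otimes> z) ` Lm e" if z: "z \<in> Lm (e + s)" for z
      using a(4)[OF z] i1(2)[OF Lm_car[OF z]] by (metis add_diff_cancel_right' imageI)
    ultimately show "Lm (e + s) \<subseteq> ssum (reg_mod L) (Lm (e + s - 1)) ((\<lambda>z. a \<otimes> z) ` Lm e)" by blast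
  qed
  ultimately show ?thesis by simp
qed

text \<open>In degree 1 the functions \<open>x\<close> and \<open>y\<close> form a basis over order
  0; multiplication by \<open>x\<close> and its inverse carries this to all other degrees.\<close>

lemma Lm_dim: "qdim Kk (reg_mod L) (Lm (e - 1)) (Lm e) 2"
proof (induction e rule: int_induct[where k = 1])
  case base
  let ?A = "adj Kk (reg_mod L) (Lm 0) x"
  have xL: "x \<notin> Lm 0"
  proof
    assume "x \<in> Lm 0"
    then have "x \<otimes> \<one> \<in> k" using Lm0_Rd[OF x_in[of 0]] x by simp
    then have "\<one> = \<zero>" by (rule strip0[OF k_Rd[OF kD(2), of 0]])
    then show False by simp
  qed
  have A: "subsp Kk (reg_mod L) ?A" using Lk.adj_subsp[OF Lm_subsp] x by simp
  have yA: "y \<notin> ?A"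
  proof
    assume "y \<in> ?A"
    then obtain l a where la: "y = l \<oplus> a \<otimes> x" "l \<in> Lm 0" "a \<in> k" unfolding adj_def by auto
    have cc: "l \<in> carrier L" "a \<in> carrier L" using la Lm_car k_sub by auto
    have "l \<oplus> x \<otimes> a \<oplus> (\<ominus> \<one>) \<otimes> y = (l \<oplus> a \<otimes> x) \<ominus> y"
      using cc x y by (simp add: a_minus_def l_minus m_comm[of x a])
    also have "\<dots> = \<zero>" using la(1) y by (metis a_minus_def r_neg)
    finally have "\<ominus> \<one> = \<zero>" using free'(1)[OF la(2) k_Rd[OF la(3), of 0] kD(5)[OF kD(2)]] by simp
    then show False by (metis minus_minus minus_zero one_closed one_not_zero)
  qed
  have "adj Kk (reg_mod L) ?A y = Lm 1"
  proof
    show "adj Kk (reg_mod L) ?A y \<subseteq> Lm 1"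
      by (rule Lk.adj_least[OF Lm_subsp Lk.adj_least[OF Lm_subsp Lm_mono x_Lm] y_Lm]) simp
    show "Lm 1 \<subseteq> adj Kk (reg_mod L) ?A y"
      using Lm1 unfolding adj_def by fastforce
  qed
  moreover have "qdim Kk (reg_mod L) (Lm 0) (adj Kk (reg_mod L) ?A y) (Suc (Suc 0))"
    by (intro qdim.intros Lm_subsp) (use x y xL yA in auto)
  ultimately show ?case by (simp add: numeral_2_eq_2)
next
  case (step1 i)
  show ?case by (rule Lm_dim_shift[OF step1(2) x]) (use Lm_x Lm_xinv in auto)
next
  case (step2 i)
  have ii: "inv (inv x) = x" "inv x \<noteq> \<zero>" using x field_Units xinv by (auto simp: Units_inv_inv)
  show ?case using Lm_dim_shift[OF step2(2) xinv(1) ii(2), of "-1"] Lm_x Lm_xinv ii by simp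
qed

text \<open>The Horner form splits the polynomials of degree \<open>d + 1\<close> into
  \<open>x\<close> times those of degree \<open>d\<close>, and the span of \<open>1\<close> and
  \<open>y\<close>.\<close>

lemma Rd_dim: "qdim Kk (reg_mod L) {\<zero>} (Rd d) (2 * d + 1)"
proof (induction d)
  case 0
  have "adj Kk (reg_mod L) {\<zero>} \<one> = k" unfolding adj_def using k_sub by force
  moreover have "qdim Kk (reg_mod L) {\<zero>} (adj Kk (reg_mod L) {\<zero>} \<one>) (Suc 0)"
    by (intro qdim.intros) (use Lk.subsp_zero in auto)
  ultimately show ?case by simp
next
  case (Suc d)
  let ?xR = "(\<lambda>z. x \<otimes> z) ` Rd d"
  have z: "subsp Kk (reg_mod L) {\<zero>}" using Lk.subsp_zero by simp
  have "qdim Kk (reg_mod L) {\<zero>} (ssum (reg_mod L) {\<zero>} ?xR) (2 * d + 1)"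
  proof (rule qdim_map[OF Lk.vecsp_axioms Lk.vecsp_axioms Suc])
    fix z assume z: "z \<in> Rd d"
    show "x \<otimes> z \<in> carrier (reg_mod L)" using x Rd_car[OF z] by simp
    show "(x \<otimes> z \<in> {\<zero>}) = (z \<in> {\<zero>})" using x Rd_car[OF z] integral_iff by auto
    fix w assume w: "w \<in> Rd d"
    show "x \<otimes> (z \<oplus>\<^bsub>reg_mod L\<^esub> w) = x \<otimes> z \<oplus>\<^bsub>reg_mod L\<^esub> x \<otimes> w" using x Rd_car[OF z] Rd_car[OF w] by (simp add: r_distr)
  next
    fix b z assume "b \<in> carrier Kk" "z \<in> Rd d"
    then show "x \<otimes> (b \<odot>\<^bsub>reg_mod L\<^esub> z) = b \<odot>\<^bsub>reg_mod L\<^esub> (x \<otimes> z)" using x k_sub Rd_car by (simp add: m_ac)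
  qed (rule z)
  moreover have "ssum (reg_mod L) {\<zero>} ?xR = ?xR" unfolding ssum_def using x Rd_car by force
  ultimately have q: "qdim Kk (reg_mod L) {\<zero>} ?xR (2 * d + 1)" by simp
  have 1: "\<one> \<notin> ?xR"
  proof
    assume "\<one> \<in> ?xR"
    then obtain z where z: "z \<in> Rd d" "\<one> = x \<otimes> z" by auto
    then have "z = \<zero>" using strip0[OF z(1)] kD by simp
    then show False using z x by simp
  qed
  let ?A = "adj Kk (reg_mod L) ?xR \<one>"
  have yA: "y \<notin> ?A"
  proof
    assume "y \<in> ?A"
    then obtain r a where la: "y = x \<otimes> r \<oplus> a" "r \<in> Rd d" "a \<in> k" unfolding adj_def using k_sub by auto
    have cc: "r \<in> carrier L" "a \<in> carrier L" using la Rd_car k_sub by auto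
    have "a \<oplus> (\<ominus> \<one>) \<otimes> y \<oplus> x \<otimes> r = (x \<otimes> r \<oplus> a) \<ominus> y"
      using cc x y by (simp add: a_minus_def l_minus a_ac)
    also have "\<dots> = \<zero>" using la(1) y by (metis a_minus_def r_neg)
    finally have "\<ominus> \<one> = \<zero>" using free[OF la(3) kD(5)[OF kD(2)] la(2)] by simp
    then show False by (metis minus_minus minus_zero one_closed one_not_zero)
  qed
  have "adj Kk (reg_mod L) ?A y = Rd (Suc d)"
  proof (intro equalityI subsetI)
    fix w assume "w \<in> adj Kk (reg_mod L) ?A y"
    then obtain z a b where w: "w = x \<otimes> z \<oplus> a \<oplus> b \<otimes> y" "z \<in> Rd d" "a \<in> k" "b \<in> k"
      unfolding adj_def using k_sub by auto
    then have "w = a \<oplus> b \<otimes> y \<oplus> x \<otimes> z" using x y Rd_car k_sub by (simp add: a_ac)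
    then show "w \<in> Rd (Suc d)" using w by auto
  next
    fix w assume "w \<in> Rd (Suc d)"
    then obtain a b z where w: "w = a \<oplus> b \<otimes> y \<oplus> x \<otimes> z" "a \<in> k" "b \<in> k" "z \<in> Rd d" by auto
    then have "w = x \<otimes> z \<oplus> a \<otimes> \<one> \<oplus> b \<otimes> y" using x y Rd_car k_sub by (simp add: a_ac)
    moreover have "x \<otimes> z \<oplus> a \<otimes> \<one> \<in> ?A" using w unfolding adj_def by auto
    ultimately show "w \<in> adj Kk (reg_mod L) ?A y" using w unfolding adj_def[of _ _ ?A] by auto
  qed
  moreover have "qdim Kk (reg_mod L) {\<zero>} (adj Kk (reg_mod L) ?A y) (Suc (Suc (2 * d + 1)))"
    by (intro qdim.intros q) (use 1 y yA in auto)
  ultimately show ?case by simp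
qed

lemma filt:
  assumes fractions: "\<And>z. z \<in> carrier L \<Longrightarrow> \<exists>d d' q. q \<in> Rd d \<and> q \<noteq> \<zero> \<and> q \<otimes> z \<in> Rd d'"
  shows "filt L k Rd Lm x c"
proof (intro filt.intro filt_axioms.intro field_axioms)
  fix z w :: 'l and e :: int and f :: int and d d' :: nat and a :: 'l
  show "subfield k L" "subsp Kk (reg_mod L) (Rd d)" "subsp Kk (reg_mod L) (Lm e)" "Rd d \<subseteq> Lm (int d)"
    by (fact k Rd_subsp Lm_subsp Rd_Lm)+
  show "z \<in> Rd d \<Longrightarrow> z \<in> Lm (int d') \<Longrightarrow> z \<in> Rd d'" by (rule Rd_inter)
  show "z \<in> Rd d \<Longrightarrow> z \<in> Lm (-1) \<Longrightarrow> z = \<zero>" by (rule Rd_neg_zero)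
  show "Lm e \<subseteq> Lm (e + 1)" by (rule Lm_mono) simp
  show "z \<in> Lm e \<Longrightarrow> w \<in> Lm f \<Longrightarrow> z \<otimes> w \<in> Lm (e + f)" by (rule Lm_mult)
  show "z \<in> Rd d \<Longrightarrow> w \<in> Rd d' \<Longrightarrow> z \<otimes> w \<in> Rd (d + d')" by (rule Rd_mult)
  show "x \<in> Rd 1" using x_in[of 0] by simp
  show "x \<noteq> \<zero>" "inv x \<in> Lm (-1)" by (fact x xinv_Lm)+
  show "qdim Kk (reg_mod L) {\<zero>} (Rd d) (2 * d + 1)" "qdim Kk (reg_mod L) (Lm (e - 1)) (Lm e) 2" by (fact Rd_dim Lm_dim)+
  show "Rd 0 = k" by simp
  show "c z \<in> k" if z: "z \<in> Lm e"
    using c_decomp[OF z] c_eq by metis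
  show "c (z \<oplus> w) = c z \<oplus> c w" if zw: "z \<in> Lm e" "w \<in> Lm e"
  proof -
    obtain l d r b where 1: "l \<in> Lm 0" "r \<in> Rd d" "b \<in> k" "z = l \<oplus> x \<otimes> r \<oplus> b \<otimes> y" using c_decomp[OF zw(1)] by blast
    obtain l' d' r' b' where 2: "l' \<in> Lm 0" "r' \<in> Rd d'" "b' \<in> k" "w = l' \<oplus> x \<otimes> r' \<oplus> b' \<otimes> y" using c_decomp[OF zw(2)] by blast
    have "r \<oplus> r' \<in> Rd (max d d')"
      using 1 2 Rd_mono[of d "max d d'"] Rd_mono[of d' "max d d'"] by (intro Rd_add) auto
    moreover have "z \<oplus> w = (l \<oplus> l') \<oplus> x \<otimes> (r \<oplus> r') \<oplus> (b \<oplus> b') \<otimes> y"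
      unfolding 1(4) 2(4) using 1 2 Lm_car Rd_car k_sub x y by (simp add: r_distr l_distr a_ac)
    ultimately have "c (z \<oplus> w) = b \<oplus> b'" using c_eq[OF Lm_add[OF 1(1) 2(1)] _ kD(3)[OF 1(3) 2(3)]] by blast
    then show ?thesis using c_eq[OF 1] c_eq[OF 2] by simp
  qed
  show "c (a \<otimes> z) = a \<otimes> c z" if az: "a \<in> k" "z \<in> Lm e"
  proof -
    obtain l d r b where 1: "l \<in> Lm 0" "r \<in> Rd d" "b \<in> k" "z = l \<oplus> x \<otimes> r \<oplus> b \<otimes> y" using c_decomp[OF az(2)] by blast
    have "a \<otimes> z = (a \<otimes> l) \<oplus> x \<otimes> (a \<otimes> r) \<oplus> (a \<otimes> b) \<otimes> y"
      unfolding 1(4) using 1 az Lm_car Rd_car k_sub x y by (simp add: r_distr m_ac)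
    then have "c (a \<otimes> z) = a \<otimes> b" by (rule c_eq[OF LmD(2)[OF az(1) 1(1)] Rd_smult[OF az(1) 1(2)] kD(4)[OF az(1) 1(3)]])
    then show ?thesis using c_eq[OF 1] by simp
  qed
  show "c z = \<zero>" if "z \<in> Lm 0"
    by (rule c_eq[OF that Rd_zero kD(1)]) (use that Lm_car x y in simp)
  show "c (x \<otimes> z) = \<zero>" if "z \<in> Rd d"
    by (rule c_eq[OF LmD(1) that kD(1)]) (use that Rd_car x y in simp)
  show "z \<in> Lm 0" if z: "z \<in> Lm 1" "\<And>w. w \<in> Lm 0 \<Longrightarrow> c (w \<otimes> z) = \<zero>"
  proof -
    obtain l a b where 1: "l \<in> Lm 0" "a \<in> k" "b \<in> k" "z = l \<oplus> a \<otimes> x \<oplus> b \<otimes> y" using Lm1[OF z(1)] by blast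
    have cc: "l \<in> carrier L" "a \<in> carrier L" "b \<in> carrier L" using 1 Lm_car k_sub by auto
    have "c z = b" by (rule c_eq[OF 1(1) k_Rd[OF 1(2)] 1(3)]) (use 1(4) cc x in \<open>simp add: m_comm\<close>)
    moreover have "c z = \<zero>" using z(2)[OF k_Lm[OF kD(2)]] Lm_car[OF z(1)] by simp
    ultimately have b: "b = \<zero>" by simp
    \<comment> \<open>Testing with 1 has removed the \<open>y\<close> coefficient. The function
      \<open>y / x\<close> has order 0 and turns \<open>a x\<close> into \<open>a y\<close>, so
      testing with it exposes the other coefficient.\<close>
    let ?w = "inv x \<otimes> y"
    have w: "?w \<in> Lm 0" using Lm_mult[OF xinv_Lm y_Lm] by simp
    have wc: "?w \<in> carrier L" using w Lm_car by auto
    have "?w \<otimes> z = ?w \<otimes> l \<oplus> a \<otimes> ((inv x \<otimes> x) \<otimes> y)"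
      unfolding 1(4) b using cc x y xinv(1) by (simp add: r_distr m_ac)
    then have "?w \<otimes> z = ?w \<otimes> l \<oplus> x \<otimes> \<zero> \<oplus> a \<otimes> y" using cc x y xinv wc by simp
    moreover have "?w \<otimes> l \<in> Lm 0" using Lm_mult[OF w 1(1)] by simp
    ultimately have "c (?w \<otimes> z) = a" using c_eq[OF _ Rd_zero 1(2)] by blast
    then have "a = \<zero>" using z(2)[OF w] by simp
    then show ?thesis using 1(1,4) b cc x y by simp
  qed
  show "\<exists>d d' q. q \<in> Rd d \<and> q \<noteq> \<zero> \<and> q \<otimes> z \<in> Rd d'" if "z \<in> carrier L" using fractions[OF that] .
  show "\<exists>N d. x [^] (N::nat) \<otimes> z \<in> Rd d" if "z \<in> Lm e" using that unfolding Lm_def by blast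
qed

end

section \<open>Evaluation of polynomials in two variables\<close>

lemma eval_two_variables:
  assumes F: "cring F" and S: "cring S" and h: "h \<in> ring_hom F S" and s: "s \<in> carrier S" and t: "t \<in> carrier S"
  shows "eval (UP F) S (eval F S h s) t \<in> ring_hom (UP (UP F)) S"
    and "c \<in> carrier F \<Longrightarrow> eval (UP F) S (eval F S h s) t (monom (UP (UP F)) (monom (UP F) c 0) 0) = h c"
    and "eval (UP F) S (eval F S h s) t (monom (UP (UP F)) (monom (UP F) \<one>\<^sub>F 1) 0) = s"
    and "eval (UP F) S (eval F S h s) t (monom (UP (UP F)) \<one>\<^bsub>UP F\<^esub> 1) = t"
proof -
  interpret F: cring F by fact
  interpret S: cring S by fact
  interpret U: UP_cring F "UP F" by unfold_locales auto
  interpret E1: UP_pre_univ_prop F S h "UP F"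
    by unfold_locales (use h in auto)
  have e1: "eval F S h s \<in> ring_hom (UP F) S" using E1.eval_ring_hom[OF s] .
  interpret UU: UP_cring "UP F" "UP (UP F)" by unfold_locales auto
  interpret E2: UP_pre_univ_prop "UP F" S "eval F S h s" "UP (UP F)"
    by unfold_locales (use e1 in auto)
  show "eval (UP F) S (eval F S h s) t \<in> ring_hom (UP (UP F)) S" using E2.eval_ring_hom[OF t] .
  show "eval (UP F) S (eval F S h s) t (monom (UP (UP F)) (monom (UP F) c 0) 0) = h c" if "c \<in> carrier F"
    using E2.eval_const[OF t] E1.eval_const[OF s] that by simp
  show "eval (UP F) S (eval F S h s) t (monom (UP (UP F)) (monom (UP F) \<one>\<^sub>F 1) 0) = s"
    using E2.eval_const[OF t] E1.eval_monom1[OF s] by simp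
  show "eval (UP F) S (eval F S h s) t (monom (UP (UP F)) \<one>\<^bsub>UP F\<^esub> 1) = t"
    using E2.eval_monom1[OF t] by simp
qed

lemma eval_two_variables_mem:
  assumes F: "cring F" and S: "cring S" and h: "h \<in> ring_hom F S" and s: "s \<in> carrier S" and t: "t \<in> carrier S"
    and W: "W \<subseteq> carrier S" "\<one>\<^sub>S \<in> W" "\<zero>\<^sub>S \<in> W" "\<And>a b. a \<in> W \<Longrightarrow> b \<in> W \<Longrightarrow> a \<oplus>\<^sub>S b \<in> W"
      "\<And>a b. a \<in> W \<Longrightarrow> b \<in> W \<Longrightarrow> a \<otimes>\<^sub>S b \<in> W"
    and hst: "\<And>c. c \<in> carrier F \<Longrightarrow> h c \<in> W" "s \<in> W" "t \<in> W"
    and P: "P \<in> carrier (UP (UP F))"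
  shows "eval (UP F) S (eval F S h s) t P \<in> W"
proof -
  interpret F: cring F by fact
  interpret S: cring S by fact
  interpret U: UP_cring F "UP F" by unfold_locales auto
  interpret UU: UP_cring "UP F" "UP (UP F)" by unfold_locales auto
  have sum: "(\<Oplus>\<^sub>S i\<in>I. f i) \<in> W" if "finite I" "\<And>i. i \<in> I \<Longrightarrow> f i \<in> W" for I :: "nat set" and f
    using that
  proof (induction I rule: finite_induct)
    case (insert i I)
    then have "f \<in> I \<rightarrow> carrier S" "f i \<in> carrier S" using W(1) by auto
    then show ?case using insert W(4) by simp
  qed (simp add: W(3))
  have pow: "w [^]\<^bsub>S\<^esub> (n::nat) \<in> W" if "w \<in> W" for w n
    by (induction n) (use W that in auto)
  have 1: "eval F S h s p \<in> W" if "p \<in> carrier (UP F)" for p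
    unfolding U.eval_on_carrier[OF that]
    by (rule sum) (use that W(5) hst pow in auto)
  show ?thesis unfolding UU.eval_on_carrier[OF P]
    by (rule sum) (use P W(5) hst pow 1 in auto)
qed

lemma conic_eval_hom:
  assumes P: "cring P" and S: "cring S" and h: "h \<in> ring_hom P S" and xyz: "x \<in> carrier P" "y \<in> carrier P" "z \<in> carrier P"
    and i: "\<And>c. c \<in> {cxx C, cyy C, czz C, cxy C, cxz C, cyz C} \<Longrightarrow> i c \<in> carrier P"
  shows "h (conic_eval P i C x y z) = conic_eval S (\<lambda>c. h (i c)) C (h x) (h y) (h z)"
proof -
  interpret P: cring P by fact
  interpret S: cring S by fact
  interpret h: ring_hom_cring P S h by unfold_locales (use h in auto)
  show ?thesis unfolding conic_eval_def using i xyz by simp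
qed

text \<open>Over a field degrees add, so a nonzero multiple of \<open>f\<close> has degree at least
  2.\<close>

lemma multiple_of_quadratic:
  assumes F: "field F" and p: "p \<in> carrier (UP F)" "deg F p \<le> 1" and q: "q \<in> carrier (UP F)"
    and f: "f \<in> carrier (UP F)" "coeff (UP F) f 2 \<noteq> \<zero>\<^sub>F" and e: "p = q \<otimes>\<^bsub>UP F\<^esub> f"
  shows "p = \<zero>\<^bsub>UP F\<^esub>"
proof -
  interpret F: field F by fact
  interpret U: UP_domain F "UP F" by unfold_locales auto
  have "2 \<le> deg F f" using U.deg_belowI[of 2 f] f by auto
  moreover have "f \<noteq> \<zero>\<^bsub>UP F\<^esub>" using f(2) U.coeff_zero[of 2] by auto
  ultimately show ?thesis using e p q f(1) U.deg_mult[of q f] by (cases "q = \<zero>\<^bsub>UP F\<^esub>") auto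
qed

section \<open>The conic as a quadratic extension of the rational function field\<close>

locale conic_setup =
  fixes F :: "'f ring" and C :: "'f conic" and L :: "('f, 'l) module"
  assumes F: "field F" and smooth: "smooth_conic F C" and no_pt: "\<not> has_rational_point F C"
    and cff: "conic_function_field F C L"
begin

sublocale F: field F by (rule F)
sublocale Lf: field L using cff unfolding conic_function_field_def by simp
sublocale L: algebra F L using cff unfolding conic_function_field_def by simp

definition \<iota> :: "'f \<Rightarrow> 'l" where "\<iota> c = c \<odot>\<^sub>L \<one>\<^sub>L"

lemma iota_hom: "\<iota> \<in> ring_hom F L"
proof (rule ring_hom_memI)
  fix a b assume ab: "a \<in> carrier F" "b \<in> carrier F"
  show "\<iota> (a \<otimes>\<^sub>F b) = \<iota> a \<otimes>\<^sub>L \<iota> b"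
    unfolding \<iota>_def using ab by (simp add: L.smult_assoc1 L.smult_assoc2)
  show "\<iota> (a \<oplus>\<^sub>F b) = \<iota> a \<oplus>\<^sub>L \<iota> b" unfolding \<iota>_def using ab by (simp add: L.smult_l_distr)
qed (simp_all add: \<iota>_def)

lemma coeffs: "c \<in> {cxx C, cyy C, czz C, cxy C, cxz C, cyz C} \<Longrightarrow> c \<in> carrier F"
  using smooth unfolding smooth_conic_def conic_over_def by auto

lemma coeffs_simps [simp]:
  "cxx C \<in> carrier F" "cyy C \<in> carrier F" "czz C \<in> carrier F" "cxy C \<in> carrier F" "cxz C \<in> carrier F" "cyz C \<in> carrier F"
  using coeffs by auto

text \<open>The point \<open>(0 : 1 : 0)\<close> is not on the conic, so \<open>y\<close> is integral over \<open>F[x]\<close>.\<close>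

lemma cyy_nonzero: "cyy C \<noteq> \<zero>\<^sub>F"
proof
  assume "cyy C = \<zero>\<^sub>F"
  then have "conic_eval F id C \<zero>\<^sub>F \<one>\<^sub>F \<zero>\<^sub>F = \<zero>\<^sub>F" unfolding conic_eval_def by simp
  then have "has_rational_point F C" unfolding has_rational_point_def
    by (intro bexI[of _ "\<zero>\<^sub>F"] bexI[of _ "\<one>\<^sub>F"]) auto
  then show False using no_pt by simp
qed

abbreviation "A1 \<equiv> UP F"
abbreviation "A2 \<equiv> UP (UP F)"
abbreviation "cst c \<equiv> monom A2 (monom A1 c 0) 0"
abbreviation "VX \<equiv> monom A2 (monom A1 \<one>\<^sub>F 1) 0"
abbreviation "VY \<equiv> monom A2 \<one>\<^sub>A1 1"

sublocale U: UP_domain F A1 by unfold_locales auto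
sublocale UU: UP_cring A1 A2 by unfold_locales auto

lemma A2_closed: "c \<in> carrier F \<Longrightarrow> cst c \<in> carrier A2" "VX \<in> carrier A2" "VY \<in> carrier A2"
  by auto

lemma conic_affine_alt: "conic_affine F C = conic_eval A2 cst C VX VY \<one>\<^sub>A2"
  unfolding conic_affine_def Let_def by simp

lemma conic_affine_closed: "conic_affine F C \<in> carrier A2"
  unfolding conic_affine_alt conic_eval_def using A2_closed by (auto simp del: UU.monom_mult)

text \<open>Substitution of the constant \<open>t\<close> for the inner variable \<open>X\<close>.
  The equation of the conic becomes a quadratic polynomial in \<open>Y\<close> with leading
  coefficient \<open>cyy C\<close>.\<close>

definition spec :: "'f \<Rightarrow> (nat \<Rightarrow> nat \<Rightarrow> 'f) \<Rightarrow> nat \<Rightarrow> 'f" where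
  "spec t = eval A1 A1 (eval F A1 (\<lambda>a. monom A1 a 0) (monom A1 t 0)) (monom A1 \<one>\<^sub>F 1)"

lemma spec:
  assumes t: "t \<in> carrier F"
  shows "spec t \<in> ring_hom A2 A1" "c \<in> carrier F \<Longrightarrow> spec t (cst c) = monom A1 c 0"
    "spec t VX = monom A1 t 0" "spec t VY = monom A1 \<one>\<^sub>F 1"
proof -
  have h: "(\<lambda>a. monom A1 a 0) \<in> ring_hom F A1" by (rule U.const_ring_hom)
  have 1: "monom A1 t 0 \<in> carrier A1" "monom A1 \<one>\<^sub>F 1 \<in> carrier A1" using t by auto
  note e = eval_two_variables[OF F.is_cring U.UP_cring[OF ] h 1, folded spec_def]
  show "spec t \<in> ring_hom A2 A1" "c \<in> carrier F \<Longrightarrow> spec t (cst c) = monom A1 c 0"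
    "spec t VX = monom A1 t 0" "spec t VY = monom A1 \<one>\<^sub>F 1" using e by simp_all
qed

lemma spec_affine:
  assumes t: "t \<in> carrier F"
  shows "spec t (conic_affine F C) \<in> carrier A1" "coeff A1 (spec t (conic_affine F C)) 2 = cyy C"
proof -
  show c: "spec t (conic_affine F C) \<in> carrier A1" using ring_hom_closed[OF spec(1)[OF t] conic_affine_closed] .
  have "spec t (conic_affine F C) = conic_eval A1 (\<lambda>c. spec t (cst c)) C (spec t VX) (spec t VY) (spec t \<one>\<^sub>A2)"
    unfolding conic_affine_alt
    by (rule conic_eval_hom[OF UU.UP_cring U.UP_cring spec(1)[OF t]]) (use A2_closed coeffs in auto)
  also have "\<dots> = conic_eval A1 (\<lambda>c. monom A1 c 0) C (monom A1 t 0) (monom A1 \<one>\<^sub>F 1) (monom A1 \<one>\<^sub>F 0)"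
    unfolding conic_eval_def using spec[OF t] ring_hom_one[OF spec(1)[OF t]] by simp
  finally have "spec t (conic_affine F C) = \<dots>" .
  then show "coeff A1 (spec t (conic_affine F C)) 2 = cyy C"
    unfolding conic_eval_def using t by (simp del: U.coeff_mult U.P_def add: U.monom_mult[symmetric] U.monom_mult)
qed

text \<open>The way to use that the kernel of evaluation is generated by the conic: a relation that
  is at most linear in \<open>Y\<close> after setting \<open>X = t\<close> vanishes there.\<close>

lemma spec_multiple:
  assumes t: "t \<in> carrier F" and g: "g \<in> carrier A2" and G: "G = g \<otimes>\<^sub>A2 conic_affine F C" "deg F (spec t G) \<le> 1"
  shows "spec t G = \<zero>\<^sub>A1"
proof -
  have Gc: "G \<in> carrier A2" unfolding G using g conic_affine_closed by simp
  have "spec t G = spec t g \<otimes>\<^sub>A1 spec t (conic_affine F C)"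
    unfolding G using ring_hom_mult[OF spec(1)[OF t] g conic_affine_closed] .
  then show ?thesis
    using multiple_of_quadratic[OF F ring_hom_closed[OF spec(1)[OF t] Gc] G(2) ring_hom_closed[OF spec(1)[OF t] g] spec_affine(1)[OF t]]
      spec_affine(2)[OF t] cyy_nonzero by simp
qed

definition k :: "'l set" where "k = \<iota> ` carrier F"

lemma k_subfield: "subfield k L"
proof -
  interpret h: ring_hom_ring F L \<iota> by unfold_locales (rule iota_hom)
  have "subfield (carrier F) F" using F.carrier_is_subfield .
  then show ?thesis unfolding k_def using h.img_is_subfield(2)[of "carrier F"] Lf.one_not_zero by auto
qed

lemma iota_closed: "c \<in> carrier F \<Longrightarrow> \<iota> c \<in> carrier L" using ring_hom_closed[OF iota_hom] .

text \<open>The relation for \<open>y^2\<close> comes from the equation, divided by its nonzero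
  \<open>Y^2\<close> coefficient. That \<open>x\<close> is nonzero and that \<open>1\<close> and
  \<open>y\<close> are independent modulo \<open>x\<close> follows by specialising relations at
  \<open>X = 1\<close> and \<open>X = 0\<close>.\<close>

lemma quad_ext: "\<exists>x y. quad_ext L k x y \<and> (\<forall>z\<in>carrier L. \<exists>d d' q. q \<in> horner L k x y d \<and>
    q \<noteq> \<zero>\<^sub>L \<and> q \<otimes>\<^sub>L z \<in> horner L k x y d')"
proof -
  obtain x y where x: "x \<in> carrier L" and y: "y \<in> carrier L"
    and ker: "a_kernel A2 L (eval_xy F L x y) = PIdl\<^bsub>A2\<^esub> (conic_affine F C)"
    and frac: "\<And>u. u \<in> carrier L \<Longrightarrow> \<exists>P\<in>carrier A2. \<exists>Q\<in>carrier A2.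
           eval_xy F L x y Q \<noteq> \<zero>\<^sub>L \<and> u \<otimes>\<^sub>L eval_xy F L x y Q = eval_xy F L x y P"
    using cff unfolding conic_function_field_def by blast
  define E where "E = eval_xy F L x y"
  have E_alt: "E = eval A1 L (eval F L \<iota> x) y"
    unfolding E_def eval_xy_def \<iota>_def by simp
  note e = eval_two_variables[OF F.is_cring Lf.is_cring iota_hom x y, folded E_alt]
  have kerD: "\<exists>g\<in>carrier A2. G = g \<otimes>\<^sub>A2 conic_affine F C" if "G \<in> carrier A2" "E G = \<zero>\<^sub>L" for G
  proof -
    have "G \<in> a_kernel A2 L E" using that unfolding a_kernel_def' by simp
    then show ?thesis using ker unfolding E_def cgenideal_def by auto
  qed
  \<comment> \<open>If \<open>x\<close> were 0, the variable \<open>X\<close> would be a multiple of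
    the equation; at \<open>X = 1\<close> it becomes 1, of degree 0 and nonzero.\<close>
  have x0: "x \<noteq> \<zero>\<^sub>L"
  proof
    assume "x = \<zero>\<^sub>L"
    then obtain g where g: "g \<in> carrier A2" "VX = g \<otimes>\<^sub>A2 conic_affine F C" using kerD[OF A2_closed(2)] e(3) by auto
    have 1: "spec \<one>\<^sub>F VX = \<one>\<^sub>A1" using spec(3)[of "\<one>\<^sub>F"] U.monom_one by simp
    have "spec \<one>\<^sub>F VX = \<zero>\<^sub>A1" proof (rule spec_multiple[OF _ g])
      show "deg F (spec \<one>\<^sub>F VX) \<le> 1" unfolding 1 by simp
    qed simp
    then show False using 1 U.UP_one_not_zero by simp
  qed
  have Q: "quad_ext L k x y"
  proof (intro quad_ext.intro quad_ext_axioms.intro Lf.field_axioms k_subfield x x0 y)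
    let ?R = "horner L k x y"
    have k0: "\<iota> c \<in> k" if "c \<in> carrier F" for c using that unfolding k_def by auto
    have E0: "E (conic_affine F C) = \<zero>\<^sub>L"
    proof -
      have "conic_affine F C \<in> PIdl\<^bsub>A2\<^esub> (conic_affine F C)" using UU.P.cgenideal_self[OF conic_affine_closed] .
      then show ?thesis using ker unfolding E_def a_kernel_def' by auto
    qed
    have "E (conic_affine F C) = conic_eval L (\<lambda>c. E (cst c)) C (E VX) (E VY) (E \<one>\<^sub>A2)"
      unfolding conic_affine_alt
      by (rule conic_eval_hom[OF UU.UP_cring Lf.is_cring e(1)]) (use A2_closed coeffs in auto)
    also have "\<dots> = conic_eval L \<iota> C x y \<one>\<^sub>L"
      unfolding conic_eval_def using e ring_hom_one[OF e(1)] by simp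
    finally have rel: "conic_eval L \<iota> C x y \<one>\<^sub>L = \<zero>\<^sub>L" using E0 by simp
    show "y \<otimes>\<^sub>L y \<in> ?R 2"
    proof -
      have io: "\<iota> (cxx C) \<in> carrier L" "\<iota> (cyy C) \<in> carrier L" "\<iota> (czz C) \<in> carrier L" "\<iota> (cxy C) \<in> carrier L" 
        "\<iota> (cxz C) \<in> carrier L" "\<iota> (cyz C) \<in> carrier L" by (auto intro: iota_closed)
      define j where "j = inv\<^bsub>F\<^esub> (cyy C)"
      have j: "j \<in> carrier F" "j \<otimes>\<^sub>F cyy C = \<one>\<^sub>F" unfolding j_def using cyy_nonzero F.field_Units by auto
      define q where "q = \<ominus>\<^sub>L \<iota> j"
      have q: "q \<in> carrier L" "\<iota> j \<in> carrier L" unfolding q_def using iota_closed[OF j(1)] by auto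
      have jy: "\<iota> j \<otimes>\<^sub>L \<iota> (cyy C) = \<one>\<^sub>L"
        using ring_hom_mult[OF iota_hom j(1), of "cyy C"] j(2) ring_hom_one[OF iota_hom] by simp
      \<comment> \<open>All terms of the equation except the one in \<open>y^2\<close>, arranged in
        Horner form of degree 2.\<close>
      define S where "S = \<iota> (czz C) \<oplus>\<^sub>L \<iota> (cyz C) \<otimes>\<^sub>L y \<oplus>\<^sub>L x \<otimes>\<^sub>L (\<iota> (cxz C) \<oplus>\<^sub>L \<iota> (cxy C) \<otimes>\<^sub>L y \<oplus>\<^sub>L x \<otimes>\<^sub>L \<iota> (cxx C))"
      have Sc: "S \<in> carrier L" unfolding S_def using io x y by simp
      have yy: "y \<otimes>\<^sub>L y \<in> carrier L" using y by simp
      have "\<iota> (cyy C) \<otimes>\<^sub>L (y \<otimes>\<^sub>L y) \<oplus>\<^sub>L S = \<zero>\<^sub>L"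
        using rel io x y unfolding conic_eval_def S_def by (simp add: Lf.r_distr Lf.a_ac Lf.m_ac)
      then have "\<iota> (cyy C) \<otimes>\<^sub>L (y \<otimes>\<^sub>L y) = \<ominus>\<^sub>L S" using io yy Sc Lf.minus_equality by (metis Lf.m_closed)
      then have "\<iota> j \<otimes>\<^sub>L (\<iota> (cyy C) \<otimes>\<^sub>L (y \<otimes>\<^sub>L y)) = q \<otimes>\<^sub>L S"
        unfolding q_def using q Sc by (simp add: Lf.l_minus Lf.r_minus)
      then have "y \<otimes>\<^sub>L y = q \<otimes>\<^sub>L S" using jy io yy q by (simp add: Lf.m_assoc[symmetric] del: Lf.m_assoc)
      also have "\<dots> = q \<otimes>\<^sub>L \<iota> (czz C) \<oplus>\<^sub>L (q \<otimes>\<^sub>L \<iota> (cyz C)) \<otimes>\<^sub>L y \<oplus>\<^sub>L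
          x \<otimes>\<^sub>L (q \<otimes>\<^sub>L \<iota> (cxz C) \<oplus>\<^sub>L (q \<otimes>\<^sub>L \<iota> (cxy C)) \<otimes>\<^sub>L y \<oplus>\<^sub>L x \<otimes>\<^sub>L (q \<otimes>\<^sub>L \<iota> (cxx C)))"
        unfolding S_def using io q x y by (simp add: Lf.r_distr Lf.m_ac)
      finally have yy2: "y \<otimes>\<^sub>L y = \<dots>" .
      have qk: "q \<otimes>\<^sub>L \<iota> c \<in> k" if "c \<in> carrier F" for c
        using subringE(5,6)[OF subfieldE(1)[OF k_subfield]] k0[OF j(1)] k0[OF that] unfolding q_def by auto
      show ?thesis unfolding numeral_2_eq_2 horner.simps yy2
        using qk[of "czz C"] qk[of "cyz C"] qk[of "cxz C"] qk[of "cxy C"] qk[of "cxx C"] by fastforce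
    qed
    \<comment> \<open>Elements of the Horner spaces are lifted to polynomials, so that a relation
      between them becomes a statement about the kernel of evaluation.\<close>
    have surj: "\<exists>P\<in>carrier A2. E P = z" if "z \<in> ?R d" for z d
      using that
    proof (induction d arbitrary: z)
      case 0
      then obtain c where c: "c \<in> carrier F" "z = \<iota> c" unfolding k_def by auto
      show ?case by (rule bexI[of _ "cst c"]) (use c e(2) A2_closed(1) in auto)
    next
      case (Suc d)
      then obtain a b w where z: "z = \<iota> a \<oplus>\<^sub>L \<iota> b \<otimes>\<^sub>L y \<oplus>\<^sub>L x \<otimes>\<^sub>L w" "a \<in> carrier F" "b \<in> carrier F" "w \<in> ?R d"
        unfolding k_def by auto
      obtain P where P: "P \<in> carrier A2" "E P = w" using Suc.IH[OF z(4)] by auto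
      have "E (cst a \<oplus>\<^sub>A2 cst b \<otimes>\<^sub>A2 VY \<oplus>\<^sub>A2 VX \<otimes>\<^sub>A2 P) = z"
        using z P e A2_closed by (simp add: ring_hom_add[OF e(1)] ring_hom_mult[OF e(1)] del: UU.monom_mult)
      moreover have "cst a \<oplus>\<^sub>A2 cst b \<otimes>\<^sub>A2 VY \<oplus>\<^sub>A2 VX \<otimes>\<^sub>A2 P \<in> carrier A2"
        using z P A2_closed by (simp del: UU.monom_mult)
      ultimately show ?case by (rule bexI)
    qed
    show "a = \<zero>\<^sub>L \<and> b = \<zero>\<^sub>L"
      if h: "a \<in> k" "b \<in> k" "z \<in> ?R d" "a \<oplus>\<^sub>L b \<otimes>\<^sub>L y \<oplus>\<^sub>L x \<otimes>\<^sub>L z = \<zero>\<^sub>L" for a b z d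
    proof -
      obtain a' b' where ab: "a' \<in> carrier F" "b' \<in> carrier F" "a = \<iota> a'" "b = \<iota> b'" using h unfolding k_def by auto
      obtain P where P: "P \<in> carrier A2" "E P = z" using surj[OF h(3)] by auto
      let ?G = "cst a' \<oplus>\<^sub>A2 cst b' \<otimes>\<^sub>A2 VY \<oplus>\<^sub>A2 VX \<otimes>\<^sub>A2 P"
      have G: "?G \<in> carrier A2" using ab P A2_closed by (simp del: UU.monom_mult)
      have "E ?G = \<zero>\<^sub>L"
        using h(4) ab P e A2_closed by (simp add: ring_hom_add[OF e(1)] ring_hom_mult[OF e(1)] del: UU.monom_mult)
      then obtain g where g: "g \<in> carrier A2" "?G = g \<otimes>\<^sub>A2 conic_affine F C" using kerD[OF G] by auto
      note s = spec[OF F.zero_closed]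
      \<comment> \<open>At \<open>X = 0\<close> the multiple of \<open>x\<close> disappears and
        \<open>a' + b' Y\<close> is left.\<close>
      have "spec \<zero>\<^sub>F ?G = monom A1 a' 0 \<oplus>\<^sub>A1 monom A1 b' 0 \<otimes>\<^sub>A1 monom A1 \<one>\<^sub>F 1 \<oplus>\<^sub>A1 monom A1 \<zero>\<^sub>F 0 \<otimes>\<^sub>A1 spec \<zero>\<^sub>F P"
        using s ab P A2_closed by (simp add: ring_hom_add[OF s(1)] ring_hom_mult[OF s(1)] del: UU.monom_mult U.monom_mult)
      also have "\<dots> = monom A1 a' 0 \<oplus>\<^sub>A1 monom A1 b' 1"
        using ab ring_hom_closed[OF s(1) P(1)] U.monom_mult[of b' "\<one>\<^sub>F" 0 1] by (simp del: U.monom_mult)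
      finally have sG: "spec \<zero>\<^sub>F ?G = monom A1 a' 0 \<oplus>\<^sub>A1 monom A1 b' 1" .
      have "deg F (monom A1 a' 0 \<oplus>\<^sub>A1 monom A1 b' 1) \<le> 1"
        by (rule U.deg_aboveI) (use ab in auto)
      then have "monom A1 a' 0 \<oplus>\<^sub>A1 monom A1 b' 1 = \<zero>\<^sub>A1"
        using spec_multiple[OF F.zero_closed g] sG by simp
      then have "coeff A1 (monom A1 a' 0 \<oplus>\<^sub>A1 monom A1 b' 1) i = \<zero>\<^sub>F" for i by simp
      from this[of 0] this[of 1] have "a' = \<zero>\<^sub>F" "b' = \<zero>\<^sub>F" using ab by simp_all
      then show ?thesis using ab unfolding \<iota>_def by simp
    qed
  qed
  interpret Q: quad_ext L k x y by (rule Q)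
  \<comment> \<open>The union of the Horner spaces is a ring containing the constants,
    \<open>x\<close> and \<open>y\<close>; hence it contains all values of polynomials, and
    fractions of values are fractions of its elements.\<close>
  have mem: "\<exists>d. E P \<in> horner L k x y d" if P: "P \<in> carrier A2" for P
  proof -
    have "E P \<in> (\<Union>d. horner L k x y d)"
      unfolding E_alt
    proof (rule eval_two_variables_mem[OF F.is_cring Lf.is_cring iota_hom x y _ _ _ _ _ _ _ _ P])
      show "(\<Union>d. horner L k x y d) \<subseteq> carrier L" using Q.Rd_car by auto
      show "\<one>\<^sub>L \<in> (\<Union>d. horner L k x y d)" using Q.k_Rd[OF Q.kD(2)] by blast
      show "\<zero>\<^sub>L \<in> (\<Union>d. horner L k x y d)" using Q.Rd_zero by blast
      show "\<iota> c \<in> (\<Union>d. horner L k x y d)" if "c \<in> carrier F" for c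
        using Q.k_Rd[of "\<iota> c" 0] that unfolding k_def by blast
      show "x \<in> (\<Union>d. horner L k x y d)" "y \<in> (\<Union>d. horner L k x y d)" using Q.x_in Q.y_in by blast+
      fix a b assume "a \<in> (\<Union>d. horner L k x y d)" "b \<in> (\<Union>d. horner L k x y d)"
      then obtain d d' where d: "a \<in> horner L k x y d" "b \<in> horner L k x y d'" by blast
      then show "a \<otimes>\<^sub>L b \<in> (\<Union>d. horner L k x y d)" using Q.Rd_mult by blast
      have "a \<in> horner L k x y (max d d')" "b \<in> horner L k x y (max d d')"
        using d Q.Rd_mono[of d "max d d'"] Q.Rd_mono[of d' "max d d'"] by auto
      then show "a \<oplus>\<^sub>L b \<in> (\<Union>d. horner L k x y d)" using Q.Rd_add by blast
    qed
    then show ?thesis by blast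
  qed
  have "\<exists>d d' q. q \<in> horner L k x y d \<and> q \<noteq> \<zero>\<^sub>L \<and> q \<otimes>\<^sub>L z \<in> horner L k x y d'" if z: "z \<in> carrier L" for z
  proof -
    obtain P Q where PQ: "P \<in> carrier A2" "Q \<in> carrier A2" "E Q \<noteq> \<zero>\<^sub>L" "z \<otimes>\<^sub>L E Q = E P"
      using frac[OF z] unfolding E_def by blast
    have "E Q \<otimes>\<^sub>L z = E P" using PQ z ring_hom_closed[OF e(1)] by (metis Lf.m_comm)
    then show ?thesis using mem[OF PQ(1)] mem[OF PQ(2)] PQ(3) by metis
  qed
  then show ?thesis using Q by blast
qed

end

section \<open>The trace form of a central simple algebra\<close>

lemma finitely_generated_qdim:
  assumes "vecsp K V" "finitely_generated K V" shows "\<exists>n. qdim K V {\<zero>\<^sub>V} (carrier V) n"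
proof -
  interpret vecsp K V by fact
  obtain S where S: "finite S" "S \<subseteq> carrier V" "\<forall>x\<in>carrier V. \<exists>a\<in>S \<rightarrow> carrier K. x = (\<Oplus>\<^sub>V s\<in>S. a s \<odot>\<^sub>V s)"
    using assms(2) unfolding finitely_generated_def by blast
  have "\<exists>Y n. qdim K V {\<zero>\<^sub>V} Y n \<and> (\<forall>a\<in>T \<rightarrow> carrier K. (\<Oplus>\<^sub>V s\<in>T. a s \<odot>\<^sub>V s) \<in> Y)" if "T \<subseteq> S" for T
    using finite_subset[OF that S(1)] that
  proof (induction T rule: finite_induct)
    case empty
    then show ?case using qdim_refl[OF subsp_zero] by auto
  next
    case (insert s T)
    then obtain Y n where Y: "qdim K V {\<zero>\<^sub>V} Y n" "\<forall>a\<in>T \<rightarrow> carrier K. (\<Oplus>\<^sub>V s\<in>T. a s \<odot>\<^sub>V s) \<in> Y" by auto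
    have sc: "s \<in> carrier V" "T \<subseteq> carrier V" using insert S by auto
    have Ys: "subsp K V Y" using qdim_subsp[OF Y(1)] by auto
    obtain j where "qdim K V Y (adj K V Y s) j" using qdim_adj_le[OF Ys sc(1)] by auto
    then have "qdim K V {\<zero>\<^sub>V} (adj K V Y s) (n + j)" using qdim_trans Y(1) by blast
    moreover have "(\<Oplus>\<^sub>V s\<in>insert s T. a s \<odot>\<^sub>V s) \<in> adj K V Y s" if a: "a \<in> insert s T \<rightarrow> carrier K" for a
    proof -
      have "(\<Oplus>\<^sub>V s\<in>T. a s \<odot>\<^sub>V s) \<in> Y" using Y(2) a by auto
      moreover have "(\<Oplus>\<^sub>V s\<in>insert s T. a s \<odot>\<^sub>V s) = (\<Oplus>\<^sub>V s\<in>T. a s \<odot>\<^sub>V s) \<oplus>\<^sub>V a s \<odot>\<^sub>V s"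
      proof -
        have f: "(\<lambda>s. a s \<odot>\<^sub>V s) \<in> T \<rightarrow> carrier V" using a sc by auto
        have "a s \<odot>\<^sub>V s \<in> carrier V" using a sc by auto
        then show ?thesis using M.finsum_insert[OF insert(1,2) f] M.finsum_closed[OF f] by (simp add: M.a_comm)
      qed
      ultimately show ?thesis using a unfolding adj_def by auto
    qed
    ultimately show ?case by blast
  qed
  then obtain Y n where Y: "qdim K V {\<zero>\<^sub>V} Y n" "\<forall>a\<in>S \<rightarrow> carrier K. (\<Oplus>\<^sub>V s\<in>S. a s \<odot>\<^sub>V s) \<in> Y" by blast
  then have "carrier V \<subseteq> Y" using S(3) by (metis subsetI)
  then have "Y = carrier V" using qdim_subsp[OF Y(1)] subspD(1) by auto
  then show ?thesis using Y(1) by auto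
qed

section \<open>The multiplication algebra of a central simple algebra\<close>

locale csa = F: field F + A: assoc_algebra F A for F :: "('f, 'p) ring_scheme" and A :: "('f, 'a) module" +
  assumes fg: "finitely_generated F A"
    and center: "{z \<in> carrier A. \<forall>a\<in>carrier A. z \<otimes>\<^sub>A a = a \<otimes>\<^sub>A z} = {c \<odot>\<^sub>A \<one>\<^sub>A | c. c \<in> carrier F}"
    and nontriv: "carrier A \<noteq> {\<zero>\<^sub>A}"
    and simple: "ideal I A \<Longrightarrow> I = {\<zero>\<^sub>A} \<or> I = carrier A"
begin

sublocale AV: vecsp F A
  by (simp add: vecsp_def A.module_axioms F.field_axioms)

abbreviation mA (infixl "\<star>" 70) where "a \<star> b \<equiv> a \<otimes>\<^sub>A b"
abbreviation pA (infixl "+\<^sub>A" 65) where "a +\<^sub>A b \<equiv> a \<oplus>\<^sub>A b"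

definition scal :: "'a set" where "scal = {c \<odot>\<^sub>A \<one>\<^sub>A | c. c \<in> carrier F}"

lemma scal_comm: "z \<in> scal \<Longrightarrow> a \<in> carrier A \<Longrightarrow> z \<star> a = a \<star> z" "z \<in> scal \<Longrightarrow> z \<in> carrier A"
  using center unfolding scal_def[symmetric] by auto

lemma scalI: "z \<in> carrier A \<Longrightarrow> (\<And>a. a \<in> carrier A \<Longrightarrow> z \<star> a = a \<star> z) \<Longrightarrow> z \<in> scal"
  using center unfolding scal_def[symmetric] by auto

lemma one_nz: "\<one>\<^sub>A \<noteq> \<zero>\<^sub>A"
proof
  assume "\<one>\<^sub>A = \<zero>\<^sub>A"
  then have "x = \<zero>\<^sub>A" if "x \<in> carrier A" for x using A.A.r_one[OF that] A.A.r_null[OF that] by simp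
  then show False using nontriv by auto
qed

text \<open>A list of pairs \<open>(u, v)\<close> stands for the tensor \<open>\<Sum> u \<otimes> v\<close> and acts on \<open>A\<close> by \<open>x \<mapsto> \<Sum> u x v\<close>.\<close>

abbreviation "pairs ps \<equiv> set ps \<subseteq> carrier A \<times> carrier A"

primrec opl :: "('a \<times> 'a) list \<Rightarrow> 'a \<Rightarrow> 'a" where
  "opl [] x = \<zero>\<^sub>A"
| "opl (p # ps) x = fst p \<star> x \<star> snd p +\<^sub>A opl ps x"

lemma opl_closed: "pairs ps \<Longrightarrow> x \<in> carrier A \<Longrightarrow> opl ps x \<in> carrier A"
  by (induction ps) auto

lemma opl_add: "pairs ps \<Longrightarrow> x \<in> carrier A \<Longrightarrow> y \<in> carrier A \<Longrightarrow> opl ps (x +\<^sub>A y) = opl ps x +\<^sub>A opl ps y"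
proof (induction ps)
  case (Cons p ps)
  then have "fst p \<in> carrier A" "snd p \<in> carrier A" "pairs ps" by auto
  then show ?case using Cons opl_closed by (simp add: A.A.r_distr A.A.l_distr A.M.a_ac)
qed simp

lemma opl_smult: "pairs ps \<Longrightarrow> c \<in> carrier F \<Longrightarrow> x \<in> carrier A \<Longrightarrow> opl ps (c \<odot>\<^sub>A x) = c \<odot>\<^sub>A opl ps x"
proof (induction ps)
  case (Cons p ps)
  then have "fst p \<in> carrier A" "snd p \<in> carrier A" "pairs ps" by auto
  then show ?case using Cons opl_closed by (simp add: A.smult_r_distr A.smult_mult_left A.smult_mult_right)
qed simp

lemma opl_append: "pairs ps \<Longrightarrow> pairs qs \<Longrightarrow> x \<in> carrier A \<Longrightarrow> opl (ps @ qs) x = opl ps x +\<^sub>A opl qs x"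
proof (induction ps)
  case (Cons p ps)
  then have "fst p \<in> carrier A" "snd p \<in> carrier A" "pairs ps" by auto
  then show ?case using Cons opl_closed by (simp add: A.M.a_assoc)
qed (simp add: opl_closed)

lemma opl_left: "pairs ps \<Longrightarrow> y \<in> carrier A \<Longrightarrow> x \<in> carrier A \<Longrightarrow> opl (map (\<lambda>p. (y \<star> fst p, snd p)) ps) x = y \<star> opl ps x"
proof (induction ps)
  case (Cons p ps)
  then have "fst p \<in> carrier A" "snd p \<in> carrier A" "pairs ps" by auto
  then show ?case using Cons opl_closed by (simp add: A.A.r_distr A.A.m_assoc)
qed simp

lemma opl_right: "pairs ps \<Longrightarrow> y \<in> carrier A \<Longrightarrow> x \<in> carrier A \<Longrightarrow> opl (map (\<lambda>p. (fst p, snd p \<star> y)) ps) x = opl ps x \<star> y"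
proof (induction ps)
  case (Cons p ps)
  then have "fst p \<in> carrier A" "snd p \<in> carrier A" "pairs ps" by auto
  then show ?case using Cons opl_closed by (simp add: A.A.l_distr A.A.m_assoc)
qed simp

text \<open>The image of \<open>A\<close> tensored with its opposite in the endomorphisms of
  \<open>A\<close>, as maps compared on the carrier only.\<close>

definition \<M> :: "('a \<Rightarrow> 'a) set" where "\<M> = {T. \<exists>ps. pairs ps \<and> (\<forall>x\<in>carrier A. T x = opl ps x)}"

lemma M_closed: "T \<in> \<M> \<Longrightarrow> x \<in> carrier A \<Longrightarrow> T x \<in> carrier A"
  unfolding \<M>_def using opl_closed by auto

lemma M_addD: "T \<in> \<M> \<Longrightarrow> x \<in> carrier A \<Longrightarrow> y \<in> carrier A \<Longrightarrow> T (x +\<^sub>A y) = T x +\<^sub>A T y"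
  unfolding \<M>_def using opl_add by auto

lemma M_smultD: "T \<in> \<M> \<Longrightarrow> c \<in> carrier F \<Longrightarrow> x \<in> carrier A \<Longrightarrow> T (c \<odot>\<^sub>A x) = c \<odot>\<^sub>A T x"
  unfolding \<M>_def using opl_smult by auto

lemma M_zeroD: "T \<in> \<M> \<Longrightarrow> T \<zero>\<^sub>A = \<zero>\<^sub>A"
  using M_smultD[of T "\<zero>\<^sub>F" "\<zero>\<^sub>A"] M_closed[of T "\<zero>\<^sub>A"] by simp

lemma M_cong: "T \<in> \<M> \<Longrightarrow> (\<And>x. x \<in> carrier A \<Longrightarrow> T' x = T x) \<Longrightarrow> T' \<in> \<M>"
  unfolding \<M>_def by auto

lemma M_id: "(\<lambda>x. x) \<in> \<M>"
  unfolding \<M>_def by (rule CollectI, rule exI[of _ "[(\<one>\<^sub>A, \<one>\<^sub>A)]"]) auto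

lemma M_plus: "T \<in> \<M> \<Longrightarrow> T' \<in> \<M> \<Longrightarrow> (\<lambda>x. T x +\<^sub>A T' x) \<in> \<M>"
proof -
  assume "T \<in> \<M>" "T' \<in> \<M>"
  then obtain ps qs where "pairs ps" "\<forall>x\<in>carrier A. T x = opl ps x" "pairs qs" "\<forall>x\<in>carrier A. T' x = opl qs x"
    unfolding \<M>_def by auto
  then show ?thesis unfolding \<M>_def by (intro CollectI exI[of _ "ps @ qs"]) (auto simp: opl_append)
qed

lemma M_left: "T \<in> \<M> \<Longrightarrow> y \<in> carrier A \<Longrightarrow> (\<lambda>x. y \<star> T x) \<in> \<M>"
proof -
  assume T: "T \<in> \<M>" and y: "y \<in> carrier A"
  then obtain ps where "pairs ps" "\<forall>x\<in>carrier A. T x = opl ps x" unfolding \<M>_def by auto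
  then show ?thesis using y unfolding \<M>_def
    by (intro CollectI exI[of _ "map (\<lambda>p. (y \<star> fst p, snd p)) ps"]) (auto simp: opl_left)
qed

lemma M_right: "T \<in> \<M> \<Longrightarrow> y \<in> carrier A \<Longrightarrow> (\<lambda>x. T x \<star> y) \<in> \<M>"
proof -
  assume T: "T \<in> \<M>" and y: "y \<in> carrier A"
  then obtain ps where "pairs ps" "\<forall>x\<in>carrier A. T x = opl ps x" unfolding \<M>_def by auto
  then show ?thesis using y unfolding \<M>_def
    by (intro CollectI exI[of _ "map (\<lambda>p. (fst p, snd p \<star> y)) ps"]) (auto simp: opl_right)
qed

lemma M_comp: assumes "T \<in> \<M>" "T' \<in> \<M>" shows "(\<lambda>x. T (T' x)) \<in> \<M>"
proof -
  have "(\<lambda>x. opl ps (T' x)) \<in> \<M>" if "pairs ps" for ps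
    using that
  proof (induction ps)
    case Nil
    have "(\<lambda>x. \<zero>\<^sub>A \<star> T' x) \<in> \<M>" using M_left[OF assms(2)] by auto
    then show ?case by (rule M_cong) (simp add: M_closed[OF assms(2)])
  next
    case (Cons p ps)
    then have p: "fst p \<in> carrier A" "snd p \<in> carrier A" "pairs ps" by auto
    show ?case using M_plus[OF M_right[OF M_left[OF assms(2) p(1)] p(2)] Cons.IH[OF p(3)]] by simp
  qed
  moreover obtain ps where ps: "pairs ps" "\<forall>x\<in>carrier A. T x = opl ps x" using assms(1) unfolding \<M>_def by blast
  ultimately have "(\<lambda>x. opl ps (T' x)) \<in> \<M>" by blast
  then show ?thesis by (rule M_cong) (use ps(2) M_closed[OF assms(2)] in blast)
qed

lemma M_minus: "T \<in> \<M> \<Longrightarrow> (\<lambda>x. \<ominus>\<^sub>A T x) \<in> \<M>"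
  by (rule M_cong[OF M_left[of T "\<ominus>\<^sub>A \<one>\<^sub>A"]]) (simp_all add: A.A.l_minus M_closed)

text \<open>The values at \<open>v\<close> of all these operators form a nonzero two-sided ideal,
  which is everything by simplicity.\<close>

lemma M_transitive:
  assumes v: "v \<in> carrier A" "v \<noteq> \<zero>\<^sub>A" shows "\<exists>T\<in>\<M>. T v = \<one>\<^sub>A"
proof -
  let ?I = "{T v | T. T \<in> \<M>}"
  have "ideal ?I A"
  proof (rule idealI[OF A.A.ring_axioms])
    show "subgroup ?I (add_monoid A)"
    proof (rule group.subgroupI[OF A.M.a_group])
      show "?I \<subseteq> carrier (add_monoid A)" using M_closed v by auto
      show "?I \<noteq> {}" using M_id by auto
      fix a assume "a \<in> ?I"
      then obtain T where T: "T \<in> \<M>" "a = T v" by auto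
      show "inv\<^bsub>add_monoid A\<^esub> a \<in> ?I" using M_minus[OF T(1)] T(2) unfolding a_inv_def[symmetric] by auto
      fix b assume "b \<in> ?I"
      then obtain T' where T': "T' \<in> \<M>" "b = T' v" by auto
      show "a \<otimes>\<^bsub>add_monoid A\<^esub> b \<in> ?I" using M_plus[OF T(1) T'(1)] T(2) T'(2) by auto
    qed
    fix a x assume "a \<in> ?I" and x: "x \<in> carrier A"
    then obtain T where T: "T \<in> \<M>" "a = T v" by auto
    show "x \<star> a \<in> ?I" using M_left[OF T(1) x] T(2) by auto
    show "a \<star> x \<in> ?I" using M_right[OF T(1) x] T(2) by auto
  qed
  moreover have "v \<in> ?I" using M_id by auto
  ultimately have "?I = carrier A" using simple[of ?I] v by auto
  then have "\<one>\<^sub>A \<in> ?I" by auto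
  then show ?thesis by auto
qed

text \<open>Jacobson density for \<open>A\<close> as a simple bimodule over itself, whose
  endomorphisms are multiplications by central elements. The induction hypothesis provides
  \<open>Tw\<close>, which kills \<open>S\<close> and sends \<open>w\<close> to 1; the case
  distinction asks whether \<open>Tw v\<close> is central.\<close>

lemma density:
  assumes "qdim F A {\<zero>\<^sub>A} S n" "v \<in> carrier A" "v \<notin> S"
  shows "\<exists>T\<in>\<M>. (\<forall>s\<in>S. T s = \<zero>\<^sub>A) \<and> T v = \<one>\<^sub>A"
  using assms
proof (induction "{\<zero>\<^sub>A}" S n arbitrary: v rule: qdim.induct)
  case qdim_refl
  then show ?case using M_transitive[of v] M_zeroD by auto
next
  case (qdim_step S n w)
  have S: "subsp F A S" using qdim_step AV.qdim_subsp by auto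
  note wc = \<open>w \<in> carrier A\<close>
  have SS: "S \<subseteq> adj F A S w" "w \<in> adj F A S w"
    using AV.adj_ge[of S w] AV.adj_mem[OF S] AV.subspD(1)[OF S] wc by auto
  obtain Tw where Tw: "Tw \<in> \<M>" "\<forall>s\<in>S. Tw s = \<zero>\<^sub>A" "Tw w = \<one>\<^sub>A" using qdim_step.hyps(2)[OF wc] qdim_step.hyps(4) by auto
  have vc: "v \<in> carrier A" by fact
  have cc: "Tw v \<in> carrier A" using M_closed Tw vc by auto
  have kill: "T s = \<zero>\<^sub>A" if T: "T \<in> \<M>" "\<forall>s\<in>S. T s = \<zero>\<^sub>A" "T w = \<zero>\<^sub>A" and s: "s \<in> adj F A S w" for T s
  proof -
    obtain t a where ta: "s = t +\<^sub>A a \<odot>\<^sub>A w" "t \<in> S" "a \<in> carrier F" using s unfolding adj_def by auto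
    then show ?thesis using T wc AV.subspD(3)[OF S] by (simp add: M_addD M_smultD)
  qed
  show ?case
  proof (cases "Tw v \<in> scal")
    \<comment> \<open>The commutator of \<open>Tw\<close> with a suitable \<open>y\<close> kills
      \<open>S\<close>, and it kills \<open>w\<close> because \<open>Tw w\<close> is 1, but it does
      not kill \<open>v\<close>.\<close>
    case False
    then obtain y where y: "y \<in> carrier A" "Tw v \<star> y \<noteq> y \<star> Tw v" using scalI[OF cc] by auto
    let ?T = "\<lambda>x. y \<star> Tw x +\<^sub>A \<ominus>\<^sub>A (Tw x \<star> y)"
    have T: "?T \<in> \<M>" using M_plus[OF M_left[OF Tw(1) y(1)] M_minus[OF M_right[OF Tw(1) y(1)]]] .
    have "?T v \<noteq> \<zero>\<^sub>A" using y cc A.M.minus_equality[of "y \<star> Tw v" "\<ominus>\<^sub>A (Tw v \<star> y)"] by auto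
    then obtain T' where T': "T' \<in> \<M>" "T' (?T v) = \<one>\<^sub>A" using M_transitive[OF M_closed[OF T vc]] by auto
    have "?T s = \<zero>\<^sub>A" if "s \<in> adj F A S w" for s
      using kill[OF T _ _ that] Tw y by (auto simp: A.M.r_neg)
    then show ?thesis using M_comp[OF T'(1) T] T'(2) M_zeroD[OF T'(1)]
      by (intro bexI[of _ "\<lambda>x. T' (?T x)"]) auto
  next
    \<comment> \<open>If \<open>Tw v\<close> is the scalar \<open>c\<close>, the operator
      \<open>?D\<close> fixes \<open>S\<close>, kills \<open>w\<close> and sends \<open>v\<close> to
      \<open>v - c w\<close>, which is still outside \<open>S\<close>, so the induction hypothesis
      applies to it.\<close>
    case True
    then obtain c where c: "c \<in> carrier F" "Tw v = c \<odot>\<^sub>A \<one>\<^sub>A" unfolding scal_def by auto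
    let ?D = "\<lambda>x. x +\<^sub>A \<ominus>\<^sub>A (w \<star> Tw x)"
    have D: "?D \<in> \<M>" using M_plus[OF M_id M_minus[OF M_left[OF Tw(1) wc]]] .
    have Dv: "?D v = v +\<^sub>A \<ominus>\<^sub>A (c \<odot>\<^sub>A w)" using c wc by (simp add: A.smult_mult_right)
    have "?D v \<notin> S"
    proof
      assume "?D v \<in> S"
      then have "?D v +\<^sub>A c \<odot>\<^sub>A w \<in> adj F A S w" using c unfolding adj_def by auto
      moreover have "?D v +\<^sub>A c \<odot>\<^sub>A w = v" unfolding Dv using vc wc c by (simp add: A.M.a_assoc A.M.l_neg)
      ultimately show False using qdim_step.prems by simp
    qed
    then obtain T' where T': "T' \<in> \<M>" "\<forall>s\<in>S. T' s = \<zero>\<^sub>A" "T' (?D v) = \<one>\<^sub>A"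
      using qdim_step.hyps(2)[OF M_closed[OF D vc]] by auto
    let ?T = "\<lambda>x. T' (?D x)"
    have T: "?T \<in> \<M>" using M_comp[OF T'(1) D] .
    have k1: "\<forall>s\<in>S. ?T s = \<zero>\<^sub>A"
    proof
      fix s assume s: "s \<in> S"
      have "?D s = s" using Tw(2) s wc AV.subspD(3)[OF S s] by simp
      then show "?T s = \<zero>\<^sub>A" using T'(2) s by simp
    qed
    have k2: "?T w = \<zero>\<^sub>A" using Tw(3) wc M_zeroD[OF T'(1)] by (simp add: A.M.r_neg)
    show ?thesis
    proof (intro bexI[of _ ?T] conjI ballI)
      fix s assume "s \<in> adj F A S w"
      then show "?T s = \<zero>\<^sub>A" by (rule kill[OF T k1 k2])
    qed (rule T'(3) T)+
  qed
qed

primrec expa :: "(('a \<Rightarrow> 'a) \<times> 'a) list \<Rightarrow> 'a \<Rightarrow> 'a" where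
  "expa [] x = \<zero>\<^sub>A"
| "expa (t # ts) x = fst t x \<star> snd t +\<^sub>A expa ts x"

text \<open>Coordinate functionals of a basis can be found inside the multiplication algebra, with
  scalars represented by central elements. Density gives the functional of the last vector, and the
  earlier functionals are composed with the projection \<open>?D\<close> along it.\<close>

lemma expansion:
  assumes "qdim F A {\<zero>\<^sub>A} S n"
  shows "\<exists>ts. set ts \<subseteq> \<M> \<times> carrier A \<and> (\<forall>x\<in>S. (\<forall>t\<in>set ts. fst t x \<in> scal) \<and> x = expa ts x)"
  using assms
proof (induction "{\<zero>\<^sub>A}" S n rule: qdim.induct)
  case qdim_refl
  show ?case by (rule exI[of _ "[]"]) auto
next
  case (qdim_step S n v)
  have S: "subsp F A S" using qdim_step AV.qdim_subsp by auto
  note vc = \<open>v \<in> carrier A\<close>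
  obtain ts where ts: "set ts \<subseteq> \<M> \<times> carrier A" "\<forall>x\<in>S. (\<forall>t\<in>set ts. fst t x \<in> scal) \<and> x = expa ts x" using qdim_step by auto
  obtain T where T: "T \<in> \<M>" "\<forall>s\<in>S. T s = \<zero>\<^sub>A" "T v = \<one>\<^sub>A" using density[OF qdim_step.hyps(1,3,4)] by auto
  let ?D = "\<lambda>x. x +\<^sub>A \<ominus>\<^sub>A (T x \<star> v)"
  have D: "?D \<in> \<M>" using M_plus[OF M_id M_minus[OF M_right[OF T(1) vc]]] .
  let ?ts = "(T, v) # map (\<lambda>t. (\<lambda>x. fst t (?D x), snd t)) ts"
  have e: "expa (map (\<lambda>t. (\<lambda>x. fst t (?D x), snd t)) ts) x = expa ts (?D x)" for x ts
    by (induction ts) auto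
  have "(\<forall>t\<in>set ?ts. fst t x \<in> scal) \<and> x = expa ?ts x" if x: "x \<in> adj F A S v" for x
  proof -
    obtain s a where sa: "x = s +\<^sub>A a \<odot>\<^sub>A v" "s \<in> S" "a \<in> carrier F" using x unfolding adj_def by auto
    have sc: "s \<in> carrier A" using sa AV.subspD(3)[OF S] by auto
    have Tx: "T x = a \<odot>\<^sub>A \<one>\<^sub>A" using sa sc T vc by (simp add: M_addD M_smultD)
    have Txv: "T x \<star> v = a \<odot>\<^sub>A v" unfolding Tx using sa vc by (simp add: A.smult_mult_left)
    have Dx: "?D x = s" unfolding Txv unfolding sa(1) using sc vc sa(3) by (simp add: A.M.a_assoc A.M.r_neg)
    have "expa ?ts x = a \<odot>\<^sub>A v +\<^sub>A expa ts s" using Txv Dx e by simp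
    also have "\<dots> = x" using ts(2) sa sc vc by (simp add: A.M.a_comm)
    finally have "x = expa ?ts x" by simp
    moreover have "T x \<in> scal" using Tx sa unfolding scal_def by auto
    moreover have "\<forall>t\<in>set ts. fst t (?D x) \<in> scal" unfolding Dx using ts(2) sa by auto
    ultimately show ?thesis by auto
  qed
  moreover have "set ?ts \<subseteq> \<M> \<times> carrier A" using ts(1) T(1) vc M_comp[OF _ D] by auto
  ultimately show ?case by blast
qed

text \<open>The action on \<open>z\<close> of the tensor obtained by applying \<open>T\<close> to
  the left factors.\<close>

primrec mix :: "('a \<Rightarrow> 'a) \<Rightarrow> ('a \<times> 'a) list \<Rightarrow> 'a \<Rightarrow> 'a" where
  "mix T [] z = \<zero>\<^sub>A"
| "mix T (p # ps) z = T (fst p) \<star> z \<star> snd p +\<^sub>A mix T ps z"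

lemma mix_closed: "pairs ps \<Longrightarrow> (\<And>x. x \<in> carrier A \<Longrightarrow> T x \<in> carrier A) \<Longrightarrow> z \<in> carrier A \<Longrightarrow> mix T ps z \<in> carrier A"
  by (induction ps) auto

lemma mix_cong: "pairs ps \<Longrightarrow> (\<And>x. x \<in> carrier A \<Longrightarrow> T x = T' x) \<Longrightarrow> mix T ps z = mix T' ps z"
  by (induction ps) auto

text \<open>For \<open>T\<close> of the form \<open>x \<mapsto> a x b\<close> the sum of all
  \<open>a u b z v\<close> is \<open>a\<close> times the action of the tensor on \<open>b z\<close>,
  hence 0.\<close>

lemma mix_opl: 
  assumes ps: "pairs ps" "\<And>z. z \<in> carrier A \<Longrightarrow> opl ps z = \<zero>\<^sub>A" and ts: "pairs ts" and z: "z \<in> carrier A"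
  shows "mix (opl ts) ps z = \<zero>\<^sub>A"
  using ts
proof (induction ts)
  case Nil
  show ?case using ps(1) z by (induction ps) auto
next
  case (Cons t ts)
  then have t: "fst t \<in> carrier A" "snd t \<in> carrier A" "pairs ts" by auto
  have m: "mix (opl (t # ts)) qs z = fst t \<star> opl qs (snd t \<star> z) +\<^sub>A mix (opl ts) qs z" if "pairs qs" for qs
    using that
  proof (induction qs)
    case (Cons q qs)
    then have q: "fst q \<in> carrier A" "snd q \<in> carrier A" "pairs qs" by auto
    show ?case using Cons.IH[OF q(3)] q t z opl_closed[OF t(3)] opl_closed[OF q(3)] mix_closed[OF q(3) opl_closed[OF t(3)] z]
      by (simp add: A.A.r_distr A.A.l_distr A.A.m_assoc A.M.a_ac)
  qed (use t in simp)
  show ?case unfolding m[OF ps(1)] using ps(2) t z Cons.IH[OF t(3)] by simp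
qed

lemma mix_M:
  assumes ps: "pairs ps" "\<And>z. z \<in> carrier A \<Longrightarrow> opl ps z = \<zero>\<^sub>A" and T: "T \<in> \<M>" and z: "z \<in> carrier A"
  shows "mix T ps z = \<zero>\<^sub>A"
proof -
  obtain ts where "pairs ts" "\<forall>x\<in>carrier A. T x = opl ts x" using T unfolding \<M>_def by auto
  then show ?thesis using mix_opl[OF ps _ z, of ts] mix_cong[OF ps(1), of T "opl ts" z] by auto
qed

abbreviation "swp ps \<equiv> map (\<lambda>p. (snd p, fst p)) ps"

lemma A_fin: "\<exists>n. qdim F A {\<zero>\<^sub>A} (carrier A) n"
  using finitely_generated_qdim[OF AV.vecsp_axioms fg] .

text \<open>A tensor acting as zero is zero, hence so does the flipped tensor.\<close>

lemma flip_zero: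
  assumes ps: "pairs ps" "\<And>z. z \<in> carrier A \<Longrightarrow> opl ps z = \<zero>\<^sub>A" and x: "x \<in> carrier A"
  shows "opl (swp ps) x = \<zero>\<^sub>A"
proof -
  obtain n where "qdim F A {\<zero>\<^sub>A} (carrier A) n" using A_fin by auto
  then obtain ts where ts: "set ts \<subseteq> \<M> \<times> carrier A" "\<forall>x\<in>carrier A. (\<forall>t\<in>set ts. fst t x \<in> scal) \<and> x = expa ts x"
    using expansion by blast
  \<comment> \<open>The sum of all \<open>v x g(u)\<close>, which is the flipped action when
    \<open>g\<close> is the identity. Writing the identity as \<open>expa ts\<close>, the scalars
    \<open>t(u)\<close> commute with \<open>v x\<close> and move to the front, and each summand
    takes the form \<open>mix t ps 1\<close> times \<open>x\<close> times a constant factor.\<close>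
  define rmix where "rmix g qs = foldr (\<lambda>q z. snd q \<star> x \<star> g (fst q) +\<^sub>A z) qs \<zero>\<^sub>A" for g :: "'a \<Rightarrow> 'a" and qs :: "('a \<times> 'a) list"
  have rc: "rmix g qs \<in> carrier A" if "pairs qs" "\<And>x. x \<in> carrier A \<Longrightarrow> g x \<in> carrier A" for g qs
    using that(1) by (induction qs) (use x that(2) in \<open>auto simp: rmix_def\<close>)
  have "opl (swp qs) x = rmix (expa ts) qs" if "pairs qs" for qs
    using that by (induction qs) (use ts(2) in \<open>auto simp: rmix_def\<close>)
  moreover have "rmix (expa us) ps = \<zero>\<^sub>A" if "set us \<subseteq> set ts" for us
    using that
  proof (induction us)
    case Nil
    show ?case using ps(1) unfolding rmix_def by (induction ps) (use x in auto)
  next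
    case (Cons u us)
    have u: "fst u \<in> \<M>" "snd u \<in> carrier A" "\<And>x. x \<in> carrier A \<Longrightarrow> fst u x \<in> scal" using Cons ts by auto
    have uc: "\<And>x. x \<in> carrier A \<Longrightarrow> fst u x \<in> carrier A" using u M_closed by auto
    have ec: "expa us y \<in> carrier A" if "y \<in> carrier A" for y
    proof -
      have "set us \<subseteq> \<M> \<times> carrier A" using Cons.prems ts(1) by auto
      then show ?thesis using that by (induction us) (auto simp: M_closed)
    qed
    have rm: "rmix (expa (u # us)) qs = mix (fst u) qs \<one>\<^sub>A \<star> x \<star> snd u +\<^sub>A rmix (expa us) qs" if "pairs qs" for qs
      using that
    proof (induction qs)
      case (Cons q qs)
      then have q: "fst q \<in> carrier A" "snd q \<in> carrier A" "pairs qs" by auto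
      have m: "mix (fst u) qs \<one>\<^sub>A \<in> carrier A" using mix_closed[OF q(3) uc] by auto
      have rq: "rmix (expa us) qs \<in> carrier A" using rc[OF q(3) ec] by auto
      \<comment> \<open>The coordinate of the left factor is central and passes to the front; this
        gives the summand of \<open>mix\<close>.\<close>
      have comm: "snd q \<star> x \<star> (fst u (fst q) \<star> snd u) = fst u (fst q) \<star> snd q \<star> x \<star> snd u"
        using scal_comm(1)[OF u(3)[OF q(1)], of "snd q \<star> x"] q x u(2) uc[OF q(1)] by (simp add: A.A.m_assoc[symmetric])
      have c1: "fst u (fst q) \<in> carrier A" "expa us (fst q) \<in> carrier A" using uc ec q by auto
      have "rmix (expa (u # us)) (q # qs) = snd q \<star> x \<star> (fst u (fst q) \<star> snd u +\<^sub>A expa us (fst q)) +\<^sub>A rmix (expa (u # us)) qs"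
        unfolding rmix_def by simp
      also have "\<dots> = (fst u (fst q) \<star> snd q \<star> x \<star> snd u +\<^sub>A snd q \<star> x \<star> expa us (fst q)) +\<^sub>A
          (mix (fst u) qs \<one>\<^sub>A \<star> x \<star> snd u +\<^sub>A rmix (expa us) qs)"
        unfolding Cons.IH[OF q(3)] using comm c1 q x u(2) by (simp add: A.A.r_distr)
      also have "\<dots> = (fst u (fst q) \<star> \<one>\<^sub>A \<star> snd q +\<^sub>A mix (fst u) qs \<one>\<^sub>A) \<star> x \<star> snd u +\<^sub>A
          (snd q \<star> x \<star> expa us (fst q) +\<^sub>A rmix (expa us) qs)"
        using c1 q x u(2) m rq by (simp add: A.A.l_distr A.M.a_ac)
      finally show ?case unfolding rmix_def by simp
    qed (use x u(2) in \<open>simp add: rmix_def\<close>)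
    show ?case unfolding rm[OF ps(1)] using mix_M[OF ps u(1)] x u(2) Cons by simp
  qed
  ultimately show ?thesis using ps(1) by auto
qed

text \<open>No reduced trace is used. A tensor acting as a coordinate functional has values
  commuting with every \<open>y\<close>; flipping this identity gives
  \<open>\<psi> (x y) = \<psi> (y x)\<close> for the flipped action \<open>\<psi>\<close>. One
  coordinate of \<open>\<psi>\<close> is the required \<open>\<tau>\<close>.\<close>

theorem trace_form:
  "\<exists>\<tau>. (\<forall>a\<in>carrier A. \<tau> a \<in> carrier F) \<and> (\<forall>a\<in>carrier A. \<forall>b\<in>carrier A. \<tau> (a +\<^sub>A b) = \<tau> a \<oplus>\<^sub>F \<tau> b) \<and>
     (\<forall>c\<in>carrier F. \<forall>a\<in>carrier A. \<tau> (c \<odot>\<^sub>A a) = c \<otimes>\<^sub>F \<tau> a) \<and>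
     (\<forall>a\<in>carrier A. \<forall>b\<in>carrier A. \<tau> (a \<star> b) = \<tau> (b \<star> a)) \<and>
     (\<forall>a\<in>carrier A. (\<forall>b\<in>carrier A. \<tau> (a \<star> b) = \<zero>\<^sub>F) \<longrightarrow> a = \<zero>\<^sub>A)"
proof -
  obtain n where "qdim F A {\<zero>\<^sub>A} (carrier A) n" using A_fin by auto
  then obtain ts where ts: "set ts \<subseteq> \<M> \<times> carrier A" "\<forall>x\<in>carrier A. (\<forall>t\<in>set ts. fst t x \<in> scal) \<and> x = expa ts x"
    using expansion by blast
  have detect: "\<exists>t\<in>set ts. fst t x \<noteq> \<zero>\<^sub>A" if x: "x \<in> carrier A" "x \<noteq> \<zero>\<^sub>A" for x
  proof (rule ccontr)
    assume "\<not> ?thesis"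
    then have *: "\<forall>t\<in>set ts. fst t x = \<zero>\<^sub>A" by auto
    have "expa us x = \<zero>\<^sub>A" if "set us \<subseteq> set ts" for us
      using that by (induction us) (use * ts(1) in auto)
    then show False using ts(2) x by auto
  qed
  \<comment> \<open>A functional that does not vanish at 1, so that its tensor does not act as
    zero.\<close>
  obtain t0 where t0: "t0 \<in> set ts" "fst t0 \<one>\<^sub>A \<noteq> \<zero>\<^sub>A" using detect[OF A.A.one_closed one_nz] by blast
  obtain ps where ps: "pairs ps" "\<forall>x\<in>carrier A. fst t0 x = opl ps x" using t0 ts(1) unfolding \<M>_def by auto
  have spairs: "pairs (swp qs)" if "pairs qs" for qs using that by auto
  define \<psi> where "\<psi> = opl (swp ps)"
  have \<psi>c: "\<psi> x \<in> carrier A" if "x \<in> carrier A" for x unfolding \<psi>_def using opl_closed[OF spairs[OF ps(1)] that] .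
  have \<psi>_sym: "\<psi> (x \<star> y) = \<psi> (y \<star> x)" if x: "x \<in> carrier A" and y: "y \<in> carrier A" for x y
  proof -
    \<comment> \<open>With \<open>T\<close> the action of \<open>ps\<close>, the two lists together
      act by \<open>z \<mapsto> y T(z) - T(z) y\<close>, which is 0 as \<open>T(z)\<close> is
      central. Their flips act on \<open>x\<close> by \<open>\<psi> (x y)\<close> and
      \<open>- \<psi> (y x)\<close>.\<close>
    let ?my = "\<ominus>\<^sub>A y"
    let ?r1 = "map (\<lambda>p. (y \<star> fst p, snd p)) ps" and ?r2 = "map (\<lambda>p. (fst p, snd p \<star> ?my)) ps"
    have w: "pairs ?r1" "pairs ?r2" using ps(1) y by auto
    have "opl (?r1 @ ?r2) z = \<zero>\<^sub>A" if z: "z \<in> carrier A" for z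
    proof -
      have oc: "opl ps z \<in> carrier A" using opl_closed[OF ps(1) z] .
      have "fst t0 z \<in> scal" using ts(2) t0(1) z by blast
      then have "opl ps z \<in> scal" using ps(2) z by simp
      then have "opl ps z \<star> y = y \<star> opl ps z" using scal_comm(1) y by auto
      then show ?thesis using opl_append[OF w z] opl_left[OF ps(1) y z] opl_right[OF ps(1) _ z, of ?my] y oc
        by (simp add: A.A.r_minus A.M.r_neg)
    qed
    then have "opl (swp (?r1 @ ?r2)) x = \<zero>\<^sub>A" using flip_zero[of "?r1 @ ?r2" x] w x by auto
    moreover have "opl (swp (?r1 @ ?r2)) x = opl (swp ?r1) x +\<^sub>A opl (swp ?r2) x"
      unfolding map_append by (rule opl_append[OF spairs[OF w(1)] spairs[OF w(2)] x])
    moreover have "opl (swp (map (\<lambda>p. (y \<star> fst p, snd p)) qs)) x = opl (swp qs) (x \<star> y)" if "pairs qs" for qs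
      using that by (induction qs) (use x y in \<open>auto simp: A.A.m_assoc\<close>)
    moreover have "opl (swp (map (\<lambda>p. (fst p, snd p \<star> ?my)) qs)) x = opl (swp qs) (?my \<star> x)" if "pairs qs" for qs
      using that by (induction qs) (use x y in \<open>auto simp: A.A.m_assoc\<close>)
    ultimately have s0: "\<psi> (x \<star> y) +\<^sub>A \<psi> (?my \<star> x) = \<zero>\<^sub>A" using ps(1) unfolding \<psi>_def by simp
    have "\<psi> (?my \<star> x) +\<^sub>A \<psi> (y \<star> x) = \<psi> (?my \<star> x +\<^sub>A y \<star> x)"
      unfolding \<psi>_def by (rule opl_add[OF spairs[OF ps(1)], symmetric]) (use x y in auto)
    also have "?my \<star> x +\<^sub>A y \<star> x = \<zero>\<^sub>F \<odot>\<^sub>A \<zero>\<^sub>A" using x y by (simp add: A.A.l_distr[symmetric] A.M.l_neg)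
    also have "\<psi> \<dots> = \<zero>\<^sub>A" unfolding \<psi>_def using opl_smult[OF spairs[OF ps(1)], of "\<zero>\<^sub>F" "\<zero>\<^sub>A"] opl_closed[OF spairs[OF ps(1)]] by simp
    finally have s1: "\<psi> (?my \<star> x) +\<^sub>A \<psi> (y \<star> x) = \<zero>\<^sub>A" .
    have "\<psi> (x \<star> y) \<in> carrier A" "\<psi> (?my \<star> x) \<in> carrier A" "\<psi> (y \<star> x) \<in> carrier A" using \<psi>c x y by auto
    then show ?thesis using s0 s1 A.M.minus_unique by (metis A.M.a_comm)
  qed
  \<comment> \<open>Flipping twice returns the original tensor, so a vanishing flip would contradict
    the choice of \<open>t0\<close>.\<close>
  have "\<exists>x\<in>carrier A. \<psi> x \<noteq> \<zero>\<^sub>A"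
  proof (rule ccontr)
    assume "\<not> ?thesis"
    then have "opl (swp (swp ps)) \<one>\<^sub>A = \<zero>\<^sub>A" using flip_zero[OF spairs[OF ps(1)], of "\<one>\<^sub>A"] unfolding \<psi>_def by auto
    moreover have "swp (swp ps) = ps" by (simp add: comp_def)
    ultimately show False using t0(2) ps(2) by auto
  qed
  then obtain x0 where x0: "x0 \<in> carrier A" "\<psi> x0 \<noteq> \<zero>\<^sub>A" by auto
  \<comment> \<open>\<open>\<psi>\<close> has values in \<open>A\<close>; a coordinate functional
    that is nonzero on one of them makes it scalar-valued and keeps it nonzero.\<close>
  obtain t1 where t1: "t1 \<in> set ts" "fst t1 (\<psi> x0) \<noteq> \<zero>\<^sub>A" using detect[OF \<psi>c[OF x0(1)] x0(2)] by auto
  define T where "T = fst t1"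
  have T: "T \<in> \<M>" "\<And>x. x \<in> carrier A \<Longrightarrow> T x \<in> scal" unfolding T_def using t1 ts by auto
  have inj: "c = c'" if "c \<in> carrier F" "c' \<in> carrier F" "c \<odot>\<^sub>A \<one>\<^sub>A = c' \<odot>\<^sub>A \<one>\<^sub>A" for c c'
  proof (rule ccontr)
    assume ne: "c \<noteq> c'"
    define d where "d = c \<ominus>\<^sub>F c'"
    have d: "d \<in> carrier F" "d \<noteq> \<zero>\<^sub>F" unfolding d_def using that ne by (auto simp: F.r_right_minus_eq)
    have "d \<odot>\<^sub>A \<one>\<^sub>A = \<zero>\<^sub>A" unfolding d_def a_minus_def using that
      by (simp add: A.smult_l_distr A.smult_l_minus A.M.r_neg)
    moreover have "inv\<^bsub>F\<^esub> d \<in> carrier F" "inv\<^bsub>F\<^esub> d \<otimes>\<^sub>F d = \<one>\<^sub>F" using d F.field_Units by auto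
    then have "\<one>\<^sub>A = inv\<^bsub>F\<^esub> d \<odot>\<^sub>A (d \<odot>\<^sub>A \<one>\<^sub>A)" using d by (simp add: A.smult_assoc1[symmetric])
    ultimately show False using one_nz \<open>inv\<^bsub>F\<^esub> d \<in> carrier F\<close> by simp
  qed
  define \<tau> where "\<tau> x = (THE c. c \<in> carrier F \<and> T (\<psi> x) = c \<odot>\<^sub>A \<one>\<^sub>A)" for x
  have lam: "\<tau> x \<in> carrier F \<and> T (\<psi> x) = \<tau> x \<odot>\<^sub>A \<one>\<^sub>A" if x: "x \<in> carrier A" for x
  proof -
    obtain c where c: "c \<in> carrier F \<and> T (\<psi> x) = c \<odot>\<^sub>A \<one>\<^sub>A" using T(2)[OF \<psi>c[OF x]] unfolding scal_def by auto
    show ?thesis unfolding \<tau>_def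
    proof (rule theI[of _ c])
      fix c' assume "c' \<in> carrier F \<and> T (\<psi> x) = c' \<odot>\<^sub>A \<one>\<^sub>A"
      then show "c' = c" using inj c by metis
    qed (rule c)
  qed
  have lam_eq: "\<tau> x = c" if "x \<in> carrier A" "c \<in> carrier F" "T (\<psi> x) = c \<odot>\<^sub>A \<one>\<^sub>A" for x c
    using lam[OF that(1)] inj that by metis
  have add: "\<tau> (a +\<^sub>A b) = \<tau> a \<oplus>\<^sub>F \<tau> b" if ab: "a \<in> carrier A" "b \<in> carrier A" for a b
  proof (rule lam_eq)
    have "\<psi> (a +\<^sub>A b) = \<psi> a +\<^sub>A \<psi> b" unfolding \<psi>_def by (rule opl_add[OF spairs[OF ps(1)] ab])
    then show "T (\<psi> (a +\<^sub>A b)) = (\<tau> a \<oplus>\<^sub>F \<tau> b) \<odot>\<^sub>A \<one>\<^sub>A"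
      using M_addD[OF T(1) \<psi>c[OF ab(1)] \<psi>c[OF ab(2)]] lam[OF ab(1)] lam[OF ab(2)] by (simp add: A.smult_l_distr)
  qed (use lam ab in auto)
  have smult: "\<tau> (c \<odot>\<^sub>A a) = c \<otimes>\<^sub>F \<tau> a" if ca: "c \<in> carrier F" "a \<in> carrier A" for c a
  proof (rule lam_eq)
    have "\<psi> (c \<odot>\<^sub>A a) = c \<odot>\<^sub>A \<psi> a" unfolding \<psi>_def by (rule opl_smult[OF spairs[OF ps(1)] ca])
    then show "T (\<psi> (c \<odot>\<^sub>A a)) = (c \<otimes>\<^sub>F \<tau> a) \<odot>\<^sub>A \<one>\<^sub>A"
      using M_smultD[OF T(1) ca(1) \<psi>c[OF ca(2)]] lam[OF ca(2)] ca by (simp add: A.smult_assoc1)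
  qed (use lam ca in auto)
  have sym: "\<tau> (a \<star> b) = \<tau> (b \<star> a)" if "a \<in> carrier A" "b \<in> carrier A" for a b
    unfolding \<tau>_def using \<psi>_sym[OF that] by simp
  have x0n: "\<tau> x0 \<noteq> \<zero>\<^sub>F"
  proof
    assume "\<tau> x0 = \<zero>\<^sub>F"
    then have "T (\<psi> x0) = \<zero>\<^sub>A" using lam[OF x0(1)] by simp
    then show False using t1(2) unfolding T_def by simp
  qed
  \<comment> \<open>The radical of the trace form is a two-sided ideal because \<open>\<tau>\<close>
    is cyclic, and it is proper because \<open>\<tau>\<close> is nonzero.\<close>
  let ?I = "{a \<in> carrier A. \<forall>b\<in>carrier A. \<tau> (a \<star> b) = \<zero>\<^sub>F}"
  have lz: "\<tau> \<zero>\<^sub>A = \<zero>\<^sub>F" using smult[of "\<zero>\<^sub>F" "\<zero>\<^sub>A"] lam[of "\<zero>\<^sub>A"] by simp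
  have "ideal ?I A"
  proof (rule idealI[OF A.A.ring_axioms])
    show "subgroup ?I (add_monoid A)"
    proof (rule group.subgroupI[OF A.M.a_group])
      show "?I \<subseteq> carrier (add_monoid A)" by auto
      show "?I \<noteq> {}" using lz by (auto intro!: exI[of _ "\<zero>\<^sub>A"])
      fix a assume a: "a \<in> ?I"
      have "\<tau> (\<ominus>\<^sub>A a \<star> b) = \<zero>\<^sub>F" if b: "b \<in> carrier A" for b
      proof -
        have "\<ominus>\<^sub>A a \<star> b = a \<star> \<ominus>\<^sub>A b" using a b by (simp add: A.A.l_minus A.A.r_minus)
        then show ?thesis using a b by simp
      qed
      then show "inv\<^bsub>add_monoid A\<^esub> a \<in> ?I" using a unfolding a_inv_def[symmetric] by auto
      fix b assume b: "b \<in> ?I"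
      show "a \<otimes>\<^bsub>add_monoid A\<^esub> b \<in> ?I" using a b by (auto simp: A.A.l_distr add)
    qed
    fix a x assume a: "a \<in> ?I" and x: "x \<in> carrier A"
    have "\<tau> (x \<star> a \<star> b) = \<zero>\<^sub>F" if b: "b \<in> carrier A" for b
      using sym[of x "a \<star> b"] a x b by (simp add: A.A.m_assoc)
    then show "x \<star> a \<in> ?I" using a x by auto
    show "a \<star> x \<in> ?I" using a x by (auto simp: A.A.m_assoc)
  qed
  moreover have "?I \<noteq> carrier A"
  proof
    assume "?I = carrier A"
    then have "\<tau> (x0 \<star> \<one>\<^sub>A) = \<zero>\<^sub>F" using x0 by blast
    then show False using x0 x0n by simp
  qed
  ultimately have "?I = {\<zero>\<^sub>A}" using simple by auto
  then have nd: "a = \<zero>\<^sub>A" if "a \<in> carrier A" "\<forall>b\<in>carrier A. \<tau> (a \<star> b) = \<zero>\<^sub>F" for a using that by blast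
  show ?thesis
    by (intro exI[of _ \<tau>] conjI ballI impI) (use lam in blast, (fact add smult sym nd)+)
qed

end

section \<open>Scalar extension\<close>

text \<open>The vectors that \<open>g\<close> sends into \<open>Z\<close> are divided out first,
  after which \<open>qdim_map\<close> applies.\<close>

lemma qdim_image_le:
  fixes K :: "('k, 'p) ring_scheme"
  assumes "vecsp K V" "vecsp K W" and q: "qdim K V T S n"
    and gc: "\<And>s. s \<in> S \<Longrightarrow> g s \<in> carrier W"
    and ga: "\<And>s t. s \<in> S \<Longrightarrow> t \<in> S \<Longrightarrow> g (s \<oplus>\<^sub>V t) = g s \<oplus>\<^sub>W g t"
    and gs: "\<And>a s. a \<in> carrier K \<Longrightarrow> s \<in> S \<Longrightarrow> g (a \<odot>\<^sub>V s) = a \<odot>\<^sub>W g s"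
    and Z: "subsp K W Z" and T: "\<And>t. t \<in> T \<Longrightarrow> g t \<in> Z"
  shows "\<exists>j\<le>n. qdim K W Z (ssum W Z (g ` S)) j"
proof -
  interpret V: vecsp K V by fact
  interpret W: vecsp K W by fact
  have S: "subsp K V S" "T \<subseteq> S" using V.qdim_subsp[OF q] by auto
  let ?S0 = "{s \<in> S. g s \<in> Z}"
  have S0: "subsp K V ?S0" unfolding subsp_def
  proof (intro conjI ballI)
    show "?S0 \<subseteq> carrier V" using V.subspD(1)[OF S(1)] by auto
    show "\<zero>\<^sub>V \<in> ?S0" using V.subspD(2)[OF S(1)] T V.qdim_subsp[OF q] V.subspD(2) by auto
    fix s t assume "s \<in> ?S0" "t \<in> ?S0"
    then show "s \<oplus>\<^sub>V t \<in> ?S0" using V.subspD(4)[OF S(1)] W.subspD(4)[OF Z] ga by auto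
  next
    fix a s assume "a \<in> carrier K" "s \<in> ?S0"
    then show "a \<odot>\<^sub>V s \<in> ?S0" using V.subspD(5)[OF S(1)] W.subspD(5)[OF Z] gs by auto
  qed
  have "T \<subseteq> ?S0" using S(2) T by auto
  then obtain m where m: "m \<le> n" "qdim K V ?S0 S (n - m)" using V.qdim_sub[OF q S0] by auto
  have "qdim K W Z (ssum W Z (g ` S)) (n - m)"
    by (rule qdim_map[OF assms(1,2) m(2) gc ga gs Z]) auto
  then show ?thesis using m(1) by (intro exI[of _ "n - m"]) auto
qed

context vecsp
begin

lemma bilin_zero:
  assumes "bilin K V (carrier V) (carrier V) p" "v \<in> carrier V"
  shows "p \<zero>\<^sub>V v = \<zero>"
proof -
  have "p (\<zero> \<odot>\<^sub>V v) v = \<zero> \<otimes> p v v" "p v v \<in> carrier K" using assms unfolding bilin_def by blast+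
  then show ?thesis using assms(2) by simp
qed

lemma bilin_sum:
  assumes B: "bilin K V (carrier V) (carrier V) p" "finite I" "\<And>i. i \<in> I \<Longrightarrow> f i \<in> carrier V" "v \<in> carrier V"
  shows "p (\<Oplus>\<^sub>V i\<in>I. f i) v = (\<Oplus>i\<in>I. p (f i) v)"
  using B(2,3)
proof (induction I rule: finite_induct)
  case (insert i I)
  have 1: "f \<in> I \<rightarrow> carrier V" "f i \<in> carrier V" using insert by auto
  have 2: "(\<lambda>i. p (f i) v) \<in> I \<rightarrow> carrier K" "p (f i) v \<in> carrier K" using insert B(1,4) unfolding bilin_def by auto
  have "p (f i \<oplus>\<^sub>V (\<Oplus>\<^sub>V i\<in>I. f i)) v = p (f i) v \<oplus> p (\<Oplus>\<^sub>V i\<in>I. f i) v"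
    using B(1,4) 1 M.finsum_closed[OF 1(1)] unfolding bilin_def by blast
  then show ?case using insert 1 2 by simp
qed (simp add: bilin_zero[OF B(1,4)])

text \<open>Dual bases for a form that need not be symmetric, built one vector at a time. The new
  dual vector has to kill the old \<open>e i\<close>, and the new basis vector has to be killed by
  the old \<open>es j\<close>.\<close>

lemma dual_basis:
  assumes B: "bilin K V (carrier V) (carrier V) p"
    and nd: "\<And>u. u \<in> carrier V \<Longrightarrow> (\<And>s. s \<in> carrier V \<Longrightarrow> p u s = \<zero>) \<Longrightarrow> u = \<zero>\<^sub>V"
    and q: "qdim K V {\<zero>\<^sub>V} S n"
  shows "\<exists>e es. (\<forall>i<n. e i \<in> S \<and> es i \<in> carrier V) \<and>
     (\<forall>i<n. \<forall>j<n. p (e i) (es j) = (if i = j then \<one> else \<zero>)) \<and>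
     (\<forall>u\<in>S. u = (\<Oplus>\<^sub>V i\<in>{..<n}. p u (es i) \<odot>\<^sub>V e i))"
  using q
proof (induction "{\<zero>\<^sub>V}" S n rule: qdim.induct)
  case (qdim_step S n v)
  note vc = \<open>v \<in> carrier V\<close>
  have S: "subsp K V S" "\<zero>\<^sub>V \<in> S" using qdim_subsp[OF qdim_step(1)] by auto
  have SS: "S \<subseteq> adj K V S v" "v \<in> adj K V S v" using adj_ge[of S v] adj_mem[OF S(1) vc] subspD(1)[OF S(1)] vc by auto
  have AS: "subsp K V (adj K V S v)" using adj_subsp[OF S(1) vc] .
  have Sc: "s \<in> carrier V" if "s \<in> S" for s using subspD(3)[OF S(1)] that .
  obtain e es where e: "\<forall>i<n. e i \<in> S \<and> es i \<in> carrier V" 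
    "\<forall>i<n. \<forall>j<n. p (e i) (es j) = (if i = j then \<one> else \<zero>)"
    "\<forall>u\<in>S. u = (\<Oplus>\<^sub>V i\<in>{..<n}. p u (es i) \<odot>\<^sub>V e i)" using qdim_step.hyps(2) by blast
  have pD: "p a b \<in> carrier K" "p (a \<oplus>\<^sub>V a') b = p a b \<oplus> p a' b" "c \<in> carrier K \<Longrightarrow> p (c \<odot>\<^sub>V a) b = c \<otimes> p a b"
    "c \<in> carrier K \<Longrightarrow> p a (c \<odot>\<^sub>V b) = c \<otimes> p a b"
    if "a \<in> carrier V" "a' \<in> carrier V" "b \<in> carrier V" for a a' b c using that B unfolding bilin_def by auto
  \<comment> \<open>Separation supplies a vector that kills \<open>S\<close> but not
    \<open>v\<close>; scaled, it is the new dual vector \<open>t'\<close>.\<close>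
  have "\<exists>s\<in>carrier V. (\<forall>x\<in>S. p x s = \<zero>) \<and> (\<exists>y\<in>adj K V S v. p y s \<noteq> \<zero>)"
  proof (rule separation[OF qdim.qdim_step[OF qdim_step.hyps(1,3,4)] S(1) _ _ subsp_carrier bilin_mono[OF B subspD(1)[OF AS] order_refl]])
    show "S \<subset> adj K V S v" using SS qdim_step.hyps by auto
    fix t s assume "t \<in> {\<zero>\<^sub>V}" "s \<in> carrier V"
    then show "p t s = \<zero>" using bilin_zero[OF B] by auto
  next
    fix y assume "y \<in> adj K V S v" "\<And>s. s \<in> carrier V \<Longrightarrow> p y s = \<zero>"
    then show "y \<in> {\<zero>\<^sub>V}" using nd subspD(3)[OF AS] by auto
  qed (use S(2) in auto)
  then obtain t y where t: "t \<in> carrier V" "\<forall>x\<in>S. p x t = \<zero>" "y \<in> adj K V S v" "p y t \<noteq> \<zero>" by auto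
  obtain s a where sa: "y = s \<oplus>\<^sub>V a \<odot>\<^sub>V v" "s \<in> S" "a \<in> carrier K" using t(3) unfolding adj_def by auto
  have "p y t = a \<otimes> p v t" using sa t(2) pD[OF Sc[OF sa(2)] _ t(1)] pD[OF vc _ t(1)] vc t(1) by simp
  then have pv: "p v t \<noteq> \<zero>" "p v t \<in> carrier K" using t(4) sa pD[OF vc vc t(1)] by auto
  define t' where "t' = inv (p v t) \<odot>\<^sub>V t"
  have iv: "inv (p v t) \<in> carrier K" "inv (p v t) \<otimes> p v t = \<one>" using pv field_Units by auto
  have t': "t' \<in> carrier V" "p v t' = \<one>" "\<And>x. x \<in> S \<Longrightarrow> p x t' = \<zero>"
    unfolding t'_def using iv t pD[OF vc vc t(1)] pD[OF Sc Sc t(1)] by auto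
  \<comment> \<open>The part of \<open>v\<close> seen by the old dual vectors.\<close>
  define s0 where "s0 = (\<Oplus>\<^sub>V i\<in>{..<n}. p v (es i) \<odot>\<^sub>V e i)"
  have ec: "e i \<in> carrier V" "es i \<in> carrier V" "e i \<in> S" if "i < n" for i using e(1) that Sc by auto
  have pve: "p v (es i) \<in> carrier K" if "i < n" for i using pD(1)[OF vc vc ec(2)[OF that]] .
  have sumS: "(\<Oplus>\<^sub>V i\<in>I. f i) \<in> S" if "finite I" "\<And>i. i \<in> I \<Longrightarrow> f i \<in> S" for I :: "nat set" and f
    using that
  proof (induction I rule: finite_induct)
    case (insert i I)
    then have "f \<in> I \<rightarrow> carrier V" "f i \<in> carrier V" using Sc by auto
    then show ?case using insert subspD(4)[OF S(1)] by simp
  qed (use S in simp)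
  have s0: "s0 \<in> S" unfolding s0_def by (rule sumS) (use pve ec subspD(5)[OF S(1)] in auto)
  have s0e: "p s0 (es j) = p v (es j)" if j: "j < n" for j
  proof -
    have "p s0 (es j) = (\<Oplus>i\<in>{..<n}. p (p v (es i) \<odot>\<^sub>V e i) (es j))"
      unfolding s0_def by (rule bilin_sum[OF B]) (use pve ec j in auto)
    also have "\<dots> = (\<Oplus>i\<in>{..<n}. if j = i then p v (es i) else \<zero>)"
    proof (rule R.finsum_cong')
      fix i assume "i \<in> {..<n}"
      then have i: "i < n" by simp
      show "p (p v (es i) \<odot>\<^sub>V e i) (es j) = (if j = i then p v (es i) else \<zero>)"
        using pD(3)[OF ec(1)[OF i] ec(1)[OF i] ec(2)[OF j] pve[OF i]] e(2) i j pve[OF i] by auto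
    qed (use pve in auto)
    also have "\<dots> = p v (es j)" by (rule R.finsum_singleton) (use j pve in auto)
    finally show ?thesis .
  qed
  \<comment> \<open>Subtracting \<open>s0\<close> makes the old dual vectors vanish on
    \<open>w\<close>; the value at \<open>t'\<close> stays 1, since \<open>t'\<close> kills
    \<open>S\<close>.\<close>
  define w where "w = v \<oplus>\<^sub>V (\<ominus> \<one>) \<odot>\<^sub>V s0"
  have s0c: "s0 \<in> carrier V" using s0 Sc by auto
  have wm: "(\<ominus> \<one>) \<odot>\<^sub>V s0 \<in> carrier V" using s0c by auto
  have wA: "w \<in> adj K V S v" unfolding w_def
    using subspD(4)[OF AS SS(2)] subspD(5)[OF AS, of "\<ominus> \<one>" s0] s0 SS(1) by auto
  have wc: "w \<in> carrier V" using wA subspD(3)[OF AS] by auto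
  have pw: "p w b = p v b \<oplus> \<ominus> (p s0 b)" if "b \<in> carrier V" for b
    unfolding w_def using pD(2)[OF vc wm that] pD(3)[OF s0c s0c that, of "\<ominus> \<one>"] pD(1)[OF s0c s0c that] by (simp add: R.l_minus)
  define e' where "e' = e(n := w)"
  define es' where "es' = es(n := t')"
  have 1: "\<forall>i<Suc n. e' i \<in> adj K V S v \<and> es' i \<in> carrier V"
    unfolding e'_def es'_def using wA ec SS t' by (auto simp: less_Suc_eq)
  have 2: "p (e' i) (es' j) = (if i = j then \<one> else \<zero>)" if "i < Suc n" "j < Suc n" for i j
  proof -
    have "p w (es j) = \<zero>" if "j < n" for j using pw[OF ec(2)[OF that]] s0e[OF that] pve[OF that] by (simp add: R.r_neg)
    moreover have "p w t' = \<one>" using pw[OF t'(1)] t' s0 by simp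
    moreover have "p (e i) t' = \<zero>" if "i < n" for i using t'(3) ec that by auto
    ultimately show ?thesis using that e(2) unfolding e'_def es'_def by (auto simp: less_Suc_eq)
  qed
  have 3: "u = (\<Oplus>\<^sub>V i\<in>{..<Suc n}. p u (es' i) \<odot>\<^sub>V e' i)" if u: "u \<in> adj K V S v" for u
  proof -
    obtain s a where sa: "u = s \<oplus>\<^sub>V a \<odot>\<^sub>V v" "s \<in> S" "a \<in> carrier K" using u unfolding adj_def by auto
    have sc: "s \<in> carrier V" using sa Sc by auto
    have avc: "a \<odot>\<^sub>V v \<in> carrier V" using sa vc by auto
    have pu: "p u b = p s b \<oplus> a \<otimes> p v b" if "b \<in> carrier V" for b
      unfolding sa(1) using pD(2)[OF sc avc that] pD(3)[OF vc vc that sa(3)] by simp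
    have put: "p u t' = a" using pu[OF t'(1)] t' sa by simp
    have pse: "p s (es i) \<in> carrier K" if "i < n" for i using pD(1)[OF sc sc ec(2)[OF that]] .
    have f1: "(\<lambda>i. p s (es i) \<odot>\<^sub>V e i) \<in> {..<n} \<rightarrow> carrier V" using pse ec by auto
    have f2: "(\<lambda>i. p v (es i) \<odot>\<^sub>V e i) \<in> {..<n} \<rightarrow> carrier V" using pve ec by auto
    have f3: "(\<lambda>i. a \<odot>\<^sub>V (p v (es i) \<odot>\<^sub>V e i)) \<in> {..<n} \<rightarrow> carrier V" using pve ec sa by auto
    have "(\<Oplus>\<^sub>V i\<in>{..<n}. p u (es' i) \<odot>\<^sub>V e' i) = (\<Oplus>\<^sub>V i\<in>{..<n}. p s (es i) \<odot>\<^sub>V e i \<oplus>\<^sub>V a \<odot>\<^sub>V (p v (es i) \<odot>\<^sub>V e i))"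
    proof (rule M.finsum_cong')
      fix i assume "i \<in> {..<n}"
      then have i: "i < n" by simp
      show "p u (es' i) \<odot>\<^sub>V e' i = p s (es i) \<odot>\<^sub>V e i \<oplus>\<^sub>V a \<odot>\<^sub>V (p v (es i) \<odot>\<^sub>V e i)"
        using i pu[OF ec(2)[OF i]] pse[OF i] pve[OF i] ec(1)[OF i] sa(3)
        unfolding e'_def es'_def by (simp add: smult_l_distr smult_assoc1)
    qed (use f1 f3 in auto)
    also have "\<dots> = (\<Oplus>\<^sub>V i\<in>{..<n}. p s (es i) \<odot>\<^sub>V e i) \<oplus>\<^sub>V (\<Oplus>\<^sub>V i\<in>{..<n}. a \<odot>\<^sub>V (p v (es i) \<odot>\<^sub>V e i))"
      by (rule M.finsum_addf[OF f1 f3])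
    also have "\<dots> = s \<oplus>\<^sub>V a \<odot>\<^sub>V s0"
      using e(3)[rule_format, OF sa(2)] finsum_smult_ldistr[OF _ sa(3) f2] unfolding s0_def by simp
    finally have sum: "(\<Oplus>\<^sub>V i\<in>{..<n}. p u (es' i) \<odot>\<^sub>V e' i) = s \<oplus>\<^sub>V a \<odot>\<^sub>V s0" .
    have uc: "u \<in> carrier V" unfolding sa(1) using sc avc by auto
    have f4: "(\<lambda>i. p u (es' i) \<odot>\<^sub>V e' i) \<in> {..<n} \<rightarrow> carrier V"
      using pD(1)[OF uc uc] ec unfolding e'_def es'_def by auto
    have "(\<Oplus>\<^sub>V i\<in>{..<Suc n}. p u (es' i) \<odot>\<^sub>V e' i) = p u (es' n) \<odot>\<^sub>V e' n \<oplus>\<^sub>V (s \<oplus>\<^sub>V a \<odot>\<^sub>V s0)"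
      unfolding lessThan_Suc sum[symmetric]
      by (rule M.finsum_insert) (use f4 put sa wc in \<open>auto simp: e'_def es'_def\<close>)
    also have "\<dots> = a \<odot>\<^sub>V w \<oplus>\<^sub>V (s \<oplus>\<^sub>V a \<odot>\<^sub>V s0)" unfolding e'_def es'_def using put by simp
    also have "\<dots> = s \<oplus>\<^sub>V (a \<odot>\<^sub>V w \<oplus>\<^sub>V a \<odot>\<^sub>V s0)" using sc sa(3) wc s0c by (simp add: M.a_lcomm)
    also have "a \<odot>\<^sub>V w \<oplus>\<^sub>V a \<odot>\<^sub>V s0 = a \<odot>\<^sub>V v"
      unfolding w_def using sa(3) vc s0c wm
      by (simp add: smult_r_distr[symmetric] M.a_assoc smult_l_minus M.l_neg)
    finally show ?thesis using sa(1) by simp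
  qed
  show ?case using 1 2 3 by blast
qed auto

end

section \<open>The vector space structure on a scalar extension\<close>

context tensor
begin

text \<open>Chosen among the homomorphisms given by the universal property. Its values on elementary
  tensors determine it on the carrier.\<close>

definition scale :: "'l \<Rightarrow> ('l, 'v) tensor \<Rightarrow> ('l, 'v) tensor" where
  "scale l = (SOME g. g \<in> hom TG TG \<and>
     (\<forall>k\<in>carrier L. \<forall>v\<in>carrier V. g (tens F L V k v) = tens F L V (l \<otimes>\<^sub>L k) v))"

lemma scale:
  assumes l: "l \<in> carrier L"
  shows "scale l \<in> hom TG TG" "k \<in> carrier L \<Longrightarrow> v \<in> carrier V \<Longrightarrow> scale l (tens F L V k v) = tens F L V (l \<otimes>\<^sub>L k) v"
proof -
  obtain g where "g \<in> hom TG TG" "\<And>k v. k \<in> carrier L \<Longrightarrow> v \<in> carrier V \<Longrightarrow> g (tens F L V k v) = tens F L V (l \<otimes>\<^sub>L k) v"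
  proof (rule universal[OF TG_comm, of "\<lambda>k v. tens F L V (l \<otimes>\<^sub>L k) v"])
    fix c k v assume "c \<in> carrier F" "k \<in> carrier L" "v \<in> carrier V"
    then show "tens F L V (l \<otimes>\<^sub>L (c \<odot>\<^sub>L k)) v = tens F L V (l \<otimes>\<^sub>L k) (c \<odot>\<^sub>V v)"
      using l tens_smult[of c "l \<otimes>\<^sub>L k" v] L.smult_assoc2[of c k l] by (simp add: L.m_comm)
  qed (use l tens_closed tens_add_l tens_add_r in \<open>auto simp: L.r_distr\<close>)
  then have "\<exists>g. g \<in> hom TG TG \<and> (\<forall>k\<in>carrier L. \<forall>v\<in>carrier V. g (tens F L V k v) = tens F L V (l \<otimes>\<^sub>L k) v)" by blast
  from someI_ex[OF this] show "scale l \<in> hom TG TG"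
    "k \<in> carrier L \<Longrightarrow> v \<in> carrier V \<Longrightarrow> scale l (tens F L V k v) = tens F L V (l \<otimes>\<^sub>L k) v"
    unfolding scale_def by blast+
qed

text \<open>\<open>L \<otimes> V\<close> as a vector space over \<open>L\<close>. Its additive
  structure is literally that of \<open>ext_algebra\<close> and \<open>ext_module\<close>, so that
  the linear algebra above applies to the carriers of both.\<close>

definition TM :: "('l, ('l, 'v) tensor) module" where
  "TM = \<lparr>carrier = carrier TG, monoid.mult = undefined, monoid.one = undefined,
     ring.zero = \<one>\<^sub>TG, ring.add = monoid.mult TG, module.smult = scale\<rparr>"

lemma TM_simps: "carrier TM = carrier TG" "\<zero>\<^sub>TM = \<one>\<^sub>TG" "s \<oplus>\<^sub>TM t = s \<otimes>\<^sub>TG t" "l \<odot>\<^sub>TM t = scale l t"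
  by (simp_all add: TM_def)

lemma TM_group: "abelian_group TM"
proof -
  interpret G: comm_group TG by (rule TG_comm)
  show ?thesis
  proof (rule abelian_groupI)
    fix s assume "s \<in> carrier TM"
    then show "\<exists>t\<in>carrier TM. t \<oplus>\<^sub>TM s = \<zero>\<^sub>TM" unfolding TM_simps by (intro bexI[of _ "inv\<^bsub>TG\<^esub> s"]) auto
  qed (simp_all add: TM_simps G.m_ac)
qed

lemma TM_module: "module L TM"
proof (rule moduleI[OF L.M_cring TM_group])
  interpret G: comm_group TG by (rule TG_comm)
  have hm: "scale a (s \<otimes>\<^sub>TG t) = scale a s \<otimes>\<^sub>TG scale a t" "scale a s \<in> carrier TG"
    if "a \<in> carrier L" "s \<in> carrier TG" "t \<in> carrier TG" for a s t
    using scale(1)[OF that(1)] that unfolding hom_def by auto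
  fix a s assume a: "a \<in> carrier L" and s: "s \<in> carrier TM"
  show "a \<odot>\<^sub>TM s \<in> carrier TM" using hm[OF a] s unfolding TM_simps by auto
  fix t assume t: "t \<in> carrier TM"
  show "a \<odot>\<^sub>TM (s \<oplus>\<^sub>TM t) = a \<odot>\<^sub>TM s \<oplus>\<^sub>TM a \<odot>\<^sub>TM t" using hm[OF a] s t unfolding TM_simps by auto
next
  interpret G: comm_group TG by (rule TG_comm)
  have hm: "scale a (s \<otimes>\<^sub>TG t) = scale a s \<otimes>\<^sub>TG scale a t" "scale a s \<in> carrier TG"
    if "a \<in> carrier L" "s \<in> carrier TG" "t \<in> carrier TG" for a s t
    using scale(1)[OF that(1)] that unfolding hom_def by auto
  fix a b s assume a: "a \<in> carrier L" and b: "b \<in> carrier L" and "s \<in> carrier TM"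
  then have s: "s \<in> carrier TG" unfolding TM_simps by simp
  show "(a \<oplus>\<^sub>L b) \<odot>\<^sub>TM s = a \<odot>\<^sub>TM s \<oplus>\<^sub>TM b \<odot>\<^sub>TM s" unfolding TM_simps using s
  proof (induction s rule: tensor_induct)
    case (tens l v)
    then show ?case using a b by (simp add: scale tens_add_l L.l_distr)
  next
    case (add s t)
    then show ?case using a b hm by (simp add: G.m_ac)
  qed
  show "(a \<otimes>\<^sub>L b) \<odot>\<^sub>TM s = a \<odot>\<^sub>TM (b \<odot>\<^sub>TM s)" unfolding TM_simps using s
  proof (induction s rule: tensor_induct)
    case (tens l v)
    then show ?case using a b by (simp add: scale L.m_assoc)
  next
    case (add s t)
    then show ?case using a b hm by simp
  qed
next
  fix s assume "s \<in> carrier TM"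
  then have s: "s \<in> carrier TG" unfolding TM_simps by simp
  have hm: "scale \<one>\<^sub>L (s \<otimes>\<^sub>TG t) = scale \<one>\<^sub>L s \<otimes>\<^sub>TG scale \<one>\<^sub>L t" "scale \<one>\<^sub>L s \<in> carrier TG"
    if "s \<in> carrier TG" "t \<in> carrier TG" for s t
    using scale(1)[of "\<one>\<^sub>L"] that unfolding hom_def by auto
  show "\<one>\<^sub>L \<odot>\<^sub>TM s = s" unfolding TM_simps using s
    by (induction s rule: tensor_induct) (auto simp: scale hm)
qed

lemma tens_sum:
  assumes "finite I" "l \<in> carrier L" "\<And>i. i \<in> I \<Longrightarrow> f i \<in> carrier V"
  shows "tens F L V l (\<Oplus>\<^sub>V i\<in>I. f i) = (\<Oplus>\<^sub>TM i\<in>I. tens F L V l (f i))"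
  using assms
proof (induction I rule: finite_induct)
  case empty
  interpret G: comm_group TG by (rule TG_comm)
  have "tens F L V l \<zero>\<^sub>V \<otimes>\<^sub>TG tens F L V l \<zero>\<^sub>V = tens F L V l \<zero>\<^sub>V" using tens_add_r[of l "\<zero>\<^sub>V" "\<zero>\<^sub>V"] empty by simp
  then have "tens F L V l \<zero>\<^sub>V = \<one>\<^sub>TG" using tens_closed[of l "\<zero>\<^sub>V"] empty G.l_cancel_one by auto
  then have z: "tens F L V l \<zero>\<^sub>V = \<zero>\<^sub>TM" by (simp only: TM_simps)
  show ?case unfolding V.finsum_empty abelian_monoid.finsum_empty[OF abelian_group.axioms(1)[OF TM_group]] by (rule z)
next
  case (insert i I)
  interpret T: abelian_group TM by (rule TM_group)
  have 1: "f \<in> I \<rightarrow> carrier V" "f i \<in> carrier V" using insert by auto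
  have 2: "(\<lambda>i. tens F L V l (f i)) \<in> I \<rightarrow> carrier TM" "tens F L V l (f i) \<in> carrier TM"
    using insert.prems tens_closed unfolding TM_simps by auto
  show ?case using insert 1 2 V.finsum_insert[OF insert(1,2) 1] T.finsum_insert[OF insert(1,2) 2]
    tens_add_r[of l "f i" "\<Oplus>\<^sub>V i\<in>I. f i"] V.finsum_closed[OF 1(1)] by (simp add: TM_simps)
qed

lemma tens_expand:
  fixes n :: nat
  assumes e: "\<And>i. i < n \<Longrightarrow> e i \<in> carrier V" and f: "\<And>i v. i < n \<Longrightarrow> v \<in> carrier V \<Longrightarrow> f i v \<in> carrier F"
    and ex: "\<And>v. v \<in> carrier V \<Longrightarrow> v = (\<Oplus>\<^sub>V i\<in>{..<n}. f i v \<odot>\<^sub>V e i)"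
    and Ph: "\<And>i t. i < n \<Longrightarrow> t \<in> carrier TG \<Longrightarrow> \<Phi> i t \<in> carrier L"
      "\<And>i s t. i < n \<Longrightarrow> s \<in> carrier TG \<Longrightarrow> t \<in> carrier TG \<Longrightarrow> \<Phi> i (s \<otimes>\<^sub>TG t) = \<Phi> i s \<oplus>\<^sub>L \<Phi> i t"
      "\<And>i l v. i < n \<Longrightarrow> l \<in> carrier L \<Longrightarrow> v \<in> carrier V \<Longrightarrow> \<Phi> i (tens F L V l v) = f i v \<odot>\<^sub>L l"
    and t: "t \<in> carrier TG"
  shows "t = (\<Oplus>\<^sub>TM i\<in>{..<n}. \<Phi> i t \<odot>\<^sub>TM tens F L V \<one>\<^sub>L (e i))"
  using t
proof (induction t rule: tensor_induct)
  interpret T: module L TM by (rule TM_module)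
  case (tens l v)
  have 1: "f i v \<odot>\<^sub>V e i \<in> carrier V" if "i < n" for i using that e f tens by auto
  have "tens F L V l v = tens F L V l (\<Oplus>\<^sub>V i\<in>{..<n}. f i v \<odot>\<^sub>V e i)" using ex[OF tens(2)] by simp
  also have "\<dots> = (\<Oplus>\<^sub>TM i\<in>{..<n}. tens F L V l (f i v \<odot>\<^sub>V e i))" 
    by (rule tens_sum[where f = "\<lambda>i. f i v \<odot>\<^sub>V e i"]) (use 1 tens.hyps in simp_all)
  also have "\<dots> = (\<Oplus>\<^sub>TM i\<in>{..<n}. \<Phi> i (tens F L V l v) \<odot>\<^sub>TM tens F L V \<one>\<^sub>L (e i))"
  proof (rule T.M.finsum_cong')
    fix i assume "i \<in> {..<n}"
    then have i: "i < n" by simp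
    have "f i v \<odot>\<^sub>L l \<in> carrier L" using f[OF i tens(2)] tens by auto
    then show "tens F L V l (f i v \<odot>\<^sub>V e i) = \<Phi> i (tens F L V l v) \<odot>\<^sub>TM tens F L V \<one>\<^sub>L (e i)"
      using Ph(3)[OF i tens] tens_smult[OF f[OF i tens(2)] tens(1) e[OF i]] e[OF i] by (simp add: TM_simps scale)
  next
    show "(\<lambda>i. \<Phi> i (tens F L V l v) \<odot>\<^sub>TM tens F L V \<one>\<^sub>L (e i)) \<in> {..<n} \<rightarrow> carrier TM"
      using Ph(1) tens_closed[OF tens] tens_closed[OF L.one_closed e] T.smult_closed TM_simps(1) by auto
  qed simp
  finally show ?case .
next
  interpret T: module L TM by (rule TM_module)
  case (add s t)
  have tc: "tens F L V \<one>\<^sub>L (e i) \<in> carrier TM" if "i < n" for i using tens_closed[OF L.one_closed e[OF that]] TM_simps(1) by simp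
  have c: "(\<lambda>i. \<Phi> i u \<odot>\<^sub>TM tens F L V \<one>\<^sub>L (e i)) \<in> {..<n} \<rightarrow> carrier TM" if "u \<in> carrier TG" for u
    using Ph(1)[OF _ that] tc by auto
  have "s \<otimes>\<^sub>TG t = (\<Oplus>\<^sub>TM i\<in>{..<n}. \<Phi> i s \<odot>\<^sub>TM tens F L V \<one>\<^sub>L (e i)) \<oplus>\<^sub>TM (\<Oplus>\<^sub>TM i\<in>{..<n}. \<Phi> i t \<odot>\<^sub>TM tens F L V \<one>\<^sub>L (e i))"
    unfolding TM_simps(3)[symmetric] by (rule arg_cong2[OF add.IH])
  also have "\<dots> = (\<Oplus>\<^sub>TM i\<in>{..<n}. \<Phi> i s \<odot>\<^sub>TM tens F L V \<one>\<^sub>L (e i) \<oplus>\<^sub>TM \<Phi> i t \<odot>\<^sub>TM tens F L V \<one>\<^sub>L (e i))"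
    by (rule T.M.finsum_addf[OF c[OF add.hyps(1)] c[OF add.hyps(2)], symmetric])
  also have "\<dots> = (\<Oplus>\<^sub>TM i\<in>{..<n}. \<Phi> i (s \<otimes>\<^sub>TG t) \<odot>\<^sub>TM tens F L V \<one>\<^sub>L (e i))"
  proof (rule T.M.finsum_cong')
    show "(\<lambda>i. \<Phi> i (s \<otimes>\<^sub>TG t) \<odot>\<^sub>TM tens F L V \<one>\<^sub>L (e i)) \<in> {..<n} \<rightarrow> carrier TM"
    proof (rule c)
      show "s \<otimes>\<^sub>TG t \<in> carrier TG"
        using T.M.a_closed[unfolded TM_simps, OF add.hyps(1,2)] .
    qed
  next
    fix i assume "i \<in> {..<n}"
    then have i: "i < n" by simp
    show "\<Phi> i s \<odot>\<^sub>TM tens F L V \<one>\<^sub>L (e i) \<oplus>\<^sub>TM \<Phi> i t \<odot>\<^sub>TM tens F L V \<one>\<^sub>L (e i)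
      = \<Phi> i (s \<otimes>\<^sub>TG t) \<odot>\<^sub>TM tens F L V \<one>\<^sub>L (e i)"
      unfolding Ph(2)[OF i add.hyps] 
      by (rule T.smult_l_distr[OF Ph(1)[OF i add.hyps(1)] Ph(1)[OF i add.hyps(2)] tc[OF i], symmetric])
  qed simp
  finally show ?case .
qed

end

lemma tensor_induct2:
  assumes U: "tensor F L U" and V: "tensor F L V"
    and s: "s \<in> carrier (tensor_group F L U)" and t: "t \<in> carrier (tensor_group F L V)"
    and P: "\<And>k u l v. k \<in> carrier L \<Longrightarrow> u \<in> carrier U \<Longrightarrow> l \<in> carrier L \<Longrightarrow> v \<in> carrier V \<Longrightarrow>
        P (tens F L U k u) (tens F L V l v)"
      "\<And>s s' t. s \<in> carrier (tensor_group F L U) \<Longrightarrow> s' \<in> carrier (tensor_group F L U) \<Longrightarrow>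
        t \<in> carrier (tensor_group F L V) \<Longrightarrow> P s t \<Longrightarrow> P s' t \<Longrightarrow> P (s \<otimes>\<^bsub>tensor_group F L U\<^esub> s') t"
      "\<And>s t t'. s \<in> carrier (tensor_group F L U) \<Longrightarrow> t \<in> carrier (tensor_group F L V) \<Longrightarrow>
        t' \<in> carrier (tensor_group F L V) \<Longrightarrow> P s t \<Longrightarrow> P s t' \<Longrightarrow> P s (t \<otimes>\<^bsub>tensor_group F L V\<^esub> t')"
  shows "P s t"
proof -
  interpret U: tensor F L U by (rule U)
  interpret V: tensor F L V by (rule V)
  have *: "P (tens F L U k u) t" if "k \<in> carrier L" "u \<in> carrier U" for k u
    using t
  proof (induction t rule: V.tensor_induct)
    case (tens l v)
    then show ?case using P(1) that by simp
  next
    case (add s t)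
    then show ?case using P(3)[OF U.tens_closed[OF that]] by simp
  qed
  show ?thesis using s
  proof (induction s rule: U.tensor_induct)
    case (tens l v)
    then show ?case using * by simp
  next
    case (add s s')
    then show ?case using P(2)[OF _ _ t] by simp
  qed
qed

lemma (in vecsp) smult_inj:
  assumes "c \<in> carrier K" "d \<in> carrier K" and v: "v \<in> carrier V" "v \<noteq> \<zero>\<^sub>V" and eq: "c \<odot>\<^sub>V v = d \<odot>\<^sub>V v"
  shows "c = d"
proof (rule ccontr)
  assume n: "c \<noteq> d"
  let ?d = "c \<ominus> d"
  have d: "?d \<in> carrier K" "?d \<noteq> \<zero>" using assms n by auto
  then have u: "inv ?d \<in> carrier K" "inv ?d \<otimes> ?d = \<one>" using field_Units by auto
  have "?d \<odot>\<^sub>V v = \<zero>\<^sub>V" using assms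
    by (simp add: a_minus_def smult_l_distr smult_l_minus M.r_neg)
  then have "(inv ?d \<otimes> ?d) \<odot>\<^sub>V v = \<zero>\<^sub>V" using smult_assoc1[OF u(1) d(1) v(1)] u by simp
  then show False using u(2) v by simp
qed

lemma (in vecsp) adj_unique:
  assumes S: "subsp K V S" and v: "v \<in> carrier V" "v \<notin> S" and s: "s \<in> S" "t \<in> S" and a: "a \<in> carrier K" "b \<in> carrier K"
    and eq: "s \<oplus>\<^sub>V a \<odot>\<^sub>V v = t \<oplus>\<^sub>V b \<odot>\<^sub>V v"
  shows "a = b" "s = t"
proof -
  note sc = subspD(3)[OF S]
  have av: "a \<odot>\<^sub>V v \<in> carrier V" "b \<odot>\<^sub>V v \<in> carrier V" using a v by auto
  show ab: "a = b"
  proof (rule ccontr)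
    assume "a \<noteq> b"
    let ?d = "a \<ominus> b"
    have d: "?d \<in> carrier K" "?d \<noteq> \<zero>" using a \<open>a \<noteq> b\<close> by auto
    then have u: "inv ?d \<in> carrier K" "inv ?d \<otimes> ?d = \<one>" using field_Units by auto
    have "s \<oplus>\<^sub>V ?d \<odot>\<^sub>V v = (s \<oplus>\<^sub>V a \<odot>\<^sub>V v) \<ominus>\<^sub>V b \<odot>\<^sub>V v"
      using sc[OF s(1)] a v av by (simp add: a_minus_def smult_l_distr smult_l_minus M.a_assoc)
    also have "\<dots> = t" unfolding eq using sc[OF s(2)] av by (simp add: a_minus_def M.a_assoc M.r_neg)
    finally have "s \<oplus>\<^sub>V ?d \<odot>\<^sub>V v = t" .
    then have "?d \<odot>\<^sub>V v \<in> S" using subsp_cancel[OF S _ s(1)] s(2) d(1) v(1) by auto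
    then have "inv ?d \<odot>\<^sub>V (?d \<odot>\<^sub>V v) \<in> S" using subspD(5)[OF S u(1)] by simp
    then show False using v smult_assoc1[OF u(1) d(1) v(1)] u by simp
  qed
  show "s = t" using eq sc[OF s(1)] sc[OF s(2)] av unfolding ab by (simp add: M.add.r_cancel)
qed

lemma finite_qdim:
  assumes "vecsp K V" "finite B" "B \<subseteq> carrier V"
  shows "\<exists>Z n. qdim K V {\<zero>\<^sub>V} Z n \<and> B \<subseteq> Z"
  using assms(2,3)
proof (induction B rule: finite_induct)
  interpret vecsp K V by fact
  case empty
  show ?case using qdim_refl[OF subsp_zero] by blast
next
  interpret vecsp K V by fact
  case (insert b B)
  then obtain Z n where Z: "qdim K V {\<zero>\<^sub>V} Z n" "B \<subseteq> Z" by auto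
  note Zs = conjunct1[OF conjunct2[OF qdim_subsp[OF Z(1)]]]
  have b: "b \<in> carrier V" using insert.prems by auto
  obtain j where "qdim K V Z (adj K V Z b) j" using qdim_adj_le[OF Zs b] by auto
  then have "qdim K V {\<zero>\<^sub>V} (adj K V Z b) (n + j)" using qdim_trans Z(1) by blast
  moreover have "insert b B \<subseteq> adj K V Z b" using Z(2) adj_ge[OF subspD(1)[OF Zs] b] adj_mem[OF Zs b] by auto
  ultimately show ?case by blast
qed

section \<open>Coordinates on the extended algebra by means of the trace form\<close>

locale alg_ext = csa F A + L: algebra F L + Lf: field L
  for F :: "('f, 'p) ring_scheme" and L :: "('f, 'l) module" and A :: "('f, 'a) module" +
  fixes \<tau> :: "'a \<Rightarrow> 'f"
  assumes tr_closed: "a \<in> carrier A \<Longrightarrow> \<tau> a \<in> carrier F"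
    and tr_add: "a \<in> carrier A \<Longrightarrow> b \<in> carrier A \<Longrightarrow> \<tau> (a \<oplus>\<^sub>A b) = \<tau> a \<oplus>\<^sub>F \<tau> b"
    and tr_smult: "c \<in> carrier F \<Longrightarrow> a \<in> carrier A \<Longrightarrow> \<tau> (c \<odot>\<^sub>A a) = c \<otimes>\<^sub>F \<tau> a"
    and tr_comm: "a \<in> carrier A \<Longrightarrow> b \<in> carrier A \<Longrightarrow> \<tau> (a \<star> b) = \<tau> (b \<star> a)"
    and tr_nondeg: "a \<in> carrier A \<Longrightarrow> (\<And>b. b \<in> carrier A \<Longrightarrow> \<tau> (a \<star> b) = \<zero>\<^sub>F) \<Longrightarrow> a = \<zero>\<^sub>A"
begin

sublocale TA: tensor F L A
  by (intro tensor.intro L.algebra_axioms A.module_axioms)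

abbreviation "AL \<equiv> ext_algebra F L A"
abbreviation "ta \<equiv> tens F L A"

lemma AL_simps: "carrier AL = carrier TA.TG" "\<zero>\<^sub>AL = \<one>\<^sub>TA.TG"
  by (simp_all add: ext_algebra_def)

lemma iota_inj:
  assumes "c \<in> carrier F" "d \<in> carrier F" "c \<odot>\<^sub>L \<one>\<^sub>L = d \<odot>\<^sub>L \<one>\<^sub>L"
  shows "c = d"
  by (rule vecsp.smult_inj[OF _ assms(1,2) L.one_closed Lf.one_not_zero assms(3)])
    (simp add: vecsp_def L.module_axioms F.field_axioms)

text \<open>The coordinate functionals of \<open>L \<otimes> A\<close>: \<open>\<mu> a\<close> is the \<open>L\<close>-linear extension of \<open>b \<mapsto> \<tau> (b a)\<close>.\<close>

definition \<mu> :: "'a \<Rightarrow> ('l, 'a) tensor \<Rightarrow> 'l" where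
  "\<mu> a = (SOME g. g \<in> hom TA.TG (add_monoid L) \<and>
     (\<forall>l\<in>carrier L. \<forall>b\<in>carrier A. g (ta l b) = \<tau> (b \<star> a) \<odot>\<^sub>L l))"

lemma mu:
  assumes a: "a \<in> carrier A"
  shows "z \<in> carrier TA.TG \<Longrightarrow> \<mu> a z \<in> carrier L"
    "z \<in> carrier TA.TG \<Longrightarrow> w \<in> carrier TA.TG \<Longrightarrow> \<mu> a (z \<otimes>\<^sub>TA.TG w) = \<mu> a z \<oplus>\<^sub>L \<mu> a w"
    "l \<in> carrier L \<Longrightarrow> b \<in> carrier A \<Longrightarrow> \<mu> a (ta l b) = \<tau> (b \<star> a) \<odot>\<^sub>L l"
proof -
  have tb: "\<tau> (b \<star> a) \<in> carrier F" if "b \<in> carrier A" for b using that a tr_closed by simp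
  obtain g where "g \<in> hom TA.TG (add_monoid L)" "\<And>l b. l \<in> carrier L \<Longrightarrow> b \<in> carrier A \<Longrightarrow> g (ta l b) = \<tau> (b \<star> a) \<odot>\<^sub>L l"
  proof (rule TA.universal[OF abelian_group.a_comm_group[OF L.abelian_group_axioms], of "\<lambda>l b. \<tau> (b \<star> a) \<odot>\<^sub>L l"])
    fix l b c assume l: "l \<in> carrier L" and b: "b \<in> carrier A" and c: "c \<in> carrier A"
    show "\<tau> ((b \<oplus>\<^sub>A c) \<star> a) \<odot>\<^sub>L l = (\<tau> (b \<star> a) \<odot>\<^sub>L l) \<otimes>\<^bsub>add_monoid L\<^esub> (\<tau> (c \<star> a) \<odot>\<^sub>L l)"
      using l b c a by (simp add: A.A.l_distr tr_add tb L.smult_l_distr)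
  next
    fix c l b assume l: "l \<in> carrier L" and b: "b \<in> carrier A" and c: "c \<in> carrier F"
    then show "\<tau> (b \<star> a) \<odot>\<^sub>L (c \<odot>\<^sub>L l) = \<tau> ((c \<odot>\<^sub>A b) \<star> a) \<odot>\<^sub>L l"
      using a by (simp add: A.smult_mult_left tr_smult tb L.smult_assoc1[symmetric] F.m_comm)
  qed (use tb in \<open>auto simp: L.smult_r_distr\<close>)
  then have "\<exists>g. g \<in> hom TA.TG (add_monoid L) \<and> (\<forall>l\<in>carrier L. \<forall>b\<in>carrier A. g (ta l b) = \<tau> (b \<star> a) \<odot>\<^sub>L l)" by blast
  from someI_ex[OF this]
  have "\<mu> a \<in> hom TA.TG (add_monoid L)" "\<forall>l\<in>carrier L. \<forall>b\<in>carrier A. \<mu> a (ta l b) = \<tau> (b \<star> a) \<odot>\<^sub>L l"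
    unfolding \<mu>_def by blast+
  then show "z \<in> carrier TA.TG \<Longrightarrow> \<mu> a z \<in> carrier L"
    "z \<in> carrier TA.TG \<Longrightarrow> w \<in> carrier TA.TG \<Longrightarrow> \<mu> a (z \<otimes>\<^sub>TA.TG w) = \<mu> a z \<oplus>\<^sub>L \<mu> a w"
    "l \<in> carrier L \<Longrightarrow> b \<in> carrier A \<Longrightarrow> \<mu> a (ta l b) = \<tau> (b \<star> a) \<odot>\<^sub>L l"
    by (auto simp: hom_def)
qed

lemma mu_one: "a \<in> carrier A \<Longrightarrow> \<mu> a \<one>\<^sub>TA.TG = \<zero>\<^sub>L"
proof -
  assume a: "a \<in> carrier A"
  interpret G: comm_group TA.TG by (rule TA.TG_comm)
  have "\<mu> a \<one>\<^sub>TA.TG \<oplus>\<^sub>L \<mu> a \<one>\<^sub>TA.TG = \<mu> a \<one>\<^sub>TA.TG" using mu(2)[OF a, of "\<one>\<^sub>TA.TG" "\<one>\<^sub>TA.TG"] by simp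
  then show ?thesis using mu(1)[OF a G.one_closed] by (simp add: L.add.l_cancel_one)
qed

lemma trace_bilin: "bilin F A (carrier A) (carrier A) (\<lambda>a b. \<tau> (a \<star> b))"
  unfolding bilin_def
  by (simp add: A.A.l_distr A.A.r_distr tr_add tr_smult tr_closed A.smult_mult_left A.smult_mult_right)

lemma A_qdim: "\<exists>n. qdim F A {\<zero>\<^sub>A} (carrier A) n"
  using finitely_generated_qdim[OF AV.vecsp_axioms fg] .

lemma AL_expand:
  "\<exists>(n::nat) e es. (\<forall>i<n. e i \<in> carrier A \<and> es i \<in> carrier A) \<and>
    (\<forall>z\<in>carrier TA.TG. z = (\<Oplus>\<^sub>TA.TM i\<in>{..<n}. \<mu> (es i) z \<odot>\<^sub>TA.TM ta \<one>\<^sub>L (e i)))"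
proof -
  obtain n where n: "qdim F A {\<zero>\<^sub>A} (carrier A) n" using A_qdim by auto
  obtain e es where e: "\<forall>i<n. e i \<in> carrier A \<and> es i \<in> carrier A"
    "\<forall>u\<in>carrier A. u = (\<Oplus>\<^sub>A i\<in>{..<n}. \<tau> (u \<star> es i) \<odot>\<^sub>A e i)"
    using AV.dual_basis[OF trace_bilin tr_nondeg n] by blast
  have ec: "i < n \<Longrightarrow> e i \<in> carrier A" "i < n \<Longrightarrow> es i \<in> carrier A" for i using e by auto
  have "z = (\<Oplus>\<^sub>TA.TM i\<in>{..<n}. \<mu> (es i) z \<odot>\<^sub>TA.TM ta \<one>\<^sub>L (e i))" if z: "z \<in> carrier TA.TG" for z
  proof (rule TA.tens_expand[where f = "\<lambda>i u. \<tau> (u \<star> es i)", OF ec(1) _ _ _ _ _ z])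
    fix v assume "v \<in> carrier A"
    then show "v = (\<Oplus>\<^sub>A i\<in>{..<n}. \<tau> (v \<star> es i) \<odot>\<^sub>A e i)" using e(2) by (rule bspec[rotated])
  qed (use ec mu tr_closed in simp_all)
  with e(1) show ?thesis by blast
qed

text \<open>The coordinates of a tensor with respect to a basis of \<open>A\<close> are values of
  \<open>\<mu>\<close> at the dual basis. Identities in \<open>L \<otimes> A\<close> are checked in
  this way below, without computing in the tensor product.\<close>

lemma AL_eqI:
  assumes z: "z \<in> carrier TA.TG" "w \<in> carrier TA.TG" and eq: "\<And>a. a \<in> carrier A \<Longrightarrow> \<mu> a z = \<mu> a w"
  shows "z = w"
proof -
  interpret TM: module L TA.TM by (rule TA.TM_module)
  obtain n :: nat and e es where e0: "\<forall>i<n. e i \<in> carrier A \<and> es i \<in> carrier A"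
    and ex: "\<forall>z\<in>carrier TA.TG. z = (\<Oplus>\<^sub>TA.TM i\<in>{..<n}. \<mu> (es i) z \<odot>\<^sub>TA.TM ta \<one>\<^sub>L (e i))"
    using AL_expand by (elim exE conjE)
  have e: "i < n \<Longrightarrow> e i \<in> carrier A" "i < n \<Longrightarrow> es i \<in> carrier A" for i using e0 by auto
  have "(\<Oplus>\<^sub>TA.TM i\<in>{..<n}. \<mu> (es i) z \<odot>\<^sub>TA.TM ta \<one>\<^sub>L (e i)) = (\<Oplus>\<^sub>TA.TM i\<in>{..<n}. \<mu> (es i) w \<odot>\<^sub>TA.TM ta \<one>\<^sub>L (e i))"
    by (rule TM.M.finsum_cong')
      (use e eq mu(1)[OF _ z(2)] TA.tens_closed[OF L.one_closed] in \<open>auto simp: TA.TM_simps(1)[symmetric]\<close>)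
  from trans[OF trans[OF bspec[OF ex z(1)] this] sym[OF bspec[OF ex z(2)]]] show ?thesis .
qed

text \<open>With constant coordinates the expansion has the form \<open>1 \<otimes> a\<close>. This
  is what brings the values of the descended form back to \<open>A\<close>.\<close>

lemma AL_descend:
  assumes z: "z \<in> carrier TA.TG" and k: "\<And>a. a \<in> carrier A \<Longrightarrow> \<exists>c\<in>carrier F. \<mu> a z = c \<odot>\<^sub>L \<one>\<^sub>L"
  shows "\<exists>a\<in>carrier A. z = ta \<one>\<^sub>L a"
proof -
  interpret TM: module L TA.TM by (rule TA.TM_module)
  obtain n :: nat and e es where e0: "\<forall>i<n. e i \<in> carrier A \<and> es i \<in> carrier A"
    and ex: "\<forall>z\<in>carrier TA.TG. z = (\<Oplus>\<^sub>TA.TM i\<in>{..<n}. \<mu> (es i) z \<odot>\<^sub>TA.TM ta \<one>\<^sub>L (e i))"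
    using AL_expand by (elim exE conjE)
  have e: "i < n \<Longrightarrow> e i \<in> carrier A" "i < n \<Longrightarrow> es i \<in> carrier A" for i using e0 by auto
  obtain c where c: "\<And>a. a \<in> carrier A \<Longrightarrow> c a \<in> carrier F \<and> \<mu> a z = c a \<odot>\<^sub>L \<one>\<^sub>L" using k by metis
  have ce: "c (es i) \<odot>\<^sub>A e i \<in> carrier A" if "i < n" for i using that e c by simp
  have "(\<Oplus>\<^sub>TA.TM i\<in>{..<n}. \<mu> (es i) z \<odot>\<^sub>TA.TM ta \<one>\<^sub>L (e i)) = (\<Oplus>\<^sub>TA.TM i\<in>{..<n}. ta \<one>\<^sub>L (c (es i) \<odot>\<^sub>A e i))"
  proof (rule TM.M.finsum_cong')
    fix i assume "i \<in> {..<n}"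
    then have i: "i < n" by simp
    have ci: "c (es i) \<in> carrier F" "\<mu> (es i) z = c (es i) \<odot>\<^sub>L \<one>\<^sub>L" "c (es i) \<odot>\<^sub>L \<one>\<^sub>L \<in> carrier L" using c[OF e(2)[OF i]] by auto
    show "\<mu> (es i) z \<odot>\<^sub>TA.TM ta \<one>\<^sub>L (e i) = ta \<one>\<^sub>L (c (es i) \<odot>\<^sub>A e i)"
      using ci e(1)[OF i] by (simp add: TA.TM_simps TA.scale TA.tens_smult[symmetric])
  qed (use ce TA.tens_closed in \<open>auto simp: TA.TM_simps\<close>)
  also have "\<dots> = ta \<one>\<^sub>L (\<Oplus>\<^sub>A i\<in>{..<n}. c (es i) \<odot>\<^sub>A e i)"
    by (rule TA.tens_sum[symmetric]) (use ce in auto)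
  finally have "z = ta \<one>\<^sub>L (\<Oplus>\<^sub>A i\<in>{..<n}. c (es i) \<odot>\<^sub>A e i)" by (rule trans[OF bspec[OF ex z]])
  moreover have "(\<Oplus>\<^sub>A i\<in>{..<n}. c (es i) \<odot>\<^sub>A e i) \<in> carrier A" by (rule A.M.finsum_closed) (use ce in auto)
  ultimately show ?thesis by blast
qed

lemma ta_inj:
  assumes a: "a \<in> carrier A" "b \<in> carrier A" "ta \<one>\<^sub>L a = ta \<one>\<^sub>L b"
  shows "a = b"
proof -
  have "\<tau> (a \<star> c) = \<tau> (b \<star> c)" if c: "c \<in> carrier A" for c
    using mu(3)[OF c L.one_closed a(1)] mu(3)[OF c L.one_closed a(2)] a c tr_closed by (intro iota_inj) simp_all
  then have "\<tau> ((a \<ominus>\<^sub>A b) \<star> c) = \<zero>\<^sub>F" if c: "c \<in> carrier A" for c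
  proof -
    have 1: "\<tau> ((a \<ominus>\<^sub>A b) \<star> c \<oplus>\<^sub>A b \<star> c) = \<tau> (b \<star> c)" using that a \<open>\<And>c. c \<in> carrier A \<Longrightarrow> \<tau> (a \<star> c) = \<tau> (b \<star> c)\<close>[OF c]
      by (simp add: A.A.l_distr[symmetric] a_minus_def A.M.a_assoc A.M.l_neg)
    have 2: "\<tau> ((a \<ominus>\<^sub>A b) \<star> c) \<in> carrier F" "\<tau> (b \<star> c) \<in> carrier F" using a c tr_closed by auto
    have "\<tau> ((a \<ominus>\<^sub>A b) \<star> c) \<oplus>\<^sub>F \<tau> (b \<star> c) = \<tau> (b \<star> c)" using 1 a c by (simp add: tr_add)
    then show ?thesis using 2 by (simp add: F.add.r_cancel_one)
  qed
  then have "a \<ominus>\<^sub>A b = \<zero>\<^sub>A" using a by (intro tr_nondeg) auto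
  then show ?thesis using a by simp
qed

end

section \<open>Extension of a right module and its submodules\<close>

locale mod_ext = alg_ext F L A \<tau> + M: right_module A M
  for F :: "('f, 'p) ring_scheme" and L :: "('f, 'l) module" and A :: "('f, 'a) module" and \<tau> :: "'a \<Rightarrow> 'f"
    and M :: "('a, 'm) module"
begin

abbreviation "V \<equiv> restrict_scalars A M"

lemma V_simps: "carrier V = carrier M" "\<zero>\<^sub>V = \<zero>\<^sub>M" "x \<oplus>\<^sub>V y = x \<oplus>\<^sub>M y" "c \<odot>\<^sub>V x = (c \<odot>\<^sub>A \<one>\<^sub>A) \<odot>\<^sub>M x"
  by (simp_all add: restrict_scalars_def)

lemma V_module: "module F V"
proof (rule moduleI)
  show "cring F" by (rule domain.axioms(1)[OF field.axioms(1)[OF F.field_axioms]])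
  show "abelian_group V"
  proof (rule abelian_groupI)
    fix x assume "x \<in> carrier V"
    then show "\<exists>y\<in>carrier V. y \<oplus>\<^sub>V x = \<zero>\<^sub>V" unfolding V_simps using M.M.l_neg M.M.a_inv_closed by blast
  qed (simp_all add: V_simps M.M.a_ac)
  fix a b x assume "a \<in> carrier F" "b \<in> carrier F" "x \<in> carrier V"
  then show "(a \<otimes>\<^sub>F b) \<odot>\<^sub>V x = a \<odot>\<^sub>V (b \<odot>\<^sub>V x)"
    unfolding V_simps by (simp add: M.act_assoc[symmetric] A.smult_mult_left A.smult_assoc1 F.m_comm[of a b])
qed (simp_all add: V_simps M.act_closed M.act_add M.act_add_scalar M.act_one A.smult_l_distr)

sublocale TV: tensor F L V
  by (intro tensor.intro L.algebra_axioms V_module)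

abbreviation "tv \<equiv> tens F L V"
abbreviation "U \<equiv> TV.TM"
abbreviation "LM \<equiv> ext_module F L A M"

sublocale U: vecsp L U
  by (simp add: vecsp_def TV.TM_module Lf.field_axioms)

lemma LM_simps: "carrier LM = carrier U" "\<zero>\<^sub>LM = \<zero>\<^sub>U" "u \<oplus>\<^sub>LM v = u \<oplus>\<^sub>U v" "\<ominus>\<^sub>LM u = \<ominus>\<^sub>U u"
  by (simp_all add: ext_module_def Let_def TV.TM_def a_inv_def m_inv_def)

lemma TG_simps: "carrier TV.TG = carrier U" "\<one>\<^sub>TV.TG = \<zero>\<^sub>U" "u \<otimes>\<^sub>TV.TG v = u \<oplus>\<^sub>U v"
  by (simp_all add: TV.TM_simps)

lemma scalar_mult:
  assumes "c \<in> carrier F" "a \<in> carrier A"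
  shows "a \<star> (c \<odot>\<^sub>A \<one>\<^sub>A) = c \<odot>\<^sub>A a" "(c \<odot>\<^sub>A \<one>\<^sub>A) \<star> a = c \<odot>\<^sub>A a"
  using assms by (simp_all add: A.smult_mult_left A.smult_mult_right)

sublocale act: tensor3 F L A V V "\<lambda>a x. a \<odot>\<^sub>M x" "\<lambda>(k, a) (l, x). (l \<otimes>\<^sub>L k, a \<odot>\<^sub>M x)"
proof (intro tensor3.intro tensor3_axioms.intro TA.tensor_axioms TV.tensor_axioms)
  show "fbil F A V V (\<lambda>a x. a \<odot>\<^sub>M x)"
    unfolding fbil_def V_simps
    by (simp add: M.act_closed M.act_add M.act_add_scalar M.act_assoc[symmetric] scalar_mult)
qed (simp add: L.m_comm)

lemma smult_LM: "z \<odot>\<^sub>LM u = act.tm z u"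
  by (simp add: ext_module_def Let_def)

lemma tv_closed: "l \<in> carrier L \<Longrightarrow> x \<in> carrier M \<Longrightarrow> tv l x \<in> carrier U"
  using TV.tens_closed by (simp add: V_simps TV.TM_simps)

lemma U_induct [consumes 1, case_names tens add]:
  assumes "u \<in> carrier U" "\<And>l x. l \<in> carrier L \<Longrightarrow> x \<in> carrier M \<Longrightarrow> P (tv l x)"
    "\<And>u v. u \<in> carrier U \<Longrightarrow> v \<in> carrier U \<Longrightarrow> P u \<Longrightarrow> P v \<Longrightarrow> P (u \<oplus>\<^sub>U v)"
  shows "P u"
  using TV.tensor_induct[of u P] assms unfolding TG_simps V_simps by blast

lemma scale_tv: "k \<in> carrier L \<Longrightarrow> l \<in> carrier L \<Longrightarrow> x \<in> carrier M \<Longrightarrow> k \<odot>\<^sub>U tv l x = tv (k \<otimes>\<^sub>L l) x"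
  by (simp add: TV.TM_simps TV.scale V_simps)

lemma act:
  "z \<in> carrier AL \<Longrightarrow> u \<in> carrier U \<Longrightarrow> z \<odot>\<^sub>LM u \<in> carrier U"
  "z \<in> carrier AL \<Longrightarrow> z' \<in> carrier AL \<Longrightarrow> u \<in> carrier U \<Longrightarrow> (z \<otimes>\<^sub>TA.TG z') \<odot>\<^sub>LM u = z \<odot>\<^sub>LM u \<oplus>\<^sub>U z' \<odot>\<^sub>LM u"
  "z \<in> carrier AL \<Longrightarrow> u \<in> carrier U \<Longrightarrow> v \<in> carrier U \<Longrightarrow> z \<odot>\<^sub>LM (u \<oplus>\<^sub>U v) = z \<odot>\<^sub>LM u \<oplus>\<^sub>U z \<odot>\<^sub>LM v"
  "k \<in> carrier L \<Longrightarrow> a \<in> carrier A \<Longrightarrow> l \<in> carrier L \<Longrightarrow> x \<in> carrier M \<Longrightarrow> ta k a \<odot>\<^sub>LM tv l x = tv (k \<otimes>\<^sub>L l) (a \<odot>\<^sub>M x)"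
  unfolding smult_LM AL_simps TG_simps[symmetric] V_simps[symmetric]
  using act.tm_closed act.tm_add_l act.tm_add_r act.tm_tens by (simp_all add: V_simps)

text \<open>The action of \<open>1 \<otimes> a\<close>. Together with the scalars from
  \<open>L\<close> it determines the whole action, by \<open>act_split\<close>.\<close>

definition T :: "'a \<Rightarrow> ('l, 'm) tensor \<Rightarrow> ('l, 'm) tensor" where "T a u = ta \<one>\<^sub>L a \<odot>\<^sub>LM u"

lemma ta_closed: "l \<in> carrier L \<Longrightarrow> a \<in> carrier A \<Longrightarrow> ta l a \<in> carrier AL"
  using TA.tens_closed AL_simps by simp

lemma T_tens: "a \<in> carrier A \<Longrightarrow> l \<in> carrier L \<Longrightarrow> x \<in> carrier M \<Longrightarrow> T a (tv l x) = tv l (a \<odot>\<^sub>M x)"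
  unfolding T_def by (simp add: act)

lemma T_closed: "a \<in> carrier A \<Longrightarrow> u \<in> carrier U \<Longrightarrow> T a u \<in> carrier U"
  unfolding T_def by (simp add: act ta_closed)

lemma T_add: "a \<in> carrier A \<Longrightarrow> u \<in> carrier U \<Longrightarrow> v \<in> carrier U \<Longrightarrow> T a (u \<oplus>\<^sub>U v) = T a u \<oplus>\<^sub>U T a v"
  unfolding T_def by (simp add: act ta_closed)

lemma T_plus: "a \<in> carrier A \<Longrightarrow> b \<in> carrier A \<Longrightarrow> u \<in> carrier U \<Longrightarrow> T (a \<oplus>\<^sub>A b) u = T a u \<oplus>\<^sub>U T b u"
  unfolding T_def by (simp add: act ta_closed TA.tens_add_r)

lemma act_split: "l \<in> carrier L \<Longrightarrow> a \<in> carrier A \<Longrightarrow> u \<in> carrier U \<Longrightarrow> ta l a \<odot>\<^sub>LM u = l \<odot>\<^sub>U T a u"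
proof -
  assume l: "l \<in> carrier L" and a: "a \<in> carrier A" and "u \<in> carrier U"
  from this(3) show ?thesis
  proof (induction u rule: U_induct)
    case (tens k x)
    then show ?case using l a by (simp add: act T_tens scale_tv M.act_closed)
  next
    case (add u v)
    then show ?case using l a by (simp add: act ta_closed T_add T_closed U.smult_r_distr)
  qed
qed

lemma T_scale: "l \<in> carrier L \<Longrightarrow> a \<in> carrier A \<Longrightarrow> u \<in> carrier U \<Longrightarrow> T a (l \<odot>\<^sub>U u) = l \<odot>\<^sub>U T a u"
proof -
  assume l: "l \<in> carrier L" and a: "a \<in> carrier A" and "u \<in> carrier U"
  from this(3) show ?thesis
  proof (induction u rule: U_induct)
    case (tens k x)
    then show ?case using l a by (simp add: T_tens scale_tv M.act_closed)
  next
    case (add u v)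
    then show ?case using l a by (simp add: T_add T_closed U.smult_r_distr)
  qed
qed

lemma T_mult: "a \<in> carrier A \<Longrightarrow> b \<in> carrier A \<Longrightarrow> u \<in> carrier U \<Longrightarrow> T (a \<star> b) u = T b (T a u)"
proof -
  assume l: "b \<in> carrier A" and a: "a \<in> carrier A" and "u \<in> carrier U"
  from this(3) show ?thesis
  proof (induction u rule: U_induct)
    case (tens k x)
    then show ?case using l a by (simp add: T_tens M.act_closed M.act_assoc)
  next
    case (add u v)
    then show ?case using l a by (simp add: T_add T_closed)
  qed
qed

lemma T_one: "u \<in> carrier U \<Longrightarrow> T \<one>\<^sub>A u = u"
proof (induction u rule: U_induct)
  case (add u v)
  then show ?case by (simp add: T_add)
qed (simp add: T_tens M.act_one)

lemma T_zero: "a \<in> carrier A \<Longrightarrow> T a \<zero>\<^sub>U = \<zero>\<^sub>U"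
  using T_scale[of "\<zero>\<^sub>L" a "\<zero>\<^sub>U"] T_closed[of a "\<zero>\<^sub>U"] by simp

definition stab :: "('l, 'm) tensor set \<Rightarrow> bool" where
  "stab Z \<longleftrightarrow> subsp L U Z \<and> (\<forall>a\<in>carrier A. \<forall>u\<in>Z. T a u \<in> Z)"

lemma stab_act:
  assumes Z: "stab Z" and z: "z \<in> carrier AL" and u: "u \<in> Z" shows "z \<odot>\<^sub>LM u \<in> Z"
proof -
  note Zs = conjunct1[OF Z[unfolded stab_def]]
  have uc: "u \<in> carrier U" using U.subspD(3)[OF Zs u] .
  show ?thesis using z[unfolded AL_simps]
  proof (induction z rule: TA.tensor_induct)
    case (tens l a)
    then show ?case using act_split[OF tens uc] U.subspD(5)[OF Zs tens(1)] Z u tens unfolding stab_def by simp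
  next
    case (add z z')
    then show ?case using act(2)[OF _ _ uc] U.subspD(4)[OF Zs] unfolding AL_simps by simp
  qed
qed

text \<open>Every element of \<open>L \<otimes> A\<close> is a sum of products of a scalar and some
  \<open>1 \<otimes> a\<close>, so submodules become subspaces stable under the operators
  \<open>T a\<close>. From here on only linear algebra over \<open>L\<close> is needed.\<close>

lemma submodule_iff: "submodule Z AL LM \<longleftrightarrow> stab Z"
proof
  assume s: "submodule Z AL LM"
  note sg = submodule.axioms(1)[OF s]
  have Zc: "Z \<subseteq> carrier U" using subgroup.subset[OF sg] by (simp add: LM_simps)
  show "stab Z" unfolding stab_def subsp_def
  proof (intro conjI ballI Zc)
    show "\<zero>\<^sub>U \<in> Z" using subgroup.one_closed[OF sg] by (simp add: LM_simps)
    fix u v assume "u \<in> Z" "v \<in> Z"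
    then show "u \<oplus>\<^sub>U v \<in> Z" using subgroup.m_closed[OF sg] by (simp add: LM_simps)
  next
    fix a u assume "a \<in> carrier A" "u \<in> Z"
    then show "T a u \<in> Z" unfolding T_def using submodule.smult_closed[OF s ta_closed] by simp
  next
    fix l u assume l: "l \<in> carrier L" and u: "u \<in> Z"
    \<comment> \<open>A scalar of \<open>L\<close> acts through \<open>l \<otimes> 1\<close>, an
      element of the extended algebra.\<close>
    have "l \<odot>\<^sub>U u = ta l \<one>\<^sub>A \<odot>\<^sub>LM u" using act_split[OF l, of "\<one>\<^sub>A" u] T_one Zc u by auto
    then show "l \<odot>\<^sub>U u \<in> Z" using submodule.smult_closed[OF s ta_closed u] l by simp
  qed
next
  assume Z: "stab Z"
  note Zs = conjunct1[OF Z[unfolded stab_def]]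
  show "submodule Z AL LM"
  proof (intro submodule.intro submodule_axioms.intro subgroup.intro)
    fix u assume "u \<in> Z"
    then show "inv\<^bsub>add_monoid LM\<^esub> u \<in> Z" using U.subsp_neg[OF Zs] LM_simps(4)[of u] by (simp add: a_inv_def)
  qed (use U.subspD[OF Zs] stab_act[OF Z] in \<open>auto simp: LM_simps\<close>)
qed

end

text \<open>The assumption \<open>nondeg\<close> is the injective half of nonsingularity. In this
  form it can be verified for the descended module too, for which the locale is instantiated a
  second time.\<close>

locale herm_ext = mod_ext F L A \<tau> M
  for F :: "('f, 'p) ring_scheme" and L :: "('f, 'l) module" and A :: "('f, 'a) module" and \<tau> :: "'a \<Rightarrow> 'f"
    and M :: "('a, 'm) module" +
  fixes \<sigma> :: "'a \<Rightarrow> 'a" and \<delta> :: int and h :: "'m \<Rightarrow> 'm \<Rightarrow> 'a"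
  assumes invol: "linear_involution F A \<sigma>" and sign: "\<delta> \<in> {1, -1}"
    and herm: "hermitian_form A \<sigma> \<delta> M h" and fgM: "finitely_generated A M"
    and nondeg: "x \<in> carrier M \<Longrightarrow> (\<And>y. y \<in> carrier M \<Longrightarrow> h y x = \<zero>\<^sub>A) \<Longrightarrow> x = \<zero>\<^sub>M"
begin

lemma sigma: "a \<in> carrier A \<Longrightarrow> \<sigma> a \<in> carrier A" "\<sigma> \<one>\<^sub>A = \<one>\<^sub>A" "a \<in> carrier A \<Longrightarrow> \<sigma> (\<sigma> a) = a"
  "a \<in> carrier A \<Longrightarrow> b \<in> carrier A \<Longrightarrow> \<sigma> (a \<oplus>\<^sub>A b) = \<sigma> a \<oplus>\<^sub>A \<sigma> b"
  "a \<in> carrier A \<Longrightarrow> b \<in> carrier A \<Longrightarrow> \<sigma> (a \<star> b) = \<sigma> b \<star> \<sigma> a"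
  "c \<in> carrier F \<Longrightarrow> a \<in> carrier A \<Longrightarrow> \<sigma> (c \<odot>\<^sub>A a) = c \<odot>\<^sub>A \<sigma> a"
  using invol unfolding linear_involution_def by auto

definition sg :: "'a \<Rightarrow> 'a" where "sg a = add_pow A \<delta> (\<sigma> a)"

lemma sg_cases: "a \<in> carrier A \<Longrightarrow> sg a = (if \<delta> = 1 then \<sigma> a else \<ominus>\<^sub>A (\<sigma> a))"
proof -
  assume a: "a \<in> carrier A"
  have "\<sigma> a \<in> carrier (add_monoid A)" using sigma(1)[OF a] by simp
  from group.int_pow_1[OF A.M.a_group this] group.int_pow_neg[OF A.M.a_group this, of 1] show ?thesis
    using sign unfolding sg_def add_pow_def a_inv_def by auto
qed

lemma sg: "a \<in> carrier A \<Longrightarrow> sg a \<in> carrier A"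
  "a \<in> carrier A \<Longrightarrow> b \<in> carrier A \<Longrightarrow> sg (a \<oplus>\<^sub>A b) = sg a \<oplus>\<^sub>A sg b"
  "c \<in> carrier F \<Longrightarrow> a \<in> carrier A \<Longrightarrow> sg (c \<odot>\<^sub>A a) = c \<odot>\<^sub>A sg a"
  by (simp_all add: sg_cases sigma A.M.minus_add A.smult_r_minus)

lemma h: "x \<in> carrier M \<Longrightarrow> y \<in> carrier M \<Longrightarrow> h x y \<in> carrier A"
  "x \<in> carrier M \<Longrightarrow> y \<in> carrier M \<Longrightarrow> z \<in> carrier M \<Longrightarrow> h (x \<oplus>\<^sub>M y) z = h x z \<oplus>\<^sub>A h y z"
  "x \<in> carrier M \<Longrightarrow> y \<in> carrier M \<Longrightarrow> z \<in> carrier M \<Longrightarrow> h z (x \<oplus>\<^sub>M y) = h z x \<oplus>\<^sub>A h z y"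
  "x \<in> carrier M \<Longrightarrow> y \<in> carrier M \<Longrightarrow> a \<in> carrier A \<Longrightarrow> h (a \<odot>\<^sub>M x) y = \<sigma> a \<star> h x y"
  "x \<in> carrier M \<Longrightarrow> y \<in> carrier M \<Longrightarrow> a \<in> carrier A \<Longrightarrow> h x (a \<odot>\<^sub>M y) = h x y \<star> a"
proof -
  have s: "sesquilinear A \<sigma> M h" using herm unfolding hermitian_form_def by simp
  show c: "x \<in> carrier M \<Longrightarrow> y \<in> carrier M \<Longrightarrow> h x y \<in> carrier A" for x y
    using s unfolding sesquilinear_def by (auto simp: Pi_def)
  show "x \<in> carrier M \<Longrightarrow> y \<in> carrier M \<Longrightarrow> z \<in> carrier M \<Longrightarrow> h (x \<oplus>\<^sub>M y) z = h x z \<oplus>\<^sub>A h y z"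
    "x \<in> carrier M \<Longrightarrow> y \<in> carrier M \<Longrightarrow> z \<in> carrier M \<Longrightarrow> h z (x \<oplus>\<^sub>M y) = h z x \<oplus>\<^sub>A h z y"
    using s unfolding sesquilinear_def by auto
  have *: "h (a \<odot>\<^sub>M x) (b \<odot>\<^sub>M y) = \<sigma> a \<star> h x y \<star> b" if "x \<in> carrier M" "y \<in> carrier M" "a \<in> carrier A" "b \<in> carrier A" for x y a b
    using s that unfolding sesquilinear_def by auto
  show "x \<in> carrier M \<Longrightarrow> y \<in> carrier M \<Longrightarrow> a \<in> carrier A \<Longrightarrow> h (a \<odot>\<^sub>M x) y = \<sigma> a \<star> h x y"
    using *[of x y a "\<one>\<^sub>A"] c sigma by (simp add: M.act_one)
  show "x \<in> carrier M \<Longrightarrow> y \<in> carrier M \<Longrightarrow> a \<in> carrier A \<Longrightarrow> h x (a \<odot>\<^sub>M y) = h x y \<star> a"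
    using *[of x y "\<one>\<^sub>A" a] c sigma by (simp add: M.act_one)
qed

lemma h_flip: "x \<in> carrier M \<Longrightarrow> y \<in> carrier M \<Longrightarrow> h x y = sg (h y x)"
proof -
  assume x: "x \<in> carrier M" and y: "y \<in> carrier M"
  have "h x y \<ominus>\<^sub>A sg (h y x) = \<zero>\<^sub>A"
    using herm x y unfolding hermitian_form_def sg_def sw_def by blast
  then show ?thesis using h(1)[OF x y] sg(1)[OF h(1)[OF y x]] by simp
qed

sublocale hf: tensor3 F L V V A h "\<lambda>(k, x) (l, y). (k \<otimes>\<^sub>L l, h x y)"
proof (intro tensor3.intro tensor3_axioms.intro TA.tensor_axioms TV.tensor_axioms)
  show "fbil F V V A h"
    unfolding fbil_def V_simps by (simp add: h scalar_mult sigma)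
qed simp

abbreviation "hL \<equiv> ext_form F L A h"

lemma hL:
  "u \<in> carrier U \<Longrightarrow> v \<in> carrier U \<Longrightarrow> hL u v \<in> carrier TA.TG"
  "u \<in> carrier U \<Longrightarrow> v \<in> carrier U \<Longrightarrow> w \<in> carrier U \<Longrightarrow> hL (u \<oplus>\<^sub>U v) w = hL u w \<otimes>\<^sub>TA.TG hL v w"
  "u \<in> carrier U \<Longrightarrow> v \<in> carrier U \<Longrightarrow> w \<in> carrier U \<Longrightarrow> hL w (u \<oplus>\<^sub>U v) = hL w u \<otimes>\<^sub>TA.TG hL w v"
  "k \<in> carrier L \<Longrightarrow> l \<in> carrier L \<Longrightarrow> x \<in> carrier M \<Longrightarrow> y \<in> carrier M \<Longrightarrow> hL (tv k x) (tv l y) = ta (k \<otimes>\<^sub>L l) (h x y)"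
  unfolding ext_form_def TG_simps[symmetric] V_simps[symmetric]
  using hf.tm_closed hf.tm_add_l hf.tm_add_r hf.tm_tens by (simp_all add: V_simps)

definition \<beta> :: "('l, 'm) tensor \<Rightarrow> ('l, 'm) tensor \<Rightarrow> 'l" where "\<beta> u v = \<mu> \<one>\<^sub>A (hL u v)"

lemma beta:
  "u \<in> carrier U \<Longrightarrow> v \<in> carrier U \<Longrightarrow> \<beta> u v \<in> carrier L"
  "u \<in> carrier U \<Longrightarrow> v \<in> carrier U \<Longrightarrow> w \<in> carrier U \<Longrightarrow> \<beta> (u \<oplus>\<^sub>U v) w = \<beta> u w \<oplus>\<^sub>L \<beta> v w"
  "u \<in> carrier U \<Longrightarrow> v \<in> carrier U \<Longrightarrow> w \<in> carrier U \<Longrightarrow> \<beta> w (u \<oplus>\<^sub>U v) = \<beta> w u \<oplus>\<^sub>L \<beta> w v"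
  "k \<in> carrier L \<Longrightarrow> l \<in> carrier L \<Longrightarrow> x \<in> carrier M \<Longrightarrow> y \<in> carrier M \<Longrightarrow> \<beta> (tv k x) (tv l y) = \<tau> (h x y) \<odot>\<^sub>L (k \<otimes>\<^sub>L l)"
  unfolding \<beta>_def by (simp_all add: hL mu h)

lemma U_induct2 [consumes 2]:
  assumes "u \<in> carrier U" "v \<in> carrier U"
    "\<And>k x l y. k \<in> carrier L \<Longrightarrow> x \<in> carrier M \<Longrightarrow> l \<in> carrier L \<Longrightarrow> y \<in> carrier M \<Longrightarrow> P (tv k x) (tv l y)"
    "\<And>u u' v. u \<in> carrier U \<Longrightarrow> u' \<in> carrier U \<Longrightarrow> v \<in> carrier U \<Longrightarrow> P u v \<Longrightarrow> P u' v \<Longrightarrow> P (u \<oplus>\<^sub>U u') v"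
    "\<And>u v v'. u \<in> carrier U \<Longrightarrow> v \<in> carrier U \<Longrightarrow> v' \<in> carrier U \<Longrightarrow> P u v \<Longrightarrow> P u v' \<Longrightarrow> P u (v \<oplus>\<^sub>U v')"
  shows "P u v"
  by (rule tensor_induct2[OF TV.tensor_axioms TV.tensor_axioms, unfolded TG_simps V_simps, OF assms(1-2)])
    (rule assms; assumption)+

lemma beta_scale:
  assumes u: "u \<in> carrier U" "v \<in> carrier U" and a: "a \<in> carrier L"
  shows "\<beta> (a \<odot>\<^sub>U u) v = a \<otimes>\<^sub>L \<beta> u v" "\<beta> u (a \<odot>\<^sub>U v) = a \<otimes>\<^sub>L \<beta> u v"
proof -
  have t: "\<tau> (h x y) \<in> carrier F" if "x \<in> carrier M" "y \<in> carrier M" for x y using that h tr_closed by simp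
  have "\<beta> (a \<odot>\<^sub>U u) v = a \<otimes>\<^sub>L \<beta> u v \<and> \<beta> u (a \<odot>\<^sub>U v) = a \<otimes>\<^sub>L \<beta> u v" using u
  proof (induction u v rule: U_induct2)
    case (1 k x l y)
    have "a \<otimes>\<^sub>L (k \<otimes>\<^sub>L l) = a \<otimes>\<^sub>L k \<otimes>\<^sub>L l" "a \<otimes>\<^sub>L (k \<otimes>\<^sub>L l) = k \<otimes>\<^sub>L (a \<otimes>\<^sub>L l)"
      using a 1 by (simp_all add: L.m_assoc L.m_lcomm)
    moreover have "a \<otimes>\<^sub>L (\<tau> (h x y) \<odot>\<^sub>L (k \<otimes>\<^sub>L l)) = \<tau> (h x y) \<odot>\<^sub>L (a \<otimes>\<^sub>L (k \<otimes>\<^sub>L l))"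
      using a 1 t[OF 1(2,4)] L.smult_assoc2[OF t[OF 1(2,4)], of "k \<otimes>\<^sub>L l" a] by (simp add: L.m_comm)
    ultimately show ?case using a 1 by (simp add: scale_tv beta(4))
  qed (use a in \<open>simp_all add: U.smult_r_distr beta L.r_distr\<close>)
  then show "\<beta> (a \<odot>\<^sub>U u) v = a \<otimes>\<^sub>L \<beta> u v" "\<beta> u (a \<odot>\<^sub>U v) = a \<otimes>\<^sub>L \<beta> u v" by auto
qed

lemma beta_bilin: "bilin L U (carrier U) (carrier U) \<beta>"
  unfolding bilin_def by (simp add: beta(1-3) beta_scale)

text \<open>On elementary tensors: \<open>h x y\<close> times \<open>a\<close> equals
  \<open>h x (y a)\<close>, which gives the coordinates of the extended form, and
  \<open>h (x \<sigma>(a)) y = a h x y\<close> has the same trace by cyclicity. So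
  \<open>T (\<sigma> a)\<close> is adjoint to \<open>T a\<close>.\<close>

lemma mu_hL:
  assumes u: "u \<in> carrier U" "v \<in> carrier U" and a: "a \<in> carrier A"
  shows "\<mu> a (hL u v) = \<beta> u (T a v)" "\<beta> (T (\<sigma> a) u) v = \<beta> u (T a v)"
proof -
  have "\<mu> a (hL u v) = \<beta> u (T a v) \<and> \<beta> (T (\<sigma> a) u) v = \<beta> u (T a v)" using u
  proof (induction u v rule: U_induct2)
    case (1 k x l y)
    then show ?case using a by (simp add: hL T_tens mu h beta sigma M.act_closed tr_comm)
  qed (use a in \<open>simp_all add: hL T_add T_closed mu beta sigma\<close>)
  then show "\<mu> a (hL u v) = \<beta> u (T a v)" "\<beta> (T (\<sigma> a) u) v = \<beta> u (T a v)" by auto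
qed

lemma hL_zero_iff:
  assumes u: "u \<in> carrier U" "v \<in> carrier U"
  shows "hL u v = \<one>\<^sub>TA.TG \<longleftrightarrow> (\<forall>a\<in>carrier A. \<beta> u (T a v) = \<zero>\<^sub>L)"
proof -
  interpret G: comm_group TA.TG by (rule TA.TG_comm)
  show ?thesis using AL_eqI[OF hL(1)[OF u] G.one_closed] mu_hL(1)[OF u] mu_one by metis
qed

text \<open>The hermitian symmetry over \<open>L\<close> is stated through the additive extension
  \<open>g\<close> of \<open>a \<mapsto> \<delta> \<sigma>(a)\<close>. In particular
  \<open>g\<close> preserves 0, which makes orthogonality symmetric.\<close>

lemma hL_swap:
  "\<exists>g\<in>hom TA.TG TA.TG. (\<forall>l\<in>carrier L. \<forall>a\<in>carrier A. g (ta l a) = ta l (sg a)) \<and>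
     (\<forall>u\<in>carrier U. \<forall>v\<in>carrier U. hL v u = g (hL u v))"
proof -
  obtain g where g: "g \<in> hom TA.TG TA.TG" "\<And>l a. l \<in> carrier L \<Longrightarrow> a \<in> carrier A \<Longrightarrow> g (ta l a) = ta l (sg a)"
    by (rule TA.universal[OF TA.TG_comm, of "\<lambda>l a. ta l (sg a)"])
      (use TA.tens_closed TA.tens_add_l TA.tens_add_r TA.tens_smult sg in auto)
  interpret g: group_hom TA.TG TA.TG g
    using g(1) by (simp add: group_hom_def group_hom_axioms_def comm_group.axioms[OF TA.TG_comm])
  have "hL v u = g (hL u v)" if "u \<in> carrier U" "v \<in> carrier U" for u v using that
  proof (induction u v rule: U_induct2)
    case (1 k x l y)
    then show ?case using h_flip[of y x] by (simp add: hL g h L.m_comm)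
  qed (simp_all add: hL)
  note * = this
  show ?thesis by (intro bexI[OF _ g(1)] conjI ballI) (erule (1) g(2), erule (1) *)
qed

lemma hL_flip:
  assumes u: "u \<in> carrier U" "v \<in> carrier U" and z: "hL u v = \<one>\<^sub>TA.TG"
  shows "hL v u = \<one>\<^sub>TA.TG"
proof -
  obtain g where g: "g \<in> hom TA.TG TA.TG" "\<forall>u\<in>carrier U. \<forall>v\<in>carrier U. hL v u = g (hL u v)" 
    using hL_swap by (elim bexE conjE)
  interpret g: group_hom TA.TG TA.TG g
    using g(1) by (simp add: group_hom_def group_hom_axioms_def comm_group.axioms[OF TA.TG_comm])
  show ?thesis using bspec[OF bspec[OF g(2) u(1)] u(2)] unfolding z by simp
qed

text \<open>The extended form vanishes at \<open>u\<close> and \<open>v\<close> iff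
  \<open>\<beta> u (T a v) = 0\<close> for all \<open>a\<close>, and stability of \<open>Z\<close>
  absorbs the \<open>T a\<close>. Hence both one-sided orthogonals for \<open>\<beta>\<close> equal
  the hermitian orthogonal.\<close>

lemma perp_beta:
  assumes Z: "stab Z" shows "perp AL LM hL Z = {u \<in> carrier U. \<forall>v\<in>Z. \<beta> v u = \<zero>\<^sub>L}"
    "perp AL LM hL Z = {u \<in> carrier U. \<forall>v\<in>Z. \<beta> u v = \<zero>\<^sub>L}"
proof -
  have Zc: "v \<in> carrier U" if "v \<in> Z" for v using Z that U.subspD(3) unfolding stab_def by blast
  have Zs: "T a v \<in> Z" if "v \<in> Z" "a \<in> carrier A" for a v using Z that unfolding stab_def by blast
  have p: "perp AL LM hL Z = {u \<in> carrier U. \<forall>v\<in>Z. hL u v = \<one>\<^sub>TA.TG}"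
    unfolding perp_def LM_simps AL_simps ..
  have one: "T \<one>\<^sub>A v = v" "\<one>\<^sub>A \<in> carrier A" if "v \<in> carrier U" for v using T_one that by auto
  have "(\<forall>v\<in>Z. hL u v = \<one>\<^sub>TA.TG) \<longleftrightarrow> (\<forall>v\<in>Z. \<beta> u v = \<zero>\<^sub>L)" if u: "u \<in> carrier U" for u
    using hL_zero_iff[OF u Zc] Zs one[OF Zc] by metis
  then show "perp AL LM hL Z = {u \<in> carrier U. \<forall>v\<in>Z. \<beta> u v = \<zero>\<^sub>L}" using p by auto
  have "(\<forall>v\<in>Z. hL u v = \<one>\<^sub>TA.TG) \<longleftrightarrow> (\<forall>v\<in>Z. \<beta> v u = \<zero>\<^sub>L)" if u: "u \<in> carrier U" for u
  proof -
    have "(\<forall>v\<in>Z. hL u v = \<one>\<^sub>TA.TG) \<longleftrightarrow> (\<forall>v\<in>Z. hL v u = \<one>\<^sub>TA.TG)" using hL_flip u Zc by blast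
    also have "\<dots> \<longleftrightarrow> (\<forall>v\<in>Z. \<forall>a\<in>carrier A. \<beta> (T (\<sigma> a) v) u = \<zero>\<^sub>L)"
      using hL_zero_iff[OF Zc u] mu_hL(2)[OF Zc u] by simp
    also have "\<dots> \<longleftrightarrow> (\<forall>v\<in>Z. \<beta> v u = \<zero>\<^sub>L)" using Zs sigma one[OF Zc] by metis
    finally show ?thesis .
  qed
  then show "perp AL LM hL Z = {u \<in> carrier U. \<forall>v\<in>Z. \<beta> v u = \<zero>\<^sub>L}" using p by auto
qed

lemma V_vecsp: "vecsp F V"
  by (simp add: vecsp_def V_module F.field_axioms)

text \<open>Each generator \<open>s\<close> of \<open>M\<close> contributes the image of the
  finite-dimensional \<open>A\<close> under \<open>a \<mapsto> s a\<close>.\<close>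

lemma V_qdim: "\<exists>n. qdim F V {\<zero>\<^sub>V} (carrier V) n"
proof -
  interpret V: vecsp F V by (rule V_vecsp)
  obtain S where S: "finite S" "S \<subseteq> carrier M" and gen: "\<And>x. x \<in> carrier M \<Longrightarrow> \<exists>a\<in>S \<rightarrow> carrier A. x = (\<Oplus>\<^sub>M s\<in>S. a s \<odot>\<^sub>M s)"
    using fgM unfolding finitely_generated_def by blast
  obtain d where d: "qdim F A {\<zero>\<^sub>A} (carrier A) d" using A_qdim by auto
  from S have "\<exists>Z n. qdim F V {\<zero>\<^sub>V} Z n \<and> (\<forall>s\<in>S. \<forall>a\<in>carrier A. a \<odot>\<^sub>M s \<in> Z)"
  proof (induction S rule: finite_induct)
    case empty
    show ?case using qdim_refl[OF V.subsp_zero] by blast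
  next
    case (insert s S)
    then obtain Z n where Z: "qdim F V {\<zero>\<^sub>V} Z n" "\<forall>s\<in>S. \<forall>a\<in>carrier A. a \<odot>\<^sub>M s \<in> Z" by auto
    note Zs = conjunct1[OF conjunct2[OF V.qdim_subsp[OF Z(1)]]]
    have s: "s \<in> carrier M" using insert.prems by auto
    let ?g = "\<lambda>a. a \<odot>\<^sub>M s"
    have gc: "?g ` carrier A \<subseteq> carrier V" using s M.act_closed V_simps by auto
    have "\<zero>\<^sub>A \<odot>\<^sub>M s \<oplus>\<^sub>M \<zero>\<^sub>A \<odot>\<^sub>M s = \<zero>\<^sub>A \<odot>\<^sub>M s" using M.act_add_scalar[of "\<zero>\<^sub>A" "\<zero>\<^sub>A" s] s by simp
    then have z: "\<zero>\<^sub>A \<odot>\<^sub>M s = \<zero>\<^sub>M" using M.act_closed[of "\<zero>\<^sub>A" s] s M.M.add.l_cancel_one by simp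
    have "\<exists>j\<le>d. qdim F V Z (ssum V Z (?g ` carrier A)) j"
      by (rule qdim_image_le[OF AV.vecsp_axioms V_vecsp d _ _ _ Zs])
        (use s z V.subspD(2)[OF Zs] in \<open>auto simp: V_simps M.act_closed M.act_add_scalar M.act_assoc[symmetric] scalar_mult\<close>)
    then obtain j where "qdim F V Z (ssum V Z (?g ` carrier A)) j" by auto
    then have "qdim F V {\<zero>\<^sub>V} (ssum V Z (?g ` carrier A)) (n + j)" using V.qdim_trans Z(1) by blast
    moreover have "Z \<subseteq> ssum V Z (?g ` carrier A)"
    proof
      fix u assume u: "u \<in> Z"
      then have "u = u \<oplus>\<^sub>V ?g \<zero>\<^sub>A" using z V.subspD(3)[OF Zs u] by (simp add: V_simps)
      then show "u \<in> ssum V Z (?g ` carrier A)" using u A.M.zero_closed unfolding ssum_def by blast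
    qed
    moreover have "?g ` carrier A \<subseteq> ssum V Z (?g ` carrier A)" by (rule V.ssum_ge2[OF Zs gc])
    ultimately show ?case using Z(2) by blast
  qed
  then obtain Z n where Z: "qdim F V {\<zero>\<^sub>V} Z n" "\<And>s a. s \<in> S \<Longrightarrow> a \<in> carrier A \<Longrightarrow> a \<odot>\<^sub>M s \<in> Z" by blast
  note Zs = conjunct1[OF conjunct2[OF V.qdim_subsp[OF Z(1)]]]
  have fs: "(\<Oplus>\<^sub>M s\<in>B. f s) \<in> Z" if "finite B" "f \<in> B \<rightarrow> Z" for B :: "'m set" and f
    using that
  proof (induction B rule: finite_induct)
    case (insert b B)
    then have "f \<in> B \<rightarrow> carrier M" "f b \<in> carrier M" using V.subspD(1)[OF Zs] V_simps(1) by auto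
    then show ?case using insert V.subspD(4)[OF Zs] by (simp add: V_simps)
  qed (use V.subspD(2)[OF Zs] V_simps in simp)
  have "carrier V \<subseteq> Z"
  proof
    fix x assume "x \<in> carrier V"
    then obtain a where "a \<in> S \<rightarrow> carrier A" "x = (\<Oplus>\<^sub>M s\<in>S. a s \<odot>\<^sub>M s)" using gen V_simps by auto
    then show "x \<in> Z" using fs[OF S(1)] Z(2) by (simp add: Pi_def)
  qed
  then have "Z = carrier V" using V.subspD(1)[OF Zs] by auto
  then show ?thesis using Z(1) by blast
qed

lemma V_bilin: "bilin F V (carrier V) (carrier V) (\<lambda>x y. \<tau> (h x y))"
  unfolding bilin_def V_simps by (simp add: h tr_closed tr_add tr_smult scalar_mult sigma)

lemma h_zero_flip: "x \<in> carrier M \<Longrightarrow> y \<in> carrier M \<Longrightarrow> h x y = \<zero>\<^sub>A \<Longrightarrow> h y x = \<zero>\<^sub>A"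
proof -
  assume x: "x \<in> carrier M" "y \<in> carrier M" "h x y = \<zero>\<^sub>A"
  have "\<sigma> \<zero>\<^sub>A = \<zero>\<^sub>A" using sigma(6)[of "\<zero>\<^sub>F" "\<zero>\<^sub>A"] sigma(1)[of "\<zero>\<^sub>A"] by simp
  then show ?thesis using h_flip[OF x(2,1)] x(3) by (simp add: sg_cases)
qed

text \<open>Dual bases for \<open>\<tau> h\<close> are taken over \<open>F\<close> and extended to
  \<open>L\<close>; this is why all their products are constants.\<close>

lemma U_basis:
  "\<exists>(n::nat) e es. (\<forall>i<n. e i \<in> carrier M \<and> es i \<in> carrier M) \<and>
     (\<forall>i<n. \<forall>j<n. \<tau> (h (e i) (es j)) = (if i = j then \<one>\<^sub>F else \<zero>\<^sub>F)) \<and>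
     (\<forall>u\<in>carrier U. u = (\<Oplus>\<^sub>U i\<in>{..<n}. \<beta> u (tv \<one>\<^sub>L (es i)) \<odot>\<^sub>U tv \<one>\<^sub>L (e i)))"
proof -
  interpret V: vecsp F V by (rule V_vecsp)
  obtain n where n: "qdim F V {\<zero>\<^sub>V} (carrier V) n" using V_qdim by auto
  \<comment> \<open>The trace vanishes on all \<open>h u (y b) = h u y b\<close>, so
    \<open>h u y\<close> is 0 by nondegeneracy of \<open>\<tau>\<close>, and then
    \<open>nondeg\<close> applies after swapping the arguments.\<close>
  have nd: "u = \<zero>\<^sub>V" if u: "u \<in> carrier V" and z: "\<And>s. s \<in> carrier V \<Longrightarrow> \<tau> (h u s) = \<zero>\<^sub>F" for u
    unfolding V_simps
  proof (rule nondeg)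
    show uM: "u \<in> carrier M" using u V_simps by simp
    fix y assume y: "y \<in> carrier M"
    have "h u y = \<zero>\<^sub>A"
    proof (rule tr_nondeg)
      show "h u y \<in> carrier A" using h uM y by simp
      fix b assume b: "b \<in> carrier A"
      then show "\<tau> (h u y \<star> b) = \<zero>\<^sub>F" using z[of "b \<odot>\<^sub>M y"] h(5)[OF uM y b] M.act_closed[OF b y] V_simps by simp
    qed
    then show "h y u = \<zero>\<^sub>A" using h_zero_flip uM y by simp
  qed
  obtain e es where e: "\<forall>i<n. e i \<in> carrier V \<and> es i \<in> carrier V"
    "\<forall>i<n. \<forall>j<n. \<tau> (h (e i) (es j)) = (if i = j then \<one>\<^sub>F else \<zero>\<^sub>F)"
    "\<forall>u\<in>carrier V. u = (\<Oplus>\<^sub>V i\<in>{..<n}. \<tau> (h u (es i)) \<odot>\<^sub>V e i)"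
    using V.dual_basis[OF V_bilin nd n] by blast
  have ec: "i < n \<Longrightarrow> e i \<in> carrier V" "i < n \<Longrightarrow> es i \<in> carrier V" for i using e(1) by auto
  have "u = (\<Oplus>\<^sub>U i\<in>{..<n}. \<beta> u (tv \<one>\<^sub>L (es i)) \<odot>\<^sub>U tv \<one>\<^sub>L (e i))" if u: "u \<in> carrier U" for u
  proof (rule TV.tens_expand[where f = "\<lambda>i u. \<tau> (h u (es i))" and \<Phi> = "\<lambda>i u. \<beta> u (tv \<one>\<^sub>L (es i))", OF ec(1) _ _ _ _ _ u[folded TG_simps(1)]])
    fix v assume "v \<in> carrier V"
    then show "v = (\<Oplus>\<^sub>V i\<in>{..<n}. \<tau> (h v (es i)) \<odot>\<^sub>V e i)" using e(3) by (rule bspec[rotated])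
  qed (use ec beta h tr_closed tv_closed in \<open>simp_all add: V_simps TG_simps\<close>)
  moreover have "\<forall>i<n. e i \<in> carrier M \<and> es i \<in> carrier M" using e(1) V_simps by simp
  ultimately show ?thesis using e(2) by blast
qed

end

section \<open>Descent of the anisotropic kernel\<close>

text \<open>Encoding the cosets of \<open>T\<close> by their coordinates lets a quotient space live on the type \<open>nat \<Rightarrow> 'c\<close>.\<close>

lemma qdim_code:
  fixes g :: "'k \<Rightarrow> 'c"
  assumes "vecsp K V" "qdim K V T S n" and g: "inj_on g (carrier K)"
  shows "\<exists>E :: 'v \<Rightarrow> nat \<Rightarrow> 'c. \<forall>u\<in>S. \<forall>w\<in>S. E u = E w \<longleftrightarrow> (\<exists>t\<in>T. u = t \<oplus>\<^sub>V w)"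
  using assms(2)
proof (induction rule: qdim.induct)
  interpret vecsp K V by fact
  case (qdim_refl T)
  have "\<exists>t\<in>T. u = t \<oplus>\<^sub>V w" if "u \<in> T" "w \<in> T" for u w
    using that subspD(3)[OF qdim_refl] subsp_diff[OF qdim_refl that]
    by (intro bexI[of _ "u \<ominus>\<^sub>V w"]) (auto simp: a_minus_def M.a_assoc M.l_neg)
  then show ?case by (intro exI[of _ "\<lambda>u. undefined"]) auto
next
  interpret vecsp K V by fact
  case (qdim_step T S n v)
  have S: "subsp K V S" "subsp K V T" "T \<subseteq> S" using qdim_subsp[OF qdim_step.hyps(1)] by auto
  note sc = subspD(3)[OF S(1)]
  note v = qdim_step.hyps(2,3)
  obtain E :: "'v \<Rightarrow> nat \<Rightarrow> 'c" where E: "\<forall>u\<in>S. \<forall>w\<in>S. E u = E w \<longleftrightarrow> (\<exists>t\<in>T. u = t \<oplus>\<^sub>V w)"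
    using qdim_step.IH by blast
  have "\<exists>p. fst p \<in> S \<and> snd p \<in> carrier K \<and> u = fst p \<oplus>\<^sub>V snd p \<odot>\<^sub>V v" if "u \<in> adj K V S v" for u
    using that unfolding adj_def by auto
  then obtain p where p: "\<And>u. u \<in> adj K V S v \<Longrightarrow> fst (p u) \<in> S \<and> snd (p u) \<in> carrier K \<and> u = fst (p u) \<oplus>\<^sub>V snd (p u) \<odot>\<^sub>V v"
    by metis
  \<comment> \<open>The coordinate along \<open>v\<close>, carried into the code type by
    \<open>g\<close>, is put in front of the code of the component in \<open>S\<close>.\<close>
  define E' where "E' = (\<lambda>u. case_nat (g (snd (p u))) (E (fst (p u))))"
  have "E' u = E' w \<longleftrightarrow> (\<exists>t\<in>T. u = t \<oplus>\<^sub>V w)" if u: "u \<in> adj K V S v" and w: "w \<in> adj K V S v" for u w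
  proof -
    define s a s' a' where "s = fst (p u)" "a = snd (p u)" "s' = fst (p w)" "a' = snd (p w)"
    then have s: "s \<in> S" "a \<in> carrier K" "u = s \<oplus>\<^sub>V a \<odot>\<^sub>V v" and s': "s' \<in> S" "a' \<in> carrier K" "w = s' \<oplus>\<^sub>V a' \<odot>\<^sub>V v"
      using p[OF u] p[OF w] by simp_all
    have "E' u = E' w \<longleftrightarrow> g a = g a' \<and> E s = E s'"
    proof
      assume e: "E' u = E' w"
      have "g a = g a'" using fun_cong[OF e, of 0] unfolding E'_def s_a_s'_a'_def by simp
      moreover have "E s i = E s' i" for i using fun_cong[OF e, of "Suc i"] unfolding E'_def s_a_s'_a'_def by simp
      ultimately show "g a = g a' \<and> E s = E s'" by auto
    qed (simp add: E'_def s_a_s'_a'_def)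
    also have "\<dots> \<longleftrightarrow> a = a' \<and> (\<exists>t\<in>T. s = t \<oplus>\<^sub>V s')" using g s(1,2) s'(1,2) E by (auto dest: inj_onD)
    also have "\<dots> \<longleftrightarrow> (\<exists>t\<in>T. u = t \<oplus>\<^sub>V w)"
    proof (intro iffI; elim conjE bexE)
      fix t assume "a = a'" "t \<in> T" "s = t \<oplus>\<^sub>V s'"
      then show "\<exists>t\<in>T. u = t \<oplus>\<^sub>V w"
        using s(3) s'(3) sc[of t] sc[OF s'(1)] S(3) s'(2) v(1) by (intro bexI[of _ t]) (auto simp: M.a_assoc)
    next
      fix t assume t: "t \<in> T" "u = t \<oplus>\<^sub>V w"
      then have tS: "t \<in> S" "t \<oplus>\<^sub>V s' \<in> S" using S(3) subspD(4)[OF S(1)] s'(1) by auto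
      have eq: "s \<oplus>\<^sub>V a \<odot>\<^sub>V v = (t \<oplus>\<^sub>V s') \<oplus>\<^sub>V a' \<odot>\<^sub>V v"
        using t(2) unfolding s(3) s'(3) using sc[OF tS(1)] sc[OF s'(1)] s'(2) v(1) by (simp add: M.a_assoc)
      from adj_unique[OF S(1) v s(1) tS(2) s(2) s'(2) eq] t(1) show "a = a' \<and> (\<exists>t\<in>T. s = t \<oplus>\<^sub>V s')" by blast
    qed
    finally show ?thesis .
  qed
  then show ?case by blast
qed

lemma qdim_generators:
  assumes "vecsp K V" "qdim K V T S n"
  shows "\<exists>B. finite B \<and> B \<subseteq> S \<and> (\<forall>Z. subsp K V Z \<longrightarrow> T \<subseteq> Z \<longrightarrow> B \<subseteq> Z \<longrightarrow> S \<subseteq> Z)"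
  using assms(2)
proof (induction rule: qdim.induct)
  case (qdim_step T S n v)
  interpret vecsp K V by fact
  have S: "subsp K V S" using qdim_subsp[OF qdim_step.hyps(1)] by auto
  obtain B where B: "finite B" "B \<subseteq> S" "\<And>Z. subsp K V Z \<Longrightarrow> T \<subseteq> Z \<Longrightarrow> B \<subseteq> Z \<Longrightarrow> S \<subseteq> Z"
    using qdim_step.IH by blast
  have "insert v B \<subseteq> adj K V S v" using B(2) adj_ge[OF subspD(1)[OF S]] adj_mem[OF S] qdim_step.hyps(2) by blast
  moreover have "adj K V S v \<subseteq> Z" if "subsp K V Z" "T \<subseteq> Z" "insert v B \<subseteq> Z" for Z
    using adj_least[OF that(1) B(3)[OF that(1,2)]] that(3) by blast
  ultimately show ?case using B(1) by (intro exI[of _ "insert v B"]) auto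
qed (intro exI[of _ "{}"], auto)

context right_module
begin

text \<open>Linear combinations in the shape required by \<open>finitely_generated\<close>, where
  each generator occurs exactly once.\<close>

definition combos where
  "combos B = {\<Oplus>\<^sub>M s\<in>B. a s \<odot>\<^sub>M s | a. a \<in> B \<rightarrow> carrier A}"

lemma act_zero: "x \<in> carrier M \<Longrightarrow> \<zero>\<^sub>A \<odot>\<^sub>M x = \<zero>\<^sub>M"
  using act_add_scalar[of "\<zero>\<^sub>A" "\<zero>\<^sub>A" x] act_closed[of "\<zero>\<^sub>A" x] M.add.l_cancel_one by simp

lemma act_zero': "a \<in> carrier A \<Longrightarrow> a \<odot>\<^sub>M \<zero>\<^sub>M = \<zero>\<^sub>M"
  using act_add[of a "\<zero>\<^sub>M" "\<zero>\<^sub>M"] act_closed[of a "\<zero>\<^sub>M"] M.add.l_cancel_one by simp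

lemma combos:
  assumes B: "finite B" "B \<subseteq> carrier M"
  shows "combos B \<subseteq> carrier M" "B \<subseteq> combos B" "\<zero>\<^sub>M \<in> combos B"
    "x \<in> combos B \<Longrightarrow> y \<in> combos B \<Longrightarrow> x \<oplus>\<^sub>M y \<in> combos B"
    "x \<in> combos B \<Longrightarrow> c \<in> carrier A \<Longrightarrow> c \<odot>\<^sub>M x \<in> combos B"
proof -
  have f: "(\<lambda>s. a s \<odot>\<^sub>M s) \<in> B \<rightarrow> carrier M" if "a \<in> B \<rightarrow> carrier A" for a
    using that B(2) act_closed by (auto simp: Pi_def)
  show "combos B \<subseteq> carrier M" unfolding combos_def using M.finsum_closed[OF f] by blast
  show "B \<subseteq> combos B"
  proof
    fix b assume b: "b \<in> B"
    let ?a = "\<lambda>s. if b = s then \<one>\<^sub>A else \<zero>\<^sub>A"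
    have "(\<Oplus>\<^sub>M s\<in>B. ?a s \<odot>\<^sub>M s) = (\<Oplus>\<^sub>M s\<in>B. if b = s then s else \<zero>\<^sub>M)"
      by (rule M.finsum_cong') (use B act_one act_zero in auto)
    also have "\<dots> = b" by (rule M.finsum_singleton[OF b B(1)]) (use B in auto)
    finally show "b \<in> combos B" unfolding combos_def by (auto intro!: exI[of _ ?a])
  qed
  have "(\<Oplus>\<^sub>M s\<in>B. \<zero>\<^sub>A \<odot>\<^sub>M s) = (\<Oplus>\<^sub>M s\<in>B. \<zero>\<^sub>M)"
    by (rule M.finsum_cong') (use B act_zero in auto)
  then have "(\<Oplus>\<^sub>M s\<in>B. \<zero>\<^sub>A \<odot>\<^sub>M s) = \<zero>\<^sub>M" by simp
  then show "\<zero>\<^sub>M \<in> combos B" unfolding combos_def by (intro CollectI exI[of _ "\<lambda>_. \<zero>\<^sub>A"]) auto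
  show "x \<oplus>\<^sub>M y \<in> combos B" if xy: "x \<in> combos B" "y \<in> combos B"
  proof -
    obtain a b where a: "a \<in> B \<rightarrow> carrier A" "x = (\<Oplus>\<^sub>M s\<in>B. a s \<odot>\<^sub>M s)"
      and b: "b \<in> B \<rightarrow> carrier A" "y = (\<Oplus>\<^sub>M s\<in>B. b s \<odot>\<^sub>M s)" using xy unfolding combos_def by blast
    have "x \<oplus>\<^sub>M y = (\<Oplus>\<^sub>M s\<in>B. a s \<odot>\<^sub>M s \<oplus>\<^sub>M b s \<odot>\<^sub>M s)"
      unfolding a(2) b(2) by (rule M.finsum_addf[OF f[OF a(1)] f[OF b(1)], symmetric])
    also have "\<dots> = (\<Oplus>\<^sub>M s\<in>B. (a s \<oplus>\<^sub>A b s) \<odot>\<^sub>M s)"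
    proof (rule M.finsum_cong'[OF refl])
      show "(\<lambda>s. (a s \<oplus>\<^sub>A b s) \<odot>\<^sub>M s) \<in> B \<rightarrow> carrier M" by (rule f) (use a b in auto)
      fix s assume "s \<in> B"
      then have "a s \<in> carrier A" "b s \<in> carrier A" "s \<in> carrier M" using a(1) b(1) B(2) by auto
      then show "a s \<odot>\<^sub>M s \<oplus>\<^sub>M b s \<odot>\<^sub>M s = (a s \<oplus>\<^sub>A b s) \<odot>\<^sub>M s" by (rule act_add_scalar[symmetric])
    qed
    finally have "x \<oplus>\<^sub>M y = (\<Oplus>\<^sub>M s\<in>B. (a s \<oplus>\<^sub>A b s) \<odot>\<^sub>M s)" .
    then show ?thesis unfolding combos_def using a(1) b(1) by (intro CollectI exI[of _ "\<lambda>s. a s \<oplus>\<^sub>A b s"]) auto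
  qed
  show "c \<odot>\<^sub>M x \<in> combos B" if x: "x \<in> combos B" and c: "c \<in> carrier A"
  proof -
    obtain a where a: "a \<in> B \<rightarrow> carrier A" "x = (\<Oplus>\<^sub>M s\<in>B. a s \<odot>\<^sub>M s)" using x unfolding combos_def by blast
    have "c \<odot>\<^sub>M (\<Oplus>\<^sub>M s\<in>B'. a s \<odot>\<^sub>M s) = (\<Oplus>\<^sub>M s\<in>B'. (a s \<otimes>\<^sub>A c) \<odot>\<^sub>M s)" if "B' \<subseteq> B" for B'
      using finite_subset[OF that B(1)] that
    proof (induction B' rule: finite_induct)
      case (insert s B')
      have ac: "a t \<in> carrier A" "t \<in> carrier M" if "t \<in> insert s B'" for t using that insert.prems a(1) B(2) by auto
      have m: "s \<in> carrier M" "a s \<in> carrier A" "a s \<odot>\<^sub>M s \<in> carrier M" "(a s \<otimes>\<^sub>A c) \<odot>\<^sub>M s \<in> carrier M"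
        using ac[of s] c by (auto intro!: act_closed)
      have f1: "(\<lambda>s. a s \<odot>\<^sub>M s) \<in> B' \<rightarrow> carrier M" "(\<lambda>s. (a s \<otimes>\<^sub>A c) \<odot>\<^sub>M s) \<in> B' \<rightarrow> carrier M"
        using ac c by (auto intro!: act_closed)
      show ?case
        unfolding M.finsum_insert[where f = "\<lambda>s. a s \<odot>\<^sub>M s", OF insert.hyps f1(1) m(3)]
          M.finsum_insert[where f = "\<lambda>s. (a s \<otimes>\<^sub>A c) \<odot>\<^sub>M s", OF insert.hyps f1(2) m(4)]
        using insert act_add[OF c m(3) M.finsum_closed[OF f1(1)]] act_assoc[OF m(2) c m(1)] by simp
    qed (simp add: act_zero' c)
    from this[OF order_refl] show ?thesis unfolding a(2) combos_def
      using a(1) c by (intro CollectI exI[of _ "\<lambda>s. a s \<otimes>\<^sub>A c"]) auto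
  qed
qed

end

context herm_ext
begin

abbreviation "kF \<equiv> (\<lambda>c. c \<odot>\<^sub>L \<one>\<^sub>L) ` carrier F"

lemma stabD:
  assumes "stab Z" shows "subsp L U Z" "u \<in> Z \<Longrightarrow> u \<in> carrier U" "a \<in> carrier A \<Longrightarrow> u \<in> Z \<Longrightarrow> T a u \<in> Z"
  using assms U.subspD(3) unfolding stab_def by blast+

lemma perp_stab: assumes Z: "stab Z" shows "stab (perp AL LM hL Z)"
  unfolding stab_def
proof (intro conjI ballI)
  show "subsp L U (perp AL LM hL Z)"
    unfolding perp_beta(1)[OF Z] subsp_def
    using stabD[OF Z] beta beta_scale U.bilin_zero[OF bilin_flip[OF beta_bilin]] by auto
  fix a u assume a: "a \<in> carrier A" and u: "u \<in> perp AL LM hL Z"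
  have "\<beta> v (T a u) = \<zero>\<^sub>L" if "v \<in> Z" for v
    using mu_hL(2)[OF stabD(2)[OF Z that] _ a, of u] u stabD(3)[OF Z sigma(1)[OF a] that] unfolding perp_beta(1)[OF Z] by auto
  then show "T a u \<in> perp AL LM hL Z" using u T_closed[OF a] unfolding perp_beta(1)[OF Z] by auto
qed

text \<open>Transfer to the filtered setting: \<open>1 \<otimes> e0\<close> and
  \<open>1 \<otimes> es0\<close> are the constant dual bases, the operators are the
  \<open>T a\<close>, and stable isotropic subspaces are the sublagrangians.\<close>

theorem descent:
  assumes filt: "filt L kF Rd Lm x c" and N: "maximal_sublagrangian AL LM hL N"
  shows "\<exists>Q m. subsp (L\<lparr>carrier := kF\<rparr>) U Q \<and> Q \<subseteq> perp AL LM hL N \<and> (\<forall>a\<in>carrier A. \<forall>q\<in>Q. T a q \<in> Q) \<and>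
     qdim (L\<lparr>carrier := kF\<rparr>) U (Q \<inter> N) Q m \<and> (\<forall>q\<in>Q. \<forall>q'\<in>Q. \<beta> q q' \<in> kF) \<and>
     (\<forall>q\<in>Q. (\<forall>q'\<in>Q. \<beta> q q' = \<zero>\<^sub>L) \<longrightarrow> q \<in> N) \<and>
     (\<forall>Z. subsp L U Z \<longrightarrow> N \<subseteq> Z \<longrightarrow> Q \<subseteq> Z \<longrightarrow> perp AL LM hL N \<subseteq> Z)"
proof -
  interpret filt L kF Rd Lm x c by (rule filt)
  obtain n :: nat and e0 es0 where e0: "\<forall>i<n. e0 i \<in> carrier M \<and> es0 i \<in> carrier M"
    "\<forall>i<n. \<forall>j<n. \<tau> (h (e0 i) (es0 j)) = (if i = j then \<one>\<^sub>F else \<zero>\<^sub>F)"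
    and ex: "\<forall>u\<in>carrier U. u = (\<Oplus>\<^sub>U i\<in>{..<n}. \<beta> u (tv \<one>\<^sub>L (es0 i)) \<odot>\<^sub>U tv \<one>\<^sub>L (e0 i))"
    using U_basis by (elim exE conjE)
  define e es where "e = (\<lambda>i. tv \<one>\<^sub>L (e0 i))" "es = (\<lambda>i. tv \<one>\<^sub>L (es0 i))"
  note defs = e_es_def
  have ec: "i < n \<Longrightarrow> e0 i \<in> carrier M" "i < n \<Longrightarrow> es0 i \<in> carrier M" for i using e0 by auto
  have b: "\<beta> (tv \<one>\<^sub>L x) (tv \<one>\<^sub>L y) = \<tau> (h x y) \<odot>\<^sub>L \<one>\<^sub>L" if "x \<in> carrier M" "y \<in> carrier M" for x y
    using that by (simp add: beta)
  have bk: "\<beta> (tv \<one>\<^sub>L x) (tv \<one>\<^sub>L y) \<in> kF" if "x \<in> carrier M" "y \<in> carrier M" for x y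
    using b[OF that] tr_closed[OF h(1)[OF that]] by auto
  interpret filt_form L kF Rd Lm x c U n e es \<beta>
  proof (intro filt_form.intro filt_form_axioms.intro filt U.module_axioms beta_bilin)
    fix u assume "u \<in> carrier U"
    then show "u = (\<Oplus>\<^sub>U i\<in>{..<n}. \<beta> u (es i) \<odot>\<^sub>U e i)" unfolding defs by (rule bspec[OF ex])
  next
    fix i j assume ij: "i < n" "j < n"
    then show "\<beta> (e i) (es j) = (if i = j then \<one>\<^sub>L else \<zero>\<^sub>L)"
      unfolding defs using b[OF ec(1)[OF ij(1)] ec(2)[OF ij(2)]] e0(2) by simp
  qed (use ec bk tv_closed in \<open>simp_all add: defs\<close>)
  interpret filt_herm L kF Rd Lm x c U n e es \<beta> "T ` carrier A"
  proof (intro filt_herm.intro filt_herm_axioms.intro filt_form_axioms)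
    fix S u E assume "S \<in> T ` carrier A" and E: "subsp (L\<lparr>carrier := kF\<rparr>) (reg_mod L) E" and u: "u \<in> UE E"
    then obtain a where a: "a \<in> carrier A" "S = T a" by auto
    note uc = UE_carrier[OF u]
    have kk: "subsp (L\<lparr>carrier := kF\<rparr>) (reg_mod L) kF" using Rd_subsp[of 0] Rd_0 by simp
    \<comment> \<open>The adjoint moves \<open>T a\<close> to the basis vector, which stays of the
      form \<open>1 \<otimes> y\<close> and so has constant coordinates. Products with it remain in
      \<open>E\<close>.\<close>
    have "\<beta> (T a u) (es i) \<in> E" if i: "i < n" for i
    proof -
      let ?y = "\<sigma> a \<odot>\<^sub>M es0 i"
      have y: "?y \<in> carrier M" using M.act_closed sigma(1)[OF a(1)] ec(2)[OF i] by simp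
      have "\<beta> (T a u) (es i) = \<beta> u (tv \<one>\<^sub>L ?y)"
        using mu_hL(2)[OF uc es_car[OF i] sigma(1)[OF a(1)]] sigma a(1) ec(2)[OF i] by (simp add: defs T_tens)
      moreover have "tv \<one>\<^sub>L ?y \<in> UE kF" unfolding UE_def using bk y ec(2) tv_closed by (simp add: defs)
      moreover have "z \<otimes>\<^sub>L w \<in> E" if z: "z \<in> E" and w: "w \<in> kF" for z w
      proof -
        have "w \<otimes>\<^sub>L z \<in> E" using Lk.subspD(5)[OF E _ z, of w] w by simp
        moreover have "z \<in> carrier L" using Lk.subspD(3)[OF E z] by simp
        moreover have "w \<in> carrier L" using w k_sub by auto
        ultimately show ?thesis by (simp add: L.m_comm)
      qed
      ultimately show ?thesis using b_UE[OF u _ E kk E] by metis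
    qed
    then show "S u \<in> UE E" unfolding UE_def using T_closed[OF a(1) uc] a(2) by simp
  next
    fix Z S u w assume Z: "subsp L U Z" "\<And>S u. S \<in> T ` carrier A \<Longrightarrow> u \<in> Z \<Longrightarrow> S u \<in> Z"
      and S: "S \<in> T ` carrier A" and u: "u \<in> carrier U" "\<And>v. v \<in> Z \<Longrightarrow> \<beta> v u = \<zero>\<^sub>L" and w: "w \<in> Z"
    have Zs: "stab Z" using Z unfolding stab_def by auto
    show "\<beta> w (S u) = \<zero>\<^sub>L" using S stabD(3)[OF perp_stab[OF Zs], of _ u] u w unfolding perp_beta(1)[OF Zs] by auto
  next
    fix Z u assume Z: "subsp L U Z" "\<And>S u. S \<in> T ` carrier A \<Longrightarrow> u \<in> Z \<Longrightarrow> S u \<in> Z" and u: "u \<in> carrier U"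
    have "stab Z" using Z unfolding stab_def by auto
    from perp_beta[OF this] u show "(\<forall>v\<in>Z. \<beta> v u = \<zero>\<^sub>L) \<longleftrightarrow> (\<forall>v\<in>Z. \<beta> u v = \<zero>\<^sub>L)" by blast
  qed (use T_add T_scale in auto)
  have st: "stable Z \<longleftrightarrow> stab Z" for Z unfolding stable_def stab_def by auto
  have orth: "orth Z = perp AL LM hL Z" if "stab Z" for Z unfolding orth_def perp_beta(1)[OF that] ..
  have NN: "stab N" "N \<subseteq> perp AL LM hL N" using N submodule_iff unfolding maximal_sublagrangian_def sublagrangian_def by auto
  interpret max_isotropic L kF Rd Lm x c U n e es \<beta> "T ` carrier A" N
  proof (intro max_isotropic.intro max_isotropic_axioms.intro filt_herm_axioms)
    fix Z assume "stable Z" "N \<subseteq> Z" "Z \<subseteq> orth Z"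
    then show "Z = N" using N orth[of Z] submodule_iff[of Z] st unfolding maximal_sublagrangian_def sublagrangian_def by metis
  qed (use NN st orth in simp_all)
  show ?thesis using descent unfolding orth[OF NN(1)] by simp
qed

end

section \<open>The form induced on cosets of an isotropic submodule\<close>

locale herm_kern = herm_ext F L A \<tau> M \<sigma> \<delta> h
  for F :: "('f, 'p) ring_scheme" and L :: "('f, 'l) module" and A :: "('f, 'a) module" and \<tau> :: "'a \<Rightarrow> 'f"
    and M :: "('a, 'm) module" and \<sigma> \<delta> h +
  fixes N :: "('l, 'm) tensor set"
  assumes N: "stab N" and N_iso: "N \<subseteq> perp AL LM hL N"
begin

abbreviation "P \<equiv> perp AL LM hL N"

definition co :: "('l, 'm) tensor \<Rightarrow> ('l, 'm) tensor set" where "co u = N +>\<^bsub>LM\<^esub> u"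

lemmas Ns = stabD[OF N] and Ps = stabD[OF perp_stab[OF N]]

lemma co_mem: "w \<in> co u \<longleftrightarrow> (\<exists>n\<in>N. w = n \<oplus>\<^sub>U u)"
  unfolding co_def a_r_coset_def r_coset_def by (auto simp: LM_simps)

lemma co_self: "u \<in> carrier U \<Longrightarrow> u \<in> co u"
  unfolding co_mem using U.subspD(2)[OF Ns(1)] by (intro bexI[of _ "\<zero>\<^sub>U"]) auto

lemma co_eq: 
  assumes u: "u \<in> carrier U" "v \<in> carrier U" shows "co u = co v \<longleftrightarrow> (\<exists>n\<in>N. u = n \<oplus>\<^sub>U v)"
proof
  assume "co u = co v"
  then show "\<exists>n\<in>N. u = n \<oplus>\<^sub>U v" using co_self[OF u(1)] co_mem by auto
next
  assume "\<exists>n\<in>N. u = n \<oplus>\<^sub>U v"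
  then obtain n where n: "n \<in> N" "u = n \<oplus>\<^sub>U v" by blast
  note nc = Ns(2)[OF n(1)]
  have v: "v = \<ominus>\<^sub>U n \<oplus>\<^sub>U u" unfolding n(2) using nc u by (simp add: U.M.a_assoc[symmetric] U.M.l_neg)
  have sub: "co (m \<oplus>\<^sub>U w) \<subseteq> co w" if "m \<in> N" "w \<in> carrier U" for m w
  proof
    fix z assume "z \<in> co (m \<oplus>\<^sub>U w)"
    then obtain n' where n': "n' \<in> N" "z = n' \<oplus>\<^sub>U (m \<oplus>\<^sub>U w)" unfolding co_mem by blast
    then have "z = (n' \<oplus>\<^sub>U m) \<oplus>\<^sub>U w" using that Ns(2) by (simp add: U.M.a_assoc)
    then show "z \<in> co w" unfolding co_mem using U.subspD(4)[OF Ns(1) n'(1) that(1)] by blast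
  qed
  have "co v \<subseteq> co u" using sub[OF U.subsp_neg[OF Ns(1) n(1)] u(1)] v by simp
  moreover have "co u \<subseteq> co v" using sub[OF n(1) u(2)] n(2) by simp
  ultimately show "co u = co v" by simp
qed

lemma co_N: "n \<in> N \<Longrightarrow> co n = N"
proof -
  assume n: "n \<in> N"
  have "n = n \<oplus>\<^sub>U \<zero>\<^sub>U" using Ns(2)[OF n] by simp
  then have "co n = co \<zero>\<^sub>U" using co_eq[OF Ns(2)[OF n] U.M.zero_closed] n by blast
  also have "\<dots> = N" using Ns(2) by (auto simp: co_mem)
  finally show ?thesis .
qed

lemma co_add:
  assumes "u \<in> carrier U" "u' \<in> carrier U" "v \<in> carrier U" "v' \<in> carrier U" "co u = co u'" "co v = co v'"
  shows "co (u \<oplus>\<^sub>U v) = co (u' \<oplus>\<^sub>U v')"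
proof -
  obtain n m where n: "n \<in> N" "u = n \<oplus>\<^sub>U u'" "m \<in> N" "v = m \<oplus>\<^sub>U v'" using assms co_eq by metis
  have "u \<oplus>\<^sub>U v = (n \<oplus>\<^sub>U m) \<oplus>\<^sub>U (u' \<oplus>\<^sub>U v')" unfolding n using assms(2,4) Ns(2)[OF n(1)] Ns(2)[OF n(3)] by (simp add: U.M.a_ac)
  then show ?thesis using co_eq[of "u \<oplus>\<^sub>U v" "u' \<oplus>\<^sub>U v'"] U.subspD(4)[OF Ns(1) n(1,3)] assms by blast
qed

lemma co_map:
  assumes u: "u \<in> carrier U" "u' \<in> carrier U" "co u = co u'"
    and f: "\<And>u v. u \<in> carrier U \<Longrightarrow> v \<in> carrier U \<Longrightarrow> f (u \<oplus>\<^sub>U v) = f u \<oplus>\<^sub>U f v"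
      "\<And>u. u \<in> carrier U \<Longrightarrow> f u \<in> carrier U" "\<And>n. n \<in> N \<Longrightarrow> f n \<in> N"
  shows "co (f u) = co (f u')"
proof -
  obtain n where n: "n \<in> N" "u = n \<oplus>\<^sub>U u'" using u co_eq by metis
  then have "f u = f n \<oplus>\<^sub>U f u'" using f(1)[OF Ns(2)[OF n(1)] u(2)] by simp
  then show ?thesis using co_eq[OF f(2)[OF u(1)] f(2)[OF u(2)]] f(3)[OF n(1)] by blast
qed

lemma co_scale: "u \<in> carrier U \<Longrightarrow> u' \<in> carrier U \<Longrightarrow> co u = co u' \<Longrightarrow> l \<in> carrier L \<Longrightarrow> co (l \<odot>\<^sub>U u) = co (l \<odot>\<^sub>U u')"
  by (rule co_map) (auto simp: U.smult_r_distr U.subspD(5)[OF Ns(1)])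

lemma co_T: "u \<in> carrier U \<Longrightarrow> u' \<in> carrier U \<Longrightarrow> co u = co u' \<Longrightarrow> a \<in> carrier A \<Longrightarrow> co (T a u) = co (T a u')"
  by (rule co_map) (auto simp: T_add T_closed Ns(3))

lemma co_act: "u \<in> carrier U \<Longrightarrow> u' \<in> carrier U \<Longrightarrow> co u = co u' \<Longrightarrow> z \<in> carrier AL \<Longrightarrow> co (z \<odot>\<^sub>LM u) = co (z \<odot>\<^sub>LM u')"
  by (rule co_map) (auto simp: act stab_act[OF N])

lemma hL_N:
  assumes "n \<in> N" "u \<in> P" shows "hL n u = \<one>\<^sub>TA.TG" "hL u n = \<one>\<^sub>TA.TG"
proof -
  show "hL u n = \<one>\<^sub>TA.TG" using assms unfolding perp_def AL_simps by auto
  then show "hL n u = \<one>\<^sub>TA.TG" using hL_flip[OF Ps(2)[OF assms(2)] Ns(2)[OF assms(1)]] by simp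
qed

text \<open>Representatives differ by elements of \<open>N\<close>, which are orthogonal to
  \<open>P\<close> on both sides.\<close>

lemma hL_co:
  assumes u: "u \<in> P" "u' \<in> P" "v \<in> P" "v' \<in> P" "co u = co u'" "co v = co v'"
  shows "hL u v = hL u' v'"
proof -
  interpret G: comm_group TA.TG by (rule TA.TG_comm)
  obtain n m where n: "n \<in> N" "u = n \<oplus>\<^sub>U u'" "m \<in> N" "v = m \<oplus>\<^sub>U v'" using u co_eq Ps(2) by metis
  have "hL u v = hL u' v" unfolding n(2) using hL(2)[OF Ns(2)[OF n(1)] Ps(2)[OF u(2)] Ps(2)[OF u(3)]] hL_N(1)[OF n(1) u(3)] hL(1)[OF Ps(2)[OF u(2)] Ps(2)[OF u(3)]] by simp
  also have "\<dots> = hL u' v'" unfolding n(4) using hL(3)[OF Ns(2)[OF n(3)] Ps(2)[OF u(4)] Ps(2)[OF u(2)]] hL_N(2)[OF n(3) u(2)] hL(1)[OF Ps(2)[OF u(2)] Ps(2)[OF u(4)]] by simp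
  finally show ?thesis .
qed

abbreviation "KM \<equiv> kernel_module AL LM hL N"

lemma KM:
  "carrier KM = co ` P"
  "u \<in> carrier U \<Longrightarrow> v \<in> carrier U \<Longrightarrow> co u \<oplus>\<^sub>KM co v = co (u \<oplus>\<^sub>U v)"
  "z \<in> carrier AL \<Longrightarrow> u \<in> carrier U \<Longrightarrow> z \<odot>\<^sub>KM co u = co (z \<odot>\<^sub>LM u)"
proof -
  show "carrier KM = co ` P" unfolding kernel_module_def co_def by auto
  show "co u \<oplus>\<^sub>KM co v = co (u \<oplus>\<^sub>U v)" if u: "u \<in> carrier U" "v \<in> carrier U"
  proof -
    have "co u \<oplus>\<^sub>KM co v = (\<Union>x\<in>co u. \<Union>y\<in>co v. {x \<oplus>\<^sub>U y})"
      unfolding kernel_module_def set_add_def set_mult_def by (simp add: LM_simps)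
    also have "\<dots> = co (u \<oplus>\<^sub>U v)"
    proof (intro equalityI subsetI)
      fix w assume "w \<in> (\<Union>x\<in>co u. \<Union>y\<in>co v. {x \<oplus>\<^sub>U y})"
      then obtain n m where n: "n \<in> N" "m \<in> N" "w = (n \<oplus>\<^sub>U u) \<oplus>\<^sub>U (m \<oplus>\<^sub>U v)" unfolding co_mem[abs_def] UN_iff by (auto simp: co_mem)
      then have "w = (n \<oplus>\<^sub>U m) \<oplus>\<^sub>U (u \<oplus>\<^sub>U v)" using u Ns(2) by (simp add: U.M.a_ac)
      then show "w \<in> co (u \<oplus>\<^sub>U v)" unfolding co_mem using U.subspD(4)[OF Ns(1) n(1,2)] by blast
    next
      fix w assume "w \<in> co (u \<oplus>\<^sub>U v)"
      then obtain n where n: "n \<in> N" "w = n \<oplus>\<^sub>U (u \<oplus>\<^sub>U v)" unfolding co_mem by blast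
      then have "w = (n \<oplus>\<^sub>U u) \<oplus>\<^sub>U v" using u Ns(2) by (simp add: U.M.a_assoc)
      moreover have "n \<oplus>\<^sub>U u \<in> co u" using n(1) co_mem by blast
      ultimately show "w \<in> (\<Union>x\<in>co u. \<Union>y\<in>co v. {x \<oplus>\<^sub>U y})" using co_self[OF u(2)] by blast
    qed
    finally show ?thesis .
  qed
  show "z \<odot>\<^sub>KM co u = co (z \<odot>\<^sub>LM u)" if z: "z \<in> carrier AL" and u: "u \<in> carrier U"
  proof -
    have "co (z \<odot>\<^sub>LM w) = co (z \<odot>\<^sub>LM u)" if w: "w \<in> co u" for w
    proof (rule co_act[OF _ u _ z])
      show wc: "w \<in> carrier U" using w Ns(2) u unfolding co_mem by auto
      show "co w = co u" using w co_eq[OF wc u] unfolding co_mem by simp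
    qed
    then have "(\<Union>w\<in>co u. co (z \<odot>\<^sub>LM w)) = co (z \<odot>\<^sub>LM u)" using co_self[OF u] by blast
    then show ?thesis unfolding kernel_module_def by (simp add: co_def)
  qed
qed

lemma kernel_form:
  assumes u: "u \<in> P" "v \<in> P" shows "kernel_form hL (co u) (co v) = hL u v"
proof -
  have *: "(SOME x. x \<in> co w) \<in> P \<and> co (SOME x. x \<in> co w) = co w" if w: "w \<in> P" for w
  proof -
    let ?x = "SOME x. x \<in> co w"
    have "?x \<in> co w" using co_self[OF Ps(2)[OF w]] by (rule someI)
    then obtain n where n: "n \<in> N" "?x = n \<oplus>\<^sub>U w" unfolding co_mem by blast
    have x: "?x \<in> P" unfolding n(2) by (rule U.subspD(4)[OF Ps(1) _ w]) (use N_iso n in auto)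
    then show ?thesis using n co_eq[OF Ps(2)[OF x] Ps(2)[OF w]] by blast
  qed
  show ?thesis unfolding kernel_form_def using hL_co[of _ u _ v] *[OF u(1)] *[OF u(2)] u by blast
qed

end

section \<open>The descended module and its scalar extension\<close>

locale quot_ext = herm_kern F L A \<tau> M \<sigma> \<delta> h N
  for F :: "('f, 'p) ring_scheme" and L :: "('f, 'l) module" and A :: "('f, 'a) module" and \<tau> :: "'a \<Rightarrow> 'f"
    and M :: "('a, 'm) module" and \<sigma> \<delta> h N +
  fixes Q :: "('l, 'm) tensor set" and m :: nat
  assumes sub: "subfield kF L" and Q: "subsp (L\<lparr>carrier := kF\<rparr>) U Q" and QP: "Q \<subseteq> P"
    and QT: "a \<in> carrier A \<Longrightarrow> q \<in> Q \<Longrightarrow> T a q \<in> Q"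
    and Qdim: "qdim (L\<lparr>carrier := kF\<rparr>) U (Q \<inter> N) Q m"
    and Qk: "q \<in> Q \<Longrightarrow> q' \<in> Q \<Longrightarrow> \<beta> q q' \<in> kF"
    and Qnd: "q \<in> Q \<Longrightarrow> (\<And>q'. q' \<in> Q \<Longrightarrow> \<beta> q q' = \<zero>\<^sub>L) \<Longrightarrow> q \<in> N"
    and Qspan: "subsp L U Z \<Longrightarrow> N \<subseteq> Z \<Longrightarrow> Q \<subseteq> Z \<Longrightarrow> P \<subseteq> Z"
begin

sublocale Uk: vecsp "L\<lparr>carrier := kF\<rparr>" U
  by (rule Lf.vecsp_subfield[OF sub U.module_axioms])

lemmas Qs = Uk.subspD[OF Q]

lemma ex_code: "\<exists>G :: ('l, 'm) tensor \<Rightarrow> nat \<Rightarrow> 'a. \<forall>u\<in>Q. \<forall>v\<in>Q. G u = G v \<longleftrightarrow> co u = co v"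
proof -
  \<comment> \<open>The codes must have values in the type of \<open>A\<close>. A constant
    \<open>c \<odot> 1\<close> of \<open>L\<close> is therefore replaced by
    \<open>c \<odot> 1\<close> in \<open>A\<close>, which is injective because 1 is nonzero in
    \<open>A\<close>.\<close>
  let ?i = "\<lambda>c. c \<odot>\<^sub>L \<one>\<^sub>L" and ?g = "\<lambda>l. inv_into (carrier F) (\<lambda>c. c \<odot>\<^sub>L \<one>\<^sub>L) l \<odot>\<^sub>A \<one>\<^sub>A"
  have i: "inj_on ?i (carrier F)" by (rule inj_onI) (rule iota_inj)
  have "inj_on ?g kF"
  proof (rule inj_onI)
    fix c d assume c: "c \<in> kF" "d \<in> kF" and eq: "?g c = ?g d"
    have "inv_into (carrier F) ?i c = inv_into (carrier F) ?i d"
      by (rule AV.smult_inj[OF inv_into_into[OF c(1)] inv_into_into[OF c(2)] _ one_nz eq]) simp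
    then show "c = d" using c inv_into_injective by metis
  qed
  then have "inj_on ?g (carrier (L\<lparr>carrier := kF\<rparr>))" by simp
  from qdim_code[OF Uk.vecsp_axioms Qdim this]
  obtain G :: "('l, 'm) tensor \<Rightarrow> nat \<Rightarrow> 'a" where G: "\<forall>u\<in>Q. \<forall>w\<in>Q. G u = G w \<longleftrightarrow> (\<exists>t\<in>Q \<inter> N. u = t \<oplus>\<^sub>U w)" by blast
  have c: "(\<exists>t\<in>Q \<inter> N. u = t \<oplus>\<^sub>U w) \<longleftrightarrow> co u = co w" if "u \<in> Q" "w \<in> Q" for u w
    unfolding co_eq[OF Qs(3)[OF that(1)] Qs(3)[OF that(2)]]
  proof (intro iffI; elim bexE)
    fix t assume t: "t \<in> N" "u = t \<oplus>\<^sub>U w"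
    have "t \<in> Q" using Uk.subsp_cancel'[OF Q Ns(2)[OF t(1)] that(2)] that(1) unfolding t(2) .
    then show "\<exists>t\<in>Q \<inter> N. u = t \<oplus>\<^sub>U w" using t by (intro bexI[of _ t]) simp_all
  next
    fix t assume "t \<in> Q \<inter> N" "u = t \<oplus>\<^sub>U w"
    then show "\<exists>t\<in>N. u = t \<oplus>\<^sub>U w" by (intro bexI[of _ t]) simp_all
  qed
  have "\<forall>u\<in>Q. \<forall>w\<in>Q. G u = G w \<longleftrightarrow> co u = co w"
  proof (intro ballI)
    fix u w assume uw: "u \<in> Q" "w \<in> Q"
    from trans[OF bspec[OF bspec[OF G uw(1)] uw(2)] c[OF uw]] show "G u = G w \<longleftrightarrow> co u = co w" .
  qed
  then show ?thesis by (rule exI[of _ G])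
qed

text \<open>The module \<open>Q / (Q \<inter> N)\<close>, with the coset of \<open>q\<close> encoded by its coordinates \<open>G q\<close>.\<close>

definition G :: "('l, 'm) tensor \<Rightarrow> nat \<Rightarrow> 'a" where
  "G = (SOME G. \<forall>u\<in>Q. \<forall>v\<in>Q. G u = G v \<longleftrightarrow> co u = co v)"

definition r :: "(nat \<Rightarrow> 'a) \<Rightarrow> ('l, 'm) tensor" where "r f = (SOME q. q \<in> Q \<and> G q = f)"

definition QM :: "('a, nat \<Rightarrow> 'a) module" where
  "QM = \<lparr>carrier = G ` Q, monoid.mult = undefined, monoid.one = undefined, ring.zero = G \<zero>\<^sub>U,
     ring.add = (\<lambda>f g. G (r f \<oplus>\<^sub>U r g)), module.smult = (\<lambda>a f. G (T a (r f)))\<rparr>"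

text \<open>The value is the \<open>a\<close> with \<open>1 \<otimes> a\<close> equal to the
  extended form; it exists by \<open>AL_descend\<close> and is unique by
  \<open>ta_inj\<close>.\<close>

definition hQ :: "(nat \<Rightarrow> 'a) \<Rightarrow> (nat \<Rightarrow> 'a) \<Rightarrow> 'a" where
  "hQ f g = (SOME a. a \<in> carrier A \<and> ta \<one>\<^sub>L a = hL (r f) (r g))"

lemma G_eq: "u \<in> Q \<Longrightarrow> v \<in> Q \<Longrightarrow> G u = G v \<longleftrightarrow> co u = co v"
  using someI_ex[OF ex_code] unfolding G_def by blast

lemma r: "q \<in> Q \<Longrightarrow> r (G q) \<in> Q" "q \<in> Q \<Longrightarrow> co (r (G q)) = co q"
proof -
  assume q: "q \<in> Q"
  then have *: "r (G q) \<in> Q \<and> G (r (G q)) = G q" unfolding r_def by (rule someI[of _ q, OF conjI]) simp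
  then show "r (G q) \<in> Q" by simp
  then show "co (r (G q)) = co q" using * q G_eq by blast
qed

lemma QM: "carrier QM = G ` Q" "\<zero>\<^sub>QM = G \<zero>\<^sub>U"
  "u \<in> Q \<Longrightarrow> v \<in> Q \<Longrightarrow> G u \<oplus>\<^sub>QM G v = G (u \<oplus>\<^sub>U v)"
  "a \<in> carrier A \<Longrightarrow> u \<in> Q \<Longrightarrow> a \<odot>\<^sub>QM G u = G (T a u)"
proof -
  show "u \<in> Q \<Longrightarrow> v \<in> Q \<Longrightarrow> G u \<oplus>\<^sub>QM G v = G (u \<oplus>\<^sub>U v)"
    unfolding QM_def using co_add[OF Qs(3) Qs(3) Qs(3) Qs(3) r(2) r(2)] r(1) Qs(4) by (simp add: G_eq)
  show "a \<in> carrier A \<Longrightarrow> u \<in> Q \<Longrightarrow> a \<odot>\<^sub>QM G u = G (T a u)"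
    unfolding QM_def using co_T[OF Qs(3) Qs(3) r(2)] r(1) QT by (simp add: G_eq)
qed (simp_all add: QM_def)

lemma hQ:
  assumes u: "u \<in> Q" "v \<in> Q" shows "hQ (G u) (G v) \<in> carrier A" "ta \<one>\<^sub>L (hQ (G u) (G v)) = hL u v"
proof -
  have "hL u v = hL (r (G u)) (r (G v))" using hL_co[of u "r (G u)" v "r (G v)"] u r QP by blast
  moreover have "\<exists>a\<in>carrier A. hL u v = ta \<one>\<^sub>L a"
  \<comment> \<open>The coordinates of \<open>hL u v\<close> are the
    \<open>\<beta> u (T a v)\<close>, and these are constants because \<open>Q\<close> is stable
    under \<open>T a\<close>.\<close>
  proof (rule AL_descend)
    fix a assume a: "a \<in> carrier A"
    show "\<exists>c\<in>carrier F. \<mu> a (hL u v) = c \<odot>\<^sub>L \<one>\<^sub>L"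
      using Qk[OF u(1) QT[OF a u(2)]] mu_hL(1)[OF Qs(3)[OF u(1)] Qs(3)[OF u(2)] a] by auto
  qed (use hL(1) Qs(3) u in auto)
  ultimately have "\<exists>a. a \<in> carrier A \<and> ta \<one>\<^sub>L a = hL (r (G u)) (r (G v))" by auto
  from someI_ex[OF this] show "hQ (G u) (G v) \<in> carrier A" "ta \<one>\<^sub>L (hQ (G u) (G v)) = hL u v"
    unfolding hQ_def \<open>hL u v = hL (r (G u)) (r (G v))\<close> by auto
qed

lemma QM_module: "right_module A QM"
proof (intro right_module.intro right_module_axioms.intro A.A.ring_axioms abelian_groupI)
  fix x assume "x \<in> carrier QM"
  then obtain u where u: "u \<in> Q" "x = G u" unfolding QM by auto
  then show "\<exists>y\<in>carrier QM. y \<oplus>\<^sub>QM x = \<zero>\<^sub>QM"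
    using Uk.subsp_neg[OF Q u(1)] Qs(3) by (intro bexI[of _ "G (\<ominus>\<^sub>U u)"]) (auto simp: QM U.M.l_neg)
qed (use Qs QT in \<open>auto simp: QM U.M.a_ac T_plus T_add T_mult T_one\<close>)

lemma hQ_herm: "hermitian_form A \<sigma> \<delta> QM hQ"
  unfolding hermitian_form_def
proof (intro conjI ballI)
  have in1: "x = y" if "x \<in> carrier A" "y \<in> carrier A" "ta \<one>\<^sub>L x = ta \<one>\<^sub>L y" for x y by (rule ta_inj[OF that])
  show "sesquilinear A \<sigma> QM hQ" unfolding sesquilinear_def
  proof (intro conjI ballI)
    show "hQ \<in> carrier QM \<rightarrow> carrier QM \<rightarrow> carrier A" using hQ(1) unfolding QM by auto
    fix x y z assume "x \<in> carrier QM" "y \<in> carrier QM" "z \<in> carrier QM"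
    then obtain u v w where u: "u \<in> Q" "x = G u" "v \<in> Q" "y = G v" "w \<in> Q" "z = G w" unfolding QM by auto
    show "hQ (x \<oplus>\<^sub>QM y) z = hQ x z \<oplus>\<^sub>A hQ y z" "hQ z (x \<oplus>\<^sub>QM y) = hQ z x \<oplus>\<^sub>A hQ z y"
      unfolding u using u(1,3,5) Qs(3,4) by (auto intro!: in1 simp: QM hQ TA.tens_add_r hL)
  next
    fix x y a c assume "x \<in> carrier QM" "y \<in> carrier QM" and a: "a \<in> carrier A" "c \<in> carrier A"
    then obtain u v where u: "u \<in> Q" "x = G u" "v \<in> Q" "y = G v" unfolding QM by auto
    define z where "z = hQ (G u) (G v)"
    have z: "z \<in> carrier A" "ta \<one>\<^sub>L z = hL u v" using hQ u unfolding z_def by auto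
    \<comment> \<open>Compared through the coordinates \<open>\<mu> b\<close>, sesquilinearity
      reduces to the adjointness of \<open>T a\<close> and \<open>T (\<sigma> a)\<close> and to the
      cyclicity of \<open>\<tau>\<close>.\<close>
    have "hL (T a u) (T c v) = ta \<one>\<^sub>L (\<sigma> a \<star> z \<star> c)"
    proof (rule AL_eqI)
      note uc = Qs(3)[OF u(1)] Qs(3)[OF u(3)]
      fix b assume b: "b \<in> carrier A"
      have "\<mu> b (hL (T a u) (T c v)) = \<beta> (T a u) (T (c \<star> b) v)" using mu_hL(1) uc a b by (simp add: T_closed T_mult)
      also have "\<dots> = \<beta> u (T (c \<star> b \<star> \<sigma> a) v)"
        using mu_hL(2)[OF uc(1) T_closed[OF _ uc(2)] sigma(1)[OF a(1)], of "c \<star> b"] a b uc by (simp add: sigma T_mult)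
      also have "\<dots> = \<mu> (c \<star> b \<star> \<sigma> a) (hL u v)" using mu_hL(1) uc a b sigma by simp
      also have "\<dots> = \<tau> (z \<star> (c \<star> b) \<star> \<sigma> a) \<odot>\<^sub>L \<one>\<^sub>L" unfolding z(2)[symmetric] using mu(3) z(1) a b sigma by (simp add: A.A.m_assoc)
      also have "\<tau> (z \<star> (c \<star> b) \<star> \<sigma> a) = \<tau> (\<sigma> a \<star> (z \<star> (c \<star> b)))" by (rule tr_comm) (use z a b sigma in auto)
      finally show "\<mu> b (hL (T a u) (T c v)) = \<mu> b (ta \<one>\<^sub>L (\<sigma> a \<star> z \<star> c))" using mu(3) z a b sigma by (simp add: A.A.m_assoc)
    qed (use hL T_closed a Qs(3) u TA.tens_closed z sigma in auto)
    then show "hQ (a \<odot>\<^sub>QM x) (c \<odot>\<^sub>QM y) = \<sigma> a \<star> hQ x y \<star> c"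
      unfolding u z_def[symmetric] using u a z(1) sigma by (auto intro!: in1 simp: QM hQ QT)
  qed
  fix x y assume "x \<in> carrier QM" "y \<in> carrier QM"
  then obtain u v where u: "u \<in> Q" "x = G u" "v \<in> Q" "y = G v" unfolding QM by auto
  obtain g where g: "\<forall>l\<in>carrier L. \<forall>a\<in>carrier A. g (ta l a) = ta l (sg a)" "\<forall>u\<in>carrier U. \<forall>v\<in>carrier U. hL v u = g (hL u v)"
    using hL_swap by (elim bexE conjE)
  have "ta \<one>\<^sub>L (hQ x y) = g (ta \<one>\<^sub>L (hQ y x))"
    unfolding u hQ(2)[OF u(1,3)] hQ(2)[OF u(3,1)] by (rule bspec[OF bspec[OF g(2)]]) (use Qs(3) u in auto)
  also have "\<dots> = ta \<one>\<^sub>L (sg (hQ y x))" using g(1) hQ(1) u by simp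
  finally have "ta \<one>\<^sub>L (hQ x y) = ta \<one>\<^sub>L (sg (hQ y x))" .
  then have "hQ x y = sg (hQ y x)" using in1 hQ(1) sg(1) u by simp
  then show "hQ x y \<ominus>\<^sub>A add_pow A \<delta> (sw \<sigma> hQ x y) = \<zero>\<^sub>A"
    using hQ(1) sg(1) u unfolding sw_def sg_def by (simp add: a_minus_def A.M.r_neg)
qed

lemma QM_fg: "finitely_generated A QM"
proof -
  interpret R: right_module A QM by (rule QM_module)
  obtain B where B: "finite B" "B \<subseteq> Q" "\<And>Z. subsp (L\<lparr>carrier := kF\<rparr>) U Z \<Longrightarrow> Q \<inter> N \<subseteq> Z \<Longrightarrow> B \<subseteq> Z \<Longrightarrow> Q \<subseteq> Z"
    using qdim_generators[OF Uk.vecsp_axioms Qdim] by blast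
  have GB: "finite (G ` B)" "G ` B \<subseteq> carrier QM" using B QM by auto
  note C = R.combos[OF GB]
  \<comment> \<open>The classes generated over \<open>A\<close> pull back to a space over the
    constants which contains \<open>Q \<inter> N\<close> and generators of \<open>Q\<close> modulo
    it, hence to all of \<open>Q\<close>.\<close>
  let ?Z = "{q \<in> Q. G q \<in> R.combos (G ` B)}"
  \<comment> \<open>Constants of \<open>L\<close> act through \<open>A\<close>, as they may be moved
    across the tensor sign.\<close>
  have kT: "c \<odot>\<^sub>L \<one>\<^sub>L \<odot>\<^sub>U q = T (c \<odot>\<^sub>A \<one>\<^sub>A) q" if c: "c \<in> carrier F" and q: "q \<in> carrier U" for c q
  proof -
    have "ta (c \<odot>\<^sub>L \<one>\<^sub>L) \<one>\<^sub>A \<odot>\<^sub>LM q = ta \<one>\<^sub>L (c \<odot>\<^sub>A \<one>\<^sub>A) \<odot>\<^sub>LM q" using TA.tens_smult[OF c, of "\<one>\<^sub>L" "\<one>\<^sub>A"] by simp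
    then show ?thesis using act_split q c by (simp add: T_one T_closed)
  qed
  have "Q \<subseteq> ?Z"
  proof (rule B(3))
    show "subsp (L\<lparr>carrier := kF\<rparr>) U ?Z" unfolding subsp_def
    proof (intro conjI ballI)
      show "?Z \<subseteq> carrier U" using Qs(1) by auto
      show "\<zero>\<^sub>U \<in> ?Z" using Qs(2) C(3) QM(2) by simp
      fix x y assume "x \<in> ?Z" "y \<in> ?Z"
      then show "x \<oplus>\<^sub>U y \<in> ?Z" using Qs(4) C(4)[of "G x" "G y"] QM(3) by auto
    next
      fix a x assume "a \<in> carrier (L\<lparr>carrier := kF\<rparr>)" "x \<in> ?Z"
      then obtain c where c: "c \<in> carrier F" "a = c \<odot>\<^sub>L \<one>\<^sub>L" "x \<in> Q" "G x \<in> R.combos (G ` B)" by auto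
      have "c \<odot>\<^sub>A \<one>\<^sub>A \<in> carrier A" using c by simp
      then show "a \<odot>\<^sub>U x \<in> ?Z" unfolding c(2) kT[OF c(1) Qs(3)[OF c(3)]]
        using QT[OF _ c(3)] C(5)[OF c(4)] QM(4)[OF _ c(3)] by simp
    qed
    show "Q \<inter> N \<subseteq> ?Z"
    proof
      fix q assume q: "q \<in> Q \<inter> N"
      then have "co q = co \<zero>\<^sub>U" using co_N U.subspD(2)[OF Ns(1)] by simp
      then have "G q = G \<zero>\<^sub>U" using G_eq q Qs(2) by simp
      then show "q \<in> ?Z" using C(3) QM(2) q by simp
    qed
    show "B \<subseteq> ?Z" using C(2) B(2) by auto
  qed
  then have "carrier QM \<subseteq> R.combos (G ` B)" unfolding QM by auto
  then show ?thesis unfolding finitely_generated_def R.combos_def using GB by blast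
qed

text \<open>A vector of \<open>Q\<close> whose class is orthogonal to everything lies in
  \<open>N\<close> by \<open>Qnd\<close>, after a swap of the arguments. The instance supplies dual
  bases for the extension of the descended form, from which the injectivity of \<open>\<psi>\<close>
  follows.\<close>

sublocale H: herm_ext F L A \<tau> QM \<sigma> \<delta> hQ
proof (intro herm_ext.intro mod_ext.intro herm_ext_axioms.intro alg_ext_axioms QM_module invol sign hQ_herm QM_fg)
  fix x assume "x \<in> carrier QM" and z: "\<And>y. y \<in> carrier QM \<Longrightarrow> hQ y x = \<zero>\<^sub>A"
  then obtain u where u: "u \<in> Q" "x = G u" unfolding QM by auto
  have ta0: "ta \<one>\<^sub>L \<zero>\<^sub>A = \<one>\<^sub>TA.TG" using TA.tens_smult[of "\<zero>\<^sub>F" "\<one>\<^sub>L" "\<zero>\<^sub>A"] TA.tens_zero[of "\<zero>\<^sub>A"] by simp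
  have "u \<in> N"
  proof (rule Qnd[OF u(1)])
    fix v assume v: "v \<in> Q"
    have "hL v u = \<one>\<^sub>TA.TG" using hQ(2)[OF v u(1)] z[of "G v"] v u(2) ta0 QM(1) by simp
    then have "hL u v = \<one>\<^sub>TA.TG" using hL_flip Qs(3) u(1) v by blast
    then show "\<beta> u v = \<zero>\<^sub>L" unfolding \<beta>_def using mu_one by simp
  qed
  then have "co u = co \<zero>\<^sub>U" using co_N U.subspD(2)[OF Ns(1)] by simp
  then show "x = \<zero>\<^sub>QM" using G_eq u Qs(2) QM(2) by simp
qed

lemma P_scale: "l \<in> carrier L \<Longrightarrow> u \<in> P \<Longrightarrow> l \<odot>\<^sub>U u \<in> P"
  using U.subspD(5)[OF Ps(1)] .

text \<open>The comparison map sends \<open>l \<otimes> G q\<close> to the coset of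
  \<open>l q\<close>. Balancing holds because constants act through \<open>A\<close>, under which
  \<open>Q\<close> is stable.\<close>

lemma psi:
  "\<exists>\<psi>. (\<forall>l\<in>carrier L. \<forall>q\<in>Q. \<psi> (H.tv l (G q)) = co (l \<odot>\<^sub>U q)) \<and>
     (\<forall>s\<in>carrier H.U. \<forall>t\<in>carrier H.U. \<psi> (s \<oplus>\<^sub>H.U t) = \<psi> s \<oplus>\<^sub>KM \<psi> t)"
proof -
  \<comment> \<open>The additive group of the kernel module in multiplicative notation, as the
    universal property expects.\<close>
  let ?K = "\<lparr>carrier = carrier KM, monoid.mult = add KM, one = co \<zero>\<^sub>U\<rparr>"
  have K: "comm_group ?K"
  proof (rule comm_groupI)
    fix x assume "x \<in> carrier ?K"
    then obtain u where u: "u \<in> P" "x = co u" unfolding KM(1) monoid.simps by auto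
    have "\<ominus>\<^sub>U u \<in> P" using U.subsp_neg[OF Ps(1) u(1)] .
    then show "\<exists>y\<in>carrier ?K. y \<otimes>\<^bsub>?K\<^esub> x = \<one>\<^bsub>?K\<^esub>" using KM(2)[of "\<ominus>\<^sub>U u" u] Ps(2) u
      by (intro bexI[of _ "co (\<ominus>\<^sub>U u)"]) (auto simp: U.M.l_neg KM(1))
  qed (use Ps(2) U.subspD(2,4)[OF Ps(1)] in \<open>auto simp: KM U.M.a_ac\<close>)
  have rG: "co (l \<odot>\<^sub>U r (G q)) = co (l \<odot>\<^sub>U q)" if "l \<in> carrier L" "q \<in> Q" for l q
    using co_scale[OF Qs(3)[OF r(1)[OF that(2)]] Qs(3)[OF that(2)] r(2)[OF that(2)] that(1)] .
  have Pc: "q \<in> Q \<Longrightarrow> l \<in> carrier L \<Longrightarrow> l \<odot>\<^sub>U q \<in> P" for q l using P_scale QP by blast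
  have kT: "(c \<odot>\<^sub>L l) \<odot>\<^sub>U q = l \<odot>\<^sub>U T (c \<odot>\<^sub>A \<one>\<^sub>A) q" if c: "c \<in> carrier F" "l \<in> carrier L" and q: "q \<in> carrier U" for c l q
    using act_split[of "c \<odot>\<^sub>L l" "\<one>\<^sub>A" q] act_split[of l "c \<odot>\<^sub>A \<one>\<^sub>A" q] TA.tens_smult[OF c, of "\<one>\<^sub>A"] c q by (simp add: T_one)
  obtain \<psi> where p: "\<psi> \<in> hom H.TV.TG ?K" "\<And>l y. l \<in> carrier L \<Longrightarrow> y \<in> carrier H.V \<Longrightarrow> \<psi> (H.tv l y) = co (l \<odot>\<^sub>U r y)"
  proof (rule H.TV.universal[OF K, of "\<lambda>l y. co (l \<odot>\<^sub>U r y)"])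
    fix l y assume l: "l \<in> carrier L" "y \<in> carrier H.V"
    then obtain q where q: "q \<in> Q" "y = G q" unfolding H.V_simps QM by auto
    show "co (l \<odot>\<^sub>U r y) \<in> carrier ?K" using rG l q Pc by (simp add: KM)
    show "co ((k \<oplus>\<^sub>L l) \<odot>\<^sub>U r y) = co (k \<odot>\<^sub>U r y) \<otimes>\<^bsub>?K\<^esub> co (l \<odot>\<^sub>U r y)" if "k \<in> carrier L" for k
      using rG l q that Qs(3) by (simp add: KM U.smult_l_distr)
    show "co ((c \<odot>\<^sub>L l) \<odot>\<^sub>U r y) = co (l \<odot>\<^sub>U r (c \<odot>\<^sub>H.V y))" if "c \<in> carrier F" for c
      using rG l q that Qs(3) QT by (simp add: QM H.V_simps kT)
    fix y' assume "y' \<in> carrier H.V"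
    then obtain q' where q': "q' \<in> Q" "y' = G q'" unfolding H.V_simps QM by auto
    show "co (l \<odot>\<^sub>U r (y \<oplus>\<^sub>H.V y')) = co (l \<odot>\<^sub>U r y) \<otimes>\<^bsub>?K\<^esub> co (l \<odot>\<^sub>U r y')"
      using rG l q q' Qs(3,4) by (simp add: KM QM H.V_simps U.smult_r_distr)
  qed blast
  have a: "\<psi> (H.tv l (G q)) = co (l \<odot>\<^sub>U q)" if "l \<in> carrier L" "q \<in> Q" for l q
    using p(2)[of l "G q"] rG that QM(1) H.V_simps(1) by simp
  have b: "\<psi> (s \<oplus>\<^sub>H.U t) = \<psi> s \<oplus>\<^sub>KM \<psi> t" if "s \<in> carrier H.U" "t \<in> carrier H.U" for s t
    using p(1) that unfolding hom_def H.TG_simps by simp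
  show ?thesis by (intro exI[of _ \<psi>] conjI ballI) (erule (1) a, erule (1) b)
qed

lemma hL_scaled:
  assumes u: "u \<in> carrier U" "v \<in> carrier U" and a: "a \<in> carrier A" "hL u v = ta \<one>\<^sub>L a" and k: "k \<in> carrier L" "l \<in> carrier L"
  shows "hL (k \<odot>\<^sub>U u) (l \<odot>\<^sub>U v) = ta (k \<otimes>\<^sub>L l) a"
proof (rule AL_eqI)
  fix b assume b: "b \<in> carrier A"
  have t: "\<tau> (a \<star> b) \<in> carrier F" using tr_closed a b by simp
  have "\<mu> b (hL (k \<odot>\<^sub>U u) (l \<odot>\<^sub>U v)) = (k \<otimes>\<^sub>L l) \<otimes>\<^sub>L \<mu> b (hL u v)"
    using mu_hL(1) u b k by (simp add: T_scale T_closed beta_scale beta L.m_assoc L.m_lcomm)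
  also have "\<dots> = \<mu> b (ta (k \<otimes>\<^sub>L l) a)" unfolding a(2) using a(1) b k t mu(3)
      L.smult_assoc2[OF t L.one_closed, of "k \<otimes>\<^sub>L l"] by (simp add: L.m_comm)
  finally show "\<mu> b (hL (k \<odot>\<^sub>U u) (l \<odot>\<^sub>U v)) = \<mu> b (ta (k \<otimes>\<^sub>L l) a)" .
qed (use u k a hL TA.tens_closed in auto)

text \<open>Injectivity of \<open>\<psi>\<close> comes from preservation of the forms and
  nondegeneracy on the source, so that dimensions need not be compared; surjectivity comes from
  \<open>Qspan\<close>.\<close>

lemma kernel_isometric: "isometric AL H.LM H.hL KM (kernel_form hL)"
proof -
  obtain \<psi> where p: "\<forall>l\<in>carrier L. \<forall>q\<in>Q. \<psi> (H.tv l (G q)) = co (l \<odot>\<^sub>U q)"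
    and pa: "\<forall>s\<in>carrier H.U. \<forall>t\<in>carrier H.U. \<psi> (s \<oplus>\<^sub>H.U t) = \<psi> s \<oplus>\<^sub>KM \<psi> t" using psi by (elim exE conjE)
  have Pc: "q \<in> Q \<Longrightarrow> l \<in> carrier L \<Longrightarrow> l \<odot>\<^sub>U q \<in> P" for q l using P_scale QP by blast
  have rep: "\<exists>u\<in>P. \<psi> t = co u" if "t \<in> carrier H.U" for t
    using that
  proof (induction t rule: H.U_induct)
    case (tens l x)
    then show ?case using p Pc QM(1) by auto
  next
    case (add s t)
    then obtain u v where u: "u \<in> P" "\<psi> s = co u" "v \<in> P" "\<psi> t = co v" by blast
    then have "\<psi> (s \<oplus>\<^sub>H.U t) = co (u \<oplus>\<^sub>U v)" using add.hyps pa KM(2)[OF Ps(2) Ps(2)] by simp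
    then show ?case using U.subspD(4)[OF Ps(1) u(1,3)] by blast
  qed
  have lin: "\<psi> (z \<odot>\<^sub>H.LM t) = z \<odot>\<^sub>KM \<psi> t" if "z \<in> carrier AL" "t \<in> carrier H.U" for z t
  proof (rule tensor_induct2[OF TA.tensor_axioms H.TV.tensor_axioms, of z t "\<lambda>z t. \<psi> (z \<odot>\<^sub>H.LM t) = z \<odot>\<^sub>KM \<psi> t", unfolded AL_simps(1)[symmetric] H.TG_simps H.V_simps, OF that])
    fix k a l x assume k: "k \<in> carrier L" "a \<in> carrier A" "l \<in> carrier L" and "x \<in> carrier QM"
    then obtain q where q: "q \<in> Q" "x = G q" "q \<in> carrier U" using QM(1) Qs(3) by auto
    show "\<psi> (ta k a \<odot>\<^sub>H.LM H.tv l x) = ta k a \<odot>\<^sub>KM \<psi> (H.tv l x)"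
      using k q p QT by (simp add: H.act QM KM ta_closed act_split T_scale U.smult_assoc1 T_closed)
  next
    fix z z' t assume z: "z \<in> carrier AL" "z' \<in> carrier AL" "t \<in> carrier H.U"
      "\<psi> (z \<odot>\<^sub>H.LM t) = z \<odot>\<^sub>KM \<psi> t" "\<psi> (z' \<odot>\<^sub>H.LM t) = z' \<odot>\<^sub>KM \<psi> t"
    obtain u where u: "u \<in> P" "\<psi> t = co u" "u \<in> carrier U" using rep[OF z(3)] Ps(2) by blast
    interpret G: comm_group TA.TG by (rule TA.TG_comm)
    have "z \<otimes>\<^sub>TA.TG z' \<in> carrier AL" using z AL_simps by simp
    then show "\<psi> ((z \<otimes>\<^sub>TA.TG z') \<odot>\<^sub>H.LM t) = (z \<otimes>\<^sub>TA.TG z') \<odot>\<^sub>KM \<psi> t"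
      using z u pa by (simp add: H.act KM act)
  next
    fix z t t' assume z: "z \<in> carrier AL" "t \<in> carrier H.U" "t' \<in> carrier H.U"
      "\<psi> (z \<odot>\<^sub>H.LM t) = z \<odot>\<^sub>KM \<psi> t" "\<psi> (z \<odot>\<^sub>H.LM t') = z \<odot>\<^sub>KM \<psi> t'"
    obtain u where u: "u \<in> P" "\<psi> t = co u" "u \<in> carrier U" using rep[OF z(2)] Ps(2) by blast
    obtain u' where u': "u' \<in> P" "\<psi> t' = co u'" "u' \<in> carrier U" using rep[OF z(3)] Ps(2) by blast
    show "\<psi> (z \<odot>\<^sub>H.LM (t \<oplus>\<^sub>H.U t')) = z \<odot>\<^sub>KM \<psi> (t \<oplus>\<^sub>H.U t')"
      using z u u' pa by (simp add: H.act KM act)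
  qed
  have form: "kernel_form hL (\<psi> s) (\<psi> t) = H.hL s t" if "s \<in> carrier H.U" "t \<in> carrier H.U" for s t
    using that
  proof (induction s t rule: H.U_induct2)
    case (1 k x l y)
    then obtain q q' where q: "q \<in> Q" "x = G q" "q' \<in> Q" "y = G q'" using QM(1) by auto
    have "hL (k \<odot>\<^sub>U q) (l \<odot>\<^sub>U q') = ta (k \<otimes>\<^sub>L l) (hQ x y)"
      by (rule hL_scaled) (use q hQ Qs(3) 1 in auto)
    then show ?case using 1 q p Pc by (simp add: kernel_form H.hL)
  next
    case (2 s s' t)
    obtain u u' v where u: "u \<in> P" "\<psi> s = co u" "u' \<in> P" "\<psi> s' = co u'" "v \<in> P" "\<psi> t = co v" using rep 2(1-3) by metis
    have "u \<oplus>\<^sub>U u' \<in> P" using U.subspD(4)[OF Ps(1)] u by simp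
    then show ?case using 2 u pa Ps(2) by (simp add: KM kernel_form H.hL hL)
  next
    case (3 t s s')
    obtain u u' v where u: "u \<in> P" "\<psi> s = co u" "u' \<in> P" "\<psi> s' = co u'" "v \<in> P" "\<psi> t = co v" using rep 3(1-3) by metis
    have "u \<oplus>\<^sub>U u' \<in> P" using U.subspD(4)[OF Ps(1)] u by simp
    then show ?case using 3 u pa Ps(2) by (simp add: KM kernel_form H.hL hL)
  qed
  \<comment> \<open>Elements with equal images have equal products with everything, hence equal
    coordinates in the dual bases of the source.\<close>
  have "inj_on \<psi> (carrier H.U)"
  proof (rule inj_onI)
    fix s t assume s: "s \<in> carrier H.U" "t \<in> carrier H.U" "\<psi> s = \<psi> t"
    have b: "H.\<beta> s w = H.\<beta> t w" if "w \<in> carrier H.U" for w using form[OF s(1) that] form[OF s(2) that] s(3) unfolding H.\<beta>_def by simp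
    obtain n :: nat and e es where e: "\<forall>i<n. e i \<in> carrier QM \<and> es i \<in> carrier QM"
      and ex: "\<forall>u\<in>carrier H.U. u = (\<Oplus>\<^sub>H.U i\<in>{..<n}. H.\<beta> u (H.tv \<one>\<^sub>L (es i)) \<odot>\<^sub>H.U H.tv \<one>\<^sub>L (e i))"
      using H.U_basis by (elim exE conjE)
    have "(\<Oplus>\<^sub>H.U i\<in>{..<n}. H.\<beta> s (H.tv \<one>\<^sub>L (es i)) \<odot>\<^sub>H.U H.tv \<one>\<^sub>L (e i)) = (\<Oplus>\<^sub>H.U i\<in>{..<n}. H.\<beta> t (H.tv \<one>\<^sub>L (es i)) \<odot>\<^sub>H.U H.tv \<one>\<^sub>L (e i))"
      by (rule H.U.M.finsum_cong') (use e b s H.beta(1) H.tv_closed in auto)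
    from trans[OF trans[OF bspec[OF ex s(1)] this] sym[OF bspec[OF ex s(2)]]] show "s = t" .
  qed
  moreover have "\<psi> ` carrier H.U = carrier KM"
  proof
    show "\<psi> ` carrier H.U \<subseteq> carrier KM" using rep unfolding KM(1) by blast
    \<comment> \<open>The vectors whose coset is attained form a subspace over \<open>L\<close> that
      contains \<open>N\<close> and \<open>Q\<close>, hence \<open>P\<close>.\<close>
    let ?Z = "{u \<in> carrier U. co u \<in> \<psi> ` carrier H.U}"
    have Q0: "q \<in> ?Z" if q: "q \<in> Q" for q
    proof -
      have "\<psi> (H.tv \<one>\<^sub>L (G q)) = co q" using p q Qs(3) by simp
      moreover have "H.tv \<one>\<^sub>L (G q) \<in> carrier H.U" by (rule H.tv_closed) (use q QM(1) in auto)
      ultimately show ?thesis using Qs(3)[OF q] by (metis (mono_tags, lifting) image_eqI mem_Collect_eq)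
    qed
    have "P \<subseteq> ?Z"
    proof (rule Qspan)
      show "subsp L U ?Z" unfolding subsp_def
      proof (intro conjI ballI)
        show "\<zero>\<^sub>U \<in> ?Z" using Q0 Qs(2) by simp
        fix u v assume "u \<in> ?Z" "v \<in> ?Z"
        then obtain s t where s: "s \<in> carrier H.U" "co u = \<psi> s" "t \<in> carrier H.U" "co v = \<psi> t" "u \<in> carrier U" "v \<in> carrier U" by blast
        then have "co (u \<oplus>\<^sub>U v) = \<psi> (s \<oplus>\<^sub>H.U t)" using pa KM(2) by metis
        then show "u \<oplus>\<^sub>U v \<in> ?Z" using s by simp
      next
        fix l u assume l: "l \<in> carrier L" and "u \<in> ?Z"
        then obtain s where s: "s \<in> carrier H.U" "co u = \<psi> s" "u \<in> carrier U" by blast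
        have z: "ta l \<one>\<^sub>A \<in> carrier AL" using l ta_closed by simp
        have "co (l \<odot>\<^sub>U u) = \<psi> (ta l \<one>\<^sub>A \<odot>\<^sub>H.LM s)"
          using lin[OF z s(1)] KM(3)[OF z s(3)] s(2,3) act_split[OF l, of "\<one>\<^sub>A" u] T_one by simp
        then show "l \<odot>\<^sub>U u \<in> ?Z" using H.act(1)[OF z s(1)] s(3) l by simp
      qed auto
      show "N \<subseteq> ?Z"
      proof
        fix n assume n: "n \<in> N"
        have "co n = co \<zero>\<^sub>U" using n co_N U.subspD(2)[OF Ns(1)] by simp
        then show "n \<in> ?Z" using Q0[OF Qs(2)] Ns(2)[OF n] by simp
      qed
    qed (use Q0 in blast)
    then show "carrier KM \<subseteq> \<psi> ` carrier H.U" unfolding KM(1) by blast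
  qed
  ultimately have "bij_betw \<psi> (carrier H.LM) (carrier KM)" unfolding bij_betw_def H.LM_simps by simp
  then show ?thesis unfolding isometric_def using pa lin form H.LM_simps by (intro exI[of _ \<psi>]) simp
qed

end

lemma isometric_trans:
  assumes "isometric R M1 h1 M2 h2" "isometric R M2 h2 M3 h3" shows "isometric R M1 h1 M3 h3"
proof -
  obtain f where f: "bij_betw f (carrier M1) (carrier M2)" "\<forall>x\<in>carrier M1. \<forall>y\<in>carrier M1. f (x \<oplus>\<^sub>M1 y) = f x \<oplus>\<^sub>M2 f y"
    "\<forall>x\<in>carrier M1. \<forall>a\<in>carrier R. f (a \<odot>\<^sub>M1 x) = a \<odot>\<^sub>M2 f x" "\<forall>x\<in>carrier M1. \<forall>y\<in>carrier M1. h2 (f x) (f y) = h1 x y"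
    using assms(1) unfolding isometric_def by (elim exE conjE)
  obtain g where g: "bij_betw g (carrier M2) (carrier M3)" "\<forall>x\<in>carrier M2. \<forall>y\<in>carrier M2. g (x \<oplus>\<^sub>M2 y) = g x \<oplus>\<^sub>M3 g y"
    "\<forall>x\<in>carrier M2. \<forall>a\<in>carrier R. g (a \<odot>\<^sub>M2 x) = a \<odot>\<^sub>M3 g x" "\<forall>x\<in>carrier M2. \<forall>y\<in>carrier M2. h3 (g x) (g y) = h2 x y"
    using assms(2) unfolding isometric_def by (elim exE conjE)
  have c: "f x \<in> carrier M2" if "x \<in> carrier M1" for x using bij_betwE[OF f(1)] that by blast
  show ?thesis unfolding isometric_def
    by (intro exI[of _ "g \<circ> f"] conjI bij_betw_trans[OF f(1) g(1)]) (use f(2-4) g(2-4) c in simp_all)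
qed

section \<open>Existence of maximal sublagrangians and uniqueness of the kernel\<close>

context herm_ext
begin

abbreviation "orthc Z \<equiv> perp AL LM hL Z"

lemma perp_swap: "stab Y \<Longrightarrow> stab Z \<Longrightarrow> Y \<subseteq> orthc Z \<longleftrightarrow> Z \<subseteq> orthc Y"
  using perp_beta(1)[of Z] perp_beta(2)[of Y] stabD(2) by blast

lemma perp_antimono: "Y \<subseteq> Z \<Longrightarrow> orthc Z \<subseteq> orthc Y"
  unfolding perp_def by auto

lemma stab_inter: "stab Y \<Longrightarrow> stab Z \<Longrightarrow> stab (Y \<inter> Z)"
  unfolding stab_def using U.subsp_inter by auto

lemma stab_sum: "stab Y \<Longrightarrow> stab Z \<Longrightarrow> stab (ssum U Y Z)"
  unfolding stab_def[of "ssum U Y Z"]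
proof (intro conjI ballI)
  assume YZ: "stab Y" "stab Z"
  show "subsp L U (ssum U Y Z)" using U.ssum_subsp stabD(1) YZ by blast
  fix a u assume a: "a \<in> carrier A" and "u \<in> ssum U Y Z"
  then obtain y z where u: "u = y \<oplus>\<^sub>U z" "y \<in> Y" "z \<in> Z" unfolding ssum_def by auto
  then have "T a u = T a y \<oplus>\<^sub>U T a z" using T_add[OF a] stabD(2) YZ by blast
  then show "T a u \<in> ssum U Y Z" using stabD(3) YZ a u(2,3) unfolding ssum_def by blast
qed

lemma U_qdim: "\<exists>n. qdim L U {\<zero>\<^sub>U} (carrier U) n"
proof -
  obtain n :: nat and e es where e: "\<forall>i<n. e i \<in> carrier M \<and> es i \<in> carrier M"
    and ex: "\<forall>u\<in>carrier U. u = (\<Oplus>\<^sub>U i\<in>{..<n}. \<beta> u (tv \<one>\<^sub>L (es i)) \<odot>\<^sub>U tv \<one>\<^sub>L (e i))"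
    using U_basis by (elim exE conjE)
  have B: "(\<lambda>i. tv \<one>\<^sub>L (e i)) ` {..<n} \<subseteq> carrier U" using e tv_closed by auto
  obtain Z d where Z: "qdim L U {\<zero>\<^sub>U} Z d" "(\<lambda>i. tv \<one>\<^sub>L (e i)) ` {..<n} \<subseteq> Z"
    using finite_qdim[OF U.vecsp_axioms _ B] by auto
  have Zs: "subsp L U Z" using U.qdim_subsp[OF Z(1)] by simp
  have sum: "(\<Oplus>\<^sub>U i\<in>I. f i) \<in> Z" if "finite I" "f \<in> I \<rightarrow> Z" for I :: "nat set" and f
    using that
  proof (induction I rule: finite_induct)
    case (insert i I)
    then have "f \<in> I \<rightarrow> carrier U" "f i \<in> carrier U" using U.subspD(1)[OF Zs] by auto
    then show ?case using insert U.subspD(4)[OF Zs] by simp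
  qed (use U.subspD(2)[OF Zs] in simp)
  have "u \<in> Z" if u: "u \<in> carrier U" for u
  proof -
    have "(\<Oplus>\<^sub>U i\<in>{..<n}. \<beta> u (tv \<one>\<^sub>L (es i)) \<odot>\<^sub>U tv \<one>\<^sub>L (e i)) \<in> Z"
      by (rule sum) (use Z(2) e u beta(1) tv_closed U.subspD(5)[OF Zs] in auto)
    then show ?thesis using bspec[OF ex u] by metis
  qed
  then have "Z = carrier U" using U.subspD(1)[OF Zs] by auto
  then show ?thesis using Z(1) by blast
qed

lemma hL_nondeg:
  assumes u: "u \<in> carrier U" and z: "\<And>v. v \<in> carrier U \<Longrightarrow> \<beta> u v = \<zero>\<^sub>L" shows "u = \<zero>\<^sub>U"
proof -
  obtain n :: nat and e es where e: "\<forall>i<n. e i \<in> carrier M \<and> es i \<in> carrier M"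
    and ex: "\<forall>u\<in>carrier U. u = (\<Oplus>\<^sub>U i\<in>{..<n}. \<beta> u (tv \<one>\<^sub>L (es i)) \<odot>\<^sub>U tv \<one>\<^sub>L (e i))"
    using U_basis by (elim exE conjE)
  have "(\<Oplus>\<^sub>U i\<in>{..<n}. \<beta> u (tv \<one>\<^sub>L (es i)) \<odot>\<^sub>U tv \<one>\<^sub>L (e i)) = (\<Oplus>\<^sub>U i\<in>{..<n}. \<zero>\<^sub>U)"
    by (rule U.M.finsum_cong') (use e z tv_closed in auto)
  then show ?thesis using trans[OF bspec[OF ex u]] by simp
qed

text \<open>For \<open>v\<close> outside \<open>Z\<close>, separation in the finite-dimensional
  space \<open>Z + L v\<close> provides a vector orthogonal to \<open>Z\<close> but not to
  \<open>v\<close>.\<close>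

lemma perp_perp: assumes Z: "stab Z" shows "orthc (orthc Z) \<subseteq> Z"
proof (rule ccontr)
  assume "\<not> orthc (orthc Z) \<subseteq> Z"
  then obtain v where v: "v \<in> orthc (orthc Z)" "v \<notin> Z" by auto
  note Zs = stabD(1)[OF Z] and O = perp_stab[OF Z]
  have vc: "v \<in> carrier U" using v(1) stabD(2)[OF perp_stab[OF O]] by simp
  let ?Y = "adj L U Z v"
  have Y: "subsp L U ?Y" "Z \<subseteq> ?Y" "v \<in> ?Y" using U.adj_subsp[OF Zs vc] U.adj_ge[OF U.subspD(1)[OF Zs] vc] U.adj_mem[OF Zs vc] by auto
  note Yc = U.subspD(1)[OF Y(1)]
  obtain n where n: "qdim L U {\<zero>\<^sub>U} (carrier U) n" using U_qdim by auto
  have z: "{\<zero>\<^sub>U} \<subseteq> ?Y" "{\<zero>\<^sub>U} \<subseteq> Z" using U.subspD(2)[OF Y(1)] U.subspD(2)[OF Zs] by auto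
  obtain j where j: "qdim L U {\<zero>\<^sub>U} ?Y j" using U.qdim_sub[OF n Y(1) z(1) Yc] by blast
  have "\<exists>s\<in>carrier U. (\<forall>x\<in>Z. \<beta> x s = \<zero>\<^sub>L) \<and> (\<exists>y\<in>?Y. \<beta> y s \<noteq> \<zero>\<^sub>L)"
  proof (rule U.separation[OF j Zs z(2) _ U.subsp_carrier bilin_mono[OF beta_bilin Yc order_refl]])
    show "Z \<subset> ?Y" using Y v by auto
    fix t s assume "t \<in> {\<zero>\<^sub>U}" "s \<in> carrier U"
    then show "\<beta> t s = \<zero>\<^sub>L" using U.bilin_zero[OF beta_bilin] by auto
  next
    fix y assume "y \<in> ?Y" "\<And>s. s \<in> carrier U \<Longrightarrow> \<beta> y s = \<zero>\<^sub>L"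
    then show "y \<in> {\<zero>\<^sub>U}" using hL_nondeg Yc by auto
  qed
  then obtain s y where s: "s \<in> carrier U" "\<forall>x\<in>Z. \<beta> x s = \<zero>\<^sub>L" "y \<in> ?Y" "\<beta> y s \<noteq> \<zero>\<^sub>L" by blast
  have "s \<in> orthc Z" using s perp_beta(1)[OF Z] by blast
  then have vs: "\<beta> v s = \<zero>\<^sub>L" using v(1) perp_beta(2)[OF O] by blast
  obtain z a where za: "y = z \<oplus>\<^sub>U a \<odot>\<^sub>U v" "z \<in> Z" "a \<in> carrier L" using s(3) unfolding adj_def by auto
  then show False using s vs vc stabD(2)[OF Z za(2)] by (simp add: beta beta_scale)
qed

lemma maximalD:
  assumes "maximal_sublagrangian AL LM hL N"
  shows "stab N" "N \<subseteq> orthc N" "stab Z \<Longrightarrow> N \<subseteq> Z \<Longrightarrow> Z \<subseteq> orthc Z \<Longrightarrow> Z = N"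
  using assms submodule_iff unfolding maximal_sublagrangian_def sublagrangian_def by auto

text \<open>Zorn's lemma: isotropy is a condition on pairs of vectors, and any two vectors of a
  union of a chain lie in one member.\<close>

lemma ex_maximal: "\<exists>N. maximal_sublagrangian AL LM hL N"
proof -
  let ?S = "{N. sublagrangian AL LM hL N}"
  have iso: "sublagrangian AL LM hL N \<longleftrightarrow> stab N \<and> (\<forall>u\<in>N. \<forall>v\<in>N. \<beta> u v = \<zero>\<^sub>L)" for N
    unfolding sublagrangian_def submodule_iff using perp_beta(2)[of N] stabD(2)[of N] by blast
  have "sublagrangian AL LM hL {\<zero>\<^sub>U}"
    unfolding iso stab_def using U.subsp_zero T_zero U.bilin_zero[OF beta_bilin] by auto
  then have ne: "?S \<noteq> {}" by blast
  have "\<exists>N\<in>?S. \<forall>Z\<in>?S. N \<subseteq> Z \<longrightarrow> Z = N"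
  proof (rule subset_Zorn_nonempty[OF ne])
    fix C assume C: "C \<noteq> {}" "subset.chain ?S C"
    have st: "stab Z" if "Z \<in> C" for Z using C(2) that iso unfolding subset_chain_def by auto
    have two: "\<exists>Z\<in>C. u \<in> Z \<and> v \<in> Z" if uv: "u \<in> \<Union>C" "v \<in> \<Union>C" for u v
    proof -
      obtain Y Z where Y: "Y \<in> C" "u \<in> Y" "Z \<in> C" "v \<in> Z" using uv by auto
      then have "Y \<subseteq> Z \<or> Z \<subseteq> Y" using C(2) unfolding subset_chain_def by blast
      then show ?thesis using Y by blast
    qed
    have "stab (\<Union>C)" unfolding stab_def subsp_def
    proof (intro conjI ballI)
      show "\<Union>C \<subseteq> carrier U" using stabD(2) st by blast
      show "\<zero>\<^sub>U \<in> \<Union>C" using C(1) U.subspD(2)[OF stabD(1)[OF st]] by blast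
      fix u v assume "u \<in> \<Union>C" "v \<in> \<Union>C"
      then obtain Z where "Z \<in> C" "u \<in> Z" "v \<in> Z" using two by blast
      then show "u \<oplus>\<^sub>U v \<in> \<Union>C" using U.subspD(4)[OF stabD(1)[OF st]] by blast
    next
      fix l u assume "l \<in> carrier L" "u \<in> \<Union>C"
      then show "l \<odot>\<^sub>U u \<in> \<Union>C" using U.subspD(5)[OF stabD(1)[OF st]] by blast
    next
      fix a u assume "a \<in> carrier A" "u \<in> \<Union>C"
      then show "T a u \<in> \<Union>C" using stabD(3)[OF st] by blast
    qed
    moreover have "\<beta> u v = \<zero>\<^sub>L" if uv: "u \<in> \<Union>C" "v \<in> \<Union>C" for u v
    proof -
      obtain Z where Z: "Z \<in> C" "u \<in> Z" "v \<in> Z" using two[OF uv] by blast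
      then have "sublagrangian AL LM hL Z" using C(2) unfolding subset_chain_def by auto
      then show ?thesis using Z unfolding iso by blast
    qed
    ultimately show "\<Union>C \<in> ?S" using iso by blast
  qed
  then show ?thesis unfolding maximal_sublagrangian_def by auto
qed

text \<open>Adding to \<open>N1\<close> the vectors of \<open>N2\<close> orthogonal to it gives an
  isotropic submodule again, so nothing new is added.\<close>

lemma maximal_meet:
  assumes N1: "maximal_sublagrangian AL LM hL N1" and N2: "maximal_sublagrangian AL LM hL N2"
  shows "orthc N1 \<inter> N2 \<subseteq> N1"
proof -
  note s1 = maximalD[OF N1] and s2 = maximalD[OF N2]
  let ?B = "orthc N1 \<inter> N2" and ?Z = "ssum U N1 (orthc N1 \<inter> N2)"
  have P: "stab (orthc N1)" using perp_stab[OF s1(1)] .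
  have B: "stab ?B" using stab_inter[OF P s2(1)] .
  have Z: "stab ?Z" using stab_sum[OF s1(1) B] .
  have ge: "N1 \<subseteq> ?Z" "?B \<subseteq> ?Z"
    using U.ssum_ge1[OF stabD(1)[OF B] U.subspD(1)[OF stabD(1)[OF s1(1)]]] U.ssum_ge2[OF stabD(1)[OF s1(1)] U.subspD(1)[OF stabD(1)[OF B]]] by auto
  have "?Z \<subseteq> orthc N1" by (rule U.ssum_least[OF stabD(1)[OF P] s1(2)]) auto
  then have 1: "N1 \<subseteq> orthc ?Z" using perp_swap[OF s1(1) Z] by blast
  have "N1 \<subseteq> orthc ?B" using perp_swap[OF B s1(1)] by blast
  moreover have "?B \<subseteq> orthc ?B" using s2(2) perp_antimono[of ?B N2] by blast
  ultimately have "?Z \<subseteq> orthc ?B" by (rule U.ssum_least[OF stabD(1)[OF perp_stab[OF B]]])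
  then have "?B \<subseteq> orthc ?Z" using perp_swap[OF B Z] by blast
  with 1 have "?Z \<subseteq> orthc ?Z" by (rule U.ssum_least[OF stabD(1)[OF perp_stab[OF Z]]])
  then have "?Z = N1" using s1(3)[OF Z ge(1)] by blast
  then show ?thesis using ge(2) by simp
qed

text \<open>The dual of \<open>maximal_meet\<close>: by the double orthogonal it suffices that the
  orthogonal of the right-hand side lies in \<open>N1\<close>.\<close>

lemma maximal_join:
  assumes N1: "maximal_sublagrangian AL LM hL N1" and N2: "maximal_sublagrangian AL LM hL N2"
  shows "orthc N1 \<subseteq> ssum U N1 (orthc N1 \<inter> orthc N2)"
proof -
  note s1 = maximalD[OF N1] and s2 = maximalD[OF N2]
  let ?B = "orthc N1 \<inter> orthc N2" and ?W = "ssum U N1 (orthc N1 \<inter> orthc N2)" and ?S = "ssum U N1 N2"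
  have P: "stab (orthc N1)" "stab (orthc N2)" using perp_stab s1(1) s2(1) by auto
  have B: "stab ?B" using stab_inter[OF P] .
  have S: "stab ?S" using stab_sum[OF s1(1) s2(1)] .
  have W: "stab ?W" using stab_sum[OF s1(1) B] .
  have geW: "N1 \<subseteq> ?W" "?B \<subseteq> ?W"
    using U.ssum_ge1[OF stabD(1)[OF B] U.subspD(1)[OF stabD(1)[OF s1(1)]]] U.ssum_ge2[OF stabD(1)[OF s1(1)] U.subspD(1)[OF stabD(1)[OF B]]] by auto
  have geS: "N1 \<subseteq> ?S" "N2 \<subseteq> ?S"
    using U.ssum_ge1[OF stabD(1)[OF s2(1)] U.subspD(1)[OF stabD(1)[OF s1(1)]]] U.ssum_ge2[OF stabD(1)[OF s1(1)] U.subspD(1)[OF stabD(1)[OF s2(1)]]] by auto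
  have "orthc ?S \<subseteq> ?B" using perp_antimono[OF geS(1)] perp_antimono[OF geS(2)] by blast
  then have "orthc ?B \<subseteq> ?S" using perp_antimono[of "orthc ?S" ?B] perp_perp[OF S] by blast
  \<comment> \<open>The orthogonal of the sum lies in \<open>(N1 + N2) \<inter> orthc N1\<close>.
    For \<open>n + m\<close> in it the component \<open>m\<close> of \<open>N2\<close> is orthogonal
    to \<open>N1\<close>, hence in \<open>N1\<close>.\<close>
  then have 1: "orthc ?W \<subseteq> ?S \<inter> orthc N1" using perp_antimono[OF geW(1)] perp_antimono[OF geW(2)] by blast
  have "orthc ?W \<subseteq> N1"
  proof
    fix x assume "x \<in> orthc ?W"
    then have x: "x \<in> ?S" "x \<in> orthc N1" using 1 by auto
    then obtain n m where n: "x = n \<oplus>\<^sub>U m" "n \<in> N1" "m \<in> N2" unfolding ssum_def by auto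
    have "m \<in> orthc N1"
      by (rule U.subsp_cancel[OF stabD(1)[OF P(1)] stabD(2)[OF s2(1) n(3)]]) (use n s1(2) x(2) in auto)
    then have "m \<in> N1" using maximal_meet[OF N1 N2] n(3) by blast
    then show "x \<in> N1" unfolding n(1) by (rule U.subspD(4)[OF stabD(1)[OF s1(1)] n(2)])
  qed
  then show ?thesis using perp_antimono[of "orthc ?W" N1] perp_perp[OF W] by blast
qed

text \<open>Both kernels are quotients of the common space \<open>?B\<close>: it represents every
  coset on either side by \<open>maximal_join\<close>, and it meets \<open>N1\<close> and
  \<open>N2\<close> in the same subspace by \<open>maximal_meet\<close>.\<close>

lemma kernel_unique:
  assumes N1: "maximal_sublagrangian AL LM hL N1" and N2: "maximal_sublagrangian AL LM hL N2"
  shows "isometric AL (kernel_module AL LM hL N1) (kernel_form hL) (kernel_module AL LM hL N2) (kernel_form hL)"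
proof -
  note s1 = maximalD[OF N1] and s2 = maximalD[OF N2]
  interpret K1: herm_kern F L A \<tau> M \<sigma> \<delta> h N1
    by (intro herm_kern.intro herm_kern_axioms.intro herm_ext_axioms s1(1,2))
  interpret K2: herm_kern F L A \<tau> M \<sigma> \<delta> h N2
    by (intro herm_kern.intro herm_kern_axioms.intro herm_ext_axioms s2(1,2))
  let ?B = "orthc N1 \<inter> orthc N2"
  have B: "stab ?B" using stab_inter[OF perp_stab[OF s1(1)] perp_stab[OF s2(1)]] .
  note Bs = stabD[OF B]
  have eq: "K1.co x = K1.co y \<longleftrightarrow> K2.co x = K2.co y" if x: "x \<in> ?B" "y \<in> ?B" for x y
  proof -
    have "n \<in> N1 \<longleftrightarrow> n \<in> N2" if n: "x = n \<oplus>\<^sub>U y" "n \<in> carrier U" for n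
    proof -
      have "n \<in> ?B" using U.subsp_cancel'[OF Bs(1) n(2) x(2)] x(1) n(1) by simp
      then show ?thesis using maximal_meet[OF N1 N2] maximal_meet[OF N2 N1] by blast
    qed
    then show ?thesis unfolding K1.co_eq[OF Bs(2)[OF x(1)] Bs(2)[OF x(2)]] K2.co_eq[OF Bs(2)[OF x(1)] Bs(2)[OF x(2)]]
      using K1.Ns(2) K2.Ns(2) by metis
  qed
  have all1: "K1.co ` orthc N1 = K1.co ` ?B"
  proof (intro equalityI subsetI)
    fix w assume "w \<in> K1.co ` orthc N1"
    then obtain u where u: "u \<in> orthc N1" "w = K1.co u" by blast
    then obtain n b where n: "u = n \<oplus>\<^sub>U b" "n \<in> N1" "b \<in> ?B" using maximal_join[OF N1 N2] unfolding ssum_def by blast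
    then have "K1.co u = K1.co b" using K1.co_eq[OF K1.Ps(2)[OF u(1)] Bs(2)[OF n(3)]] by blast
    then show "w \<in> K1.co ` ?B" using u n(3) by blast
  qed blast
  have all2: "K2.co ` orthc N2 = K2.co ` ?B"
  proof (intro equalityI subsetI)
    fix w assume "w \<in> K2.co ` orthc N2"
    then obtain u where u: "u \<in> orthc N2" "w = K2.co u" by blast
    then obtain n b where n: "u = n \<oplus>\<^sub>U b" "n \<in> N2" "b \<in> ?B" using maximal_join[OF N2 N1] unfolding ssum_def by blast
    then have "K2.co u = K2.co b" using K2.co_eq[OF K2.Ps(2)[OF u(1)] Bs(2)[OF n(3)]] by blast
    then show "w \<in> K2.co ` ?B" using u n(3) by blast
  qed blast
  \<comment> \<open>A coset is sent to the other coset of a representative in \<open>?B\<close>; by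
    \<open>eq\<close> the choice does not matter.\<close>
  define f where "f w = K2.co (SOME x. x \<in> ?B \<and> K1.co x = w)" for w
  have f: "f (K1.co x) = K2.co x" if x: "x \<in> ?B" for x
  proof -
    have "(SOME y. y \<in> ?B \<and> K1.co y = K1.co x) \<in> ?B \<and> K1.co (SOME y. y \<in> ?B \<and> K1.co y = K1.co x) = K1.co x"
      by (rule someI[of _ x]) (use x in simp)
    then show ?thesis unfolding f_def using eq x by blast
  qed
  have BP: "u \<in> ?B \<Longrightarrow> u \<in> orthc N1" "u \<in> ?B \<Longrightarrow> u \<in> orthc N2" for u by auto
  show ?thesis unfolding isometric_def
  proof (intro exI[of _ f] conjI ballI)
    show "bij_betw f (carrier K1.KM) (carrier K2.KM)" unfolding K1.KM(1) K2.KM(1) all1 all2 bij_betw_def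
    proof
      show "inj_on f (K1.co ` ?B)"
      proof (rule inj_onI)
        fix v w assume v: "v \<in> K1.co ` ?B" "w \<in> K1.co ` ?B" and fe: "f v = f w"
        then obtain x y where x: "x \<in> ?B" "v = K1.co x" "y \<in> ?B" "w = K1.co y" by blast
        then show "v = w" using fe f[OF x(1)] f[OF x(3)] eq[OF x(1,3)] by simp
      qed
      show "f ` K1.co ` ?B = K2.co ` ?B" unfolding image_image using f by (rule image_cong[OF refl])
    qed
    fix v w assume "v \<in> carrier K1.KM" "w \<in> carrier K1.KM"
    then obtain x y where x: "x \<in> ?B" "v = K1.co x" "y \<in> ?B" "w = K1.co y" unfolding K1.KM(1) all1 by blast
    have xc: "x \<in> carrier U" "y \<in> carrier U" "x \<oplus>\<^sub>U y \<in> ?B" using Bs(2) x U.subspD(4)[OF Bs(1)] by blast+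
    show "f (v \<oplus>\<^sub>K1.KM w) = f v \<oplus>\<^sub>K2.KM f w"
      unfolding x(2,4) K1.KM(2)[OF xc(1,2)] f[OF xc(3)] f[OF x(1)] f[OF x(3)] K2.KM(2)[OF xc(1,2)] ..
    show "kernel_form hL (f v) (f w) = kernel_form hL v w"
      unfolding x(2,4) f[OF x(1)] f[OF x(3)] K1.kernel_form[OF BP(1)[OF x(1)] BP(1)[OF x(3)]] K2.kernel_form[OF BP(2)[OF x(1)] BP(2)[OF x(3)]] ..
  next
    fix v z assume "v \<in> carrier K1.KM" and z: "z \<in> carrier AL"
    then obtain x where x: "x \<in> ?B" "v = K1.co x" unfolding K1.KM(1) all1 by blast
    have xc: "x \<in> carrier U" "z \<odot>\<^sub>LM x \<in> ?B" using Bs(2) x stab_act[OF B z] by blast+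
    show "f (z \<odot>\<^sub>K1.KM v) = z \<odot>\<^sub>K2.KM f v"
      unfolding x(2) K1.KM(3)[OF z xc(1)] f[OF xc(2)] f[OF x(1)] K2.KM(3)[OF z xc(1)] ..
  qed
qed

end

theorem theorem3p3:
  fixes F :: "'f ring"
    and C :: "'f conic"
    and L :: "('f, 'l) module"
    and A :: "('f, 'a) module"
    and \<sigma> :: "'a \<Rightarrow> 'a"
    and \<delta> :: int
    and M :: "('a, 'm) module"
    and h :: "'m \<Rightarrow> 'm \<Rightarrow> 'a"
  assumes "field F"
    and "smooth_conic F C"
    and "\<not> has_rational_point F C"
    and "conic_function_field F C L"
    and "central_simple_algebra F A"
    and "linear_involution F A \<sigma>"
    and "\<delta> \<in> {1, -1}"
    and "right_module A M"
    and "finitely_generated A M"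
    and "hermitian_form A \<sigma> \<delta> M h"
    and "nonsingular_form A \<sigma> M h"
  shows "let A\<^sub>L = ext_algebra F L A; M\<^sub>L = ext_module F L A M; h\<^sub>L = ext_form F L A h in
    (\<exists>N. maximal_sublagrangian A\<^sub>L M\<^sub>L h\<^sub>L N) \<and>
    (\<exists>(M' :: ('a, nat \<Rightarrow> 'a) module) h'.
       right_module A M' \<and> finitely_generated A M' \<and> hermitian_form A \<sigma> \<delta> M' h' \<and>
       (\<forall>N. maximal_sublagrangian A\<^sub>L M\<^sub>L h\<^sub>L N \<longrightarrow>
          isometric A\<^sub>L (ext_module F L A M') (ext_form F L A h')
            (kernel_module A\<^sub>L M\<^sub>L h\<^sub>L N) (kernel_form h\<^sub>L)))"
proof -
  interpret conic_setup F C L by (intro conic_setup.intro assms)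
  interpret csa F A
    using assms(5) unfolding central_simple_algebra_def by (intro csa.intro csa_axioms.intro) blast+
  obtain \<tau> where tr: "\<forall>a\<in>carrier A. \<tau> a \<in> carrier F" "\<forall>a\<in>carrier A. \<forall>b\<in>carrier A. \<tau> (a \<oplus>\<^sub>A b) = \<tau> a \<oplus>\<^sub>F \<tau> b"
    "\<forall>c\<in>carrier F. \<forall>a\<in>carrier A. \<tau> (c \<odot>\<^sub>A a) = c \<otimes>\<^sub>F \<tau> a"
    "\<forall>a\<in>carrier A. \<forall>b\<in>carrier A. \<tau> (a \<otimes>\<^sub>A b) = \<tau> (b \<otimes>\<^sub>A a)"
    "\<forall>a\<in>carrier A. (\<forall>b\<in>carrier A. \<tau> (a \<otimes>\<^sub>A b) = \<zero>\<^sub>F) \<longrightarrow> a = \<zero>\<^sub>A"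
    using trace_form by (elim exE conjE)
  interpret alg_ext F L A \<tau>
    by (intro alg_ext.intro alg_ext_axioms.intro csa_axioms L.algebra_axioms Lf.field_axioms) (use tr in blast)+
  interpret right_module A M by (rule assms(8))
  have sesq: "sesquilinear A \<sigma> M h" using assms(10) unfolding hermitian_form_def by simp
  have h0: "h y \<zero>\<^sub>M = \<zero>\<^sub>A" if y: "y \<in> carrier M" for y
  proof -
    have "h y (\<zero>\<^sub>M \<oplus>\<^sub>M \<zero>\<^sub>M) = h y \<zero>\<^sub>M \<oplus>\<^sub>A h y \<zero>\<^sub>M" "h y \<zero>\<^sub>M \<in> carrier A"
      using sesq y M.zero_closed unfolding sesquilinear_def by blast+
    then show ?thesis by (simp add: A.M.add.l_cancel_one)
  qed
  interpret herm_ext F L A \<tau> M \<sigma> \<delta> h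
  proof (intro herm_ext.intro mod_ext.intro herm_ext_axioms.intro alg_ext_axioms assms right_module_axioms)
    fix x assume x: "x \<in> carrier M" and z: "\<And>y. y \<in> carrier M \<Longrightarrow> h y x = \<zero>\<^sub>A"
    \<comment> \<open>Vanishing of \<open>h y x\<close> for all \<open>y\<close> means that
      \<open>x\<close> and 0 define the same semilinear map; nonsingularity makes the assignment
      injective.\<close>
    have "(\<lambda>y\<in>carrier M. h y x) = (\<lambda>y\<in>carrier M. h y \<zero>\<^sub>M)" using z h0 by (intro restrict_ext) simp
    then show "x = \<zero>\<^sub>M"
      using inj_onD[OF bij_betw_imp_inj_on[OF assms(11)[unfolded nonsingular_form_def]] _ x M.zero_closed] by simp
  qed
  have kF: "k = kF" unfolding k_def \<iota>_def ..
  obtain x y where xy: "quad_ext L k x y" "\<forall>z\<in>carrier L. \<exists>d d' q. q \<in> horner L k x y d \<and>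
    q \<noteq> \<zero>\<^sub>L \<and> q \<otimes>\<^sub>L z \<in> horner L k x y d'" using quad_ext by blast
  have "filt L k (horner L k x y) (quad_ext.Lm L k x y) x (quad_ext.c L k x y)"
    by (rule quad_ext.filt[OF xy(1)]) (use xy(2) in blast)
  note filt = this[unfolded kF]
  \<comment> \<open>The descended module is constructed from one fixed maximal
    sublagrangian.\<close>
  obtain N where Nmax: "maximal_sublagrangian AL LM hL N" using ex_maximal by (elim exE)
  obtain Q m where Q: "subsp (L\<lparr>carrier := kF\<rparr>) U Q" "Q \<subseteq> orthc N" "\<forall>a\<in>carrier A. \<forall>q\<in>Q. T a q \<in> Q"
     "qdim (L\<lparr>carrier := kF\<rparr>) U (Q \<inter> N) Q m" "\<forall>q\<in>Q. \<forall>q'\<in>Q. \<beta> q q' \<in> kF"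
     "\<forall>q\<in>Q. (\<forall>q'\<in>Q. \<beta> q q' = \<zero>\<^sub>L) \<longrightarrow> q \<in> N"
     "\<forall>Z. subsp L U Z \<longrightarrow> N \<subseteq> Z \<longrightarrow> Q \<subseteq> Z \<longrightarrow> orthc N \<subseteq> Z"
    using descent[OF filt Nmax] by (elim exE conjE)
  have sub: "subfield kF L" using k_subfield kF by simp
  interpret quot_ext F L A \<tau> M \<sigma> \<delta> h N Q m
    by (intro quot_ext.intro herm_kern.intro herm_kern_axioms.intro quot_ext_axioms.intro herm_ext_axioms maximalD(1,2)[OF Nmax] sub Q(1,2,4))
      (erule (1) bspec[OF bspec[OF Q(3)]], erule (1) bspec[OF bspec[OF Q(5)]],
       erule mp[OF bspec[OF Q(6)]], rule ballI, assumption,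
       erule mp[OF mp[OF mp[OF HOL.spec[OF Q(7)]]]])
  \<comment> \<open>For any other maximal sublagrangian the isometry is composed with the comparison
    of the two kernels, so the same \<open>QM\<close> serves for all of them.\<close>
  have "isometric AL (ext_module F L A QM) (ext_form F L A hQ) (kernel_module AL LM hL N') (kernel_form hL)"
    if "maximal_sublagrangian AL LM hL N'" for N'
    by (rule isometric_trans[OF kernel_isometric kernel_unique[OF Nmax that]])
  then show ?thesis unfolding Let_def using ex_maximal QM_module QM_fg hQ_herm by blast
qed

end
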